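(* Let $r \geq 2$ be an integer and let $p = p(n) \geq 2^9 r^{5} n^{-1/(2r)}$. Then with high probability the random graph $\Gamma \sim G(n,p)$ has the following property: for every colouring of the edges of $\Gamma$ with $r$ colours, the vertex set of $\Gamma$ can be partitioned into at most $1000 r^4 \log r$ vertex-disjoint monochromatic cycles.
   Context: $G(n,p)$ is the binomial random graph on $n$ vertices in which each pair of vertices is an edge independently with probability $p$. "With high probability" means with probability tending to $1$ as $n \to \infty$. A monochromatic cycle is a cycle all of whose edges have the same colour; a single vertex and a single edge are allowed as (degenerate) cycles. $\log$ denotes the natural logarithm. *)

theory Defs
  imports Complex_Main
begin

definition all_edges :: "nat \<Rightarrow> nat set set" where
  "all_edges n = {e. e \<subseteq> {0..<n} \<and> card e = 2}"

definition prob_Gnp :: "nat \<Rightarrow> real \<Rightarrow> (nat set set \<Rightarrow> bool) \<Rightarrow> real" where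
  "prob_Gnp n p P =
     (\<Sum>E\<in>{E. E \<subseteq> all_edges n \<and> P E}.
        p ^ card E * (1 - p) ^ (card (all_edges n) - card E))"

text \<open>A monochromatic cycle in graph E under colouring c, given as a list of
  distinct vertices in cyclic order; a single vertex and a single edge count
  as (degenerate) cycles.\<close>
definition mono_cycle :: "nat set set \<Rightarrow> (nat set \<Rightarrow> nat) \<Rightarrow> nat list \<Rightarrow> bool" where
  "mono_cycle E c vs \<longleftrightarrow> vs \<noteq> [] \<and> distinct vs \<and>
     (length vs = 1 \<or>
      (length vs = 2 \<and> {vs ! 0, vs ! 1} \<in> E) \<or>
      (length vs \<ge> 3 \<and> (\<exists>i. \<forall>j < length vs.
          {vs ! j, vs ! ((j + 1) mod length vs)} \<in> E \<and>
          c {vs ! j, vs ! ((j + 1) mod length vs)} = i)))"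

definition cycle_partition_property :: "nat \<Rightarrow> real \<Rightarrow> nat \<Rightarrow> nat set set \<Rightarrow> bool" where
  "cycle_partition_property r K n E \<longleftrightarrow>
     (\<forall>c :: nat set \<Rightarrow> nat. (\<forall>e\<in>E. c e < r) \<longrightarrow>
        (\<exists>Cs :: nat list list.
           (\<forall>vs\<in>set Cs. mono_cycle E c vs) \<and>
           (\<forall>i < length Cs. \<forall>j < length Cs. i \<noteq> j \<longrightarrow> set (Cs ! i) \<inter> set (Cs ! j) = {}) \<and>
           (\<Union>vs\<in>set Cs. set vs) = {0..<n} \<and>
           real (length Cs) \<le> K))"

end

theory Submission
  imports Defs
begin

text \<open>The vertices congruent to 0, 1, 2, 3 modulo 8 contain \<open>\<gamma> n^3 p^3\<close> monochromatic triangles, hence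
  linearly many disjoint edges \<open>x y\<close> of one colour \<open>i\<close> with \<open>\<gamma> n p^2 / 24\<close> common \<open>i\<close>-neighbours \<open>z\<close> each. A long
  cycle alternating between such \<open>x\<close> and \<open>z\<close> becomes an absorber: each \<open>z\<close> may be visited or bypassed
  through the edge \<open>x y\<close>, so that a set \<open>Z\<close> together with any subset of a linear set \<open>B\<close> spans a cycle.
  Outside \<open>Z \<union> B\<close>, long cycles are removed greedily until \<open>\<epsilon> n\<close> vertices remain; these are covered by cycles
  alternating with one half of \<open>B\<close>, up to \<open>O(log n / p)\<close> vertices \<open>L\<close>. On \<open>L\<close> join two vertices in colour \<open>i\<close>
  if they have many common \<open>i\<close>-neighbours in the other half of \<open>B\<close>. As any \<open>r + 1\<close> vertices have many common
  neighbours there, this auxiliary multicoloured graph has independence number at most \<open>r\<close>, and such graphs are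
  partitioned into \<open>O(r^4 log r)\<close> monochromatic cycles; the auxiliary edges are realised by paths of length
  two. The few vertices violating the codegree condition are treated in the same way beforehand, with
  four reserved residue classes modulo 8 as connectors.\<close>

section \<open>Cycles separating a small set\<close>

text \<open>The reservoir \<open>B\<close> depends on the graph and the colouring, so codegrees into
  half of it are only controlled by a union bound over all linear sets. This is affordable for
  families of about \<open>1 / p^(r + 1)\<close> disjoint \<open>r + 1\<close>-tuples and leaves an
  exceptional set of that order without any guarantee. The residue classes are fixed in advance, so
  every tuple outside a class has its full codegree there; but the exceptional set may itself occupy
  the connectors. From level to level the tuples spoiled in this way become fewer by a factor of
  order \<open>n * p^(r + 1)\<close>, and three descents suffice once
  \<open>n^3 * p^(4 * r + 4)\<close> is large, which is borderline for \<open>r = 2\<close>. The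
  exponent \<open>1 / (2 * r)\<close> comes from Hall's condition: among \<open>p^(-r-1)\<close>
  connectors a pair of vertices typically sees \<open>p^(1-r)\<close>, which must stay below the
  supply, of order \<open>n * p^(r + 1)\<close>; that is, \<open>n * p^(2 * r)\<close> must exceed a
  constant. All randomness enters through one binomial count: pairs of a tuple and a common
  neighbour of it, over disjoint tuples.\<close>

definition rpath :: "('a \<Rightarrow> 'a \<Rightarrow> bool) \<Rightarrow> 'a set \<Rightarrow> 'a list \<Rightarrow> bool" where
  "rpath R S xs \<longleftrightarrow> xs \<noteq> [] \<and> distinct xs \<and> set xs \<subseteq> S \<and> successively R xs"

definition reach :: "('a \<Rightarrow> 'a \<Rightarrow> bool) \<Rightarrow> 'a set \<Rightarrow> 'a \<Rightarrow> 'a \<Rightarrow> bool" where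
  "reach R S u v \<longleftrightarrow> (\<exists>xs. rpath R S xs \<and> hd xs = u \<and> last xs = v)"

text \<open>For symmetric \<open>R\<close> these are the unions of connected components of the graph
  induced on \<open>S\<close>.\<close>

definition rclosed :: "('a \<Rightarrow> 'a \<Rightarrow> bool) \<Rightarrow> 'a set \<Rightarrow> 'a set \<Rightarrow> bool" where
  "rclosed R S T \<longleftrightarrow> T \<subseteq> S \<and> (\<forall>t\<in>T. \<forall>u\<in>S. R t u \<longrightarrow> u \<in> T)"

text \<open>Single edges are excluded here; a cycle in the sense of \<open>mono_cycle\<close> may have two vertices.\<close>

definition cyc :: "('a \<Rightarrow> 'a \<Rightarrow> bool) \<Rightarrow> 'a list \<Rightarrow> bool" where
  "cyc R vs \<longleftrightarrow> vs \<noteq> [] \<and> distinct vs \<and>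
     (length vs = 1 \<or> length vs \<ge> 3 \<and> successively R vs \<and> R (last vs) (hd vs))"

lemma reach_refl: "u \<in> S \<Longrightarrow> reach R S u u"
  unfolding reach_def rpath_def by (intro exI[of _ "[u]"]) auto

lemma reach_in: "reach R S u v \<Longrightarrow> u \<in> S \<and> v \<in> S"
  unfolding reach_def rpath_def by (metis hd_in_set last_in_set subsetD)

lemma rpath_split:
  assumes "rpath R S (xs @ w # ys)"
  shows "rpath R S (xs @ [w])" "rpath R S (w # ys)"
  using assms unfolding rpath_def by (auto simp: successively_append_iff)

lemma reach_step:
  assumes "reach R S u v" "R v w" "w \<in> S"
  shows "reach R S u w"
proof -
  obtain xs where xs: "rpath R S xs" "hd xs = u" "last xs = v"
    using assms(1) unfolding reach_def by auto
  show ?thesis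
  \<comment> \<open>If \<open>w\<close> already lies on the path, the initial segment up to
    \<open>w\<close> is taken, so that no vertex repeats.\<close>
  proof (cases "w \<in> set xs")
    case True
    then obtain as bs where ab: "xs = as @ w # bs" by (meson split_list)
    have "rpath R S (as @ [w])" using rpath_split(1) xs(1) ab by metis
    moreover have "hd (as @ [w]) = u" using xs(2) ab by (cases as) auto
    ultimately show ?thesis unfolding reach_def by (intro exI[of _ "as @ [w]"]) auto
  next
    case False
    have "rpath R S (xs @ [w])"
      using xs assms False unfolding rpath_def by (auto simp: successively_append_iff)
    moreover have "hd (xs @ [w]) = u" using xs unfolding rpath_def by auto
    ultimately show ?thesis unfolding reach_def by (intro exI[of _ "xs @ [w]"]) auto
  qed
qed

lemma rpath_closed:
  assumes "symp R" "rclosed R S T" "rpath R S xs" "set xs \<inter> T \<noteq> {}"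
  shows "set xs \<subseteq> T"
proof -
  have "set ys \<subseteq> S \<Longrightarrow> successively R ys \<Longrightarrow> set ys \<inter> T \<noteq> {} \<Longrightarrow> set ys \<subseteq> T" for ys
  proof (induction ys)
    case (Cons y ys)
    show ?case
    proof (cases "ys = []")
      case False
      have yR: "R y (hd ys)" "successively R ys" "hd ys \<in> set ys" using Cons.prems False
        by (auto simp: successively_Cons)
      have inS: "y \<in> S" "hd ys \<in> S" using Cons.prems(1) yR(3) by auto
      have cl: "\<And>t u. t \<in> T \<Longrightarrow> u \<in> S \<Longrightarrow> R t u \<Longrightarrow> u \<in> T"
        using assms(2) unfolding rclosed_def by blast
      have "y \<in> T \<or> set ys \<inter> T \<noteq> {}" using Cons.prems(3) by auto
      hence "set ys \<inter> T \<noteq> {}" using cl[OF _ inS(2) yR(1)] yR(3) by blast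
      hence sub: "set ys \<subseteq> T" using Cons.IH Cons.prems(1) yR(2) by simp
      moreover have "R (hd ys) y" using yR(1) assms(1) by (rule sympD[rotated])
      ultimately have "y \<in> T" using cl[of "hd ys" y] yR(3) inS by blast
      thus ?thesis using sub by auto
    qed (use Cons in auto)
  qed auto
  thus ?thesis using assms(3,4) unfolding rpath_def by blast
qed

lemma reach_closed_comp: "rclosed R S {w. reach R S v w}"
  unfolding rclosed_def by (auto dest: reach_in intro: reach_step)

lemma rclosed_Diff:
  assumes "symp R" "rclosed R S T" "rclosed R S U"
  shows "rclosed R S (T - U)"
  unfolding rclosed_def
proof (intro conjI ballI impI)
  show "T - U \<subseteq> S" using assms(2) unfolding rclosed_def by auto
  fix t u assume "t \<in> T - U" "u \<in> S" "R t u"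
  thus "u \<in> T - U" using assms unfolding rclosed_def by (metis DiffD1 DiffD2 DiffI subsetD sympD)
qed

text \<open>In a closed set of least cardinality with at least \<open>m\<close> points of
  \<open>X\<close>, removing a small closed set \<open>D\<close> around any of its vertices leaves a
  smaller closed set, which by minimality has fewer than \<open>m\<close> of them. So the minimal
  set has at most \<open>2 * m\<close>.\<close>

lemma minimal_closed:
  assumes "finite S" "symp R" "1 \<le> m" "m \<le> card (S \<inter> X)"
    and small: "\<And>u. u \<in> S \<Longrightarrow> \<exists>D. rclosed R S D \<and> u \<in> D \<and> card (D \<inter> X) \<le> m"
  obtains T where "rclosed R S T" "m \<le> card (T \<inter> X)" "card (T \<inter> X) \<le> 2 * m"
proof -
  let ?P = "\<lambda>T. rclosed R S T \<and> m \<le> card (T \<inter> X)"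
  have "?P S" using assms unfolding rclosed_def by auto
  then obtain T where T: "?P T" and min: "\<And>T'. ?P T' \<Longrightarrow> card T \<le> card T'"
    using ex_has_least_nat[of ?P S card] by auto
  have finT: "finite T" using T assms(1) finite_subset unfolding rclosed_def by auto
  have "T \<inter> X \<noteq> {}" using T assms(3) by auto
  then obtain u where u: "u \<in> T" by auto
  hence "u \<in> S" using T unfolding rclosed_def by auto
  then obtain D where D: "rclosed R S D" "u \<in> D" "card (D \<inter> X) \<le> m" using small by blast
  have "card (T - D) < card T" using finT u D by (intro psubset_card_mono) auto
  hence "\<not> ?P (T - D)" using min by fastforce
  hence lt: "card ((T - D) \<inter> X) < m" using rclosed_Diff[OF assms(2)] T D by auto
  have finD: "finite D" using D(1) assms(1) unfolding rclosed_def by (meson finite_subset)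
  have "card (T \<inter> X) \<le> card (((T - D) \<inter> X) \<union> (D \<inter> X))"
    using finT finD by (intro card_mono) auto
  also have "\<dots> \<le> card ((T - D) \<inter> X) + card (D \<inter> X)" by (rule card_Un_le)
  finally have "card (T \<inter> X) \<le> card ((T - D) \<inter> X) + card (D \<inter> X)" .
  thus ?thesis using that[of T] T lt D by linarith
qed

text \<open>As in depth-first search, the path \<open>P\<close> is extended into a component of the rest while one of them contains
  more than \<open>m\<close> points of \<open>X\<close>; in the end \<open>T\<close> is assembled from small components.\<close>

lemma rooted_separator:
  assumes "finite S" "symp R" "1 \<le> m" "v \<in> S" "\<And>u. u \<in> S \<Longrightarrow> reach R S v u" "m + 1 \<le> card (S \<inter> X)"
  shows "\<exists>P T. rpath R S P \<and> hd P = v \<and> T \<subseteq> S \<and> T \<inter> set P = {} \<and>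
           m \<le> card (T \<inter> X) \<and> card (T \<inter> X) \<le> 2 * m \<and>
           (\<forall>t\<in>T. \<forall>u\<in>S. R t u \<longrightarrow> u \<in> T \<union> set P) \<and>
           (\<forall>t\<in>T. reach R (insert (last P) T) (last P) t)"
  using assms
proof (induction "card S" arbitrary: S v rule: less_induct)
  case less
  let ?S = "S - {v}"
  let ?C = "\<lambda>w. {x. reach R ?S w x}"
  \<comment> \<open>Every component of the graph on \<open>?S\<close> contains a neighbour of the
    root, because the root reaches all of \<open>S\<close>.\<close>
  have nb: "\<exists>w\<in>?S. R v w \<and> reach R ?S w u" if u: "u \<in> ?S" for u
  proof -
    obtain xs where xs: "rpath R S xs" "hd xs = v" "last xs = u"
      using less.prems(5) u unfolding reach_def by blast
    then obtain ys where ys: "xs = v # ys" unfolding rpath_def by (cases xs) auto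
    have ne: "ys \<noteq> []" using ys xs u by auto
    have "rpath R ?S ys" "R v (hd ys)" using xs ne unfolding ys rpath_def
      by (auto simp: successively_Cons)
    moreover have "last ys = u" using xs ys ne by auto
    ultimately show ?thesis unfolding reach_def rpath_def
      by (metis hd_in_set subsetD)
  qed
  show ?case
  proof (cases "\<exists>w\<in>?S. R v w \<and> m + 1 \<le> card (?C w \<inter> X)")
    case True
    then obtain w where w: "w \<in> ?S" "R v w" "m + 1 \<le> card (?C w \<inter> X)" by blast
    let ?D = "?C w"
    have Dcl: "rclosed R ?S ?D" using reach_closed_comp .
    have Dsub: "?D \<subseteq> ?S" using Dcl unfolding rclosed_def by auto
    have finD: "finite ?D" using Dsub less.prems(1) by (meson finite_Diff finite_subset)
    have "card ?D < card S" using Dsub less.prems(1,4) by (intro psubset_card_mono) auto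
    moreover have wD: "w \<in> ?D" using reach_refl[of w ?S R] w by auto
    moreover have "reach R ?D w u" if uD: "u \<in> ?D" for u
    proof -
      obtain xs where xs: "rpath R ?S xs" "hd xs = w" "last xs = u"
        using uD unfolding reach_def by blast
      have "set xs \<subseteq> ?D"
        by (rule rpath_closed[OF less.prems(2) Dcl xs(1)])
           (use xs wD in \<open>metis IntI empty_iff hd_in_set rpath_def\<close>)
      hence "rpath R ?D xs" using xs unfolding rpath_def by auto
      thus ?thesis using xs unfolding reach_def by auto
    qed
    ultimately obtain P T where PT: "rpath R ?D P" "hd P = w" "T \<subseteq> ?D" "T \<inter> set P = {}"
      "m \<le> card (T \<inter> X)" "card (T \<inter> X) \<le> 2 * m"
      "\<forall>t\<in>T. \<forall>u\<in>?D. R t u \<longrightarrow> u \<in> T \<union> set P"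
      "\<forall>t\<in>T. reach R (insert (last P) T) (last P) t"
      using less.hyps[of ?D w] finD less.prems(2,3) w(3) by auto
    have Pne: "P \<noteq> []" using PT(1) unfolding rpath_def by auto
    have PD: "set P \<subseteq> ?D" using PT(1) unfolding rpath_def by auto
    have vD: "v \<notin> ?D" using Dsub by auto
    have "rpath R S (v # P)" using PT(1,2) Dsub w less.prems(4) Pne vD unfolding rpath_def
      by (auto simp: successively_Cons)
    moreover have "T \<inter> set (v # P) = {}" using PT(3,4) vD by auto
    moreover have "T \<subseteq> S" using PT(3) Dsub by auto
    \<comment> \<open>\<open>?D\<close> is a component of the graph without \<open>v\<close>, so an
      edge leaving it can only end in \<open>v\<close>, which is now on the path.\<close>
    moreover have "\<forall>t\<in>T. \<forall>u\<in>S. R t u \<longrightarrow> u \<in> T \<union> set (v # P)"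
    proof (intro ballI impI)
      fix t u assume t: "t \<in> T" "u \<in> S" "R t u"
      show "u \<in> T \<union> set (v # P)"
      proof (cases "u = v")
        case False
        hence "u \<in> ?D" using t PT(3) Dcl unfolding rclosed_def by blast
        thus ?thesis using PT(7) t by auto
      qed auto
    qed
    ultimately show ?thesis using PT Pne
      by (intro exI[of _ "v # P"] exI[of _ T]) auto
  next
    case False
    have fin: "finite ?S" using less.prems(1) by auto
    have "card (S \<inter> X) \<le> card (insert v (?S \<inter> X))" using fin by (intro card_mono) auto
    also have "\<dots> \<le> card (?S \<inter> X) + 1" using card_insert_le_m1[of 1] fin by (simp add: card_insert_if)
    finally have big: "m \<le> card (?S \<inter> X)" using less.prems(6) by linarith
    obtain T where T: "rclosed R ?S T" "m \<le> card (T \<inter> X)" "card (T \<inter> X) \<le> 2 * m"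
    proof (rule minimal_closed[OF fin less.prems(2,3) big])
      fix u assume "u \<in> ?S"
      then obtain w where w: "w \<in> ?S" "R v w" "reach R ?S w u" using nb by blast
      show "\<exists>D. rclosed R ?S D \<and> u \<in> D \<and> card (D \<inter> X) \<le> m"
        using w False reach_closed_comp[of R ?S w] by (intro exI[of _ "?C w"]) auto
    qed
    have Tsub: "T \<subseteq> ?S" using T unfolding rclosed_def by auto
    have r: "reach R (insert v T) v t" if t: "t \<in> T" for t
    proof -
      obtain w where w: "w \<in> ?S" "R v w" "reach R ?S w t" using nb Tsub t by blast
      then obtain xs where xs: "rpath R ?S xs" "hd xs = w" "last xs = t" unfolding reach_def by blast
      have sub: "set xs \<subseteq> T"
        by (rule rpath_closed[OF less.prems(2) T(1) xs(1)])
           (use xs t in \<open>metis IntI empty_iff last_in_set rpath_def\<close>)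
      have "rpath R (insert v T) (v # xs)" using xs sub w Tsub unfolding rpath_def
        by (auto simp: successively_Cons)
      moreover have "last (v # xs) = t" using xs unfolding rpath_def by auto
      ultimately show ?thesis unfolding reach_def by (intro exI[of _ "v # xs"]) auto
    qed
    have "rpath R S [v]" using less.prems(4) unfolding rpath_def by auto
    moreover have "\<forall>t\<in>T. \<forall>u\<in>S. R t u \<longrightarrow> u \<in> T \<union> set [v]"
      using T(1) unfolding rclosed_def by auto
    ultimately show ?thesis using T Tsub r by (intro exI[of _ "[v]"] exI[of _ T]) auto
  qed
qed

text \<open>The rooted version gives a path \<open>P\<close> and a set \<open>T\<close> hanging off
  its end. If \<open>y\<close> is the first vertex of \<open>P\<close> with a neighbour in
  \<open>T\<close>, then the segment of \<open>P\<close> from \<open>y\<close> onwards, closed by a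
  path through \<open>T\<close> back to \<open>y\<close>, is a cycle containing every neighbour of
  \<open>T\<close> on \<open>P\<close>. In the degenerate cases there is no such \<open>y\<close>
  and hence no cycle, or \<open>y\<close> is the end of \<open>P\<close> and the cycle is a single
  vertex.\<close>

lemma cycle_separator:
  assumes "finite S" "symp R" "1 \<le> m" "m \<le> card (S \<inter> X)"
  obtains T C where "T \<subseteq> S" "m \<le> card (T \<inter> X)" "card (T \<inter> X) \<le> 2 * m"
    "C = [] \<or> cyc R C" "set C \<subseteq> S" "\<And>t u. t \<in> T \<Longrightarrow> u \<in> S \<Longrightarrow> R t u \<Longrightarrow> u \<in> T \<union> set C"
proof (cases "\<exists>v\<in>S. m + 1 \<le> card ({u. reach R S v u} \<inter> X)")
  case False
  obtain T where T: "rclosed R S T" "m \<le> card (T \<inter> X)" "card (T \<inter> X) \<le> 2 * m"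
  proof (rule minimal_closed[OF assms])
    fix u assume "u \<in> S"
    thus "\<exists>D. rclosed R S D \<and> u \<in> D \<and> card (D \<inter> X) \<le> m"
      using False reach_closed_comp[of R S u] reach_refl[of u S R]
      by (intro exI[of _ "{w. reach R S u w}"]) auto
  qed
  show ?thesis by (rule that[of T "[]"]) (use T in \<open>auto simp: rclosed_def\<close>)
next
  case True
  then obtain v where v: "v \<in> S" "m + 1 \<le> card ({u. reach R S v u} \<inter> X)" by auto
  let ?D = "{u. reach R S v u}"
  have Dcl: "rclosed R S ?D" using reach_closed_comp .
  have Dsub: "?D \<subseteq> S" using Dcl unfolding rclosed_def by auto
  have finD: "finite ?D" using Dsub assms(1) by (meson finite_subset)
  have vD: "v \<in> ?D" using reach_refl[of v S R] v by auto
  have "reach R ?D v u" if uD: "u \<in> ?D" for u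
  proof -
    obtain xs where xs: "rpath R S xs" "hd xs = v" "last xs = u"
      using uD unfolding reach_def by blast
    have "set xs \<subseteq> ?D"
      by (rule rpath_closed[OF assms(2) Dcl xs(1)])
         (use xs vD in \<open>metis IntI empty_iff hd_in_set rpath_def\<close>)
    hence "rpath R ?D xs" using xs unfolding rpath_def by auto
    thus ?thesis using xs unfolding reach_def by auto
  qed
  then obtain P T where PT: "rpath R ?D P" "hd P = v" "T \<subseteq> ?D" "T \<inter> set P = {}"
      "m \<le> card (T \<inter> X)" "card (T \<inter> X) \<le> 2 * m"
      "\<forall>t\<in>T. \<forall>u\<in>?D. R t u \<longrightarrow> u \<in> T \<union> set P"
      "\<forall>t\<in>T. reach R (insert (last P) T) (last P) t"
    using rooted_separator[OF finD assms(2,3) vD, of X] v(2) by auto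
  have PD: "set P \<subseteq> ?D" and Pne: "P \<noteq> []" and dP: "distinct P" and sP: "successively R P"
    using PT(1) unfolding rpath_def by auto
  have nbT: "u \<in> T \<union> set P" if "t \<in> T" "u \<in> S" "R t u" for t u
    using that PT(3,7) Dcl unfolding rclosed_def by blast
  let ?Q = "\<lambda>y. \<exists>t\<in>T. R t y"
  show ?thesis
  proof (cases "\<exists>y\<in>set P. ?Q y")
    case False
    have "u \<in> T" if "t \<in> T" "u \<in> S" "R t u" for t u
      using nbT[OF that] False that by blast
    thus ?thesis using that[of T "[]"] PT(3,5,6) Dsub by auto
  next
    case True
    then obtain P1 y P2 where P: "P = P1 @ y # P2" "?Q y" "\<forall>z\<in>set P1. \<not> ?Q z"
      using split_list_first_prop[of P ?Q] by auto
    obtain t where t: "t \<in> T" "R t y" using P(2) by auto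
    show ?thesis
    proof (cases "P2 = []")
      case True
      have "u \<in> T \<union> {y}" if "t' \<in> T" "u \<in> S" "R t' u" for t' u
        using nbT[OF that] P True that by auto
      moreover have "y \<in> S" using P PD Dsub by auto
      ultimately show ?thesis using that[of T "[y]"] PT(3,5,6) Dsub by (auto simp: cyc_def)
    next
      case False
      have lP: "last P = last P2" using P False by auto
      obtain xs where xs: "rpath R (insert (last P) T) xs" "hd xs = last P" "last xs = t"
        using PT(8) t unfolding reach_def by blast
      then obtain ys where ys: "xs = last P # ys" unfolding rpath_def by (cases xs) auto
      have "last P \<notin> T" using PT(4) Pne by (meson disjoint_iff last_in_set)
      hence ne: "ys \<noteq> []" using xs ys t by auto
      have ysT: "set ys \<subseteq> T" using xs(1) unfolding ys rpath_def by auto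
      have sys: "R (last P) (hd ys)" "successively R ys" "distinct ys" using xs(1) ne unfolding ys rpath_def
        by (auto simp: successively_Cons)
      let ?C = "y # P2 @ ys"
      have "cyc R ?C"
        unfolding cyc_def
      proof (intro conjI disjI2)
        show "distinct ?C" using dP P ysT PT(4) sys(3) by auto
        show "3 \<le> length ?C" using False ne by (cases P2; cases ys) auto
        show "successively R ?C" using sP P sys False ne lP
          by (auto simp: successively_append_iff successively_Cons)
        show "R (last ?C) (hd ?C)" using ne t xs(3) ys by auto
      qed auto
      moreover have "set ?C \<subseteq> S" using P PD ysT PT(3) Dsub by auto
      moreover have "u \<in> T \<union> set ?C" if "t' \<in> T" "u \<in> S" "R t' u" for t' u
        using nbT[OF that] P that by auto
      ultimately show ?thesis using that[of T ?C] PT Dsub by blast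
    qed
  qed
qed

section \<open>Covering one side of a bipartite graph\<close>

lemma successively_last_iff:
  "successively R (x # xs) \<and> R (last (x # xs)) z \<longleftrightarrow> list_all2 R (x # xs) (xs @ [z])"
  by (induction xs arbitrary: x) (auto simp: successively_Cons)

text \<open>Relates a cycle pointwise to its rotation, so that the closing edge needs no separate
  treatment.\<close>

lemma cyc_rotate:
  assumes "cyc R vs" "length vs \<noteq> 1"
  shows "list_all2 R vs (rotate1 vs)"
  using assms successively_last_iff[of R "hd vs" "tl vs" "hd vs"] unfolding cyc_def
  by (cases vs) auto

lemma list_all2_filter_le:
  "list_all2 P xs ys \<Longrightarrow> (\<And>x y. P x y \<Longrightarrow> A x \<Longrightarrow> B y) \<Longrightarrow>
     length (filter A xs) \<le> length (filter B ys)"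
  by (induction rule: list_all2_induct) auto

text \<open>The cyclic successor is injective and sends vertices of \<open>A\<close> to vertices of
  \<open>B\<close>.\<close>

lemma cyc_bipartite_card:
  assumes "cyc R vs" "length vs \<noteq> 1" "\<And>u v. R u v \<Longrightarrow> u \<in> A \<Longrightarrow> v \<in> B"
  shows "card (set vs \<inter> A) \<le> card (set vs \<inter> B)"
proof -
  have d: "distinct vs" using assms(1) unfolding cyc_def by auto
  have c: "card (set vs \<inter> D) = length (filter (\<lambda>x. x \<in> D) vs)" for D
  proof -
    have "set vs \<inter> D = set (filter (\<lambda>x. x \<in> D) vs)" by auto
    thus ?thesis using d distinct_card[of "filter (\<lambda>x. x \<in> D) vs"] by simp
  qed
  have r: "set (rotate1 vs) = set vs" "distinct (rotate1 vs)" using d by auto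
  have c2: "card (set vs \<inter> B) = length (filter (\<lambda>x. x \<in> B) (rotate1 vs))"
  proof -
    have "set vs \<inter> B = set (filter (\<lambda>x. x \<in> B) (rotate1 vs))" using r by auto
    thus ?thesis using r distinct_card[of "filter (\<lambda>x. x \<in> B) (rotate1 vs)"] by simp
  qed
  show ?thesis unfolding c[of A] c2
    by (rule list_all2_filter_le[OF cyc_rotate[OF assms(1,2)]]) (use assms(3) in blast)
qed

definition biprel :: "'a set \<Rightarrow> 'a set \<Rightarrow> ('a \<Rightarrow> 'a \<Rightarrow> bool) \<Rightarrow> 'a \<Rightarrow> 'a \<Rightarrow> bool" where
  "biprel X Y A u v \<longleftrightarrow> u \<in> X \<and> v \<in> Y \<and> A u v \<or> u \<in> Y \<and> v \<in> X \<and> A v u"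

lemma symp_biprel: "symp (biprel X Y A)"
  unfolding symp_def biprel_def by auto

text \<open>In each round \<open>cycle_separator\<close> cuts off a set \<open>T\<close> with
  \<open>m\<close> to \<open>2 * m\<close> points of \<open>X\<close>; its cycle is kept and the
  rest of \<open>T\<close> abandoned. \<open>X'\<close> and \<open>Y'\<close> are what remains of
  the two sides, and \<open>Z\<close> contains the part of \<open>Y\<close> used by earlier cycles.
  By separation no remaining vertex of \<open>X'\<close> has an abandoned neighbour, so the
  \<open>\<nu>\<close> neighbours of \<open>T\<close> lie in \<open>Z\<close>, which is too small
  for them, or in the part of \<open>Y'\<close> removed now. Hence each round consumes
  \<open>\<nu> / 2\<close> vertices of \<open>Y'\<close>, and this bounds the number
  \<open>a\<close> of rounds.\<close>

lemma bipartite_cover_aux: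
  fixes \<nu> :: real
  assumes fin: "finite X" "finite Y" and dis: "X \<inter> Y = {}" and m: "1 \<le> m"
    and ex: "\<And>S. S \<subseteq> X \<Longrightarrow> m \<le> card S \<Longrightarrow> \<nu> \<le> card {y \<in> Y. \<exists>x\<in>S. A x y}"
    and X: "2 * card X \<le> \<nu>"
    and st: "X' \<subseteq> X" "Y' \<subseteq> Y" "Z \<subseteq> Y" "card Z + card X' \<le> card X"
    "\<And>x y. x \<in> X' \<Longrightarrow> y \<in> Y \<Longrightarrow> A x y \<Longrightarrow> y \<in> Y' \<union> Z"
  shows "\<exists>Cs a. (\<forall>C\<in>set Cs. cyc (biprel X Y A) C) \<and> distinct (concat Cs) \<and>
      set (concat Cs) \<subseteq> X' \<union> Y' \<and> card (X' - set (concat Cs)) \<le> 2 * m * a + m \<and>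
      length Cs \<le> a \<and> a * (\<nu> / 2) \<le> card Y' \<and>
      card (set (concat Cs) \<inter> Y) \<le> card X'"
  using st
proof (induction "card X'" arbitrary: X' Y' Z rule: less_induct)
  case less
  let ?R = "biprel X Y A"
  have finX': "finite X'" and finY': "finite Y'"
    using less.prems fin finite_subset by metis+
  show ?case
  proof (cases "card X' < m")
    case True
    show ?thesis by (rule exI[of _ "[]"], rule exI[of _ 0]) (use True in auto)
  next
    case False
    let ?S = "X' \<union> Y'"
    have SX: "?S \<inter> X = X'" using less.prems(1,2) dis by auto
    obtain T C where TC: "T \<subseteq> ?S" "m \<le> card (T \<inter> X)" "card (T \<inter> X) \<le> 2 * m"
      "C = [] \<or> cyc ?R C" "set C \<subseteq> ?S"
      and nb: "\<And>t u. t \<in> T \<Longrightarrow> u \<in> ?S \<Longrightarrow> ?R t u \<Longrightarrow> u \<in> T \<union> set C"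
      using cycle_separator[of ?S ?R m X] finX' finY' symp_biprel[of X Y A] m False SX
      by (metis finite_UnI not_le)
    define X2 where "X2 = X' - (T \<union> set C)"
    define Y2 where "Y2 = Y' - (T \<union> set C)"
    define Z2 where "Z2 = Z \<union> (set C \<inter> Y)"
    have finT: "finite T" using TC(1) finX' finY' finite_subset by blast
    have TX: "T \<inter> X = T \<inter> X'" using TC(1) SX by auto
    have cardX2: "card X2 + card (X' \<inter> (T \<union> set C)) = card X'"
      using finX' card_Diff_subset_Int[of X' "T \<union> set C"] finT card_mono[OF finX', of "X' \<inter> (T \<union> set C)"]
      unfolding X2_def by simp
    have Tpos: "card (T \<inter> X') > 0" using TC(2) m TX by auto
    have Tle: "card (T \<inter> X') \<le> card (X' \<inter> (T \<union> set C))"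
      by (rule card_mono) (use finX' in auto)
    have lt: "card X2 < card X'" using cardX2 Tpos Tle by linarith
    have CY: "card (set C \<inter> Y) \<le> card (X' \<inter> (T \<union> set C))"
    proof (cases "cyc ?R C \<and> length C \<noteq> 1")
      case True
      have "card (set C \<inter> Y) \<le> card (set C \<inter> X)"
        by (rule cyc_bipartite_card[of ?R]) (use True dis in \<open>auto simp: biprel_def\<close>)
      also have "\<dots> \<le> card (X' \<inter> (T \<union> set C))"
        by (rule card_mono) (use finX' TC(5) SX in auto)
      finally show ?thesis .
    next
      case False
      \<comment> \<open>A cycle of one vertex may lie in \<open>Y\<close>; it is paid for by a point
        of \<open>X\<close> lost with \<open>T\<close>.\<close>
      hence "length C \<le> 1" using TC(4) by auto
      hence "card (set C) \<le> 1" using card_length[of C] by linarith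
      hence "card (set C \<inter> Y) \<le> 1" using card_mono[of "set C" "set C \<inter> Y"] by auto
      thus ?thesis using Tpos Tle by linarith
    qed
    have st2: "X2 \<subseteq> X" "Y2 \<subseteq> Y" "Z2 \<subseteq> Y" unfolding X2_def Y2_def Z2_def using less.prems by auto
    have "card Z2 \<le> card Z + card (set C \<inter> Y)" unfolding Z2_def by (rule card_Un_le)
    hence st3: "card Z2 + card X2 \<le> card X" using CY cardX2 less.prems(4) by linarith
    have st4: "y \<in> Y2 \<union> Z2" if "x \<in> X2" "y \<in> Y" "A x y" for x y
    proof -
      have x: "x \<in> X'" "x \<notin> T" "x \<notin> set C" using that unfolding X2_def by auto
      have "y \<in> Y' \<union> Z" using less.prems(5) x that by auto
      moreover have "y \<in> Y2 \<union> set C" if y: "y \<in> Y'"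
      proof -
        have "y \<notin> T"
        proof
          assume "y \<in> T"
          moreover have "?R y x" unfolding biprel_def using x y \<open>A x y\<close> less.prems(1,2) by auto
          ultimately show False using nb[of y x] x by auto
        qed
        thus ?thesis using y unfolding Y2_def by auto
      qed
      ultimately show ?thesis using that unfolding Z2_def by auto
    qed
    have drop: "\<nu> / 2 \<le> real (card Y') - real (card Y2)"
    proof -
      let ?N = "{y \<in> Y. \<exists>x\<in>T \<inter> X. A x y}"
      have "?N \<subseteq> Z \<union> (Y' \<inter> (T \<union> set C))"
      proof
        fix y assume "y \<in> ?N"
        then obtain x where x: "x \<in> T" "x \<in> X'" "y \<in> Y" "A x y" using TX by auto
        have yy: "y \<in> Y' \<union> Z" using less.prems(5) x by auto
        show "y \<in> Z \<union> (Y' \<inter> (T \<union> set C))"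
        proof (cases "y \<in> Y'")
          case True
          have "?R x y" unfolding biprel_def using x less.prems(1) by auto
          thus ?thesis using nb[of x y] x True by auto
        qed (use yy in auto)
      qed
      moreover have finZ: "finite Z" using less.prems(3) fin finite_subset by blast
      ultimately have "card ?N \<le> card Z + card (Y' \<inter> (T \<union> set C))"
        using card_mono[of "Z \<union> (Y' \<inter> (T \<union> set C))" ?N] card_Un_le[of Z "Y' \<inter> (T \<union> set C)"] finY' by auto
      moreover have "\<nu> \<le> card ?N" using ex[of "T \<inter> X"] TC(2) by auto
      moreover have "card Y2 + card (Y' \<inter> (T \<union> set C)) = card Y'"
        using finY' card_Diff_subset_Int[of Y' "T \<union> set C"] finT card_mono[OF finY', of "Y' \<inter> (T \<union> set C)"]
        unfolding Y2_def by simp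
      moreover have "real (card Z) \<le> real (card X)" using less.prems(4) by linarith
      moreover have "real (card ?N) \<le> real (card Z) + real (card (Y' \<inter> (T \<union> set C)))"
        using calculation(1) by linarith
      moreover have "real (card Y2) + real (card (Y' \<inter> (T \<union> set C))) = real (card Y')"
        using calculation(3) by linarith
      ultimately show ?thesis using X by linarith
    qed
    have "\<exists>Cs a. (\<forall>C\<in>set Cs. cyc ?R C) \<and> distinct (concat Cs) \<and>
      set (concat Cs) \<subseteq> X2 \<union> Y2 \<and> card (X2 - set (concat Cs)) \<le> 2 * m * a + m \<and>
      length Cs \<le> a \<and> a * (\<nu> / 2) \<le> card Y2 \<and>
      card (set (concat Cs) \<inter> Y) \<le> card X2"
      by (rule less.hyps[OF lt st2 st3]) (rule st4)
    then obtain Cs a where IH: "\<forall>C\<in>set Cs. cyc ?R C" "distinct (concat Cs)" "set (concat Cs) \<subseteq> X2 \<union> Y2"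
      "card (X2 - set (concat Cs)) \<le> 2 * m * a + m" "length Cs \<le> a" "a * (\<nu> / 2) \<le> card Y2"
      "card (set (concat Cs) \<inter> Y) \<le> card X2"
      by (elim exE conjE)
    define Ds where "Ds = (if C = [] then Cs else C # Cs)"
    have disC: "set C \<inter> set (concat Cs) = {}" using IH(3) unfolding X2_def Y2_def by blast
    have cDs: "set (concat Ds) = set C \<union> set (concat Cs)" unfolding Ds_def by auto
    have dC: "distinct C" using TC(4) unfolding cyc_def by auto
    have 1: "\<forall>C\<in>set Ds. cyc ?R C" using IH(1) TC(4) unfolding Ds_def by auto
    have 2: "distinct (concat Ds)" using IH(2) dC disC unfolding Ds_def by auto
    have 3: "set (concat Ds) \<subseteq> X' \<union> Y'" using cDs IH(3) TC(5) unfolding X2_def Y2_def by auto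
    have 4: "card (X' - set (concat Ds)) \<le> 2 * m * (a + 1) + m"
    proof -
      have "X' - set (concat Ds) \<subseteq> (T \<inter> X) \<union> (X2 - set (concat Cs))"
        using cDs less.prems(1) unfolding X2_def by auto
      hence "card (X' - set (concat Ds)) \<le> card ((T \<inter> X) \<union> (X2 - set (concat Cs)))"
        by (rule card_mono[rotated]) (use finT finX' in \<open>auto simp: X2_def\<close>)
      also have "\<dots> \<le> card (T \<inter> X) + card (X2 - set (concat Cs))" by (rule card_Un_le)
      finally show ?thesis using TC(3) IH(4) by simp
    qed
    have 5: "length Ds \<le> a + 1" using IH(5) unfolding Ds_def by auto
    have 6: "real (a + 1) * (\<nu> / 2) \<le> card Y'" using IH(6) drop by (simp add: algebra_simps)
    have 7: "card (set (concat Ds) \<inter> Y) \<le> card X'"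
    proof -
      have "set (concat Ds) \<inter> Y = (set C \<inter> Y) \<union> (set (concat Cs) \<inter> Y)" using cDs by auto
      hence "card (set (concat Ds) \<inter> Y) \<le> card (set C \<inter> Y) + card (set (concat Cs) \<inter> Y)"
        by (metis card_Un_le)
      thus ?thesis using CY IH(7) cardX2 by linarith
    qed
    show ?thesis using 1 2 3 4 5 6 7 by blast
  qed
qed

lemma bipartite_cover:
  fixes \<nu> :: real
  assumes "finite X" "finite Y" "X \<inter> Y = {}" "1 \<le> m"
    "\<And>S. S \<subseteq> X \<Longrightarrow> m \<le> card S \<Longrightarrow> \<nu> \<le> card {y \<in> Y. \<exists>x\<in>S. A x y}"
    "2 * card X \<le> \<nu>"
  obtains Cs a where "\<And>C. C \<in> set Cs \<Longrightarrow> cyc (biprel X Y A) C" "distinct (concat Cs)"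
      "set (concat Cs) \<subseteq> X \<union> Y" "card (X - set (concat Cs)) \<le> 2 * m * a + m"
      "length Cs \<le> a" "a * (\<nu> / 2) \<le> card Y" "card (set (concat Cs) \<inter> Y) \<le> card X"
  using bipartite_cover_aux[OF assms, of X Y "{}"] by auto

lemma multicolour_cover:
  fixes \<nu> :: real
  assumes fin: "finite Y" "\<And>i. i < r \<Longrightarrow> finite (X i)" and dis: "\<And>i. i < r \<Longrightarrow> X i \<inter> Y = {}"
    and disX: "\<And>i j. i < r \<Longrightarrow> j < r \<Longrightarrow> i \<noteq> j \<Longrightarrow> X i \<inter> X j = {}" and m: "1 \<le> m"
    and ex: "\<And>i S. i < r \<Longrightarrow> S \<subseteq> X i \<Longrightarrow> m \<le> card S \<Longrightarrow> \<nu> \<le> card {y \<in> Y. \<exists>x\<in>S. A i x y}"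
    and X: "4 * (\<Sum>i<r. card (X i)) \<le> \<nu>"
    and a: "8 * card Y \<le> 3 * \<nu> * real a" and \<nu>: "0 < \<nu>"
  shows "\<exists>Cs. (\<forall>C\<in>set Cs. \<exists>i<r. cyc (biprel (X i) Y (A i)) C) \<and> distinct (concat Cs) \<and>
      set (concat Cs) \<subseteq> (\<Union>i<r. X i) \<union> Y \<and>
      card ((\<Union>i<r. X i) - set (concat Cs)) \<le> r * (2 * m * a + m) \<and> length Cs \<le> r * a"
proof -
  have "k \<le> r \<Longrightarrow> \<exists>Cs. (\<forall>C\<in>set Cs. \<exists>i<r. cyc (biprel (X i) Y (A i)) C) \<and> distinct (concat Cs) \<and>
      set (concat Cs) \<subseteq> (\<Union>i<k. X i) \<union> Y \<and>
      card ((\<Union>i<k. X i) - set (concat Cs)) \<le> k * (2 * m * a + m) \<and> length Cs \<le> k * a \<and>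
      card (set (concat Cs) \<inter> Y) \<le> (\<Sum>i<k. card (X i))" for k
  proof (induction k)
    case 0
    show ?case by (rule exI[of _ "[]"]) auto
  next
    case (Suc k)
    hence k: "k < r" by auto
    obtain Cs where Cs: "\<forall>C\<in>set Cs. \<exists>i<r. cyc (biprel (X i) Y (A i)) C" "distinct (concat Cs)"
      "set (concat Cs) \<subseteq> (\<Union>i<k. X i) \<union> Y"
      "card ((\<Union>i<k. X i) - set (concat Cs)) \<le> k * (2 * m * a + m)" "length Cs \<le> k * a"
      "card (set (concat Cs) \<inter> Y) \<le> (\<Sum>i<k. card (X i))" using Suc by auto
    let ?U = "set (concat Cs)"
    let ?Y = "Y - ?U"
    have s1: "(\<Sum>i<Suc k. card (X i)) \<le> (\<Sum>i<r. card (X i))"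
      using k by (intro sum_mono2) auto
    have s2: "real (\<Sum>i<k. card (X i)) + real (card (X k)) \<le> \<nu> / 4"
    proof -
      have "real (\<Sum>i<Suc k. card (X i)) \<le> real (\<Sum>i<r. card (X i))" using s1 of_nat_mono by blast
      thus ?thesis using X by simp
    qed
    have ex': "3 * \<nu> / 4 \<le> card {y \<in> ?Y. \<exists>x\<in>S. A k x y}" if "S \<subseteq> X k" "m \<le> card S" for S
    proof -
      let ?M = "{y \<in> Y. \<exists>x\<in>S. A k x y}"
      have "?M \<subseteq> {y \<in> ?Y. \<exists>x\<in>S. A k x y} \<union> (?U \<inter> Y)" by auto
      hence "card ?M \<le> card ({y \<in> ?Y. \<exists>x\<in>S. A k x y} \<union> (?U \<inter> Y))"
        by (rule card_mono[rotated]) (use fin in auto)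
      also have "\<dots> \<le> card {y \<in> ?Y. \<exists>x\<in>S. A k x y} + card (?U \<inter> Y)" by (rule card_Un_le)
      finally have "real (card ?M) \<le> real (card {y \<in> ?Y. \<exists>x\<in>S. A k x y}) + real (card (?U \<inter> Y))"
        by linarith
      moreover have "real (card (?U \<inter> Y)) \<le> \<nu> / 4" using Cs(6) s2 by linarith
      ultimately show ?thesis using ex[OF k that] by linarith
    qed
    have c: "2 * real (card (X k)) \<le> 3 * \<nu> / 4" using s2 \<nu> by linarith
    obtain Ds b where Ds: "\<And>C. C \<in> set Ds \<Longrightarrow> cyc (biprel (X k) ?Y (A k)) C" "distinct (concat Ds)"
      "set (concat Ds) \<subseteq> X k \<union> ?Y" "card (X k - set (concat Ds)) \<le> 2 * m * b + m"
      "length Ds \<le> b" "b * ((3 * \<nu> / 4) / 2) \<le> card ?Y" "card (set (concat Ds) \<inter> ?Y) \<le> card (X k)"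
    proof (rule bipartite_cover[of "X k" ?Y m "3 * \<nu> / 4" "A k"])
      show "X k \<inter> ?Y = {}" using dis[OF k] by auto
    qed (use fin k m ex' c in auto)
    have ba: "b \<le> a"
    proof -
      have "real (card ?Y) \<le> real (card Y)" using fin(1) by (simp add: card_mono)
      hence "real b * ((3 * \<nu> / 4) / 2) \<le> 3 * \<nu> * real a / 8" using Ds(6) a by linarith
      hence "real b * (3 * \<nu> / 8) \<le> real a * (3 * \<nu> / 8)" by (simp add: algebra_simps)
      thus ?thesis using \<nu> by simp
    qed
    have "X k \<inter> X i = {}" if "i < k" for i using disX[of k i] k that by simp
    hence disU: "X k \<inter> ?U = {}" using Cs(3) dis[OF k] by blast
    have cyD: "cyc (biprel (X k) Y (A k)) C" if "C \<in> set Ds" for C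
    proof -
      have "biprel (X k) Y (A k) u v" if "biprel (X k) ?Y (A k) u v" for u v
        using that unfolding biprel_def by auto
      thus ?thesis using Ds(1)[OF that] successively_mono[of "biprel (X k) ?Y (A k)" C "biprel (X k) Y (A k)"]
        unfolding cyc_def by metis
    qed
    have 1: "\<forall>C\<in>set (Cs @ Ds). \<exists>i<r. cyc (biprel (X i) Y (A i)) C" using Cs(1) cyD k by auto
    have 2: "distinct (concat (Cs @ Ds))" using Cs(2) Ds(2,3) disU by auto
    have 3: "set (concat (Cs @ Ds)) \<subseteq> (\<Union>i<Suc k. X i) \<union> Y" using Cs(3) Ds(3) unfolding concat_append set_append lessThan_Suc by blast
    have 4: "card ((\<Union>i<Suc k. X i) - set (concat (Cs @ Ds))) \<le> Suc k * (2 * m * a + m)"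
    proof -
      have "(\<Union>i<Suc k. X i) - set (concat (Cs @ Ds)) \<subseteq> ((\<Union>i<k. X i) - ?U) \<union> (X k - set (concat Ds))"
        by (auto simp: less_Suc_eq)
      moreover have "finite (((\<Union>i<k. X i) - ?U) \<union> (X k - set (concat Ds)))"
        using fin k by auto
      ultimately have "card ((\<Union>i<Suc k. X i) - set (concat (Cs @ Ds)))
          \<le> card (((\<Union>i<k. X i) - ?U) \<union> (X k - set (concat Ds)))" by (rule card_mono[rotated])
      also have "\<dots> \<le> card ((\<Union>i<k. X i) - ?U) + card (X k - set (concat Ds))" by (rule card_Un_le)
      also have "\<dots> \<le> k * (2 * m * a + m) + (2 * m * a + m)"
        using Cs(4) Ds(4) mult_le_mono2[OF ba, of "2 * m"] by linarith
      finally show ?thesis by simp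
    qed
    have 5: "length (Cs @ Ds) \<le> Suc k * a" using Cs(5) Ds(5) ba by simp
    have 6: "card (set (concat (Cs @ Ds)) \<inter> Y) \<le> (\<Sum>i<Suc k. card (X i))"
    proof -
      have "set (concat (Cs @ Ds)) \<inter> Y \<subseteq> (?U \<inter> Y) \<union> (set (concat Ds) \<inter> ?Y)" by auto
      hence "card (set (concat (Cs @ Ds)) \<inter> Y) \<le> card ((?U \<inter> Y) \<union> (set (concat Ds) \<inter> ?Y))"
        by (rule card_mono[rotated]) auto
      also have "\<dots> \<le> card (?U \<inter> Y) + card (set (concat Ds) \<inter> ?Y)" by (rule card_Un_le)
      finally show ?thesis using Cs(6) Ds(7) by simp
    qed
    show ?case using 1 2 3 4 5 6 by blast
  qed
  from this[of r] show ?thesis by auto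
qed

section \<open>Absorbers from disjoint edges\<close>

lemma hd_concat_map: "vs \<noteq> [] \<Longrightarrow> (\<And>v. v \<in> set vs \<Longrightarrow> F v \<noteq> []) \<Longrightarrow> hd (concat (map F vs)) = hd (F (hd vs))"
  by (cases vs) auto

lemma last_concat_map: "vs \<noteq> [] \<Longrightarrow> (\<And>v. v \<in> set vs \<Longrightarrow> F v \<noteq> []) \<Longrightarrow> last (concat (map F vs)) = last (F (last vs))"
  by (induction vs rule: rev_induct) auto

lemma successively_concat_map:
  assumes "\<And>v. v \<in> set vs \<Longrightarrow> F v \<noteq> [] \<and> successively K (F v)"
    and "successively (\<lambda>u v. K (last (F u)) (hd (F v))) vs"
  shows "successively K (concat (map F vs))"
  using assms
proof (induction vs)
  case (Cons v vs)
  show ?case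
  proof (cases "vs = []")
    case False
    have "hd (concat (map F vs)) = hd (F (hd vs))" using hd_concat_map[of vs F] Cons.prems(1) False by simp
    thus ?thesis using Cons False by (auto simp: successively_append_iff successively_Cons)
  qed (use Cons in auto)
qed auto

lemma distinct_concat_map:
  assumes "distinct vs" "\<And>v. v \<in> set vs \<Longrightarrow> distinct (F v)"
    "\<And>u v. u \<in> set vs \<Longrightarrow> v \<in> set vs \<Longrightarrow> u \<noteq> v \<Longrightarrow> set (F u) \<inter> set (F v) = {}"
  shows "distinct (concat (map F vs))"
  using assms
proof (induction vs)
  case (Cons v vs)
  have "set (F v) \<inter> set (F u) = {}" if "u \<in> set vs" for u
    using Cons.prems(3)[of v u] Cons.prems(1) that by auto
  hence "set (F v) \<inter> set (concat (map F vs)) = {}" by auto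
  thus ?case using Cons by auto
qed auto

text \<open>Substitutes a path for each vertex of a cycle. It serves both for inserting absorbed
  vertices and for realising auxiliary edges by paths of length two.\<close>

lemma cyc_concat_map:
  assumes cy: "cyc R vs" "length vs \<ge> 3"
    and F: "\<And>v. v \<in> set vs \<Longrightarrow> F v \<noteq> [] \<and> distinct (F v) \<and> successively K (F v)"
    and dis: "\<And>u v. u \<in> set vs \<Longrightarrow> v \<in> set vs \<Longrightarrow> u \<noteq> v \<Longrightarrow> set (F u) \<inter> set (F v) = {}"
    and step: "\<And>u v. u \<in> set vs \<Longrightarrow> v \<in> set vs \<Longrightarrow> R u v \<Longrightarrow> K (last (F u)) (hd (F v))"
  shows "cyc K (concat (map F vs))"
proof -
  have c: "vs \<noteq> []" "distinct vs" "successively R vs" "R (last vs) (hd vs)"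
    using cy unfolding cyc_def by auto
  have s: "successively (\<lambda>u v. K (last (F u)) (hd (F v))) vs"
    by (rule successively_mono[OF c(3)]) (use step in auto)
  have d: "distinct (concat (map F vs))"
    by (rule distinct_concat_map) (use c F dis in auto)
  have l: "length vs \<le> length (concat (map F vs))"
  proof -
    have "(\<forall>v\<in>set xs. F v \<noteq> []) \<Longrightarrow> length xs \<le> length (concat (map F xs))" for xs
    proof (induction xs)
      case (Cons a xs) thus ?case by (cases "F a") auto
    qed auto
    thus ?thesis using F by blast
  qed
  have "K (last (concat (map F vs))) (hd (concat (map F vs)))"
    using hd_concat_map[of vs F] last_concat_map[of vs F] c F step by (metis hd_in_set last_in_set)
  moreover have "successively K (concat (map F vs))"
    by (rule successively_concat_map) (use F s in auto)
  moreover have "3 \<le> length (concat (map F vs))" using l cy(2) by linarith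
  moreover from this have "concat (map F vs) \<noteq> []" by (metis list.size(3) not_numeral_le_zero)
  ultimately show ?thesis unfolding cyc_def using d by blast
qed

lemma concat_card_le:
  assumes "\<And>C. C \<in> set Cs \<Longrightarrow> card (set C \<inter> X) \<le> k"
  shows "card (set (concat Cs) \<inter> X) \<le> length Cs * k"
  using assms
proof (induction Cs)
  case (Cons C Cs)
  have "set (concat (C # Cs)) \<inter> X = (set C \<inter> X) \<union> (set (concat Cs) \<inter> X)" by auto
  hence "card (set (concat (C # Cs)) \<inter> X) \<le> card (set C \<inter> X) + card (set (concat Cs) \<inter> X)"
    by (metis card_Un_le)
  also have "\<dots> \<le> k + length Cs * k" using Cons by (intro add_mono) auto
  finally show ?case by simp
qed auto

text \<open>If all cycles of a bipartite cover of \<open>X\<close> through common neighbours had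
  fewer than \<open>k\<close> points of \<open>X\<close>, they would miss too much of
  \<open>X\<close> by \<open>big\<close>; so some cycle \<open>C\<close> is long. Each
  \<open>x\<close> on \<open>C\<close> is replaced by the edge from \<open>x\<close> to
  \<open>q x\<close>, both of whose ends see the neighbouring \<open>z\<close>. The absorbable
  vertices are not those on \<open>C\<close> but distinct common neighbours \<open>f x\<close> off
  \<open>C\<close>, which can be inserted between \<open>x\<close> and \<open>q x\<close>.\<close>

lemma absorber:
  fixes \<nu> :: real
  assumes fin: "finite X" "finite Y" and dis: "X \<inter> Y = {}" "q ` X \<inter> X = {}" "q ` X \<inter> Y = {}"
    and inj: "inj_on q X" and K: "symp K" and Kq: "\<And>x. x \<in> X \<Longrightarrow> K x (q x)"
    and Cn: "\<And>x z. x \<in> X \<Longrightarrow> z \<in> Cn x \<Longrightarrow> z \<in> Y \<and> K x z \<and> K (q x) z" and m: "1 \<le> m"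
    and ex: "\<And>S. S \<subseteq> X \<Longrightarrow> m \<le> card S \<Longrightarrow> \<nu> \<le> card (\<Union>x\<in>S. Cn x)"
    and X: "4 * card X \<le> \<nu>" and \<nu>: "0 < \<nu>" and a: "2 * card Y \<le> \<nu> * real a" and k: "2 \<le> k"
    and big: "a * (k - 1) + (2 * m * a + m) < card X"
  obtains Z B where "Z \<inter> B = {}" "B \<subseteq> Y" "Z \<subseteq> X \<union> q ` X \<union> Y" "k \<le> card B + m"
    "\<And>B'. B' \<subseteq> B \<Longrightarrow> \<exists>vs. cyc K vs \<and> set vs = Z \<union> B'"
proof -
  let ?R = "biprel X Y (\<lambda>x z. z \<in> Cn x)"
  obtain Cs b where Cs: "\<And>C. C \<in> set Cs \<Longrightarrow> cyc ?R C" "distinct (concat Cs)"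
      "set (concat Cs) \<subseteq> X \<union> Y" "card (X - set (concat Cs)) \<le> 2 * m * b + m"
      "length Cs \<le> b" "b * (\<nu> / 2) \<le> card Y" "card (set (concat Cs) \<inter> Y) \<le> card X"
  proof (rule bipartite_cover[OF fin dis(1) m, of \<nu> "\<lambda>x z. z \<in> Cn x"])
    fix S assume S: "S \<subseteq> X" "m \<le> card S"
    have "(\<Union>x\<in>S. Cn x) = {y \<in> Y. \<exists>x\<in>S. y \<in> Cn x}" using Cn S by blast
    thus "\<nu> \<le> card {y \<in> Y. \<exists>x\<in>S. y \<in> Cn x}" using ex[OF S] by simp
  next
    show "real (2 * card X) \<le> \<nu>" using X by linarith
  qed auto
  have "real b * (\<nu> / 2) \<le> real a * (\<nu> / 2)" using Cs(6) a by (simp add: algebra_simps)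
  hence ba: "b \<le> a" using \<nu> by simp
  obtain C where C: "C \<in> set Cs" "k \<le> card (set C \<inter> X)"
  proof -
    have "\<exists>C\<in>set Cs. k \<le> card (set C \<inter> X)"
    proof (rule ccontr)
      assume "\<not> ?thesis"
      hence "\<And>C. C \<in> set Cs \<Longrightarrow> card (set C \<inter> X) \<le> k - 1" by fastforce
      hence "card (set (concat Cs) \<inter> X) \<le> length Cs * (k - 1)" by (rule concat_card_le)
      also have "\<dots> \<le> a * (k - 1)" using Cs(5) ba by (intro mult_right_mono) auto
      finally have 1: "card (set (concat Cs) \<inter> X) \<le> a * (k - 1)" .
      have "card X \<le> card ((set (concat Cs) \<inter> X) \<union> (X - set (concat Cs)))"
        using fin by (intro card_mono) auto
      also have "\<dots> \<le> card (set (concat Cs) \<inter> X) + card (X - set (concat Cs))" by (rule card_Un_le)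
      also have "\<dots> \<le> a * (k - 1) + (2 * m * a + m)"
        using 1 Cs(4) mult_le_mono2[OF ba, of "2 * m"] by linarith
      finally show False using big by linarith
    qed
    thus ?thesis using that by blast
  qed
  have cyC: "cyc ?R C" using Cs(1) C(1) by auto
  have CXY: "set C \<subseteq> X \<union> Y" using Cs(3) C(1) by auto
  have "k \<le> card (set C)" using C(2) card_mono[of "set C" "set C \<inter> X"] by auto
  hence "2 \<le> length C" using k card_length[of C] by linarith
  hence len: "3 \<le> length C" using cyC unfolding cyc_def by auto
  let ?D = "set C \<inter> X"
  have CY: "card (set C \<inter> Y) \<le> card X"
    using Cs(7) C(1) card_mono[of "set (concat Cs) \<inter> Y" "set C \<inter> Y"] by force
  \<comment> \<open>Greedy choice of representatives: as long as \<open>m\<close> points of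
    \<open>?D\<close> are without one, they have \<open>\<nu>\<close> common neighbours in total,
    while at most \<open>2 * card X < \<nu>\<close> vertices are taken or lie on \<open>C\<close>.
    Only the last \<open>m\<close> points may remain without a representative.\<close>
  have "j + m \<le> k \<Longrightarrow> \<exists>D f. D \<subseteq> ?D \<and> card D = j \<and> inj_on f D \<and> (\<forall>x\<in>D. f x \<in> Cn x \<and> f x \<notin> set C)" for j
  proof (induction j)
    case 0
    show ?case by (rule exI[of _ "{}"]) auto
  next
    case (Suc j)
    then obtain D f where D: "D \<subseteq> ?D" "card D = j" "inj_on f D" "\<forall>x\<in>D. f x \<in> Cn x \<and> f x \<notin> set C"
      by auto
    have finD: "finite D" using D(1) by (meson finite_Int finite_set finite_subset)
    have "card (?D - D) = card ?D - j" using D(1,2) finD by (simp add: card_Diff_subset)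
    hence "m \<le> card (?D - D)" using C(2) Suc.prems by linarith
    hence "\<nu> \<le> card (\<Union>x\<in>?D - D. Cn x)" by (intro ex) auto
    moreover have "card (f ` D \<union> (set C \<inter> Y)) \<le> card X + card X"
    proof -
      have "card (f ` D) \<le> card X"
        using card_image_le[OF finD, of f] card_mono[OF fin(1), of D] D(1) by (meson le_inf_iff le_trans)
      thus ?thesis using CY card_Un_le[of "f ` D" "set C \<inter> Y"] by linarith
    qed
    hence "real (card (f ` D \<union> (set C \<inter> Y))) < \<nu>" using X \<nu> by linarith
    ultimately have "card (f ` D \<union> (set C \<inter> Y)) < card (\<Union>x\<in>?D - D. Cn x)" by linarith
    hence "\<not> (\<Union>x\<in>?D - D. Cn x) \<subseteq> f ` D \<union> (set C \<inter> Y)"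
      using card_mono[of "f ` D \<union> (set C \<inter> Y)" "\<Union>x\<in>?D - D. Cn x"] finD by fastforce
    then obtain x z where xz: "x \<in> ?D - D" "z \<in> Cn x" "z \<notin> f ` D" "z \<notin> set C \<inter> Y" by blast
    have "z \<notin> set C" using xz Cn by auto
    let ?f = "f(x := z)"
    have "insert x D \<subseteq> ?D" using D xz by auto
    moreover have "card (insert x D) = Suc j" using xz D(2) finD by auto
    moreover have "inj_on ?f (insert x D)" using D(3) xz by (auto simp: inj_on_def)
    moreover have "\<forall>y\<in>insert x D. ?f y \<in> Cn y \<and> ?f y \<notin> set C" using D(4) xz \<open>z \<notin> set C\<close> by auto
    ultimately show ?case by blast
  qed
  from this[of "k - m"] obtain D f where D: "D \<subseteq> ?D" "k \<le> card D + m" "inj_on f D"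
    "\<forall>x\<in>D. f x \<in> Cn x \<and> f x \<notin> set C"
  proof (cases "m \<le> k")
    case False
    show ?thesis by (rule that[of "{}" f]) (use False in auto)
  qed fastforce
  define B where "B = f ` D"
  define Z where "Z = set C \<union> q ` ?D"
  have BY: "B \<subseteq> Y" unfolding B_def using D Cn by blast
  have ZB: "Z \<inter> B = {}"
  proof -
    have "q ` ?D \<inter> Y = {}" using dis(3) by auto
    thus ?thesis using BY D(4) unfolding Z_def B_def by blast
  qed
  have "\<exists>vs. cyc K vs \<and> set vs = Z \<union> B'" if B': "B' \<subseteq> B" for B'
  proof -
    define F where "F v = (if v \<in> X then (if v \<in> D \<and> f v \<in> B' then [v, f v, q v] else [v, q v]) else [v])" for v
    have KD: "K (f v) (q v)" "K v (f v)" "f v \<in> Y" "f v \<notin> set C" if "v \<in> D" for v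
    proof -
      have "v \<in> X" "f v \<in> Cn v" "f v \<notin> set C" using that D by auto
      thus "K (f v) (q v)" "K v (f v)" "f v \<in> Y" "f v \<notin> set C" using Cn[of v "f v"] K by (auto dest: sympD)
    qed
    have "cyc K (concat (map F C))"
    proof (rule cyc_concat_map[OF cyC len])
      fix v assume v: "v \<in> set C"
      have "q v \<noteq> v" if "v \<in> X" using dis(2) that by (metis disjoint_iff imageI)
      moreover have "q v \<noteq> f v" if "v \<in> X" "v \<in> D" using dis(3) KD(3)[of v] that by (metis disjoint_iff imageI)
      moreover have "f v \<noteq> v" if "v \<in> D" using KD(4)[OF that] v by auto
      ultimately show "F v \<noteq> [] \<and> distinct (F v) \<and> successively K (F v)"
        unfolding F_def using KD[of v] Kq[of v] by auto
    next
      fix u v assume uv: "u \<in> set C" "v \<in> set C" "u \<noteq> v"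
      have F: "set (F w) \<subseteq> {w} \<union> (if w \<in> X then {q w} else {}) \<union> (if w \<in> D then {f w} else {})" for w
        unfolding F_def by auto
      have q1: "q w \<notin> X" "q w \<notin> Y" if "w \<in> X" for w using dis(2,3) that by blast+
      have q2: "q u \<noteq> q v" if "u \<in> X" "v \<in> X" using inj that uv by (meson inj_onD)
      have q3: "f u \<noteq> f v" if "u \<in> D" "v \<in> D" using D(3) that uv by (meson inj_onD)
      have w: "w \<in> X \<or> w \<in> Y" if "w \<in> set C" for w using CXY that by auto
      have wy: "q w \<noteq> w'" if "w \<in> X" "w' \<in> set C" for w w' using q1[OF that(1)] w[OF that(2)] by auto
      have wf: "q w \<noteq> f w'" if "w \<in> X" "w' \<in> D" for w w' using q1[OF that(1)] KD(3)[OF that(2)] by auto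
      have fw: "f w \<noteq> w'" if "w \<in> D" "w' \<in> set C" for w w' using KD(4)[OF that(1)] that(2) by auto
      have "({u} \<union> (if u \<in> X then {q u} else {}) \<union> (if u \<in> D then {f u} else {})) \<inter>
            ({v} \<union> (if v \<in> X then {q v} else {}) \<union> (if v \<in> D then {f v} else {})) = {}"
        using uv q2 q3 wy[of u v] wy[of v u] wf[of u v] wf[of v u] fw[of u v] fw[of v u] by auto
      thus "set (F u) \<inter> set (F v) = {}" using F[of u] F[of v] by blast
    next
      fix u v assume uv: "u \<in> set C" "v \<in> set C" "?R u v"
      show "K (last (F u)) (hd (F v))"
      proof (cases "u \<in> X \<and> v \<in> Y \<and> v \<in> Cn u")
        case True
        hence "v \<notin> X" using dis by auto
        thus ?thesis using True Cn[of u v] unfolding F_def by auto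
      next
        case False
        hence *: "u \<in> Y" "v \<in> X" "u \<in> Cn v" using uv(3) unfolding biprel_def by auto
        hence "u \<notin> X" using dis by auto
        thus ?thesis using * Cn[of v u] K unfolding F_def by (auto dest: sympD)
      qed
    qed
    moreover have "set (concat (map F C)) = Z \<union> B'"
    proof -
      have "set (F v) = {v} \<union> (if v \<in> X then {q v} else {}) \<union> (if v \<in> D \<and> f v \<in> B' then {f v} else {})" if "v \<in> set C" for v
        unfolding F_def using D(1) by auto
      hence "set (concat (map F C)) = (\<Union>v\<in>set C. {v} \<union> (if v \<in> X then {q v} else {}) \<union> (if v \<in> D \<and> f v \<in> B' then {f v} else {}))"
        by auto
      also have "\<dots> = Z \<union> B'"
      proof
        show "Z \<union> B' \<subseteq> (\<Union>v\<in>set C. {v} \<union> (if v \<in> X then {q v} else {}) \<union> (if v \<in> D \<and> f v \<in> B' then {f v} else {}))"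
          using B' D(1) unfolding Z_def B_def by fastforce
      qed (auto simp: Z_def split: if_splits)
      finally show ?thesis .
    qed
    ultimately show ?thesis by blast
  qed
  moreover have "k \<le> card B + m" unfolding B_def using D(2,3) by (simp add: card_image)
  moreover have "Z \<subseteq> X \<union> q ` X \<union> Y" unfolding Z_def using CXY by auto
  ultimately show ?thesis using that[of Z B] ZB BY by blast
qed

section \<open>Hall's theorem, minimum degree and greedy covering\<close>

text \<open>The induction of Halmos and Vaughan: either a proper nonempty tight subfamily is matched
  first and its union removed from the other sets, or no subfamily is tight and an arbitrary first
  choice preserves the condition.\<close>

theorem hall:
  assumes "finite I" "\<And>i. i \<in> I \<Longrightarrow> finite (A i)"
    "\<And>J. J \<subseteq> I \<Longrightarrow> card J \<le> card (\<Union>i\<in>J. A i)"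
  shows "\<exists>f. inj_on f I \<and> (\<forall>i\<in>I. f i \<in> A i)"
  using assms
proof (induction "card I" arbitrary: I A rule: less_induct)
  case less
  show ?case
  proof (cases "I = {}")
    case False
    then obtain i where i: "i \<in> I" by auto
    show ?thesis
    proof (cases "\<exists>J. J \<subset> I \<and> J \<noteq> {} \<and> card (\<Union>i\<in>J. A i) = card J")
      case True
      then obtain J where J: "J \<subset> I" "J \<noteq> {}" "card (\<Union>i\<in>J. A i) = card J" by auto
      have finJ: "finite J" using J(1) less.prems(1) finite_subset by blast
      have ltJ: "card J < card I" using J(1) less.prems(1) by (simp add: psubset_card_mono)
      obtain f where f: "inj_on f J" "\<forall>i\<in>J. f i \<in> A i"
        using less.hyps[OF ltJ, of A] finJ less.prems J(1) by (metis psubset_imp_subset subset_eq subset_trans)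
      let ?U = "\<Union>i\<in>J. A i"
      let ?A = "\<lambda>i. A i - ?U"
      have ltIJ: "card (I - J) < card I"
        using J less.prems(1) by (intro psubset_card_mono) auto
      have "card L \<le> card (\<Union>i\<in>L. ?A i)" if L: "L \<subseteq> I - J" for L
      proof -
        have finL: "finite L" using L less.prems(1) finite_subset by blast
        have "card L + card J = card (L \<union> J)" using L finL finJ by (subst card_Un_disjoint) auto
        also have "\<dots> \<le> card (\<Union>i\<in>L \<union> J. A i)" using L J(1) by (intro less.prems(3)) auto
        also have "(\<Union>i\<in>L \<union> J. A i) = (\<Union>i\<in>L. ?A i) \<union> ?U" by auto
        also have "card \<dots> \<le> card (\<Union>i\<in>L. ?A i) + card ?U" by (rule card_Un_le)
        finally show ?thesis using J(3) by simp
      qed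
      then obtain g where g: "inj_on g (I - J)" "\<forall>i\<in>I - J. g i \<in> ?A i"
        using less.hyps[OF ltIJ, of ?A] less.prems(1,2) by auto
      let ?h = "\<lambda>i. if i \<in> J then f i else g i"
      have ne: "f i \<noteq> g j" if "i \<in> J" "j \<in> I - J" for i j
      proof -
        have "f i \<in> ?U" using f(2) that(1) by blast
        moreover have "g j \<notin> ?U" using g(2) that(2) by auto
        ultimately show ?thesis by metis
      qed
      have "inj_on ?h I"
      proof (rule inj_onI)
        fix x y assume xy: "x \<in> I" "y \<in> I" "?h x = ?h y"
        show "x = y" using xy ne[of x y] ne[of y x] inj_onD[OF f(1), of x y] inj_onD[OF g(1), of x y]
          by (auto split: if_splits)
      qed
      moreover have "\<forall>i\<in>I. ?h i \<in> A i" using f g by auto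
      ultimately show ?thesis by blast
    next
      case noJ: False
      have "card {i} \<le> card (\<Union>i\<in>{i}. A i)" using i by (intro less.prems(3)) auto
      hence "A i \<noteq> {}" by auto
      then obtain a where a: "a \<in> A i" by auto
      let ?A = "\<lambda>j. A j - {a}"
      have lt: "card (I - {i}) < card I" using i less.prems(1) by (meson card_Diff1_less)
      have ex: "card L \<le> card (\<Union>j\<in>L. ?A j)" if L: "L \<subseteq> I - {i}" for L
      proof (cases "L = {}")
        case False
        have finL: "finite L" using L less.prems(1) finite_subset by blast
        have "L \<subset> I" using L i by auto
        hence 1: "card (\<Union>j\<in>L. A j) \<noteq> card L" using noJ False by blast
        have 2: "card L \<le> card (\<Union>j\<in>L. A j)" using less.prems(3)[of L] \<open>L \<subset> I\<close> by auto
        have 3: "(\<Union>j\<in>L. ?A j) = (\<Union>j\<in>L. A j) - {a}" by auto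
        have "card (\<Union>j\<in>L. A j) - 1 \<le> card ((\<Union>j\<in>L. A j) - {a})" by (simp add: card_Diff_singleton_if)
        thus ?thesis unfolding 3 using 1 2 by linarith
      qed auto
      have "\<exists>g. inj_on g (I - {i}) \<and> (\<forall>j\<in>I - {i}. g j \<in> ?A j)"
        by (rule less.hyps[OF lt _ _ ex]) (use less.prems(1,2) in auto)
      then obtain g where g: "inj_on g (I - {i})" "\<forall>j\<in>I - {i}. g j \<in> ?A j" by blast
      have "inj_on (g(i := a)) I" using g unfolding inj_on_def by auto
      moreover have "\<forall>j\<in>I. (g(i := a)) j \<in> A j" using g a by auto
      ultimately show ?thesis by blast
    qed
  qed auto
qed

section \<open>Degree sums and greedy rounds\<close>

lemma degree_sum_remove:
  assumes "finite U" "symp K" "irreflp K" "v \<in> U"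
  shows "(\<Sum>u\<in>U. card {w \<in> U. K u w}) =
    (\<Sum>u\<in>U - {v}. card {w \<in> U - {v}. K u w}) + 2 * card {w \<in> U. K v w}"
proof -
    let ?U = "U - {v}" and ?d = "card {w \<in> U. K v w}"
    have fin: "finite ?U" using assms(1) by auto
    have "card {w \<in> U. K u w} = card {w \<in> ?U. K u w} + (if K u v then 1 else 0)" if "u \<in> ?U" for u
    proof (cases "K u v")
      case True
      hence *: "{w \<in> U. K u w} = insert v {w \<in> ?U. K u w}" using assms(4) by auto
      show ?thesis unfolding * using True fin by simp
    next
      case False
      hence "{w \<in> U. K u w} = {w \<in> ?U. K u w}" by auto
      thus ?thesis using False by simp
    qed
    hence "(\<Sum>u\<in>?U. card {w \<in> U. K u w}) = (\<Sum>u\<in>?U. card {w \<in> ?U. K u w}) + (\<Sum>u\<in>?U. if K u v then 1 else 0)"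
      by (simp add: sum.distrib)
    also have "(\<Sum>u\<in>?U. if K u v then 1 else 0) = card {u \<in> ?U. K u v}"
      by (subst sum.inter_filter[OF fin, symmetric]) simp
    also have "{u \<in> ?U. K u v} = {w \<in> U. K v w}"
      using assms(2,3) by (auto dest: sympD irreflpD)
    finally show ?thesis
      using sum.remove[OF assms(1) assms(4), of "\<lambda>u. card {w \<in> U. K u w}"] by simp
qed

text \<open>Deleting a vertex of degree below \<open>D / 2\<close> takes less than \<open>D\<close>
  from the degree sum, so the average degree stays at least \<open>D\<close>. The deletion cannot
  exhaust the graph: a last vertex has degree 0, so the average condition gives
  \<open>D \<le> 0\<close>, while being deleted requires \<open>D > 0\<close>.\<close>

lemma min_degree_subgraph:
  fixes D :: real
  assumes "finite U" "symp K" "irreflp K" "U \<noteq> {}"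
    "D * card U \<le> (\<Sum>v\<in>U. card {w \<in> U. K v w})"
  shows "\<exists>S\<subseteq>U. S \<noteq> {} \<and> (\<forall>v\<in>S. D / 2 \<le> card {w \<in> S. K v w})"
  using assms
proof (induction "card U" arbitrary: U rule: less_induct)
  case less
  show ?case
  proof (cases "\<forall>v\<in>U. D / 2 \<le> card {w \<in> U. K v w}")
    case False
    then obtain v where v: "v \<in> U" "real (card {w \<in> U. K v w}) < D / 2" by auto
    let ?U = "U - {v}" and ?d = "card {w \<in> U. K v w}"
    have fin: "finite ?U" using less.prems(1) by auto
    have eq: "(\<Sum>u\<in>U. card {w \<in> U. K u w}) = (\<Sum>u\<in>?U. card {w \<in> ?U. K u w}) + 2 * ?d"
      by (rule degree_sum_remove[OF less.prems(1-3) v(1)])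
    have cU: "real (card U) = real (card ?U) + 1" using card_Suc_Diff1[OF less.prems(1) v(1)] by linarith
    have ge: "D * card ?U \<le> (\<Sum>u\<in>?U. card {w \<in> ?U. K u w})"
      using less.prems(5) v(2) unfolding eq cU by (simp add: algebra_simps)
    have ne: "?U \<noteq> {}"
    proof
      assume "?U = {}"
      hence U: "U = {v}" using v by auto
      have "{w \<in> U. K v w} = {}" using U less.prems(3) by (auto dest: irreflpD)
      thus False using less.prems(5) v(2) U by (simp add: Collect_conv_if irreflpD[OF less.prems(3)])
    qed
    have "card ?U < card U" using v less.prems(1) by (meson card_Diff1_less)
    then obtain S where "S \<subseteq> ?U" "S \<noteq> {}" "\<forall>v\<in>S. D / 2 \<le> card {w \<in> S. K v w}"
      using less.hyps[of ?U] fin less.prems(2,3) ne ge by blast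
    thus ?thesis by blast
  qed (use less.prems in blast)
qed

text \<open>\<open>\<tau>\<close> is the size down to which large sets are available; a run may stop
  there early. Otherwise every round leaves at most the fraction
  \<open>1 - 1 / \<kappa>\<close>.\<close>

lemma greedy_rounds:
  fixes \<kappa> \<tau> :: real
  assumes fin: "finite U" and \<kappa>: "1 \<le> \<kappa>"
    and step: "\<And>V. V \<subseteq> U \<Longrightarrow> \<tau> < card V \<Longrightarrow> \<exists>C. Q C \<and> distinct C \<and> set C \<subseteq> V \<and> card V \<le> \<kappa> * card (set C)"
  shows "\<exists>Cs. (\<forall>C\<in>set Cs. Q C) \<and> distinct (concat Cs) \<and> set (concat Cs) \<subseteq> U \<and> length Cs \<le> j \<and>
     (card (U - set (concat Cs)) \<le> \<tau> \<or> card (U - set (concat Cs)) \<le> card U * (1 - 1 / \<kappa>) ^ j)"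
proof (induction j)
  case 0
  show ?case by (rule exI[of _ "[]"]) auto
next
  case (Suc j)
  then obtain Cs where Cs: "\<forall>C\<in>set Cs. Q C" "distinct (concat Cs)" "set (concat Cs) \<subseteq> U" "length Cs \<le> j"
    "card (U - set (concat Cs)) \<le> \<tau> \<or> card (U - set (concat Cs)) \<le> card U * (1 - 1 / \<kappa>) ^ j" by auto
  let ?V = "U - set (concat Cs)"
  show ?case
  proof (cases "card ?V \<le> \<tau>")
    case True
    thus ?thesis using Cs by (intro exI[of _ Cs]) auto
  next
    case False
    then obtain C where C: "Q C" "distinct C" "set C \<subseteq> ?V" "card ?V \<le> \<kappa> * card (set C)"
      using step[of ?V] by auto
    have eq: "U - set (concat (C # Cs)) = ?V - set C" by auto
    have "card (?V - set C) = card ?V - card (set C)"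
      using C(3) by (simp add: card_Diff_subset)
    moreover have "card (set C) \<le> card ?V" using C(3) fin by (simp add: card_mono)
    ultimately have c1: "real (card (?V - set C)) = real (card ?V) - real (card (set C))" by simp
    have "real (card ?V) / \<kappa> \<le> card (set C)" using C(4) \<kappa> by (simp add: field_simps)
    hence "real (card (?V - set C)) \<le> card ?V * (1 - 1 / \<kappa>)" using c1 by (simp add: algebra_simps)
    also have "\<dots> \<le> (card U * (1 - 1 / \<kappa>) ^ j) * (1 - 1 / \<kappa>)"
      using Cs(5) False \<kappa> by (intro mult_right_mono) auto
    finally have "card (U - set (concat (C # Cs))) \<le> card U * (1 - 1 / \<kappa>) ^ Suc j"
      unfolding eq by (simp add: algebra_simps)
    moreover have "distinct (concat (C # Cs))" using Cs(2) C(2,3) by auto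
    moreover have "set (concat (C # Cs)) \<subseteq> U" using Cs(3) C(3) by auto
    ultimately show ?thesis using Cs(1,4) C(1) by (intro exI[of _ "C # Cs"]) auto
  qed
qed

lemma greedy_rounds_ln:
  fixes \<kappa> \<tau> \<epsilon> :: real
  assumes fin: "finite U" and \<kappa>: "1 \<le> \<kappa>" and \<epsilon>: "0 < \<epsilon>" "\<epsilon> \<le> 1"
    and step: "\<And>V. V \<subseteq> U \<Longrightarrow> \<tau> < card V \<Longrightarrow> \<exists>C. Q C \<and> distinct C \<and> set C \<subseteq> V \<and> card V \<le> \<kappa> * card (set C)"
  obtains Cs where "\<And>C. C \<in> set Cs \<Longrightarrow> Q C" "distinct (concat Cs)" "set (concat Cs) \<subseteq> U"
    "length Cs \<le> \<kappa> * ln (1 / \<epsilon>) + 1"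
    "card (U - set (concat Cs)) \<le> \<tau> \<or> card (U - set (concat Cs)) \<le> \<epsilon> * card U"
proof -
  define j where "j = nat \<lceil>\<kappa> * ln (1 / \<epsilon>)\<rceil>"
  have pos: "0 \<le> \<kappa> * ln (1 / \<epsilon>)" using \<kappa> \<epsilon> by simp
  have j: "\<kappa> * ln (1 / \<epsilon>) \<le> j" "j \<le> \<kappa> * ln (1 / \<epsilon>) + 1" unfolding j_def using pos by linarith+
  obtain Cs where Cs: "\<forall>C\<in>set Cs. Q C" "distinct (concat Cs)" "set (concat Cs) \<subseteq> U" "length Cs \<le> j"
    "card (U - set (concat Cs)) \<le> \<tau> \<or> card (U - set (concat Cs)) \<le> card U * (1 - 1 / \<kappa>) ^ j"
    using greedy_rounds[where Q = Q and j = j and \<tau> = \<tau>, OF fin \<kappa> step] by blast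
  have "(1 - 1 / \<kappa>) ^ j \<le> exp (- (1 / \<kappa>)) ^ j"
    using \<kappa> exp_ge_add_one_self[of "- (1 / \<kappa>)"] by (intro power_mono) auto
  also have "\<dots> = exp (- (j / \<kappa>))" by (simp add: exp_of_nat_mult[symmetric])
  also have "\<dots> \<le> exp (- ln (1 / \<epsilon>))" using j(1) \<kappa> by (simp add: field_simps)
  also have "\<dots> = \<epsilon>" using \<epsilon> by (simp add: ln_div)
  finally have "card U * (1 - 1 / \<kappa>) ^ j \<le> card U * \<epsilon>" by (intro mult_left_mono) auto
  thus ?thesis using that[of Cs] Cs j(2) by (force simp: mult.commute)
qed

section \<open>Multicoloured graphs of small independence number\<close>

lemma pigeonhole_le:
  fixes f :: "nat \<Rightarrow> real"
  assumes "0 < r" "c \<le> (\<Sum>i<r. f i)"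
  shows "\<exists>i<r. c \<le> r * f i"
proof (rule ccontr)
  assume "\<not> ?thesis"
  hence "r * f i < c" if "i < r" for i using that by (meson not_le)
  hence "(\<Sum>i<r. r * f i) < (\<Sum>i<r. c)" using assms(1) by (intro sum_strict_mono) auto
  also have "(\<Sum>i<r. c) = r * c" by simp
  finally have "r * (\<Sum>i<r. f i) < r * c" by (simp add: sum_distrib_left)
  thus False using assms by simp
qed

lemma cyc_mono: "cyc R C \<Longrightarrow> (\<And>u v. R u v \<Longrightarrow> K u v) \<Longrightarrow> cyc K C"
  unfolding cyc_def using successively_mono[of R C K] by blast

lemma cyc_singleton: "cyc R [v]"
  unfolding cyc_def by simp

text \<open>Colours may overlap: an edge of the auxiliary graph can carry several of them.\<close>

locale coloured_graph =
  fixes E :: "nat \<Rightarrow> 'a \<Rightarrow> 'a \<Rightarrow> bool" and r :: nat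
  assumes r2: "2 \<le> r" and sym: "\<And>i. symp (E i)" and irr: "\<And>i. irreflp (E i)"
begin

definition adj :: "'a \<Rightarrow> 'a \<Rightarrow> bool" where "adj u v \<longleftrightarrow> (\<exists>i<r. E i u v)"

definition indep_le :: "'a set \<Rightarrow> nat \<Rightarrow> bool" where
  "indep_le X k \<longleftrightarrow> (\<forall>I\<subseteq>X. (\<forall>u\<in>I. \<forall>v\<in>I. u \<noteq> v \<longrightarrow> \<not> adj u v) \<longrightarrow> card I \<le> k)"

definition mono_cyc :: "'a list \<Rightarrow> bool" where "mono_cyc C \<longleftrightarrow> (\<exists>i<r. cyc (E i) C)"

lemma adj_sym: "adj u v \<Longrightarrow> adj v u"
  unfolding adj_def
proof (elim exE conjE)
  fix i assume "i < r" "E i u v"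
  thus "\<exists>i<r. E i v u" using sympD[OF sym, of i u v] by auto
qed

lemma adj_irrefl: "\<not> adj v v"
  unfolding adj_def by (simp add: irreflpD[OF irr])

lemma indep_le_subset: "indep_le X k \<Longrightarrow> Y \<subseteq> X \<Longrightarrow> indep_le Y k"
  unfolding indep_le_def using subset_trans[of _ Y X] by simp

lemma indep_le_mono: "indep_le X k \<Longrightarrow> k \<le> l \<Longrightarrow> indep_le X l"
  unfolding indep_le_def by (elim all_forward imp_forward) simp_all

text \<open>A largest independent set dominates \<open>U\<close> and has at most \<open>k\<close>
  vertices, so one of them dominates a fraction \<open>1 / k\<close>.\<close>

lemma ex_large_degree:
  assumes fin: "finite U" and ne: "U \<noteq> {}" and al: "indep_le U k"
  shows "\<exists>v\<in>U. card U \<le> k * (1 + card {w \<in> U. adj v w})"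
proof (rule ccontr)
  assume neg: "\<not> ?thesis"
  define P where "P I \<longleftrightarrow> I \<subseteq> U \<and> (\<forall>u\<in>I. \<forall>v\<in>I. u \<noteq> v \<longrightarrow> \<not> adj u v)" for I
  have "P {}" unfolding P_def by auto
  moreover have "\<forall>I. P I \<longrightarrow> card I < Suc (card U)"
    using fin unfolding P_def by (auto intro: card_mono le_imp_less_Suc)
  ultimately have "\<exists>I. P I \<and> (\<forall>J. P J \<longrightarrow> card J \<le> card I)"
    by (rule ex_has_greatest_nat[of P "{}" card "Suc (card U)"])
  then obtain I where PI: "P I" and max: "\<And>J. P J \<Longrightarrow> card J \<le> card I" by blast
  have I: "I \<subseteq> U" "\<And>u v. u \<in> I \<Longrightarrow> v \<in> I \<Longrightarrow> u \<noteq> v \<Longrightarrow> \<not> adj u v"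
    using PI unfolding P_def by auto
  have finI: "finite I" using I(1) fin finite_subset by blast
  have dom: "U \<subseteq> (\<Union>v\<in>I. insert v {w \<in> U. adj v w})"
  proof
    fix u assume u: "u \<in> U"
    show "u \<in> (\<Union>v\<in>I. insert v {w \<in> U. adj v w})"
    proof (rule ccontr)
      assume *: "\<not> ?thesis"
      hence "\<not> adj v u \<and> \<not> adj u v" if "v \<in> I" for v using that u adj_sym by blast
      hence "P (insert u I)" using I u unfolding P_def by auto
      hence "card (insert u I) \<le> card I" by (rule max)
      thus False using * finI by auto
    qed
  qed
  have "card U \<le> card (\<Union>v\<in>I. insert v {w \<in> U. adj v w})"
    using dom finI fin by (intro card_mono) auto
  also have "\<dots> \<le> (\<Sum>v\<in>I. card (insert v {w \<in> U. adj v w}))" by (rule card_UN_le[OF finI])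
  also have "\<dots> \<le> (\<Sum>v\<in>I. 1 + card {w \<in> U. adj v w})"
    using fin by (intro sum_mono) (simp add: card_insert_if)
  finally have "k * card U \<le> (\<Sum>v\<in>I. k * (1 + card {w \<in> U. adj v w}))"
    by (metis mult_le_mono2 sum_distrib_left)
  also have "\<dots> < (\<Sum>v\<in>I. card U)"
  proof (rule sum_strict_mono[OF finI])
    show "I \<noteq> {}" using dom ne by auto
    fix v assume "v \<in> I"
    thus "k * (1 + card {w \<in> U. adj v w}) < card U" using neg I(1) by (meson not_le subsetD)
  qed
  also have "\<dots> = card I * card U" by simp
  also have "\<dots> \<le> k * card U" using al PI unfolding indep_le_def P_def by (intro mult_right_mono) auto
  finally show False by simp
qed

lemma adj_degree_le:
  assumes "finite U"
  shows "card {w \<in> U. adj v w} \<le> (\<Sum>i<r. card {w \<in> U. E i v w})"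
proof -
  have "{w \<in> U. adj v w} = (\<Union>i<r. {w \<in> U. E i v w})" unfolding adj_def by auto
  thus ?thesis using card_UN_le[of "{..<r}" "\<lambda>i. {w \<in> U. E i v w}"] by simp
qed

lemma ex_colour_degree:
  assumes "finite U"
  shows "\<exists>i<r. card {w \<in> U. adj v w} \<le> r * card {w \<in> U. E i v w}"
proof -
  have "real (card {w \<in> U. adj v w}) \<le> (\<Sum>i<r. real (card {w \<in> U. E i v w}))"
    using of_nat_mono[OF adj_degree_le[OF assms, of v], where 'a = real] by simp
  then obtain i where "i < r" "real (card {w \<in> U. adj v w}) \<le> r * real (card {w \<in> U. E i v w})"
    using pigeonhole_le[of r "real (card {w \<in> U. adj v w})" "\<lambda>i. real (card {w \<in> U. E i v w})"] r2 by auto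
  thus ?thesis by (intro exI[of _ i]) (simp flip: of_nat_mult)
qed

lemma r_sq: "r + 1 \<le> r\<^sup>2"
proof -
  have "2 * r \<le> r * r" using r2 by (intro mult_right_mono) auto
  thus ?thesis using r2 unfolding power2_eq_square by linarith
qed

text \<open>Some \<open>w \<in> W\<close> has many neighbours of one colour \<open>i\<close> in \<open>W\<close>. If \<open>i \<in> F\<close>, the pair \<open>wv i\<close>, \<open>w\<close> is heavy; otherwise \<open>i\<close>
  joins \<open>F\<close>, with \<open>w\<close> as \<open>wv i\<close>, which can happen only \<open>r\<close> times.\<close>

lemma heavy_pair_step:
  assumes fin: "finite W0" and al: "indep_le W0 r"
    and F: "F \<subseteq> {..<r}" "card F + j = r" "W \<subseteq> W0"
    "\<forall>c\<in>F. wv c \<in> W0 \<and> wv c \<notin> W \<and> (\<forall>w\<in>W. E c (wv c) w)"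
    and W: "(r\<^sup>2) ^ (j + 1) \<le> card W"
    and IH: "\<And>F' W' wv' j'. \<lbrakk>j = Suc j'; F' \<subseteq> {..<r}; card F' + j' = r; W' \<subseteq> W0;
      \<forall>c\<in>F'. wv' c \<in> W0 \<and> wv' c \<notin> W' \<and> (\<forall>w\<in>W'. E c (wv' c) w);
      (r\<^sup>2) ^ (j' + 1) \<le> card W'\<rbrakk> \<Longrightarrow>
      \<exists>u v i. i < r \<and> u \<in> W0 \<and> v \<in> W0 \<and> u \<noteq> v \<and> E i u v \<and>
       card W' + 1 \<le> (r\<^sup>2) ^ (j' + 1) * (card {w \<in> W'. E i u w \<and> E i v w} + 1)"
  shows "\<exists>u v i. i < r \<and> u \<in> W0 \<and> v \<in> W0 \<and> u \<noteq> v \<and> E i u v \<and>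
       card W + 1 \<le> (r\<^sup>2) ^ (j + 1) * (card {w \<in> W. E i u w \<and> E i v w} + 1)"
proof -
  have finW: "finite W" using F(3) fin finite_subset by blast
  have "0 < card W" using W r2 by (metis gr_zeroI le_zero_eq not_numeral_le_zero power_eq_0_iff)
  hence "W \<noteq> {}" by auto
  then obtain v where v: "v \<in> W" "card W \<le> r * (1 + card {w \<in> W. adj v w})"
    using ex_large_degree[OF finW _ indep_le_subset[OF al F(3)]] by blast
  obtain i where i: "i < r" "card {w \<in> W. adj v w} \<le> r * card {w \<in> W. E i v w}"
    using ex_colour_degree[OF finW] by blast
  let ?U = "{w \<in> W. E i v w}"
  have le: "card W \<le> r + r\<^sup>2 * card ?U"
  proof -
    have "r * card {w \<in> W. adj v w} \<le> r\<^sup>2 * card ?U"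
      using mult_le_mono2[OF i(2), of r] by (simp only: power2_eq_square mult.assoc)
    moreover have "card W \<le> r + r * card {w \<in> W. adj v w}" using v(2) by (simp only: distrib_left mult_1_right)
    ultimately show ?thesis by linarith
  qed
  \<comment> \<open>Counting with an extra 1 on both sides absorbs the additive loss through
    \<open>r + 1 \<le> r^2\<close>, so the losses of successive steps simply multiply.\<close>
  have le2: "card W + 1 \<le> r\<^sup>2 * (card ?U + 1)"
    unfolding distrib_left mult_1_right using le r_sq by linarith
  have r2pos: "0 < r\<^sup>2" using r2 by simp
  show ?thesis
  proof (cases "i \<in> F")
    case True
    have w: "wv i \<in> W0" "wv i \<notin> W" "\<And>w. w \<in> W \<Longrightarrow> E i (wv i) w" using F(4) True by auto
    have eq: "{w \<in> W. E i (wv i) w \<and> E i v w} = ?U" using w by auto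
    have "r\<^sup>2 * 1 \<le> r\<^sup>2 * (r\<^sup>2) ^ j" using r2pos by (intro mult_le_mono2) (simp add: Suc_leI)
    hence "r\<^sup>2 \<le> (r\<^sup>2) ^ (j + 1)" by simp
    hence "r\<^sup>2 * (card ?U + 1) \<le> (r\<^sup>2) ^ (j + 1) * (card ?U + 1)" by (rule mult_right_mono) simp
    hence "card W + 1 \<le> (r\<^sup>2) ^ (j + 1) * (card {w \<in> W. E i (wv i) w \<and> E i v w} + 1)"
      unfolding eq using le2 by linarith
    moreover have "wv i \<noteq> v" using w(2) v(1) by auto
    ultimately show ?thesis using i(1) w v(1) F(3) by blast
  next
    case False
    have finF: "finite F" using F(1) finite_subset by blast
    have "F \<noteq> {..<r}" using False i(1) by auto
    hence "card F < r" using F(1) psubset_card_mono[of "{..<r}" F] by auto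
    then obtain j' where j': "j = Suc j'" using F(2) by (cases j) auto
    have a5: "(r\<^sup>2) ^ (j' + 1) \<le> card ?U"
    proof -
      have "r\<^sup>2 * (r\<^sup>2) ^ (j' + 1) \<le> r + r\<^sup>2 * card ?U" using W le unfolding j' by simp
      also have "\<dots> < r\<^sup>2 * (card ?U + 1)" unfolding distrib_left mult_1_right using r_sq by linarith
      finally have "(r\<^sup>2) ^ (j' + 1) < card ?U + 1" by (rule mult_less_cancel1[THEN iffD1, THEN conjunct2])
      thus ?thesis by linarith
    qed
    have a2: "card (insert i F) + j' = r" using F(2) False finF j' by simp
    have "v \<notin> ?U" using irr by (auto dest: irreflpD)
    hence a4: "\<forall>c\<in>insert i F. (wv(i := v)) c \<in> W0 \<and> (wv(i := v)) c \<notin> ?U \<and> (\<forall>w\<in>?U. E c ((wv(i := v)) c) w)"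
      using F(3,4) v(1) False by auto
    have a1: "insert i F \<subseteq> {..<r}" and a3: "?U \<subseteq> W0" using F(1,3) i(1) by auto
    obtain u v' i' where u: "i' < r" "u \<in> W0" "v' \<in> W0" "u \<noteq> v'" "E i' u v'"
       "card ?U + 1 \<le> (r\<^sup>2) ^ (j' + 1) * (card {w \<in> ?U. E i' u w \<and> E i' v' w} + 1)"
      using IH[OF j' a1 a2 a3 a4 a5] by (elim exE conjE)
    have "card {w \<in> ?U. E i' u w \<and> E i' v' w} \<le> card {w \<in> W. E i' u w \<and> E i' v' w}"
      using finW by (intro card_mono) auto
    hence "(r\<^sup>2) ^ (j' + 1) * (card {w \<in> ?U. E i' u w \<and> E i' v' w} + 1)
        \<le> (r\<^sup>2) ^ (j' + 1) * (card {w \<in> W. E i' u w \<and> E i' v' w} + 1)" by simp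
    hence "r\<^sup>2 * (card ?U + 1) \<le> r\<^sup>2 * ((r\<^sup>2) ^ (j' + 1) * (card {w \<in> W. E i' u w \<and> E i' v' w} + 1))"
      using u(6) by (meson le_trans mult_le_mono2)
    hence le3: "card W + 1 \<le> r\<^sup>2 * ((r\<^sup>2) ^ (j' + 1) * (card {w \<in> W. E i' u w \<and> E i' v' w} + 1))"
      by (rule le_trans[OF le2])
    have e: "(r\<^sup>2) ^ (j + 1) * z = r\<^sup>2 * ((r\<^sup>2) ^ (j' + 1) * z)" for z
      unfolding j' by simp
    have "card W + 1 \<le> (r\<^sup>2) ^ (j + 1) * (card {w \<in> W. E i' u w \<and> E i' v' w} + 1)"
      unfolding e by (rule le3)
    thus ?thesis using u(1-5) by (intro exI[of _ u] exI[of _ v'] exI[of _ i'] conjI)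
  qed
qed

text \<open>\<open>j\<close> is the number of colours outside \<open>F\<close>. Each step costs a
  factor \<open>r\<close> for the independence number and a factor \<open>r\<close> for the choice
  of a colour. The step takes the induction hypothesis as an assumption guarded by
  \<open>j = Suc j'\<close>, so that it also proves the base case, in which \<open>F\<close>
  contains all colours.\<close>

lemma heavy_pair_aux:
  assumes fin: "finite W0" and al: "indep_le W0 r"
  shows "\<lbrakk>F \<subseteq> {..<r}; card F + j = r; W \<subseteq> W0; \<forall>c\<in>F. wv c \<in> W0 \<and> wv c \<notin> W \<and> (\<forall>w\<in>W. E c (wv c) w);
     (r\<^sup>2) ^ (j + 1) \<le> card W\<rbrakk> \<Longrightarrow>
     \<exists>u v i. i < r \<and> u \<in> W0 \<and> v \<in> W0 \<and> u \<noteq> v \<and> E i u v \<and>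
       card W + 1 \<le> (r\<^sup>2) ^ (j + 1) * (card {w \<in> W. E i u w \<and> E i v w} + 1)"
proof (induction j arbitrary: F W wv)
  case (0 F W wv)
  have Feq: "F = {..<r}" using 0 by (metis add.right_neutral card_lessThan card_subset_eq finite_lessThan)
  show ?case using heavy_pair_step[OF fin al, of F 0 W wv] 0 Feq by auto
next
  case (Suc j)
  show ?case
  proof (rule heavy_pair_step[OF fin al Suc.prems])
    fix F' W' wv' j' assume a: "Suc j = Suc j'" and b: "F' \<subseteq> {..<r}" "card F' + j' = r" "W' \<subseteq> W0"
      "\<forall>c\<in>F'. wv' c \<in> W0 \<and> wv' c \<notin> W' \<and> (\<forall>w\<in>W'. E c (wv' c) w)" "(r\<^sup>2) ^ (j' + 1) \<le> card W'"
    have j: "j' = j" using a by simp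
    show "\<exists>u v i. i < r \<and> u \<in> W0 \<and> v \<in> W0 \<and> u \<noteq> v \<and> E i u v \<and>
       card W' + 1 \<le> (r\<^sup>2) ^ (j' + 1) * (card {w \<in> W'. E i u w \<and> E i v w} + 1)"
      using b unfolding j by (rule Suc.IH)
  qed
qed

definition g :: nat where "g = (r\<^sup>2) ^ (r + 1)"

lemma heavy_pair:
  assumes "finite W" "indep_le W r" "g \<le> card W"
  shows "\<exists>u v i. i < r \<and> u \<in> W \<and> v \<in> W \<and> u \<noteq> v \<and> E i u v \<and>
       card W + 1 \<le> g * (card {w \<in> W. E i u w \<and> E i v w} + 1)"
  unfolding g_def
\<comment> \<open>No colour has a witness yet, so the witness map is arbitrary.\<close>
proof (rule heavy_pair_aux[OF assms(1,2), of "{}" r W "\<lambda>_. undefined"])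
  show "(r\<^sup>2) ^ (r + 1) \<le> card W" using assms(3) unfolding g_def .
qed simp_all

text \<open>Up to \<open>n\<close> pairs occupy at most half of \<open>X\<close>, so
  \<open>heavy_pair\<close> applies to the rest, and the lost half turns \<open>g\<close> into
  \<open>2 * g\<close>.\<close>

lemma disjoint_heavy_pairs:
  assumes fin: "finite X" and al: "indep_le X r" and n: "4 * n \<le> card X" "2 * g \<le> card X"
  shows "j \<le> n \<Longrightarrow> \<exists>A q col. A \<subseteq> X \<and> card A = j \<and> q ` A \<subseteq> X \<and> inj_on q A \<and> q ` A \<inter> A = {} \<and>
    (\<forall>x\<in>A. col x < r \<and> E (col x) x (q x) \<and>
      card X + 2 \<le> 2 * g * (card {w \<in> X. E (col x) x w \<and> E (col x) (q x) w} + 1))"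
proof (induction j)
  case 0
  show ?case by (rule exI[of _ "{}"]) auto
next
  case (Suc j)
  then obtain A q col where A: "A \<subseteq> X" "card A = j" "q ` A \<subseteq> X" "inj_on q A" "q ` A \<inter> A = {}"
    "\<forall>x\<in>A. col x < r \<and> E (col x) x (q x) \<and>
      card X + 2 \<le> 2 * g * (card {w \<in> X. E (col x) x w \<and> E (col x) (q x) w} + 1)" by auto
  have finA: "finite A" using A(1) fin finite_subset by blast
  let ?W = "X - (A \<union> q ` A)"
  have "card (A \<union> q ` A) \<le> 2 * j"
    using card_Un_le[of A "q ` A"] card_image_le[OF finA, of q] A(2) by linarith
  moreover have "card X - card (A \<union> q ` A) \<le> card ?W"
    by (rule diff_card_le_card_Diff) (use finA in auto)
  ultimately have W: "card X \<le> 2 * card ?W" using n(1) Suc.prems by linarith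
  obtain u v i where u: "i < r" "u \<in> ?W" "v \<in> ?W" "u \<noteq> v" "E i u v"
    "card ?W + 1 \<le> g * (card {w \<in> ?W. E i u w \<and> E i v w} + 1)"
    using heavy_pair[of ?W] fin indep_le_subset[OF al, of ?W] W n(2) by (auto simp del: Diff_iff Un_iff)
  have "card {w \<in> ?W. E i u w \<and> E i v w} \<le> card {w \<in> X. E i u w \<and> E i v w}"
    using fin by (intro card_mono) auto
  hence "g * (card {w \<in> ?W. E i u w \<and> E i v w} + 1) \<le> g * (card {w \<in> X. E i u w \<and> E i v w} + 1)" by simp
  hence c: "card X + 2 \<le> 2 * g * (card {w \<in> X. E i u w \<and> E i v w} + 1)" using u(6) W by linarith
  let ?A = "insert u A" and ?q = "q(u := v)" and ?col = "col(u := i)"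
  have uA: "u \<notin> A" "u \<notin> q ` A" "v \<notin> A" "v \<notin> q ` A" using u by auto
  have im: "?q ` ?A = insert v (q ` A)" using uA by auto
  have "inj_on ?q ?A" using A(4) uA by (auto simp: inj_on_def)
  moreover have "card ?A = Suc j" using A(2) finA uA by simp
  moreover have "?q ` ?A \<inter> ?A = {}" unfolding im using A(5) uA u(4) by auto
  moreover have "?q ` ?A \<subseteq> X" unfolding im using A(3) u by auto
  moreover have "\<forall>x\<in>?A. ?col x < r \<and> E (?col x) x (?q x) \<and>
      card X + 2 \<le> 2 * g * (card {w \<in> X. E (?col x) x w \<and> E (?col x) (?q x) w} + 1)"
    using A(6) u c uA by auto
  moreover have "?A \<subseteq> X" using A(1) u by auto
  ultimately show ?case by blast
qed

lemma g_ge: "r \<le> g" "1 \<le> g"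
proof -
  have r1: "1 \<le> r\<^sup>2" using r2 by simp
  have "r \<le> r\<^sup>2" using r_sq by linarith
  also have "r\<^sup>2 * 1 \<le> r\<^sup>2 * (r\<^sup>2) ^ r" using r1 by (intro mult_le_mono2) simp
  finally show "r \<le> g" unfolding g_def by simp
  thus "1 \<le> g" using r2 by linarith
qed

text \<open>A single heavy pair already has a positive proportion of all vertices as common
  neighbours, so \<open>absorber\<close> applies with \<open>m = 1\<close>. The
  \<open>r * k0\<close> pairs contain \<open>k0\<close> of one colour. As \<open>k0\<close> is about
  \<open>card X / (32 * g)\<close>, these pairs destroy at most about an eighth of the
  \<open>card X / (2 * g)\<close> common neighbours of a pair, which leaves room for
  \<open>\<nu>\<close>; then \<open>a = 11 * g\<close> because \<open>33 / 16\<close> exceeds 2.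
  Finally \<open>11 * g * k\<close> is less than about half of \<open>k0\<close>, so cycles with
  fewer than \<open>k\<close> points cannot cover the pairs.\<close>

lemma dense_absorber:
  assumes fin: "finite X" and al: "indep_le X r" and N: "1600 * g\<^sup>2 \<le> card X"
  shows "\<exists>i Z B. i < r \<and> Z \<subseteq> X \<and> B \<subseteq> X \<and> Z \<inter> B = {} \<and> card X \<le> 2400 * g\<^sup>2 * card B \<and>
     (\<forall>B'\<subseteq>B. \<exists>vs. cyc (E i) vs \<and> set vs = Z \<union> B')"
proof -
  let ?N = "card X"
  define k0 where "k0 = ?N div (32 * g)"
  define k where "k = ?N div (800 * g\<^sup>2)"
  have gg: "g \<le> g\<^sup>2" using g_ge(2) by (simp add: power2_eq_square)
  have k0: "32 * (g * k0) \<le> ?N" "?N < 32 * (g * k0) + 32 * g"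
    using div_times_less_eq_dividend[of ?N "32 * g"] dividend_less_div_times[of "32 * g" ?N] g_ge(2)
    unfolding k0_def by (simp_all add: algebra_simps)
  have k: "800 * (g\<^sup>2 * k) \<le> ?N" "?N < 800 * (g\<^sup>2 * k) + 800 * g\<^sup>2"
    using div_times_less_eq_dividend[of ?N "800 * g\<^sup>2"] dividend_less_div_times[of "800 * g\<^sup>2" ?N] g_ge(2)
    unfolding k_def by (simp_all add: algebra_simps)
  have "r * k0 \<le> g * k0" using g_ge(1) by simp
  hence n: "4 * (r * k0) \<le> ?N" using k0(1) by linarith
  have g2: "2 * g \<le> ?N" using N gg by linarith
  obtain A q col where A: "A \<subseteq> X" "card A = r * k0" "q ` A \<subseteq> X" "inj_on q A" "q ` A \<inter> A = {}"
    "\<forall>x\<in>A. col x < r \<and> E (col x) x (q x) \<and>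
      ?N + 2 \<le> 2 * g * (card {w \<in> X. E (col x) x w \<and> E (col x) (q x) w} + 1)"
    using disjoint_heavy_pairs[OF fin al n g2 order_refl] by (elim exE conjE)
  have finA: "finite A" using A(1) fin finite_subset by blast
  have "A = (\<Union>i<r. {x \<in> A. col x = i})" using A(6) by auto
  hence "card A \<le> (\<Sum>i<r. card {x \<in> A. col x = i})"
    using card_UN_le[of "{..<r}" "\<lambda>i. {x \<in> A. col x = i}"] by simp
  hence "real (card A) \<le> (\<Sum>i<r. real (card {x \<in> A. col x = i}))"
    using of_nat_mono[where 'a = real] by fastforce
  then obtain i where i: "i < r" "real (card A) \<le> r * real (card {x \<in> A. col x = i})"
    using pigeonhole_le[of r "real (card A)" "\<lambda>i. real (card {x \<in> A. col x = i})"] r2 by auto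
  have "k0 \<le> card {x \<in> A. col x = i}" using i(2) A(2) r2 by simp
  then obtain A0 where A0: "A0 \<subseteq> {x \<in> A. col x = i}" "card A0 = k0"
    using obtain_subset_with_card_n by metis
  define Y where "Y = X - (A0 \<union> q ` A0)"
  define Cn where "Cn x = {w \<in> X. E i x w \<and> E i (q x) w} \<inter> Y" for x
  have finA0: "finite A0" using finite_subset[of A0 A] A0(1) finA by auto
  have gpos: "0 < real g" using g_ge(2) by simp
  have Npos: "0 < ?N" using N gg g_ge(2) by linarith
  define \<nu> where "\<nu> = 3 * real ?N / (16 * real g)"
  have ex: "\<nu> \<le> card (\<Union>x\<in>S. Cn x)" if S: "S \<subseteq> A0" "1 \<le> card S" for S
  proof -
    obtain x where x: "x \<in> S" using S(2) by fastforce
    let ?c = "card {w \<in> X. E i x w \<and> E i (q x) w}"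
    have "?N + 2 \<le> 2 * g * (?c + 1)" using A(6) x S(1) A0(1) by auto
    hence "real ?N + 2 \<le> real (2 * g * (?c + 1))" by linarith
    hence c: "real ?N + 2 \<le> 2 * (real g * real ?c) + 2 * real g" by (simp add: algebra_simps)
    have "card (A0 \<union> q ` A0) \<le> 2 * k0"
      using card_Un_le[of A0 "q ` A0"] card_image_le[OF finA0, of q] A0(2) by linarith
    moreover have "?c - card (A0 \<union> q ` A0) \<le> card (Cn x)"
    proof -
      have "Cn x = {w \<in> X. E i x w \<and> E i (q x) w} - (A0 \<union> q ` A0)" unfolding Cn_def Y_def by auto
      thus ?thesis using diff_card_le_card_Diff[of "A0 \<union> q ` A0"] finA0 by simp
    qed
    moreover have "finite (\<Union>x\<in>S. Cn x)"
      by (rule finite_subset[of _ X]) (auto simp: Cn_def fin)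
    hence "card (Cn x) \<le> card (\<Union>x\<in>S. Cn x)" by (rule card_mono) (use x in auto)
    ultimately have "real ?c \<le> real (card (\<Union>x\<in>S. Cn x)) + 2 * real k0" by linarith
    hence "real g * real ?c \<le> real g * (real (card (\<Union>x\<in>S. Cn x)) + 2 * real k0)"
      by (rule mult_left_mono) (use gpos in simp)
    hence "real g * real ?c \<le> real g * real (card (\<Union>x\<in>S. Cn x)) + 2 * (real g * real k0)"
      by (simp add: algebra_simps)
    moreover have "32 * (real g * real k0) \<le> ?N" using k0(1) by (metis of_nat_le_iff of_nat_mult of_nat_numeral)
    moreover have "1600 * real g \<le> ?N" using N gg by linarith
    ultimately have "3 * real ?N \<le> 16 * (real g * real (card (\<Union>x\<in>S. Cn x)))" using c by linarith
    thus ?thesis unfolding \<nu>_def using gpos by (simp add: field_simps)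
  qed
  have finY: "finite Y" unfolding Y_def using fin by auto
  have cY: "card Y \<le> ?N" unfolding Y_def using fin by (simp add: card_mono)
  have k2: "2 \<le> k" unfolding k_def using N g_ge(2) by (simp add: less_eq_div_iff_mult_less_eq)
  have big: "11 * g * (k - 1) + (2 * 1 * (11 * g) + 1) < card A0"
  proof -
    have "32 * g * (11 * g * (k - 1) + (2 * 1 * (11 * g) + 1)) + 352 * g\<^sup>2 = 352 * (g\<^sup>2 * k) + 704 * g\<^sup>2 + 32 * g"
      using k2 by (cases k) (simp_all add: power2_eq_square algebra_simps)
    moreover have "352 * (g\<^sup>2 * k) + 384 * g\<^sup>2 < 32 * (g * k0)"
      using k(1) k0(2) N gg g_ge(2) by linarith
    ultimately have "32 * g * (11 * g * (k - 1) + (2 * 1 * (11 * g) + 1)) < 32 * g * k0"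
      using gg by (simp only: mult.assoc)
    thus ?thesis unfolding A0(2) by (rule mult_less_cancel1[THEN iffD1, THEN conjunct2])
  qed
  have c4: "real (4 * card A0) \<le> \<nu>"
  proof -
    have "32 * (real g * real k0) \<le> ?N" using k0(1) by (metis of_nat_le_iff of_nat_mult of_nat_numeral)
    thus ?thesis unfolding \<nu>_def A0(2) using gpos by (simp add: field_simps)
  qed
  have a: "2 * card Y \<le> \<nu> * real (11 * g)"
    unfolding \<nu>_def using gpos cY by (simp add: field_simps)
  have qA: "q ` A0 \<subseteq> q ` A" "A0 \<subseteq> A" using A0(1) by auto
  obtain Z B where ZB: "Z \<inter> B = {}" "B \<subseteq> Y" "Z \<subseteq> A0 \<union> q ` A0 \<union> Y" "k \<le> card B + 1"
    "\<And>B'. B' \<subseteq> B \<Longrightarrow> \<exists>vs. cyc (E i) vs \<and> set vs = Z \<union> B'"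
  proof (rule absorber[of A0 Y q "E i" Cn 1 \<nu> "11 * g" k])
    show "q ` A0 \<inter> A0 = {}" using A(5) qA by blast
    show "inj_on q A0" using A(4) qA inj_on_subset by blast
    show "0 < \<nu>" unfolding \<nu>_def using Npos gpos by simp
    show "\<And>x. x \<in> A0 \<Longrightarrow> E i x (q x)" using A(6) A0(1) by auto
    show "\<And>x z. x \<in> A0 \<Longrightarrow> z \<in> Cn x \<Longrightarrow> z \<in> Y \<and> E i x z \<and> E i (q x) z" unfolding Cn_def by auto
  qed (use finA0 finY sym ex c4 a k2 big in \<open>auto simp: Y_def\<close>)
  have "card B \<ge> 1" using ZB(4) k2 by linarith
  hence "g\<^sup>2 * 1 \<le> g\<^sup>2 * card B" by (rule mult_le_mono2)
  moreover have "g\<^sup>2 * k \<le> g\<^sup>2 * card B + g\<^sup>2"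
    using mult_le_mono2[OF ZB(4), of "g\<^sup>2"] by (simp add: algebra_simps)
  ultimately have "?N \<le> 2400 * (g\<^sup>2 * card B)" using k(2) by linarith
  moreover have "Z \<subseteq> X" "B \<subseteq> X" using ZB(2,3) A(1,3) qA unfolding Y_def by blast+
  ultimately show ?thesis using i(1) ZB(1,5) by (intro exI[of _ i] exI[of _ Z] exI[of _ B]) (auto simp: mult.assoc)
qed

text \<open>A bound of Turan type: remove a vertex of degree about \<open>card U / r\<close> and
  induct. Twice these degrees add up to \<open>(card U)^2 / r\<close> up to a linear term.\<close>

lemma degree_sum_ge:
  assumes "finite U" "indep_le U r"
  shows "(card U)\<^sup>2 \<le> r * (\<Sum>v\<in>U. card {w \<in> U. adj v w}) + 2 * r * card U"
  using assms
proof (induction "card U" arbitrary: U rule: less_induct)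
  case less
  show ?case
  proof (cases "U = {}")
    case False
    obtain v where v: "v \<in> U" "card U \<le> r * (1 + card {w \<in> U. adj v w})"
      using ex_large_degree[OF less.prems(1) False less.prems(2)] by blast
    let ?U = "U - {v}" and ?d = "card {w \<in> U. adj v w}"
    have eq: "(\<Sum>u\<in>U. card {w \<in> U. adj u w}) = (\<Sum>u\<in>?U. card {w \<in> ?U. adj u w}) + 2 * ?d"
      by (rule degree_sum_remove[OF less.prems(1) _ _ v(1)]) (auto simp: symp_def irreflp_def adj_irrefl intro: adj_sym)
    have c: "card U = card ?U + 1" using card_Suc_Diff1[OF less.prems(1) v(1)] by linarith
    have "(card ?U)\<^sup>2 \<le> r * (\<Sum>u\<in>?U. card {w \<in> ?U. adj u w}) + 2 * r * card ?U"
      by (rule less.hyps) (use c less.prems indep_le_subset[OF less.prems(2)] in auto)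
    moreover have "2 * card U \<le> 2 * r + 2 * (r * ?d)" using v(2) by (simp add: algebra_simps)
    moreover have "(card U)\<^sup>2 = (card ?U)\<^sup>2 + 2 * card ?U + 1" unfolding c by (simp add: power2_eq_square)
    moreover have "2 * r * card U = 2 * r * card ?U + 2 * r" unfolding c by simp
    moreover have "r * (\<Sum>u\<in>U. card {w \<in> U. adj u w}) = r * (\<Sum>u\<in>?U. card {w \<in> ?U. adj u w}) + 2 * (r * ?d)"
      unfolding eq by (simp add: distrib_left)
    ultimately show ?thesis using c by linarith
  qed auto
qed

text \<open>Some colour has average degree about \<open>card U / r^2\<close>, one factor
  \<open>r\<close> being due to the independence number and one to the choice of the colour; it
  contains a subgraph of half that minimum degree. Separation with \<open>m = 1\<close> yields at
  most two vertices, and all neighbours of one of them, except possibly the other, lie on the cycle.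
  For \<open>card U \<le> 6 * r^2\<close> a single vertex is long enough.\<close>

lemma long_cycle:
  assumes fin: "finite U" and al: "indep_le U r" and ne: "U \<noteq> {}"
  shows "\<exists>C. mono_cyc C \<and> distinct C \<and> set C \<subseteq> U \<and> card U \<le> 6 * r\<^sup>2 * card (set C)"
proof (cases "card U \<le> 6 * r\<^sup>2")
  case True
  obtain v where "v \<in> U" using ne by auto
  thus ?thesis using True r2 unfolding mono_cyc_def
    by (intro exI[of _ "[v]"]) (auto simp: cyc_def intro!: exI[of _ 0])
next
  case False
  let ?u = "real (card U)"
  define D where "D = (?u / r - 2) / r"
  have rpos: "0 < real r" using r2 by simp
  have upos: "0 < ?u" using False by linarith
  have "real ((card U)\<^sup>2) \<le> real (r * (\<Sum>v\<in>U. card {w \<in> U. adj v w}) + 2 * r * card U)"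
    using degree_sum_ge[OF fin al] by (rule of_nat_mono)
  hence "?u\<^sup>2 \<le> r * real (\<Sum>v\<in>U. card {w \<in> U. adj v w}) + 2 * r * ?u" by simp
  hence "(?u\<^sup>2 - 2 * r * ?u) / r \<le> real (\<Sum>v\<in>U. card {w \<in> U. adj v w})"
    using rpos by (simp add: pos_divide_le_eq mult.commute)
  moreover have "r * D * ?u = (?u\<^sup>2 - 2 * r * ?u) / r"
    unfolding D_def using rpos by (simp add: field_simps power2_eq_square)
  ultimately have "r * D * ?u \<le> real (\<Sum>v\<in>U. card {w \<in> U. adj v w})" by linarith
  also have "\<dots> \<le> real (\<Sum>v\<in>U. \<Sum>i<r. card {w \<in> U. E i v w})"
    by (intro of_nat_mono sum_mono adj_degree_le fin)
  also have "\<dots> = (\<Sum>i<r. real (\<Sum>v\<in>U. card {w \<in> U. E i v w}))"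
    by (subst sum.swap) simp
  finally obtain i where i: "i < r" "r * D * ?u \<le> r * real (\<Sum>v\<in>U. card {w \<in> U. E i v w})"
    using pigeonhole_le[of r "r * D * ?u" "\<lambda>i. real (\<Sum>v\<in>U. card {w \<in> U. E i v w})"] r2 by auto
  have "D * ?u \<le> real (\<Sum>v\<in>U. card {w \<in> U. E i v w})" using i(2) rpos by (simp add: mult.assoc)
  hence "\<exists>S\<subseteq>U. S \<noteq> {} \<and> (\<forall>v\<in>S. D / 2 \<le> card {w \<in> S. E i v w})"
    by (intro min_degree_subgraph[OF fin sym irr ne]) simp
  then obtain S where S: "S \<subseteq> U" "S \<noteq> {}" "\<forall>v\<in>S. D / 2 \<le> card {w \<in> S. E i v w}"
    by (elim exE conjE)
  have finS: "finite S" using S(1) fin finite_subset by blast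
  have "1 \<le> card (S \<inter> S)" using S(2) finS by (simp add: Suc_leI card_gt_0_iff)
  then obtain T C where TC: "T \<subseteq> S" "1 \<le> card (T \<inter> S)" "card (T \<inter> S) \<le> 2 * 1"
    "C = [] \<or> cyc (E i) C" "set C \<subseteq> S" "\<And>t u. t \<in> T \<Longrightarrow> u \<in> S \<Longrightarrow> E i t u \<Longrightarrow> u \<in> T \<union> set C"
    using cycle_separator[OF finS sym[of i] order_refl, of S] by (metis)
  have TS: "T \<inter> S = T" using TC(1) by auto
  obtain t where t: "t \<in> T" using TC(2) unfolding TS by fastforce
  have finT: "finite T" using TC(1) finS finite_subset by blast
  have "{w \<in> S. E i t w} \<subseteq> (T - {t}) \<union> set C" using TC(6)[OF t] irreflpD[OF irr] by blast
  hence "card {w \<in> S. E i t w} \<le> card ((T - {t}) \<union> set C)" using finT by (intro card_mono) auto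
  also have "\<dots> \<le> card (T - {t}) + card (set C)" by (rule card_Un_le)
  also have "card (T - {t}) \<le> 1" using TC(3) t finT unfolding TS by simp
  finally have "D / 2 \<le> 1 + real (card (set C))" using S(3) t TC(1) by fastforce
  moreover have "D / 2 = ?u / (2 * r\<^sup>2) - 1 / r" unfolding D_def using rpos by (simp add: field_simps power2_eq_square)
  moreover have "1 / real r \<le> 1 / 2" using r2 by simp
  moreover have "1 < ?u / (6 * r\<^sup>2)"
  proof -
    have "real (6 * r\<^sup>2) < ?u" using False by linarith
    thus ?thesis using rpos by simp
  qed
  moreover have "?u / (2 * r\<^sup>2) = 3 * (?u / (6 * r\<^sup>2))" by simp
  ultimately have c: "?u / (6 * r\<^sup>2) \<le> card (set C)" and "1 < card (set C)" by linarith+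
  hence "cyc (E i) C" using TC(4) by auto
  moreover have "card U \<le> 6 * r\<^sup>2 * card (set C)"
  proof -
    have "?u \<le> real (6 * r\<^sup>2 * card (set C))" using c rpos by (simp add: field_simps)
    thus ?thesis by linarith
  qed
  ultimately show ?thesis using i(1) TC(5) S(1) unfolding mono_cyc_def cyc_def by blast
qed

end

section \<open>Partition by recursion on the independence number\<close>

lemma singleton_cover:
  assumes "finite L"
  obtains Cs where "\<And>C. C \<in> set Cs \<Longrightarrow> \<exists>v. C = [v]" "distinct (concat Cs)" "set (concat Cs) = L" "length Cs = card L"
proof -
  obtain xs where xs: "set xs = L" "distinct xs" using finite_distinct_list[OF assms] by auto
  have "concat (map (\<lambda>v. [v]) xs) = xs" by (induction xs) auto
  thus ?thesis using that[of "map (\<lambda>v. [v]) xs"] xs distinct_card[of xs] by auto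
qed

context coloured_graph
begin

lemma mono_cyc_singleton: "mono_cyc [v]"
  unfolding mono_cyc_def using r2 by (intro exI[of _ 0]) (simp add: cyc_singleton)

lemma mono_cyc_biprel:
  assumes "i < r" "cyc (biprel X Y (E i)) C"
  shows "mono_cyc C"
  unfolding mono_cyc_def
proof (intro exI[of _ i] conjI)
  show "cyc (E i) C" by (rule cyc_mono[OF assms(2)]) (use sympD[OF sym] in \<open>auto simp: biprel_def\<close>)
qed (rule assms(1))

text \<open>Each vertex of \<open>U\<close> has \<open>\<nu> = card B / (r * (r + 1))\<close>
  neighbours of its most frequent colour in \<open>B\<close>, so already single vertices expand. The
  at most \<open>r * (2 * a + 1)\<close> vertices missed by the cover become cycles of one
  vertex.\<close>

lemma good_cover:
  assumes fin: "finite U" "finite B" and dis: "U \<inter> B = {}" and B: "B \<noteq> {}"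
    and deg: "\<And>v. v \<in> U \<Longrightarrow> card B \<le> (r + 1) * card {b \<in> B. adj v b}"
    and small: "4 * (r * (r + 1) * card U) \<le> card B"
  shows "\<exists>Cs. (\<forall>C\<in>set Cs. mono_cyc C) \<and> distinct (concat Cs) \<and> U \<subseteq> set (concat Cs) \<and>
    set (concat Cs) \<subseteq> U \<union> B \<and> length Cs \<le> 9 * r\<^sup>2 * (r + 1) + r"
proof -
  have "\<forall>v. \<exists>i<r. card {b \<in> B. adj v b} \<le> r * card {b \<in> B. E i v b}"
    using ex_colour_degree[OF fin(2)] by blast
  then obtain col where col: "\<And>v. col v < r" "\<And>v. card {b \<in> B. adj v b} \<le> r * card {b \<in> B. E (col v) v b}"
    by metis
  define X where "X i = {v \<in> U. col v = i}" for i
  have UX: "(\<Union>i<r. X i) = U" using col(1) unfolding X_def by auto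
  have cX: "(\<Sum>i<r. card (X i)) = card U"
  proof -
    have "card (\<Union>i\<in>{..<r}. X i) = (\<Sum>i<r. card (X i))"
      by (rule card_UN_disjoint) (auto simp: X_def fin)
    thus ?thesis using UX by simp
  qed
  define R where "R = real (r * (r + 1))"
  have "0 < r * (r + 1)" using r2 by simp
  hence Rpos: "0 < R" unfolding R_def by (simp only: of_nat_0_less_iff)
  define \<nu> where "\<nu> = real (card B) / R"
  have cB: "0 < card B" using B fin(2) by (simp add: card_gt_0_iff)
  define a where "a = 3 * (r * (r + 1))"
  have "\<exists>Cs. (\<forall>C\<in>set Cs. \<exists>i<r. cyc (biprel (X i) B (E i)) C) \<and> distinct (concat Cs) \<and>
      set (concat Cs) \<subseteq> (\<Union>i<r. X i) \<union> B \<and>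
      card ((\<Union>i<r. X i) - set (concat Cs)) \<le> r * (2 * 1 * a + 1) \<and> length Cs \<le> r * a"
  proof (rule multicolour_cover)
    fix i S assume S: "i < r" "S \<subseteq> X i" "1 \<le> card S"
    then obtain v where v: "v \<in> S" by fastforce
    have vU: "v \<in> U" "col v = i" using v S(2) unfolding X_def by auto
    have "(r + 1) * card {b \<in> B. adj v b} \<le> (r + 1) * (r * card {b \<in> B. E i v b})"
      using col(2)[of v] vU(2) by (intro mult_le_mono2) simp
    hence "card B \<le> (r + 1) * (r * card {b \<in> B. E i v b})" by (rule le_trans[OF deg[OF vU(1)]])
    hence "card B \<le> r * (r + 1) * card {b \<in> B. E i v b}" by (simp only: mult.assoc mult.left_commute)
    hence "real (card B) \<le> real (r * (r + 1) * card {b \<in> B. E i v b})" by (rule of_nat_mono)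
    hence "real (card B) \<le> R * real (card {b \<in> B. E i v b})" unfolding R_def by simp
    hence "\<nu> \<le> card {b \<in> B. E i v b}" unfolding \<nu>_def using Rpos by (simp add: pos_divide_le_eq mult.commute)
    also have "card {b \<in> B. E i v b} \<le> card {y \<in> B. \<exists>x\<in>S. E i x y}"
      using fin(2) v by (intro card_mono) auto
    finally show "\<nu> \<le> card {y \<in> B. \<exists>x\<in>S. E i x y}" by simp
  next
    have "real (4 * (r * (r + 1) * card U)) \<le> real (card B)" using small by (rule of_nat_mono)
    hence "R * real (4 * card U) \<le> card B" unfolding R_def by (simp add: algebra_simps)
    thus "real (4 * (\<Sum>i<r. card (X i))) \<le> \<nu>"
      unfolding cX \<nu>_def using Rpos by (simp add: pos_le_divide_eq mult.commute)
  next
    have "real a = 3 * R" unfolding a_def R_def by (simp only: of_nat_mult of_nat_numeral)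
    hence "3 * \<nu> * real a = 9 * card B" unfolding \<nu>_def using Rpos by simp
    thus "real (8 * card B) \<le> 3 * \<nu> * real a" by simp
  next
    show "0 < \<nu>" unfolding \<nu>_def using cB Rpos by simp
  qed (use fin dis in \<open>auto simp: X_def\<close>)
  then obtain Cs where Cs: "\<forall>C\<in>set Cs. \<exists>i<r. cyc (biprel (X i) B (E i)) C" "distinct (concat Cs)"
      "set (concat Cs) \<subseteq> U \<union> B" "card (U - set (concat Cs)) \<le> r * (2 * 1 * a + 1)" "length Cs \<le> r * a"
    unfolding UX by (elim exE conjE)
  obtain Ds where Ds: "\<And>C. C \<in> set Ds \<Longrightarrow> \<exists>v. C = [v]" "distinct (concat Ds)"
    "set (concat Ds) = U - set (concat Cs)" "length Ds = card (U - set (concat Cs))"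
    using singleton_cover[of "U - set (concat Cs)"] fin(1) by blast
  have "\<forall>C\<in>set (Cs @ Ds). mono_cyc C"
    using Cs(1) Ds(1) mono_cyc_singleton mono_cyc_biprel by fastforce
  moreover have "distinct (concat (Cs @ Ds))" using Cs(2) Ds(2,3) by auto
  moreover have "U \<subseteq> set (concat (Cs @ Ds))" "set (concat (Cs @ Ds)) \<subseteq> U \<union> B" using Ds(3) Cs(3) by auto
  moreover have "length (Cs @ Ds) \<le> 9 * r\<^sup>2 * (r + 1) + r"
  proof -
    have "length (Cs @ Ds) \<le> r * a + r * (2 * 1 * a + 1)"
      unfolding length_append Ds(4) using Cs(4,5) by linarith
    also have "\<dots> = 9 * r\<^sup>2 * (r + 1) + r" unfolding a_def by (simp add: power2_eq_square algebra_simps)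
    finally show ?thesis .
  qed
  ultimately show ?thesis by blast
qed

text \<open>Each bad vertex sees less than the fraction \<open>1 / (r + 1)\<close> of
  \<open>B\<close>. If \<open>k + 1\<close> of them were independent, some \<open>b \<in> B\<close>
  would be adjacent to none, and adding \<open>b\<close> would exceed the independence number of
  \<open>X\<close>. So the bad vertices have a smaller independence number, which is what the
  recursion needs.\<close>

lemma bad_indep:
  assumes al: "indep_le X (Suc k)" and k: "Suc k \<le> r" and U: "U \<subseteq> X" "B \<subseteq> X" "U \<inter> B = {}" "finite B" "finite X"
    and bad: "\<And>v. v \<in> U \<Longrightarrow> (r + 1) * card {b \<in> B. adj v b} < card B" and Bne: "B \<noteq> {}"
  shows "indep_le U k"
  unfolding indep_le_def
proof (intro allI impI)
  fix I assume I: "I \<subseteq> U" "\<forall>u\<in>I. \<forall>v\<in>I. u \<noteq> v \<longrightarrow> \<not> adj u v"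
  have finI: "finite I" using I(1) U(1,5) by (meson finite_subset)
  show "card I \<le> k"
  proof (rule ccontr)
    assume "\<not> card I \<le> k"
    hence Ik: "Suc k \<le> card I" by simp
    have "I \<subseteq> X" using I(1) U(1) by auto
    hence Ir: "card I \<le> Suc k" using al I(2) unfolding indep_le_def by blast
    let ?N = "\<Union>v\<in>I. {b \<in> B. adj v b}"
    have "card ?N \<le> (\<Sum>v\<in>I. card {b \<in> B. adj v b})" by (rule card_UN_le[OF finI])
    hence "(r + 1) * card ?N \<le> (\<Sum>v\<in>I. (r + 1) * card {b \<in> B. adj v b})"
      unfolding sum_distrib_left[symmetric] by (rule mult_le_mono2)
    also have "\<dots> \<le> (\<Sum>v\<in>I. card B)" using bad I(1) by (intro sum_mono less_imp_le) auto
    also have "\<dots> \<le> r * card B" using Ir k by simp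
    also have "\<dots> < (r + 1) * card B" using Bne U(4) by (simp add: card_gt_0_iff)
    finally have "card ?N < card B" by (rule mult_less_cancel1[THEN iffD1, THEN conjunct2])
    moreover have "finite ?N" using finI U(4) by auto
    ultimately have "\<not> B \<subseteq> ?N" using card_mono by (metis not_le)
    then obtain b where b: "b \<in> B" "b \<notin> ?N" by auto
    hence nb: "\<not> adj v b" "\<not> adj b v" if "v \<in> I" for v using that adj_sym by auto
    have bI: "b \<notin> I" using b(1) I(1) U(3) by auto
    have "insert b I \<subseteq> X" using b(1) U(2) \<open>I \<subseteq> X\<close> by auto
    moreover have "\<forall>u\<in>insert b I. \<forall>v\<in>insert b I. u \<noteq> v \<longrightarrow> \<not> adj u v" using nb I(2) by auto
    ultimately have "card (insert b I) \<le> Suc k" using al unfolding indep_le_def by blast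
    thus False using bI finI Ik by simp
  qed
qed

text \<open>Logarithm of the factor by which greedy rounds must shrink the vertex set:
  \<open>2400 * g^2\<close> for the relative size of the absorbable set, times
  \<open>4 * r * (r + 1)\<close> for the smallness condition of \<open>good_cover\<close>.\<close>

definition \<Lambda> :: real where "\<Lambda> = ln (9600 * (real g)\<^sup>2 * real (r * (r + 1)))"
text \<open>Cost of lowering the independence number by one: greedy long cycles, a cover of the
  well-connected vertices and one absorbing cycle.\<close>

definition \<Phi> :: real where "\<Phi> = 6 * real (r\<^sup>2) * \<Lambda> + 1 + real (9 * r\<^sup>2 * (r + 1) + r) + 1"

lemma dense_partition:
  assumes "finite X" "indep_le X k" "k \<le> r"
  shows "\<exists>Cs. (\<forall>C\<in>set Cs. mono_cyc C) \<and> distinct (concat Cs) \<and> set (concat Cs) = X \<and> length Cs \<le> k * \<Phi>"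
  using assms
proof (induction k arbitrary: X)
  case 0
  have "X = {}"
  proof (rule ccontr)
    assume "X \<noteq> {}"
    then obtain x where "x \<in> X" by auto
    hence "card {x} \<le> 0" using "0.prems"(2) unfolding indep_le_def by (metis empty_subsetI insert_subset singletonD)
    thus False by simp
  qed
  thus ?case by (intro exI[of _ "[]"]) auto
next
  case (Suc k)
  note fin = Suc.prems(1)
  have al: "indep_le X r" using indep_le_mono[OF Suc.prems(2,3)] .
  define \<epsilon> where "\<epsilon> = 1 / (9600 * (real g)\<^sup>2 * real (r * (r + 1)))"
  have gp: "1 \<le> (real g)\<^sup>2" using g_ge(2) by simp
  have rr: "1 \<le> real (r * (r + 1))"
  proof -
    have "1 \<le> r * (r + 1)" using r2 by simp
    thus ?thesis by linarith
  qed
  have prod1: "1 \<le> (real g)\<^sup>2 * real (r * (r + 1))" using mult_mono[OF gp rr] by simp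
  have \<epsilon>: "0 < \<epsilon>" "\<epsilon> \<le> 1" unfolding \<epsilon>_def using prod1 by (simp_all add: mult.assoc)
  have \<Lambda>\<epsilon>: "\<Lambda> = ln (1 / \<epsilon>)" unfolding \<Lambda>_def \<epsilon>_def by simp
  have \<Lambda>0: "0 \<le> \<Lambda>" unfolding \<Lambda>\<epsilon> using \<epsilon> by simp
  have "1 \<le> 6 * r\<^sup>2" using r_sq by linarith
  hence "real 1 \<le> real (6 * r\<^sup>2)" by (rule of_nat_mono)
  hence \<kappa>: "1 \<le> 6 * real (r\<^sup>2)" by simp
  have step: "\<exists>C. mono_cyc C \<and> distinct C \<and> set C \<subseteq> V \<and> card V \<le> 6 * real (r\<^sup>2) * card (set C)"
    if V: "V \<subseteq> X" "0 < real (card V)" for V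
  proof -
    have "finite V" "V \<noteq> {}" using V fin finite_subset by auto
    then obtain C where C: "mono_cyc C" "distinct C" "set C \<subseteq> V" "card V \<le> 6 * r\<^sup>2 * card (set C)"
      using long_cycle[of V] indep_le_subset[OF al V(1)] by blast
    have "real (card V) \<le> real (6 * r\<^sup>2 * card (set C))" using C(4) by (rule of_nat_mono)
    thus ?thesis using C by auto
  qed
  show ?case
  \<comment> \<open>Below this size no absorber is guaranteed, but then
    \<open>\<epsilon> * card X < 1\<close>, so the greedy rounds exhaust \<open>X\<close>.\<close>
  proof (cases "1600 * g\<^sup>2 \<le> card X")
    case False
    obtain Cs where Cs: "\<And>C. C \<in> set Cs \<Longrightarrow> mono_cyc C" "distinct (concat Cs)" "set (concat Cs) \<subseteq> X"
      "length Cs \<le> 6 * real (r\<^sup>2) * ln (1 / \<epsilon>) + 1"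
      "card (X - set (concat Cs)) \<le> (0::real) \<or> card (X - set (concat Cs)) \<le> \<epsilon> * card X"
      using greedy_rounds_ln[where \<tau> = 0 and Q = mono_cyc, OF fin \<kappa> \<epsilon> step] by blast
    have "real (card X) < 1600 * (real g)\<^sup>2" using False by (simp flip: of_nat_power)
    also have "\<dots> \<le> 9600 * (real g)\<^sup>2 * real (r * (r + 1))"
    proof -
      have "(real g)\<^sup>2 * 1 \<le> (real g)\<^sup>2 * real (r * (r + 1))" using rr by (intro mult_left_mono) auto
      thus ?thesis using gp by linarith
    qed
    finally have "\<epsilon> * card X < 1" unfolding \<epsilon>_def using prod1 by (simp add: pos_divide_less_eq)
    hence "card (X - set (concat Cs)) = 0" using Cs(5) by linarith
    hence "X = set (concat Cs)" using fin Cs(3) by auto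
    moreover have "real (length Cs) \<le> Suc k * \<Phi>"
    proof -
      have "x \<le> c \<Longrightarrow> 0 \<le> y \<Longrightarrow> x \<le> 1 * (c + y + 1)" for x c y :: real by simp
      hence "real (length Cs) \<le> 1 * \<Phi>"
        using Cs(4) unfolding \<Phi>_def \<Lambda>\<epsilon> by (meson of_nat_0_le_iff)
      also have "\<dots> \<le> Suc k * \<Phi>" by (intro mult_right_mono) (use \<Lambda>0 in \<open>auto simp: \<Phi>_def\<close>)
      finally show ?thesis .
    qed
    ultimately show ?thesis using Cs(1,2) by (intro exI[of _ Cs]) auto
  next
    case True
    obtain i Z B where ZB: "i < r" "Z \<subseteq> X" "B \<subseteq> X" "Z \<inter> B = {}" "card X \<le> 2400 * g\<^sup>2 * card B"
      "\<forall>B'\<subseteq>B. \<exists>vs. cyc (E i) vs \<and> set vs = Z \<union> B'"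
      using dense_absorber[OF fin al True] by (elim exE conjE)
    have Bne: "B \<noteq> {}" using ZB(5) True g_ge(2) by auto
    have finB: "finite B" using ZB(3) fin finite_subset by blast
    define U where "U = X - (Z \<union> B)"
    have UX: "U \<subseteq> X" and finU: "finite U" unfolding U_def using fin by auto
    have stepU: "\<exists>C. mono_cyc C \<and> distinct C \<and> set C \<subseteq> V \<and> card V \<le> 6 * real (r\<^sup>2) * card (set C)"
      if "V \<subseteq> U" "0 < real (card V)" for V
      by (rule step) (use that UX in auto)
    obtain Cs where Cs: "\<And>C. C \<in> set Cs \<Longrightarrow> mono_cyc C" "distinct (concat Cs)" "set (concat Cs) \<subseteq> U"
      "length Cs \<le> 6 * real (r\<^sup>2) * ln (1 / \<epsilon>) + 1"
      "card (U - set (concat Cs)) \<le> (0::real) \<or> card (U - set (concat Cs)) \<le> \<epsilon> * card U"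
      using greedy_rounds_ln[where \<tau> = 0 and Q = mono_cyc, OF finU \<kappa> \<epsilon> stepU] by blast
    define V where "V = U - set (concat Cs)"
    have "\<epsilon> * card U \<le> \<epsilon> * card X" using \<epsilon> UX fin by (intro mult_left_mono of_nat_mono card_mono) auto
    moreover have "0 \<le> \<epsilon> * card X" using \<epsilon> by simp
    ultimately have "real (card V) \<le> \<epsilon> * card X" using Cs(5) unfolding V_def by (elim disjE) linarith+
    also have "\<dots> \<le> \<epsilon> * (2400 * g\<^sup>2 * card B)" using \<epsilon> ZB(5) by (intro mult_left_mono of_nat_mono) auto
    also have "real (2400 * g\<^sup>2 * card B) = 2400 * (real g)\<^sup>2 * real (card B)" by simp
    also have "\<epsilon> * \<dots> = card B / (4 * real (r * (r + 1)))"
    proof -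
      have "1 / (9600 * G * R) * (2400 * G * b) = b / (4 * R)" if "1 \<le> G" "1 \<le> R" for G R b :: real
        using that by (simp add: field_simps)
      from this[OF gp rr] show ?thesis unfolding \<epsilon>_def .
    qed
    finally have "4 * real (r * (r + 1)) * real (card V) \<le> card B" using rr by (simp add: pos_le_divide_eq mult.commute)
    hence "real (4 * (r * (r + 1) * card V)) \<le> real (card B)" by (simp add: algebra_simps)
    hence cV: "4 * (r * (r + 1) * card V) \<le> card B" by linarith
    have finV: "finite V" unfolding V_def using finU by auto
    define V1 where "V1 = {v \<in> V. card B \<le> (r + 1) * card {b \<in> B. adj v b}}"
    define V2 where "V2 = V - V1"
    have VB: "V \<inter> B = {}" "V \<subseteq> X" unfolding V_def U_def by auto
    have "card V1 \<le> card V" unfolding V1_def using finV by (intro card_mono) auto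
    hence "4 * (r * (r + 1) * card V1) \<le> 4 * (r * (r + 1) * card V)" by simp
    hence cV1: "4 * (r * (r + 1) * card V1) \<le> card B" using cV by linarith
    have fV1: "finite V1" "V1 \<inter> B = {}" using finV VB unfolding V1_def by auto
    obtain Ds where Ds: "\<forall>C\<in>set Ds. mono_cyc C" "distinct (concat Ds)" "V1 \<subseteq> set (concat Ds)"
      "set (concat Ds) \<subseteq> V1 \<union> B" "length Ds \<le> 9 * r\<^sup>2 * (r + 1) + r"
      using good_cover[OF fV1(1) finB fV1(2) Bne _ cV1] unfolding V1_def by auto
    have al2: "indep_le V2 k"
      by (rule bad_indep[OF Suc.prems(2,3), of V2 B]) (use VB ZB(3) finB fin Bne in \<open>auto simp: V2_def V1_def\<close>)
    have finV2: "finite V2" unfolding V2_def using finV by auto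
    obtain Fs where Fs: "\<forall>C\<in>set Fs. mono_cyc C" "distinct (concat Fs)" "set (concat Fs) = V2" "length Fs \<le> k * \<Phi>"
      using Suc.IH[OF finV2 al2] Suc.prems(3) by auto
    obtain vs where vs: "cyc (E i) vs" "set vs = Z \<union> (B - set (concat Ds))" using ZB(6)[rule_format, of "B - set (concat Ds)"] by auto
    let ?A = "Cs @ Ds @ Fs @ [vs]"
    have mvs: "mono_cyc vs" "distinct vs" using vs(1) ZB(1) unfolding mono_cyc_def cyc_def by auto
    have CV: "set (concat Cs) \<inter> V = {}" "set (concat Cs) \<inter> B = {}" "set (concat Cs) \<inter> Z = {}" "V \<inter> Z = {}"
      using Cs(3) unfolding V_def U_def by auto
    have V1V: "V1 \<subseteq> V" "V2 \<subseteq> V" "V1 \<inter> V2 = {}" "V1 \<union> V2 = V" unfolding V1_def V2_def by auto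
    have "\<forall>C\<in>set ?A. mono_cyc C" using Cs(1) Ds(1) Fs(1) mvs by auto
    moreover have "distinct (concat ?A)"
    proof -
      have 1: "set (concat Cs) \<inter> (set (concat Ds) \<union> set (concat Fs) \<union> set vs) = {}"
        using CV Ds(4) Fs(3) vs(2) V1V by blast
      have 2: "set (concat Ds) \<inter> (set (concat Fs) \<union> set vs) = {}"
        using CV Ds(4) Fs(3) vs(2) V1V VB(1) ZB(4) by blast
      have 3: "set (concat Fs) \<inter> set vs = {}" using CV Fs(3) vs(2) V1V VB(1) by blast
      show ?thesis using 1 2 3 Cs(2) Ds(2) Fs(2) mvs(2) unfolding concat_append distinct_append set_append by auto
    qed
    moreover have "set (concat ?A) = X"
    proof -
      have "set (concat ?A) = set (concat Cs) \<union> set (concat Ds) \<union> V2 \<union> (Z \<union> (B - set (concat Ds)))"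
        using Fs(3) vs(2) by auto
      also have "\<dots> = set (concat Cs) \<union> V \<union> Z \<union> B" using Ds(3,4) V1V by blast
      also have "\<dots> = X" using Cs(3) ZB(2,3) unfolding V_def U_def by blast
      finally show ?thesis .
    qed
    moreover have "real (length ?A) \<le> Suc k * \<Phi>"
    proof -
      have "real (length Ds) \<le> real (9 * r\<^sup>2 * (r + 1) + r)" using Ds(5) by (rule of_nat_mono)
      hence "real (length Cs) + real (length Ds) + 1 \<le> \<Phi>" using Cs(4) unfolding \<Phi>_def \<Lambda>\<epsilon> by (intro add_mono) auto
      hence "real (length ?A) \<le> \<Phi> + k * \<Phi>" using Fs(4) by simp
      thus ?thesis by (simp add: algebra_simps)
    qed
    ultimately show ?thesis by blast
  qed
qed

end

section \<open>Deviations of neighbourhood counts in the random graph\<close>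

text \<open>Expectation over a random subset of an arbitrary ground set, so that independence
  becomes a product formula for disjoint unions of ground sets.\<close>

definition edge_expectation :: "'a set \<Rightarrow> real \<Rightarrow> ('a set \<Rightarrow> real) \<Rightarrow> real" where
  "edge_expectation A p f = (\<Sum>E\<in>Pow A. p ^ card E * (1 - p) ^ (card A - card E) * f E)"

lemma edge_expectation_empty: "edge_expectation {} p f = f {}"
  unfolding edge_expectation_def by simp

lemma edge_expectation_Un:
  assumes "finite A" "finite B" "A \<inter> B = {}"
  shows "edge_expectation (A \<union> B) p (\<lambda>E. f (E \<inter> A) * h (E \<inter> B)) = edge_expectation A p f * edge_expectation B p h"
proof -
  let ?w = "\<lambda>A E. p ^ card E * (1 - p) ^ (card A - card E)"
  have inj: "inj_on (\<lambda>(X, Y). X \<union> Y) (Pow A \<times> Pow B)"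
    by (rule inj_on_inverseI[where g = "\<lambda>E. (E \<inter> A, E \<inter> B)"]) (use assms(3) in auto)
  have im: "(\<lambda>(X, Y). X \<union> Y) ` (Pow A \<times> Pow B) = Pow (A \<union> B)"
  proof
    show "Pow (A \<union> B) \<subseteq> (\<lambda>(X, Y). X \<union> Y) ` (Pow A \<times> Pow B)"
    proof
      fix E assume "E \<in> Pow (A \<union> B)"
      hence "E = (\<lambda>(X, Y). X \<union> Y) (E \<inter> A, E \<inter> B)" by auto
      thus "E \<in> (\<lambda>(X, Y). X \<union> Y) ` (Pow A \<times> Pow B)" by (rule image_eqI) auto
    qed
  qed auto
  have "edge_expectation (A \<union> B) p (\<lambda>E. f (E \<inter> A) * h (E \<inter> B)) =
    (\<Sum>(X, Y)\<in>Pow A \<times> Pow B. ?w (A \<union> B) (X \<union> Y) * (f ((X \<union> Y) \<inter> A) * h ((X \<union> Y) \<inter> B)))"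
    unfolding edge_expectation_def im[symmetric] by (subst sum.reindex[OF inj]) (simp add: case_prod_unfold)
  also have "\<dots> = (\<Sum>(X, Y)\<in>Pow A \<times> Pow B. (?w A X * f X) * (?w B Y * h Y))"
  proof (intro sum.cong refl, safe)
    fix X Y assume XY: "X \<subseteq> A" "Y \<subseteq> B"
    have fin: "finite X" "finite Y" using XY assms finite_subset[of X A] finite_subset[of Y B] by auto
    have c1: "card (X \<union> Y) = card X + card Y" using XY assms fin by (intro card_Un_disjoint) auto
    have c2: "card (A \<union> B) = card A + card B" using assms by (intro card_Un_disjoint) auto
    have le: "card X \<le> card A" "card Y \<le> card B" using card_mono[OF assms(1) XY(1)] card_mono[OF assms(2) XY(2)] by auto
    have e: "card (A \<union> B) - card (X \<union> Y) = (card A - card X) + (card B - card Y)"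
      unfolding c1 c2 using le by simp
    have s: "(X \<union> Y) \<inter> A = X" "(X \<union> Y) \<inter> B = Y" using XY assms(3) by auto
    show "?w (A \<union> B) (X \<union> Y) * (f ((X \<union> Y) \<inter> A) * h ((X \<union> Y) \<inter> B)) = (?w A X * f X) * (?w B Y * h Y)"
      unfolding s e unfolding c1 power_add by (simp only: mult_ac)
  qed
  also have "\<dots> = edge_expectation A p f * edge_expectation B p h"
    unfolding edge_expectation_def sum_product sum.cartesian_product by simp
  finally show ?thesis .
qed

lemma edge_expectation_one: "finite A \<Longrightarrow> edge_expectation A p (\<lambda>_. 1) = 1"
proof (induction rule: finite_induct)
  case (insert x A)
  have "edge_expectation {x} p (\<lambda>_. 1) = 1" unfolding edge_expectation_def by (simp add: Pow_insert)
  thus ?case using edge_expectation_Un[of "{x}" A p "\<lambda>_. 1" "\<lambda>_. 1"] insert by simp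
qed (simp add: edge_expectation_empty)

lemma edge_expectation_add: "edge_expectation A p (\<lambda>E. f E + h E) = edge_expectation A p f + edge_expectation A p h"
  unfolding edge_expectation_def by (simp add: distrib_left sum.distrib)

lemma edge_expectation_block:
  assumes "finite F"
  shows "edge_expectation F p (\<lambda>E. if F \<subseteq> E then l else 1) = 1 + (l - 1) * p ^ card F"
proof -
  have "edge_expectation F p (\<lambda>E. if F \<subseteq> E then l else 1) = edge_expectation F p (\<lambda>E. 1 + (if F \<subseteq> E then l - 1 else 0))"
    unfolding edge_expectation_def by (intro sum.cong refl) auto
  also have "\<dots> = 1 + edge_expectation F p (\<lambda>E. if F \<subseteq> E then l - 1 else 0)" unfolding edge_expectation_add using edge_expectation_one[OF assms] by simp
  also have "edge_expectation F p (\<lambda>E. if F \<subseteq> E then l - 1 else 0) = (\<Sum>E\<in>{F}. p ^ card E * (1 - p) ^ (card F - card E) * (l - 1))"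
    unfolding edge_expectation_def using assms by (intro sum.mono_neutral_cong_right) auto
  finally show ?thesis by simp
qed

text \<open>Disjoint blocks of \<open>t\<close> edges are present independently, each with
  probability \<open>p^t\<close>. The right-hand side is the generating function of a binomial
  variable at \<open>l\<close>, obtained by splitting off one block at a time.\<close>

lemma edge_expectation_prod_blocks:
  assumes "finite I" "finite A" "\<And>i. i \<in> I \<Longrightarrow> F i \<subseteq> A \<and> card (F i) = t"
    "\<And>i j. i \<in> I \<Longrightarrow> j \<in> I \<Longrightarrow> i \<noteq> j \<Longrightarrow> F i \<inter> F j = {}"
  shows "edge_expectation A p (\<lambda>E. \<Prod>i\<in>I. if F i \<subseteq> E then l else 1) = (1 + (l - 1) * p ^ t) ^ card I"
  using assms
proof (induction I arbitrary: A rule: finite_induct)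
  case empty
  thus ?case by (simp add: edge_expectation_one)
next
  case (insert i I)
  let ?B = "A - F i"
  have Fi: "F i \<subseteq> A" "finite (F i)" "card (F i) = t" using insert.prems finite_subset[of "F i" A] by auto
  have eq: "A = F i \<union> ?B" using Fi by auto
  have sub: "F j \<subseteq> ?B" if "j \<in> I" for j
    using insert.prems(2)[of j] insert.prems(3)[of i j] insert.hyps that by auto
  have "edge_expectation A p (\<lambda>E. \<Prod>j\<in>insert i I. if F j \<subseteq> E then l else 1) =
    edge_expectation (F i \<union> ?B) p (\<lambda>E. (if F i \<subseteq> E \<inter> F i then l else 1) * (\<Prod>j\<in>I. if F j \<subseteq> E \<inter> ?B then l else 1))"
    using eq insert.hyps sub unfolding edge_expectation_def
    by (intro sum.cong) (auto intro!: prod.cong arg_cong2[of _ _ _ _ "(*)"])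
  also have "\<dots> = edge_expectation (F i) p (\<lambda>E. if F i \<subseteq> E then l else 1) * edge_expectation ?B p (\<lambda>E. \<Prod>j\<in>I. if F j \<subseteq> E then l else 1)"
    by (rule edge_expectation_Un) (use Fi insert.prems(1) in auto)
  also have "\<dots> = (1 + (l - 1) * p ^ t) * (1 + (l - 1) * p ^ t) ^ card I"
    using edge_expectation_block[OF Fi(2)] Fi(3) insert.IH[of ?B] insert.prems sub by auto
  finally show ?case using insert.hyps by simp
qed

lemma finite_all_edges: "finite (all_edges n)"
  unfolding all_edges_def by (rule finite_subset[of _ "Pow {0..<n}"]) auto

lemma prob_Gnp_expectation: "prob_Gnp n p P = edge_expectation (all_edges n) p (\<lambda>E. of_bool (P E))"
proof -
  have "prob_Gnp n p P = (\<Sum>E\<in>{E \<in> Pow (all_edges n). P E}. p ^ card E * (1 - p) ^ (card (all_edges n) - card E))"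
    unfolding prob_Gnp_def by (intro sum.cong) auto
  also have "\<dots> = (\<Sum>E\<in>Pow (all_edges n). if P E then p ^ card E * (1 - p) ^ (card (all_edges n) - card E) else 0)"
    by (rule sum.inter_filter) (simp add: finite_all_edges)
  also have "\<dots> = edge_expectation (all_edges n) p (\<lambda>E. of_bool (P E))"
    unfolding edge_expectation_def by (intro sum.cong refl) auto
  finally show ?thesis .
qed

lemma edge_expectation_mono:
  assumes "0 \<le> p" "p \<le> 1" "\<And>E. E \<subseteq> A \<Longrightarrow> f E \<le> h E"
  shows "edge_expectation A p f \<le> edge_expectation A p h"
  unfolding edge_expectation_def by (intro sum_mono mult_left_mono) (use assms in auto)

lemma edge_expectation_cmult: "edge_expectation A p (\<lambda>E. c * f E) = c * edge_expectation A p f"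
  unfolding edge_expectation_def by (simp add: sum_distrib_left mult_ac)

lemma prob_Gnp_mono:
  assumes "0 \<le> p" "p \<le> 1" "\<And>E. E \<subseteq> all_edges n \<Longrightarrow> P E \<Longrightarrow> Q E"
  shows "prob_Gnp n p P \<le> prob_Gnp n p Q"
  unfolding prob_Gnp_expectation by (rule edge_expectation_mono) (use assms in auto)

lemma prob_Gnp_compl: "prob_Gnp n p P = 1 - prob_Gnp n p (\<lambda>E. \<not> P E)"
proof -
  have "edge_expectation (all_edges n) p (\<lambda>E. of_bool (P E) + of_bool (\<not> P E)) = edge_expectation (all_edges n) p (\<lambda>_. 1)"
    unfolding edge_expectation_def by (intro sum.cong refl) auto
  thus ?thesis unfolding prob_Gnp_expectation edge_expectation_add using edge_expectation_one[OF finite_all_edges, of n p] by simp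
qed

lemma prob_Gnp_nonneg: "0 \<le> p \<Longrightarrow> p \<le> 1 \<Longrightarrow> 0 \<le> prob_Gnp n p P"
  unfolding prob_Gnp_def by (intro sum_nonneg) auto

lemma prob_Gnp_Un:
  assumes "0 \<le> p" "p \<le> 1"
  shows "prob_Gnp n p (\<lambda>E. P E \<or> Q E) \<le> prob_Gnp n p P + prob_Gnp n p Q"
  unfolding prob_Gnp_expectation edge_expectation_add[symmetric] by (rule edge_expectation_mono) (use assms in auto)

lemma prob_Gnp_UN:
  assumes "0 \<le> p" "p \<le> 1" "finite S"
  shows "prob_Gnp n p (\<lambda>E. \<exists>x\<in>S. P x E) \<le> (\<Sum>x\<in>S. prob_Gnp n p (P x))"
  using assms(3)
proof (induction rule: finite_induct)
  case empty
  thus ?case unfolding prob_Gnp_def by simp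
next
  case (insert x S)
  have "prob_Gnp n p (\<lambda>E. \<exists>y\<in>insert x S. P y E) = prob_Gnp n p (\<lambda>E. P x E \<or> (\<exists>y\<in>S. P y E))" by simp
  also have "\<dots> \<le> prob_Gnp n p (P x) + prob_Gnp n p (\<lambda>E. \<exists>y\<in>S. P y E)" by (rule prob_Gnp_Un[OF assms(1,2)])
  finally show ?case using insert by simp
qed

section \<open>Common neighbours of disjoint tuples and their binomial tails\<close>

definition cnt :: "nat set set \<Rightarrow> nat set set \<Rightarrow> nat set \<Rightarrow> nat" where
  "cnt E T W = card {(\<tau>, w). \<tau> \<in> T \<and> w \<in> W \<and> (\<forall>x\<in>\<tau>. {w, x} \<in> E)}"

text \<open>The disjointness conditions ensure that different pairs of a tuple and a vertex of
  \<open>W\<close> involve disjoint sets of edges. Hence \<open>cnt\<close> is binomial with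
  \<open>card T * card W\<close> trials of probability \<open>p^t\<close>.\<close>

definition family :: "nat \<Rightarrow> nat \<Rightarrow> nat set set \<Rightarrow> nat set \<Rightarrow> bool" where
  "family n t T W \<longleftrightarrow> (\<forall>\<tau>\<in>T. \<tau> \<subseteq> {0..<n} \<and> card \<tau> = t) \<and> pairwise disjnt T \<and>
     W \<subseteq> {0..<n} \<and> \<Union>T \<inter> W = {}"

lemma family_finite: "family n t T W \<Longrightarrow> finite T \<and> finite W"
  unfolding family_def by (auto intro: finite_subset[of T "Pow {0..<n}"] finite_subset[of W "{0..<n}"])

lemma edge_expectation_power_cnt:
  assumes fam: "family n t T W"
  shows "edge_expectation (all_edges n) p (\<lambda>E. l ^ cnt E T W) = (1 + (l - 1) * p ^ t) ^ (card T * card W)"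
proof -
  let ?I = "T \<times> W"
  let ?F = "\<lambda>(\<tau>, w). (\<lambda>x. {w, x}) ` \<tau>"
  have fin: "finite ?I" using family_finite[OF fam] by simp
  have c: "l ^ cnt E T W = (\<Prod>i\<in>?I. if ?F i \<subseteq> E then l else 1)" for E
  proof -
    have "(\<Prod>i\<in>?I. if ?F i \<subseteq> E then l else 1) = (\<Prod>i\<in>{i \<in> ?I. ?F i \<subseteq> E}. l)"
      using prod.inter_filter[OF fin, of "\<lambda>_. l" "\<lambda>i. ?F i \<subseteq> E"] by simp
    also have "{i \<in> ?I. ?F i \<subseteq> E} = {(\<tau>, w). \<tau> \<in> T \<and> w \<in> W \<and> (\<forall>x\<in>\<tau>. {w, x} \<in> E)}" by auto
    finally show ?thesis unfolding cnt_def by simp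
  qed
  have "edge_expectation (all_edges n) p (\<lambda>E. \<Prod>i\<in>?I. if ?F i \<subseteq> E then l else 1) = (1 + (l - 1) * p ^ t) ^ card ?I"
  proof (rule edge_expectation_prod_blocks[OF fin finite_all_edges])
    fix i assume i: "i \<in> ?I"
    obtain \<tau> w where iw: "i = (\<tau>, w)" "\<tau> \<in> T" "w \<in> W" using i by auto
    have \<tau>: "\<tau> \<subseteq> {0..<n}" "card \<tau> = t" "w \<in> {0..<n}" "w \<notin> \<tau>" using fam iw unfolding family_def by auto
    have "inj_on (\<lambda>x. {w, x}) \<tau>" by (auto simp: inj_on_def doubleton_eq_iff)
    hence "card ((\<lambda>x. {w, x}) ` \<tau>) = t" using \<tau>(2) by (simp add: card_image)
    moreover have "(\<lambda>x. {w, x}) ` \<tau> \<subseteq> all_edges n" using \<tau> unfolding all_edges_def by (auto simp: card_insert_if)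
    ultimately show "?F i \<subseteq> all_edges n \<and> card (?F i) = t" using iw by simp
  next
    fix i j assume i: "i \<in> ?I" "j \<in> ?I" "i \<noteq> j"
    obtain \<tau> w \<sigma> v where ij: "i = (\<tau>, w)" "\<tau> \<in> T" "w \<in> W" "j = (\<sigma>, v)" "\<sigma> \<in> T" "v \<in> W"
      using i by auto
    have out: "x \<notin> W" if "x \<in> \<tau> \<or> x \<in> \<sigma>" for x using fam ij that unfolding family_def by blast
    have dj: "\<tau> = \<sigma>" if "x \<in> \<tau>" "x \<in> \<sigma>" for x
      using fam ij that unfolding family_def pairwise_def disjnt_def by blast
    show "?F i \<inter> ?F j = {}"
    proof (rule ccontr)
      assume "?F i \<inter> ?F j \<noteq> {}"
      then obtain x y where xy: "x \<in> \<tau>" "y \<in> \<sigma>" "{w, x} = {v, y}" using ij by auto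
      hence "w = v \<and> x = y" using out[of x] out[of y] ij by (metis doubleton_eq_iff)
      thus False using dj[of x] xy i(3) ij by auto
    qed
  qed
  thus ?thesis unfolding c by (simp add: card_cartesian_product)
qed

text \<open>Markov's inequality for \<open>l ^ cnt E T W\<close>. With the event stated in terms of
  \<open>l powr z\<close>, bases above 1 give upper tails and bases below 1 lower tails.\<close>

lemma prob_cnt_tail:
  fixes l z p :: real
  assumes fam: "family n t T W" and p: "0 \<le> p" "p \<le> 1" and l: "0 < l"
  shows "prob_Gnp n p (\<lambda>E. l powr z \<le> l ^ cnt E T W) \<le> exp ((l - 1) * (real (card T * card W) * p ^ t)) * l powr (- z)"
proof -
  have pt: "0 \<le> p ^ t" "p ^ t \<le> 1" using p by (simp_all add: power_le_one)
  have nn: "0 \<le> 1 + (l - 1) * p ^ t"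
  proof -
    have "0 \<le> l * p ^ t" using l pt by simp
    thus ?thesis using pt by (simp add: algebra_simps)
  qed
  have "prob_Gnp n p (\<lambda>E. l powr z \<le> l ^ cnt E T W) \<le> edge_expectation (all_edges n) p (\<lambda>E. l powr (- z) * l ^ cnt E T W)"
    unfolding prob_Gnp_expectation
  proof (rule edge_expectation_mono[OF p])
    fix E
    have "1 \<le> l powr (- z) * l ^ cnt E T W" if "l powr z \<le> l ^ cnt E T W"
      using that l by (simp add: powr_minus field_simps)
    thus "of_bool (l powr z \<le> l ^ cnt E T W) \<le> l powr (- z) * l ^ cnt E T W" using l by auto
  qed
  also have "\<dots> = l powr (- z) * (1 + (l - 1) * p ^ t) ^ (card T * card W)"
    unfolding edge_expectation_cmult edge_expectation_power_cnt[OF fam] ..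
  also have "\<dots> \<le> l powr (- z) * exp ((l - 1) * p ^ t) ^ (card T * card W)"
    using nn exp_ge_add_one_self[of "(l - 1) * p ^ t"] by (intro mult_left_mono power_mono) auto
  also have "exp ((l - 1) * p ^ t) ^ (card T * card W) = exp ((l - 1) * (real (card T * card W) * p ^ t))"
    unfolding exp_of_nat_mult[symmetric] by (simp add: mult_ac)
  finally show ?thesis by (simp add: mult.commute)
qed

text \<open>The base is \<open>3 / 2\<close>; from \<open>ln (3 / 2) \<ge> 17 / 48\<close> the
  exponent is at most \<open>\<mu> / 2 - 17 * \<mu> / 32 = - \<mu> / 32\<close>. Here
  \<open>\<mu>\<close> may exceed the mean, which matters for small \<open>W\<close>.\<close>

lemma prob_cnt_upper:
  fixes \<mu> p :: real
  assumes fam: "family n t T W" and p: "0 \<le> p" "p \<le> 1" and \<mu>: "real (card T * card W) * p ^ t \<le> \<mu>"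
  shows "prob_Gnp n p (\<lambda>E. 3 / 2 * \<mu> \<le> cnt E T W) \<le> exp (- \<mu> / 32)"
proof -
  have "prob_Gnp n p (\<lambda>E. 3 / 2 * \<mu> \<le> cnt E T W) \<le> prob_Gnp n p (\<lambda>E. (3 / 2) powr (3 / 2 * \<mu>) \<le> (3 / 2) ^ cnt E T W)"
    by (rule prob_Gnp_mono[OF p]) (simp add: powr_realpow[symmetric])
  also have "\<dots> \<le> exp ((3 / 2 - 1) * (real (card T * card W) * p ^ t)) * (3 / 2) powr (- (3 / 2 * \<mu>))"
    by (rule prob_cnt_tail[OF fam p]) simp
  also have "\<dots> \<le> exp (\<mu> / 2) * exp (- (17 / 32) * \<mu>)"
  proof (intro mult_mono)
    have "0 \<le> \<mu>" using \<mu> p by (meson mult_nonneg_nonneg of_nat_0_le_iff order_trans zero_le_power)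
    have "exp (17 / 48 :: real) \<le> 1 + 17 / 48 + (17 / 48)\<^sup>2" by (rule exp_bound) auto
    also have "\<dots> \<le> 3 / 2" by (simp add: power2_eq_square)
    finally have "17 / 48 \<le> ln (3 / 2 :: real)" by (rule ln_ge_iff[THEN iffD2, rotated]) simp
    hence "3 / 2 * \<mu> * (17 / 48) \<le> 3 / 2 * \<mu> * ln (3 / 2)" using \<open>0 \<le> \<mu>\<close> by (intro mult_left_mono) auto
    thus "(3 / 2) powr (- (3 / 2 * \<mu>)) \<le> exp (- (17 / 32) * \<mu>)" by (simp add: powr_def)
  qed (use \<mu> in auto)
  also have "\<dots> = exp (- \<mu> / 32)" unfolding exp_add[symmetric] by simp
  finally show ?thesis .
qed

text \<open>The base is \<open>3 / 4\<close>; from \<open>ln (4 / 3) \<le> 7 / 24\<close> the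
  exponent is at most \<open>- \<mu> / 4 + 7 * \<mu> / 32\<close>, the same rate as for the upper
  tail.\<close>

lemma prob_cnt_lower:
  fixes p :: real
  assumes fam: "family n t T W" and p: "0 \<le> p" "p \<le> 1" and \<mu>: "\<mu> = real (card T * card W) * p ^ t"
  shows "prob_Gnp n p (\<lambda>E. cnt E T W \<le> 3 / 4 * \<mu>) \<le> exp (- \<mu> / 32)"
proof -
  have "prob_Gnp n p (\<lambda>E. cnt E T W \<le> 3 / 4 * \<mu>) \<le> prob_Gnp n p (\<lambda>E. (3 / 4) powr (3 / 4 * \<mu>) \<le> (3 / 4) ^ cnt E T W)"
  proof (rule prob_Gnp_mono[OF p])
    fix E assume "cnt E T W \<le> 3 / 4 * \<mu>"
    hence "(3 / 4 :: real) powr (3 / 4 * \<mu>) \<le> (3 / 4) powr (real (cnt E T W))" by (intro powr_mono') auto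
    thus "(3 / 4) powr (3 / 4 * \<mu>) \<le> (3 / 4 :: real) ^ cnt E T W" by (simp add: powr_realpow)
  qed
  also have "\<dots> \<le> exp ((3 / 4 - 1) * (real (card T * card W) * p ^ t)) * (3 / 4) powr (- (3 / 4 * \<mu>))"
    by (rule prob_cnt_tail[OF fam p]) simp
  also have "\<dots> \<le> exp (- \<mu> / 4) * exp ((7 / 32) * \<mu>)"
  proof (intro mult_mono)
    have "0 \<le> \<mu>" unfolding \<mu> using p by simp
    have "1 + 7 / 24 + (7 / 24)\<^sup>2 / 2 \<le> exp (7 / 24 :: real)" by (rule exp_lower_Taylor_quadratic) simp
    moreover have "4 / 3 \<le> 1 + 7 / 24 + (7 / 24 :: real)\<^sup>2 / 2" by (simp add: power2_eq_square)
    ultimately have "4 / 3 \<le> exp (7 / 24 :: real)" by linarith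
    hence "ln (4 / 3 :: real) \<le> ln (exp (7 / 24))" by (subst ln_le_cancel_iff) auto
    hence "ln (4 / 3 :: real) \<le> 7 / 24" by simp
    moreover have "ln (3 / 4 :: real) = - ln (4 / 3)" by (simp add: ln_div)
    ultimately have "- (7 / 24) \<le> ln (3 / 4 :: real)" by simp
    hence "3 / 4 * \<mu> * (- (7 / 24)) \<le> 3 / 4 * \<mu> * ln (3 / 4)" using \<open>0 \<le> \<mu>\<close> by (intro mult_left_mono) auto
    thus "(3 / 4) powr (- (3 / 4 * \<mu>)) \<le> exp ((7 / 32) * \<mu>)" by (simp add: powr_def)
  qed (use \<mu> in auto)
  also have "\<dots> = exp (- \<mu> / 32)" unfolding exp_add[symmetric] by simp
  finally show ?thesis .
qed

text \<open>The base is \<open>1 / \<theta>\<close>. For \<open>z\<close> far above the mean this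
  bound of Poisson type is small enough to pay for a union over many sets \<open>W\<close>.\<close>

lemma prob_cnt_large:
  fixes \<theta> z p :: real
  assumes fam: "family n t T W" and p: "0 \<le> p" "p \<le> 1" and \<theta>: "0 < \<theta>" "\<theta> \<le> 1"
    and \<mu>: "real (card T * card W) * p ^ t \<le> \<theta> * z"
  shows "prob_Gnp n p (\<lambda>E. z \<le> cnt E T W) \<le> (exp 1 * \<theta>) powr z"
proof -
  have "prob_Gnp n p (\<lambda>E. z \<le> cnt E T W) \<le> prob_Gnp n p (\<lambda>E. (1 / \<theta>) powr z \<le> (1 / \<theta>) ^ cnt E T W)"
    by (rule prob_Gnp_mono[OF p]) (use \<theta> in \<open>auto simp: powr_realpow[symmetric] intro!: powr_mono\<close>)
  also have "\<dots> \<le> exp ((1 / \<theta> - 1) * (real (card T * card W) * p ^ t)) * (1 / \<theta>) powr (- z)"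
    by (rule prob_cnt_tail[OF fam p]) (use \<theta> in simp)
  also have "\<dots> \<le> exp z * \<theta> powr z"
  proof (intro mult_mono)
    have "(1 / \<theta> - 1) * (real (card T * card W) * p ^ t) \<le> 1 / \<theta> * (real (card T * card W) * p ^ t)"
      using p \<theta> by (intro mult_right_mono) auto
    also have "\<dots> \<le> 1 / \<theta> * (\<theta> * z)" using \<mu> \<theta> by (intro mult_left_mono) auto
    finally show "exp ((1 / \<theta> - 1) * (real (card T * card W) * p ^ t)) \<le> exp z" using \<theta> by simp
    show "(1 / \<theta>) powr (- z) \<le> \<theta> powr z" using \<theta> by (simp add: powr_minus powr_divide)
  qed auto
  also have "\<dots> = (exp 1 * \<theta>) powr z" using \<theta> by (simp add: powr_def ln_mult exp_add[symmetric] algebra_simps)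
  finally show ?thesis .
qed

section \<open>Union bounds over families of tuples and vertex sets\<close>

lemma card_subsets_le:
  assumes "finite S"
  shows "card {B. B \<subseteq> S \<and> card B = k} \<le> card S ^ k"
  unfolding n_subsets[OF assms] by (cases "k \<le> card S") (auto intro: binomial_le_pow simp: binomial_eq_0) 


text \<open>Tuples are counted crudely, but \<open>W\<close> by a binomial coefficient: for linear
  \<open>W\<close> the count \<open>n ^ w\<close> would exceed what the tail bound can pay.\<close>

lemma prob_family_union:
  fixes p :: real
  assumes p: "0 \<le> p" "p \<le> 1" and B: "0 \<le> B"
    and le: "\<And>T W. family n t T W \<Longrightarrow> card T = k \<Longrightarrow> card W = w \<Longrightarrow> prob_Gnp n p (Q T W) \<le> B"
  shows "prob_Gnp n p (\<lambda>E. \<exists>T W. family n t T W \<and> card T = k \<and> card W = w \<and> Q T W E)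
     \<le> real n ^ (t * k) * real (n choose w) * B"
proof -
  let ?A = "{T. T \<subseteq> {\<tau>. \<tau> \<subseteq> {0..<n} \<and> card \<tau> = t} \<and> card T = k}"
  let ?B = "{W. W \<subseteq> {0..<n} \<and> card W = w}"
  let ?S = "{(T, W). (T, W) \<in> ?A \<times> ?B \<and> family n t T W}"
  have fin\<tau>: "finite {\<tau>. \<tau> \<subseteq> {0..<n} \<and> card \<tau> = t}" by (rule finite_subset[of _ "Pow {0..<n}"]) auto
  have finA: "finite ?A" by (rule finite_subset[of _ "Pow {\<tau>. \<tau> \<subseteq> {0..<n} \<and> card \<tau> = t}"]) (use fin\<tau> in auto)
  have finB: "finite ?B" by (rule finite_subset[of _ "Pow {0..<n}"]) auto
  have sub: "?S \<subseteq> ?A \<times> ?B" by auto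
  have finS: "finite ?S" by (rule finite_subset[OF sub]) (use finA finB in simp)
  have cA: "card ?A \<le> n ^ (t * k)"
  proof -
    have "card ?A \<le> card {\<tau>. \<tau> \<subseteq> {0..<n} \<and> card \<tau> = t} ^ k" by (rule card_subsets_le[OF fin\<tau>])
    also have "\<dots> \<le> (n ^ t) ^ k" using card_subsets_le[of "{0..<n}" t] by (intro power_mono) auto
    finally show ?thesis by (simp add: power_mult)
  qed
  have cB: "card ?B = n choose w" using n_subsets[of "{0..<n}" w] by simp
  have "card ?S \<le> card (?A \<times> ?B)" by (rule card_mono[OF _ sub]) (use finA finB in simp)
  also have "\<dots> \<le> n ^ (t * k) * (n choose w)" unfolding card_cartesian_product cB using cA by simp
  finally have "real (card ?S) \<le> real (n ^ (t * k) * (n choose w))" by (rule of_nat_mono)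
  hence cS: "real (card ?S) \<le> real n ^ (t * k) * real (n choose w)" by simp
  have "prob_Gnp n p (\<lambda>E. \<exists>T W. family n t T W \<and> card T = k \<and> card W = w \<and> Q T W E)
    \<le> prob_Gnp n p (\<lambda>E. \<exists>x\<in>?S. Q (fst x) (snd x) E)"
  proof (rule prob_Gnp_mono[OF p])
    fix E assume "\<exists>T W. family n t T W \<and> card T = k \<and> card W = w \<and> Q T W E"
    then obtain T W where TW: "family n t T W" "card T = k" "card W = w" "Q T W E" by auto
    hence "(T, W) \<in> ?S" unfolding family_def by auto
    thus "\<exists>x\<in>?S. Q (fst x) (snd x) E" using TW(4) by (intro bexI[of _ "(T, W)"]) simp
  qed
  also have "\<dots> \<le> (\<Sum>x\<in>?S. prob_Gnp n p (Q (fst x) (snd x)))" by (rule prob_Gnp_UN[OF p finS])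
  also have "\<dots> \<le> (\<Sum>x\<in>?S. B)" by (rule sum_mono) (use le in auto)
  also have "\<dots> = card ?S * B" by simp
  also have "\<dots> \<le> real n ^ (t * k) * real (n choose w) * B" using cS B by (rule mult_right_mono)
  finally show ?thesis .
qed

lemma family_card_Union:
  assumes "family n t T W"
  shows "card (\<Union>T) = t * card T"
proof -
  have fin: "finite T" "\<And>\<tau>. \<tau> \<in> T \<Longrightarrow> finite \<tau>"
    using family_finite[OF assms(1)] assms unfolding family_def by (auto intro: finite_subset)
  have "card (\<Union>T) = (\<Sum>\<tau>\<in>T. card \<tau>)"
    using assms(1) fin(2) unfolding family_def by (intro card_Union_disjoint) auto
  also have "\<dots> = t * card T" using assms(1) unfolding family_def by simp
  finally show ?thesis .
qed

lemma family_card_le: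
  assumes "family n t T W" "1 \<le> t"
  shows "card T \<le> n"
proof -
  have "t * card T = card (\<Union>T)" using family_card_Union[OF assms(1)] by simp
  also have "\<dots> \<le> card {0..<n}" by (rule card_mono) (use assms(1) in \<open>auto simp: family_def\<close>)
  finally have "t * card T \<le> n" by simp
  moreover have "1 * card T \<le> t * card T" using assms(2) by (rule mult_le_mono1)
  ultimately show ?thesis by linarith
qed

text \<open>There are at most \<open>(n + 1)^2\<close> pairs of sizes, and each contributes at most
  \<open>1 / n^4\<close>; the tail bound may depend on both sizes.\<close>

lemma prob_family_double_union:
  fixes \<beta> :: "nat \<Rightarrow> nat \<Rightarrow> real"
  assumes p: "0 \<le> p" "p \<le> 1" and t: "1 \<le> t" and n: "4 \<le> n"
    and le: "\<And>T W. family n t T W \<Longrightarrow> Z (card T) (card W) \<Longrightarrow>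
        real n ^ (t * card T) * real n ^ card W * (if Z (card T) (card W) then \<beta> (card T) (card W) else 0) \<le> 1 / real n ^ 4"
    and \<beta>: "\<And>T W. family n t T W \<Longrightarrow> Z (card T) (card W) \<Longrightarrow> prob_Gnp n p (Q T W) \<le> \<beta> (card T) (card W)"
    "\<And>k w. 0 \<le> \<beta> k w"
  shows "prob_Gnp n p (\<lambda>E. \<exists>T W. family n t T W \<and> Z (card T) (card W) \<and> Q T W E) \<le> 1 / n"
proof -
  let ?I = "{..n} \<times> {..n}"
  have bd: "prob_Gnp n p (\<lambda>E. \<exists>T W. family n t T W \<and> card T = k \<and> card W = w \<and> Z k w \<and> Q T W E) \<le> 1 / real n ^ 4" for k w
  proof (cases "\<exists>T W. family n t T W \<and> card T = k \<and> card W = w \<and> Z k w")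
    case True
    then obtain T0 W0 where TW: "family n t T0 W0" "card T0 = k" "card W0 = w" "Z k w" by auto
    have "prob_Gnp n p (\<lambda>E. \<exists>T W. family n t T W \<and> card T = k \<and> card W = w \<and> Z k w \<and> Q T W E)
       \<le> prob_Gnp n p (\<lambda>E. \<exists>T W. family n t T W \<and> card T = k \<and> card W = w \<and> Q T W E)"
      by (rule prob_Gnp_mono[OF p]) auto
    also have "\<dots> \<le> real n ^ (t * k) * real (n choose w) * \<beta> k w"
      by (rule prob_family_union[OF p]) (use \<beta> TW(4) in auto)
    also have "\<dots> \<le> real n ^ (t * k) * real n ^ w * \<beta> k w"
    proof (intro mult_right_mono mult_left_mono)
      have "n choose w \<le> n ^ w" by (cases "w \<le> n") (auto intro: binomial_le_pow simp: binomial_eq_0)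
      thus "real (n choose w) \<le> real n ^ w" by (metis of_nat_mono of_nat_power)
    qed (use \<beta>(2) in auto)
    also have "\<dots> \<le> 1 / real n ^ 4" using le[OF TW(1)] TW by simp
    finally show ?thesis .
  next
    case False
    hence *: "(\<lambda>E. \<exists>T W. family n t T W \<and> card T = k \<and> card W = w \<and> Z k w \<and> Q T W E) = (\<lambda>_. False)" by blast
    show ?thesis unfolding * by (simp add: prob_Gnp_def)
  qed
  have "prob_Gnp n p (\<lambda>E. \<exists>T W. family n t T W \<and> Z (card T) (card W) \<and> Q T W E)
    \<le> prob_Gnp n p (\<lambda>E. \<exists>x\<in>?I. \<exists>T W. family n t T W \<and> card T = fst x \<and> card W = snd x \<and> Z (fst x) (snd x) \<and> Q T W E)"
  proof (rule prob_Gnp_mono[OF p])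
    fix E assume "\<exists>T W. family n t T W \<and> Z (card T) (card W) \<and> Q T W E"
    then obtain T W where TW: "family n t T W" "Z (card T) (card W)" "Q T W E" by auto
    have "card W \<le> card {0..<n}" by (rule card_mono) (use TW(1) in \<open>auto simp: family_def\<close>)
    hence "(card T, card W) \<in> ?I" using family_card_le[OF TW(1) t] by simp
    thus "\<exists>x\<in>?I. \<exists>T W. family n t T W \<and> card T = fst x \<and> card W = snd x \<and> Z (fst x) (snd x) \<and> Q T W E"
      using TW by (intro bexI[of _ "(card T, card W)"]) auto
  qed
  also have "\<dots> \<le> (\<Sum>x\<in>?I. prob_Gnp n p (\<lambda>E. \<exists>T W. family n t T W \<and> card T = fst x \<and> card W = snd x \<and> Z (fst x) (snd x) \<and> Q T W E))"
    by (rule prob_Gnp_UN[OF p]) simp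
  also have "\<dots> \<le> (\<Sum>x\<in>?I. 1 / real n ^ 4)" by (rule sum_mono) (rule bd)
  also have "\<dots> = (real n + 1)\<^sup>2 / real n ^ 4" by (simp add: power2_eq_square algebra_simps add_divide_distrib)
  also have "\<dots> \<le> 1 / n"
  proof -
    have "(real n + 1)\<^sup>2 \<le> (2 * real n)\<^sup>2" using n by (intro power_mono) auto
    also have "\<dots> = 4 * real n ^ 2" by (simp add: power2_eq_square)
    also have "\<dots> \<le> real n * real n ^ 2" using n by (intro mult_right_mono) auto
    finally have "(real n + 1)\<^sup>2 * real n \<le> real n * real n ^ 2 * real n" by (intro mult_right_mono) auto
    also have "\<dots> = real n ^ 4" by (simp add: power2_eq_square power4_eq_xxxx)
    finally have "(real n + 1)\<^sup>2 * real n \<le> real n ^ 4" .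
    thus ?thesis using n by (simp add: field_simps)
  qed
  finally show ?thesis .
qed

text \<open>Both \<open>k * p^t\<close> and \<open>m * p^t\<close> are at least
  \<open>512 * ln n\<close>, so \<open>k * m * p^t\<close> is at least
  \<open>256 * (k + m) * ln n\<close>. Divided by 32 this is \<open>8 * (k + m) * ln n\<close>,
  which beats the entropy \<open>(t * k + w) * ln n\<close> with \<open>4 * ln n\<close> to
  spare.\<close>

lemma uniform_exponent:
  fixes z p :: real
  assumes n: "4 \<le> n" and t: "t \<le> 2" and p: "0 < p" and z: "512 * ln n \<le> z * p ^ t"
    and k: "z \<le> real k" and w: "real w \<le> m" "z \<le> m"
  shows "real n ^ (t * k) * real n ^ w * exp (- (k * m * p ^ t) / 32) \<le> 1 / real n ^ 4"
proof -
  have ln: "1 \<le> ln (real n)"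
  proof -
    have "exp 1 \<le> (4::real)" using exp_le by simp
    hence "exp 1 \<le> real n" using n by linarith
    thus ?thesis using n by (subst ln_ge_iff) auto
  qed
  have pt: "0 < p ^ t" using p by simp
  have k1: "512 * ln n \<le> k * p ^ t" using z k pt by (meson less_imp_le mult_right_mono order_trans)
  have m1: "512 * ln n \<le> m * p ^ t" using z w pt by (meson less_imp_le mult_right_mono order_trans)
  have mpos: "0 \<le> m" using w(1) by linarith
  have "512 * ln n * m \<le> k * p ^ t * m" using k1 mpos by (rule mult_right_mono)
  moreover have "512 * ln n * k \<le> m * p ^ t * k" using m1 by (rule mult_right_mono) simp
  ultimately have "256 * ln n * (k + m) \<le> k * m * p ^ t" by (simp add: algebra_simps)
  hence "8 * ln n * (k + m) \<le> k * m * p ^ t / 32" by simp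
  moreover have "8 * ln n * (k + real w) \<le> 8 * ln n * (k + m)" using ln w by (intro mult_left_mono) auto
  ultimately have e: "8 * ln n * (k + real w) \<le> k * m * p ^ t / 32" by linarith
  have k1': "1 \<le> k"
  proof (rule ccontr)
    assume "\<not> 1 \<le> k"
    hence "k = 0" by simp
    thus False using k1 ln by simp
  qed
  have "real n ^ (t * k) * real n ^ w * exp (- (k * m * p ^ t) / 32)
    \<le> real n ^ (t * k) * real n ^ w * exp (- (8 * ln n * (k + real w)))"
    using e by (intro mult_left_mono) auto
  also have "\<dots> = exp (ln n * (t * k)) * exp (ln n * w) * exp (- (8 * ln n * (k + real w)))"
    using n by (simp add: powr_realpow[symmetric] powr_def mult.commute)
  also have "\<dots> = exp (ln n * (t * k + w - 8 * (k + real w)))"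
    unfolding exp_add[symmetric] by (simp add: algebra_simps)
  also have "\<dots> \<le> exp (ln n * (- 4))"
  proof (subst exp_le_cancel_iff, rule mult_left_mono)
    have "real t * real k \<le> 2 * real k" using t by (intro mult_right_mono) auto
    moreover have "1 \<le> real k" "0 \<le> real w" using k1' by simp_all
    ultimately show "real (t * k + w) - 8 * (real k + real w) \<le> - 4"
    proof -
      have "X \<le> 2 * K \<Longrightarrow> 1 \<le> K \<Longrightarrow> 0 \<le> W \<Longrightarrow> X + W - 8 * (K + W) \<le> - 4" for X K W :: real by simp
      thus "real t * real k \<le> 2 * real k \<Longrightarrow> 1 \<le> real k \<Longrightarrow> 0 \<le> real w \<Longrightarrow> real (t * k + w) - 8 * (real k + real w) \<le> - 4"
        unfolding of_nat_add of_nat_mult .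
    qed
  qed (use ln in auto)
  also have "\<dots> = 1 / real n ^ 4"
    using n by (simp add: exp_minus powr_realpow[symmetric] powr_def mult.commute field_simps)
  finally show ?thesis .
qed

text \<open>For \<open>W\<close> smaller than \<open>z\<close> the mean is too small for
  concentration; replacing its size by \<open>max (card W) z\<close> gives a bound valid for all
  \<open>W\<close> at once.\<close>

lemma prob_upper_uniform:
  fixes z p :: real
  assumes n: "4 \<le> n" and t: "1 \<le> t" "t \<le> 2" and p: "0 < p" "p \<le> 1" and z: "512 * ln n \<le> z * p ^ t"
  shows "prob_Gnp n p (\<lambda>E. \<exists>T W. family n t T W \<and> z \<le> card T \<and>
     3 / 2 * (card T * max (card W) z * p ^ t) \<le> cnt E T W) \<le> 1 / n"
proof (rule prob_family_double_union[where Z = "\<lambda>k w. z \<le> real k" and \<beta> = "\<lambda>k w. exp (- (k * max (real w) z * p ^ t) / 32)"])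
  fix T W assume f: "family n t T W" "z \<le> card T"
  show "prob_Gnp n p (\<lambda>E. 3 / 2 * (card T * max (card W) z * p ^ t) \<le> cnt E T W) \<le> exp (- (card T * max (card W) z * p ^ t) / 32)"
    by (rule prob_cnt_upper[OF f(1)]) (use p in \<open>auto intro!: mult_right_mono mult_left_mono\<close>)
  show "real n ^ (t * card T) * real n ^ card W *
      (if z \<le> card T then exp (- (card T * max (card W) z * p ^ t) / 32) else 0) \<le> 1 / real n ^ 4"
    using uniform_exponent[OF n t(2) p(1) z f(2), of "card W" "max (card W) z"] f(2) by simp
qed (use assms in auto)

lemma prob_lower_uniform:
  fixes z p :: real
  assumes n: "4 \<le> n" and t: "1 \<le> t" "t \<le> 2" and p: "0 < p" "p \<le> 1" and z: "512 * ln n \<le> z * p ^ t"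
  shows "prob_Gnp n p (\<lambda>E. \<exists>T W. family n t T W \<and> (z \<le> card T \<and> z \<le> card W) \<and>
     cnt E T W \<le> 3 / 4 * (real (card T * card W) * p ^ t)) \<le> 1 / n"
proof (rule prob_family_double_union[where Z = "\<lambda>k w. z \<le> real k \<and> z \<le> real w" and \<beta> = "\<lambda>k w. exp (- (real (k * w) * p ^ t) / 32)"])
  fix T W assume f: "family n t T W" "z \<le> card T \<and> z \<le> card W"
  show "prob_Gnp n p (\<lambda>E. cnt E T W \<le> 3 / 4 * (real (card T * card W) * p ^ t)) \<le> exp (- (real (card T * card W) * p ^ t) / 32)"
    by (rule prob_cnt_lower[OF f(1)]) (use p in auto)
  show "real n ^ (t * card T) * real n ^ card W *
      (if z \<le> card T \<and> z \<le> card W then exp (- (real (card T * card W) * p ^ t) / 32) else 0) \<le> 1 / real n ^ 4"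
    using uniform_exponent[OF n t(2) p(1) z, of "card T" "card W" "card W"] f(2) by simp
qed (use assms in auto)

text \<open>Meant for sets \<open>W\<close> too small for concentration, where \<open>s\<close> per
  tuple exceeds the mean by a factor \<open>1 / \<theta>\<close>. As \<open>W\<close> has at most
  \<open>\<rho>\<close> vertices per tuple, the union bound costs \<open>n^t * n powr \<rho>\<close>
  per tuple, against a probability of \<open>(exp 1 * \<theta>) powr s\<close> per tuple.\<close>

lemma prob_few_connectors:
  fixes s \<rho> \<theta> q p :: real
  assumes n: "4 \<le> n" and t: "1 \<le> t" and p: "0 < p" "p \<le> 1" and \<theta>: "0 < \<theta>" "\<theta> \<le> 1"
    and q: "q * p ^ t \<le> \<theta> * s" and b: "(exp 1 * \<theta>) powr s * real n ^ t * real n powr \<rho> \<le> 1 / real n ^ 4"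
  shows "prob_Gnp n p (\<lambda>E. \<exists>T W. family n t T W \<and> (1 \<le> card T \<and> card W \<le> \<rho> * card T \<and> card W \<le> q) \<and>
     s * card T \<le> cnt E T W) \<le> 1 / n"
proof (rule prob_family_double_union[where Z = "\<lambda>k w. 1 \<le> k \<and> real w \<le> \<rho> * k \<and> w \<le> q" and \<beta> = "\<lambda>k w. (exp 1 * \<theta>) powr (s * k)"])
  fix T W assume f: "family n t T W" "1 \<le> card T \<and> card W \<le> \<rho> * card T \<and> card W \<le> q"
  show "prob_Gnp n p (\<lambda>E. s * card T \<le> cnt E T W) \<le> (exp 1 * \<theta>) powr (s * card T)"
  proof (rule prob_cnt_large[OF f(1)])
    have "card W * p ^ t \<le> q * p ^ t" using f(2) p by (intro mult_right_mono) auto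
    hence "card T * (card W * p ^ t) \<le> card T * (\<theta> * s)" using q by (intro mult_left_mono) auto
    thus "real (card T * card W) * p ^ t \<le> \<theta> * (s * card T)" by (simp add: algebra_simps)
  qed (use p \<theta> in auto)
  have "real n ^ card W \<le> real n powr (\<rho> * card T)"
    using f(2) n by (subst powr_realpow[symmetric]) (auto intro!: powr_mono)
  hence "real n ^ (t * card T) * real n ^ card W * (exp 1 * \<theta>) powr (s * card T)
    \<le> real n ^ (t * card T) * real n powr (\<rho> * card T) * (exp 1 * \<theta>) powr (s * card T)"
    by (intro mult_right_mono mult_left_mono) auto
  also have "\<dots> = ((exp 1 * \<theta>) powr s * real n ^ t * real n powr \<rho>) ^ card T"
  proof -
    have e: "x powr (y * real k) = (x powr y) ^ k" if "0 < x" for x y :: real and k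
      using that by (simp add: powr_powr[symmetric] powr_realpow)
    show ?thesis using n \<theta> by (simp add: e power_mult_distrib power_mult)
  qed
  also have "\<dots> \<le> (1 / real n ^ 4) ^ card T" using b by (intro power_mono) auto
  also have "\<dots> \<le> (1 / real n ^ 4) ^ 1" using f(2) n by (intro power_decreasing) auto
  finally show "real n ^ (t * card T) * real n ^ card W *
      (if 1 \<le> card T \<and> card W \<le> \<rho> * card T \<and> card W \<le> q then (exp 1 * \<theta>) powr (s * card T) else 0) \<le> 1 / real n ^ 4"
    using f(2) by simp
qed (use assms in auto)

text \<open>\<open>W\<close> is fixed before the graph is drawn, so only the tuple enters the union
  bound and no exceptional tuples arise. This is the reason for using fixed residue classes as
  connectors.\<close>

lemma prob_codegree_lower:
  fixes p :: real
  assumes p: "0 \<le> p" "p \<le> 1"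
  shows "prob_Gnp n p (\<lambda>E. \<exists>\<tau>. family n t {\<tau>} W \<and> cnt E {\<tau>} W \<le> 3 / 4 * (card W * p ^ t)) \<le> real n ^ t * exp (- (card W * p ^ t) / 32)"
proof -
  let ?S = "{\<tau>. \<tau> \<subseteq> {0..<n} \<and> card \<tau> = t}"
  have fin: "finite ?S" by (rule finite_subset[of _ "Pow {0..<n}"]) auto
  have "prob_Gnp n p (\<lambda>E. \<exists>\<tau>. family n t {\<tau>} W \<and> cnt E {\<tau>} W \<le> 3 / 4 * (card W * p ^ t))
    \<le> prob_Gnp n p (\<lambda>E. \<exists>\<tau>\<in>?S. family n t {\<tau>} W \<and> cnt E {\<tau>} W \<le> 3 / 4 * (card W * p ^ t))"
    by (rule prob_Gnp_mono[OF p]) (auto simp: family_def)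
  also have "\<dots> \<le> (\<Sum>\<tau>\<in>?S. prob_Gnp n p (\<lambda>E. family n t {\<tau>} W \<and> cnt E {\<tau>} W \<le> 3 / 4 * (card W * p ^ t)))"
    by (rule prob_Gnp_UN[OF p fin])
  also have "\<dots> \<le> (\<Sum>\<tau>\<in>?S. exp (- (card W * p ^ t) / 32))"
  proof (rule sum_mono)
    fix \<tau>
    show "prob_Gnp n p (\<lambda>E. family n t {\<tau>} W \<and> cnt E {\<tau>} W \<le> 3 / 4 * (card W * p ^ t)) \<le> exp (- (card W * p ^ t) / 32)"
    proof (cases "family n t {\<tau>} W")
      case True
      thus ?thesis using prob_cnt_lower[OF True p, of "card W * p ^ t"] by simp
    qed (simp add: prob_Gnp_def)
  qed
  also have "\<dots> = card ?S * exp (- (card W * p ^ t) / 32)" by simp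
  also have "\<dots> \<le> real n ^ t * exp (- (card W * p ^ t) / 32)"
  proof (rule mult_right_mono)
    have "card ?S \<le> card {0..<n} ^ t" by (rule card_subsets_le) simp
    thus "real (card ?S) \<le> real n ^ t" by (metis card_atLeastLessThan diff_zero of_nat_mono of_nat_power)
  qed simp
  finally show ?thesis .
qed

lemma prob_codegree_upper:
  fixes p :: real
  assumes p: "0 \<le> p" "p \<le> 1"
  shows "prob_Gnp n p (\<lambda>E. \<exists>\<tau>. \<tau> \<subseteq> {0..<n} \<and> card \<tau> = t \<and> 3 / 2 * (n * p ^ t) \<le> cnt E {\<tau>} ({0..<n} - \<tau>)) \<le> real n ^ t * exp (- (n * p ^ t) / 32)"
proof -
  let ?S = "{\<tau>. \<tau> \<subseteq> {0..<n} \<and> card \<tau> = t}"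
  have fin: "finite ?S" by (rule finite_subset[of _ "Pow {0..<n}"]) auto
  have "prob_Gnp n p (\<lambda>E. \<exists>\<tau>. \<tau> \<subseteq> {0..<n} \<and> card \<tau> = t \<and> 3 / 2 * (n * p ^ t) \<le> cnt E {\<tau>} ({0..<n} - \<tau>))
    \<le> prob_Gnp n p (\<lambda>E. \<exists>\<tau>\<in>?S. 3 / 2 * (n * p ^ t) \<le> cnt E {\<tau>} ({0..<n} - \<tau>))"
    by (rule prob_Gnp_mono[OF p]) auto
  also have "\<dots> \<le> (\<Sum>\<tau>\<in>?S. prob_Gnp n p (\<lambda>E. 3 / 2 * (n * p ^ t) \<le> cnt E {\<tau>} ({0..<n} - \<tau>)))"
    by (rule prob_Gnp_UN[OF p fin])
  also have "\<dots> \<le> (\<Sum>\<tau>\<in>?S. exp (- (n * p ^ t) / 32))"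
  proof (rule sum_mono)
    fix \<tau> assume \<tau>: "\<tau> \<in> ?S"
    have "card ({0..<n} - \<tau>) \<le> card {0..<n}" by (rule card_mono) auto
    hence "real (card ({0..<n} - \<tau>)) * p ^ t \<le> n * p ^ t" using p by (intro mult_right_mono) auto
    thus "prob_Gnp n p (\<lambda>E. 3 / 2 * (n * p ^ t) \<le> cnt E {\<tau>} ({0..<n} - \<tau>)) \<le> exp (- (n * p ^ t) / 32)"
      using prob_cnt_upper[of n t "{\<tau>}" "{0..<n} - \<tau>" p "n * p ^ t"] p \<tau> by (simp add: family_def)
  qed
  also have "\<dots> = card ?S * exp (- (n * p ^ t) / 32)" by simp
  also have "\<dots> \<le> real n ^ t * exp (- (n * p ^ t) / 32)"
  proof (rule mult_right_mono)
    have "card ?S \<le> card {0..<n} ^ t" by (rule card_subsets_le) simp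
    thus "real (card ?S) \<le> real n ^ t" by (metis card_atLeastLessThan diff_zero of_nat_mono of_nat_power)
  qed simp
  finally show ?thesis .
qed

lemma prob_entropy_lower:
  fixes p :: real
  assumes p: "0 \<le> p" "p \<le> 1"
  shows "prob_Gnp n p (\<lambda>E. \<exists>T W. family n t T W \<and> card T = k \<and> card W = b \<and>
     cnt E T W \<le> 3 / 4 * (real (k * b) * p ^ t)) \<le> real n ^ (t * k) * real (n choose b) * exp (- (real (k * b) * p ^ t) / 32)"
proof (rule prob_family_union[OF p])
  fix T W assume f: "family n t T W" "card T = k" "card W = b"
  show "prob_Gnp n p (\<lambda>E. cnt E T W \<le> 3 / 4 * (real (k * b) * p ^ t)) \<le> exp (- (real (k * b) * p ^ t) / 32)"
    by (rule prob_cnt_lower[OF f(1) p]) (use f in simp)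
qed simp

section \<open>Realising auxiliary cycles by connecting vertices\<close>

lemma distinct_concat_disjoint:
  assumes "distinct (concat Cs)" "i < length Cs" "j < length Cs" "i \<noteq> j"
  shows "set (Cs ! i) \<inter> set (Cs ! j) = {}"
  using assms
proof (induction Cs arbitrary: i j)
  case (Cons C Cs)
  have *: "set C \<inter> set (Cs ! k) = {}" if "k < length Cs" for k
    using Cons.prems(1) that by (auto dest: nth_mem)
  show ?case
    using Cons * by (cases i; cases j) (auto simp: Int_commute)
qed auto

lemma distinct_outer:
  "distinct (concat Cs) \<Longrightarrow> (\<forall>C\<in>set Cs. C \<noteq> []) \<Longrightarrow> distinct Cs"
proof (induction Cs)
  case (Cons C Cs)
  have "C \<notin> set Cs"
  proof
    assume "C \<in> set Cs"
    hence "set C \<subseteq> set (concat Cs)" by auto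
    thus False using Cons.prems by (auto simp: Int_absorb2 inf_commute)
  qed
  thus ?case using Cons by auto
qed auto

text \<open>An arc meets at most two others, one starting at its head and one ending at its tail, so
  a greedy choice keeps a third of them. Disjointness is what the binomial counts require of
  pairs.\<close>

lemma sparse_matching:
  assumes "finite J" "inj_on fst J" "inj_on snd J" "\<And>a. a \<in> J \<Longrightarrow> fst a \<noteq> snd a"
  shows "\<exists>M\<subseteq>J. card J \<le> 3 * card M \<and> (\<forall>a\<in>M. \<forall>b\<in>M. a \<noteq> b \<longrightarrow> {fst a, snd a} \<inter> {fst b, snd b} = {})"
  using assms
proof (induction "card J" arbitrary: J rule: less_induct)
  case less
  show ?case
  proof (cases "J = {}")
    case False
    then obtain a where a: "a \<in> J" by auto
    let ?R1 = "{b \<in> J. fst b = snd a}" and ?R2 = "{b \<in> J. snd b = fst a}"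
    have "\<forall>x\<in>?R1. \<forall>y\<in>?R1. x = y" using inj_onD[OF less.prems(2)] by auto
    hence c1: "card ?R1 \<le> 1" using card_le_Suc0_iff_eq[of ?R1] less.prems(1) by simp
    have "\<forall>x\<in>?R2. \<forall>y\<in>?R2. x = y" using inj_onD[OF less.prems(3)] by auto
    hence c2: "card ?R2 \<le> 1" using card_le_Suc0_iff_eq[of ?R2] less.prems(1) by simp
    let ?J = "J - ({a} \<union> ?R1 \<union> ?R2)"
    have "card ?J < card J" using a less.prems(1) by (intro psubset_card_mono) auto
    moreover have "inj_on fst ?J" "inj_on snd ?J" using less.prems(2,3) by (auto intro: inj_on_subset)
    ultimately obtain M where M: "M \<subseteq> ?J" "card ?J \<le> 3 * card M"
      "\<forall>a\<in>M. \<forall>b\<in>M. a \<noteq> b \<longrightarrow> {fst a, snd a} \<inter> {fst b, snd b} = {}"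
      using less.hyps[of ?J] less.prems(1,4) by auto
    have finM: "finite M" using M(1) less.prems(1) by (meson Diff_subset finite_subset)
    have "card J \<le> card (?J \<union> ({a} \<union> ?R1 \<union> ?R2))" using less.prems(1) by (intro card_mono) auto
    also have "\<dots> \<le> card ?J + card ({a} \<union> ?R1 \<union> ?R2)" by (rule card_Un_le)
    also have "card ({a} \<union> ?R1 \<union> ?R2) \<le> card {a} + card ?R1 + card ?R2"
      using card_Un_le[of "{a} \<union> ?R1" ?R2] card_Un_le[of "{a}" ?R1] by linarith
    finally have "card J \<le> 3 * card M + 3" using M(2) c1 c2 by simp
    moreover have "a \<notin> M" using M(1) by auto
    hence "card (insert a M) = card M + 1" using finM by simp
    moreover have dis: "{fst a, snd a} \<inter> {fst b, snd b} = {}" if b: "b \<in> M" for b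
    proof -
      have bJ: "b \<in> J" "b \<noteq> a" "fst b \<noteq> snd a" "snd b \<noteq> fst a" using M(1) b by auto
      moreover have "fst b \<noteq> fst a" using inj_onD[OF less.prems(2), of b a] bJ a by auto
      moreover have "snd b \<noteq> snd a" using inj_onD[OF less.prems(3), of b a] bJ a by auto
      ultimately show ?thesis by auto
    qed
    have "\<forall>x\<in>insert a M. \<forall>y\<in>insert a M. x \<noteq> y \<longrightarrow> {fst x, snd x} \<inter> {fst y, snd y} = {}"
    proof (intro ballI impI)
      fix x y assume xy: "x \<in> insert a M" "y \<in> insert a M" "x \<noteq> y"
      show "{fst x, snd x} \<inter> {fst y, snd y} = {}"
      proof (cases "x = a")
        case True
        thus ?thesis using dis[of y] xy by auto
      next
        case False
        show ?thesis
        proof (cases "y = a")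
          case True
          thus ?thesis using dis[of x] xy False by (metis Int_commute insertE)
        next
          case ya: False
          thus ?thesis using M(3) xy False by blast
        qed
      qed
    qed
    ultimately show ?thesis using M(1) a by (intro exI[of _ "insert a M"]) auto
  qed auto
qed

text \<open>The directed edges of a cycle in cyclic order. They form a cycle themselves, under the
  relation that the head of one is the tail of the next, and into this cycle the connectors are
  substituted.\<close>

definition arcs :: "'a list \<Rightarrow> ('a \<times> 'a) list" where "arcs C = zip C (rotate1 C)"

lemma arcs_props:
  assumes "cyc R C" "3 \<le> length C"
  shows "distinct (arcs C)" "length (arcs C) = length C" "cyc (\<lambda>a b. snd a = fst b) (arcs C)"
    "set (map fst (arcs C)) = set C" "set (map snd (arcs C)) = set C" "inj_on fst (set (arcs C))" "inj_on snd (set (arcs C))"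
    "\<And>a. a \<in> set (arcs C) \<Longrightarrow> R (fst a) (snd a)"
proof -
  have d: "distinct C" "C \<noteq> []" using assms(1) unfolding cyc_def by auto
  show len: "length (arcs C) = length C" unfolding arcs_def by simp
  have m1: "map fst (arcs C) = C" unfolding arcs_def by simp
  have m2: "map snd (arcs C) = rotate1 C" unfolding arcs_def by simp
  show da: "distinct (arcs C)" unfolding arcs_def using d by (simp add: distinct_zipI1)
  show "set (map fst (arcs C)) = set C" unfolding m1 ..
  show "set (map snd (arcs C)) = set C" unfolding m2 by simp
  show "inj_on fst (set (arcs C))" using d m1 by (metis distinct_map)
  show "inj_on snd (set (arcs C))" using d m2 by (metis distinct_map distinct1_rotate)
  have nth: "arcs C ! i = (C ! i, C ! (Suc i mod length C))" if "i < length C" for i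
    unfolding arcs_def using that by (simp add: nth_rotate1)
  have all: "list_all2 R C (rotate1 C)" by (rule cyc_rotate[OF assms(1)]) (use assms(2) in auto)
  show "R (fst a) (snd a)" if "a \<in> set (arcs C)" for a
    using all that unfolding arcs_def list_all2_iff by auto
  have s: "successively (\<lambda>a b. snd a = fst b) (arcs C)"
    unfolding successively_conv_nth len using nth by (auto simp: mod_less)
  have "arcs C \<noteq> []" using len d by auto
  hence "last (arcs C) = arcs C ! (length C - 1)" "hd (arcs C) = arcs C ! 0"
    using len by (simp_all add: last_conv_nth hd_conv_nth)
  hence "snd (last (arcs C)) = fst (hd (arcs C))" using nth[of "length C - 1"] nth[of 0] d by auto
  thus "cyc (\<lambda>a b. snd a = fst b) (arcs C)" unfolding cyc_def using da s assms(2) len d by auto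
qed

section \<open>Edge-coloured graphs and their auxiliary graphs\<close>

locale edge_coloured =
  fixes n r :: nat and E :: "nat set set" and c :: "nat set \<Rightarrow> nat"
  assumes r2: "2 \<le> r" and E: "E \<subseteq> all_edges n" and col: "\<And>e. e \<in> E \<Longrightarrow> c e < r"
begin

definition K :: "nat \<Rightarrow> nat \<Rightarrow> nat \<Rightarrow> bool" where "K i u v \<longleftrightarrow> {u, v} \<in> E \<and> c {u, v} = i"

definition cn :: "nat set \<Rightarrow> nat set \<Rightarrow> nat set" where "cn W \<tau> = {w \<in> W. \<forall>x\<in>\<tau>. {w, x} \<in> E}"

lemma K_sym: "symp (K i)" unfolding K_def symp_def by (auto simp: insert_commute)

lemma edge_distinct: "{u, v} \<in> E \<Longrightarrow> u \<noteq> v" using E unfolding all_edges_def by auto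

lemma edge_vertices: "{u, v} \<in> E \<Longrightarrow> u < n \<and> v < n" using E unfolding all_edges_def by auto

lemma K_irr: "irreflp (K i)" unfolding K_def irreflp_def using edge_distinct by blast

lemma cnt_sum: "finite T \<Longrightarrow> finite W \<Longrightarrow> cnt E T W = (\<Sum>\<tau>\<in>T. card (cn W \<tau>))"
proof -
  assume fin: "finite T" "finite W"
  have "{(\<tau>, w). \<tau> \<in> T \<and> w \<in> W \<and> (\<forall>x\<in>\<tau>. {w, x} \<in> E)} = (SIGMA \<tau>:T. cn W \<tau>)" unfolding cn_def by auto
  moreover have "\<forall>\<tau>\<in>T. finite (cn W \<tau>)" using fin unfolding cn_def by auto
  ultimately show ?thesis unfolding cnt_def using card_SigmaI[OF fin(1)] by simp
qed

definition cc :: "nat list \<Rightarrow> bool" where "cc C \<longleftrightarrow> (\<exists>i<r. cyc (K i) C)"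

lemma cc_mono_cycle: assumes "cc C" shows "mono_cycle E c C"
proof -
  obtain i where i: "cyc (K i) C" using assms unfolding cc_def by auto
  show ?thesis
  proof (cases "length C = 1")
    case True
    thus ?thesis using i unfolding cyc_def mono_cycle_def by auto
  next
    case False
    hence l: "3 \<le> length C" using i unfolding cyc_def by auto
    have "list_all2 (K i) C (rotate1 C)" by (rule cyc_rotate[OF i False])
    hence "K i (C ! j) (C ! (Suc j mod length C))" if "j < length C" for j
      using that by (auto simp: list_all2_conv_all_nth nth_rotate1)
    hence "\<forall>j<length C. {C ! j, C ! ((j + 1) mod length C)} \<in> E \<and> c {C ! j, C ! ((j + 1) mod length C)} = i"
      unfolding K_def by simp
    thus ?thesis using i l unfolding cyc_def mono_cycle_def by blast
  qed
qed

lemma cc_singleton: "cc [v]" unfolding cc_def using r2 by (intro exI[of _ 0]) (simp add: cyc_singleton)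

lemma partition_property:
  assumes "\<forall>C\<in>set Cs. cc C" "distinct (concat Cs)" "set (concat Cs) = {0..<n}" "real (length Cs) \<le> B"
  shows "\<exists>Cs. (\<forall>vs\<in>set Cs. mono_cycle E c vs) \<and>
      (\<forall>i<length Cs. \<forall>j<length Cs. i \<noteq> j \<longrightarrow> set (Cs ! i) \<inter> set (Cs ! j) = {}) \<and>
      (\<Union>vs\<in>set Cs. set vs) = {0..<n} \<and> real (length Cs) \<le> B"
  using assms cc_mono_cycle distinct_concat_disjoint[OF assms(2)] by (intro exI[of _ Cs]) auto

text \<open>The bound for graphs of independence number \<open>r\<close>. Since
  \<open>\<Phi>\<close> depends only on \<open>r\<close>, it is available without choosing an
  auxiliary graph.\<close>

definition F :: real where "F = r * coloured_graph.\<Phi> r"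

text \<open>Each of the \<open>h\<close> common neighbours of \<open>r + 1\<close> vertices sends
  them \<open>r + 1\<close> edges in \<open>r\<close> colours and thus joins some two of them in one
  colour; as \<open>s * r * (r + 1)^2 \<le> h\<close>, some pair obtains \<open>s\<close> connectors
  of one colour. So the auxiliary graph has independence number at most \<open>r\<close>. Connectors
  for all arcs of all auxiliary cycles are chosen simultaneously by Hall's theorem. Were its
  condition violated, disjoint pairs would have \<open>s\<close> common neighbours each in a set of
  at most three times as many vertices, against \<open>few\<close>.\<close>

lemma dense_cover:
  fixes s h :: real
  assumes X: "X \<subseteq> {0..<n}" and W: "W \<subseteq> {0..<n}" "X \<inter> W = {}"
    and cod: "\<And>\<tau>. \<tau> \<subseteq> X \<Longrightarrow> card \<tau> = r + 1 \<Longrightarrow> h \<le> card (cn W \<tau>)"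
    and few: "\<And>T U. family n 2 T U \<Longrightarrow> \<Union>T \<subseteq> X \<Longrightarrow> U \<subseteq> W \<Longrightarrow> T \<noteq> {} \<Longrightarrow> card U \<le> 3 * card T \<Longrightarrow> cnt E T U < s * card T"
    and s: "s * (r * (r + 1)\<^sup>2) \<le> h"
  shows "\<exists>Cs. (\<forall>C\<in>set Cs. cc C) \<and> distinct (concat Cs) \<and> X \<subseteq> set (concat Cs) \<and> set (concat Cs) \<subseteq> X \<union> W \<and> length Cs \<le> F"
proof -
  have finX: "finite X" and finW: "finite W" using finite_subset[OF X] finite_subset[OF W(1)] by auto
  define N where "N i u v = {w \<in> W. K i u w \<and> K i v w}" for i u v
  define A where "A i u v \<longleftrightarrow> u \<in> X \<and> v \<in> X \<and> u \<noteq> v \<and> s \<le> card (N i u v)" for i u v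
  interpret A: coloured_graph A r
    by unfold_locales (auto simp: r2 A_def N_def symp_def irreflp_def conj_commute)
  have "A.indep_le X r"
    unfolding A.indep_le_def
  proof (intro allI impI)
    fix I assume I: "I \<subseteq> X" "\<forall>u\<in>I. \<forall>v\<in>I. u \<noteq> v \<longrightarrow> \<not> A.adj u v"
    show "card I \<le> r"
    proof (rule ccontr)
      assume "\<not> card I \<le> r"
      hence "r + 1 \<le> card I" by simp
      then obtain \<tau> where \<tau>: "\<tau> \<subseteq> I" "card \<tau> = r + 1" using obtain_subset_with_card_n by metis
      have fin\<tau>: "finite \<tau>" using \<tau>(2) by (metis add_gr_0 card_ge_0_finite zero_less_one)
      let ?P = "{(x, y). x \<in> \<tau> \<and> y \<in> \<tau> \<and> x \<noteq> y}"
      have finP: "finite ?P" using fin\<tau> by (auto intro: finite_subset[of _ "\<tau> \<times> \<tau>"])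
      have "cn W \<tau> \<subseteq> (\<Union>(x, y)\<in>?P. \<Union>i<r. N i x y)"
      proof
        fix w assume w: "w \<in> cn W \<tau>"
        have e: "{w, x} \<in> E" if "x \<in> \<tau>" for x using w that unfolding cn_def by auto
        have "card ((\<lambda>x. c {w, x}) ` \<tau>) \<le> card {..<r}" using e col by (intro card_mono) auto
        hence "\<not> inj_on (\<lambda>x. c {w, x}) \<tau>" using \<tau>(2) card_image by fastforce
        then obtain x y where xy: "x \<in> \<tau>" "y \<in> \<tau>" "x \<noteq> y" "c {w, x} = c {w, y}" unfolding inj_on_def by blast
        have "w \<in> N (c {w, x}) x y" using w e[OF xy(1)] e[OF xy(2)] xy(4) unfolding N_def K_def cn_def
          by (auto simp: insert_commute)
        moreover have "c {w, x} < r" using col e xy by auto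
        ultimately show "w \<in> (\<Union>(x, y)\<in>?P. \<Union>i<r. N i x y)" using xy by blast
      qed
      moreover have finN: "finite (N i x y)" for i x y unfolding N_def using finW by auto
      ultimately have "card (cn W \<tau>) \<le> card (\<Union>(x, y)\<in>?P. \<Union>i<r. N i x y)"
        using finP by (intro card_mono) auto
      also have "\<dots> \<le> (\<Sum>a\<in>?P. card (case a of (x, y) \<Rightarrow> \<Union>i<r. N i x y))" by (rule card_UN_le[OF finP])
      also have "\<dots> \<le> (\<Sum>a\<in>?P. \<Sum>i<r. card (case a of (x, y) \<Rightarrow> N i x y))"
        by (intro sum_mono) (auto intro: card_UN_le)
      finally have "real (card (cn W \<tau>)) \<le> (\<Sum>a\<in>?P. \<Sum>i<r. real (card (case a of (x, y) \<Rightarrow> N i x y)))"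
        by (metis (mono_tags, lifting) of_nat_mono of_nat_sum sum.cong)
      also have "\<dots> < (\<Sum>a\<in>?P. \<Sum>i<r. s)"
      proof (rule sum_strict_mono[OF finP])
        have "2 \<le> card \<tau>" using \<tau>(2) r2 by simp
        then obtain x y where "x \<in> \<tau>" "y \<in> \<tau>" "x \<noteq> y"
          by (metis card_2_iff' card_le_Suc0_iff_eq fin\<tau> not_less_eq_eq numeral_2_eq_2)
        thus "?P \<noteq> {}" by auto
        fix a assume "a \<in> ?P"
        then obtain x y where a: "a = (x, y)" "x \<in> \<tau>" "y \<in> \<tau>" "x \<noteq> y" by auto
        have "\<not> A.adj x y" using I(2) a \<tau>(1) by blast
        hence "real (card (N i x y)) < s" if "i < r" for i
          using that a \<tau>(1) I(1) unfolding A.adj_def A_def by (meson not_le subsetD)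
        thus "(\<Sum>i<r. real (card (case a of (x, y) \<Rightarrow> N i x y))) < (\<Sum>i<r. s)"
          unfolding a(1) using r2 by (intro sum_strict_mono) (auto simp: a(1) lessThan_empty_iff)
      qed
      also have "\<dots> = real (card ?P) * (r * s)" by simp
      finally have less: "real (card (cn W \<tau>)) < real (card ?P) * (r * s)" .
      have spos: "0 < s"
      proof (rule ccontr)
        assume "\<not> 0 < s"
        hence "real (card ?P) * (r * s) \<le> 0" by (simp add: mult_nonneg_nonpos)
        thus False using less by linarith
      qed
      have "card ?P \<le> card (\<tau> \<times> \<tau>)" using fin\<tau> by (intro card_mono) auto
      hence "card ?P \<le> (r + 1)\<^sup>2" using \<tau>(2) by (simp add: card_cartesian_product power2_eq_square)
      hence "real (card ?P) \<le> real ((r + 1)\<^sup>2)" by (rule of_nat_mono)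
      hence "real (card ?P) * (r * s) \<le> real ((r + 1)\<^sup>2) * (r * s)" using spos by (intro mult_right_mono) auto
      also have "\<dots> \<le> h" using s by (simp add: mult_ac)
      also have "\<dots> \<le> card (cn W \<tau>)" by (rule cod) (use \<tau> I(1) in auto)
      finally show False using less by linarith
    qed
  qed
  then obtain Cs where Cs: "\<forall>C\<in>set Cs. A.mono_cyc C" "distinct (concat Cs)" "set (concat Cs) = X" "length Cs \<le> r * A.\<Phi>"
    using A.dense_partition[OF finX _ order_refl] by blast
  have "\<forall>C. \<exists>i. C \<in> set Cs \<longrightarrow> i < r \<and> cyc (A i) C" using Cs(1) unfolding A.mono_cyc_def by blast
  then obtain co where co: "\<And>C. C \<in> set Cs \<Longrightarrow> co C < r \<and> cyc (A (co C)) C" by metis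
  have ne: "\<forall>C\<in>set Cs. C \<noteq> []" using co unfolding cyc_def by auto
  have dCs: "distinct Cs" by (rule distinct_outer[OF Cs(2) ne])
  have disC: "set C \<inter> set D = {}" if CD: "C \<in> set Cs" "D \<in> set Cs" "C \<noteq> D" for C D
  proof -
    obtain i j where "i < length Cs" "j < length Cs" "C = Cs ! i" "D = Cs ! j" using CD by (metis in_set_conv_nth)
    thus ?thesis using distinct_concat_disjoint[OF Cs(2), of i j] CD(3) by auto
  qed
  define L where "L = {C \<in> set Cs. 3 \<le> length C}"
  define I where "I = (\<Union>C\<in>L. set (arcs C))"
  have finI: "finite I" unfolding I_def L_def by auto
  have arcC: "fst a \<in> set C" "snd a \<in> set C" "A (co C) (fst a) (snd a)" if "C \<in> L" "a \<in> set (arcs C)" for C a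
    using arcs_props(4,5,8)[of "A (co C)" C] that co unfolding L_def by auto
  have sameC: "C = D" if "C \<in> L" "D \<in> L" "a \<in> set (arcs C)" "b \<in> set (arcs D)" "{fst a, snd a} \<inter> {fst b, snd b} \<noteq> {}" for C D a b
  proof (rule ccontr)
    assume "C \<noteq> D"
    hence "set C \<inter> set D = {}" using disC[of C D] that(1,2) unfolding L_def by auto
    moreover have "{fst a, snd a} \<subseteq> set C" "{fst b, snd b} \<subseteq> set D"
      using arcC[OF that(1,3)] arcC[OF that(2,4)] by auto
    ultimately show False using that(5) by auto
  qed
  have injf: "inj_on fst I"
  proof (rule inj_onI)
    fix a b assume ab: "a \<in> I" "b \<in> I" "fst a = fst b"
    then obtain C D where CD: "C \<in> L" "a \<in> set (arcs C)" "D \<in> L" "b \<in> set (arcs D)" unfolding I_def by auto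
    have "C = D" by (rule sameC[OF CD(1,3,2,4)]) (use ab in auto)
    thus "a = b" using arcs_props(6)[of "A (co C)" C] CD co ab(3) unfolding L_def by (auto dest: inj_onD)
  qed
  have injs: "inj_on snd I"
  proof (rule inj_onI)
    fix a b assume ab: "a \<in> I" "b \<in> I" "snd a = snd b"
    then obtain C D where CD: "C \<in> L" "a \<in> set (arcs C)" "D \<in> L" "b \<in> set (arcs D)" unfolding I_def by auto
    have "C = D" by (rule sameC[OF CD(1,3,2,4)]) (use ab in auto)
    thus "a = b" using arcs_props(7)[of "A (co C)" C] CD co ab(3) unfolding L_def by (auto dest: inj_onD)
  qed
  \<comment> \<open>The auxiliary cycles are vertex-disjoint, so an arc lies on only one of them and
    the choice of \<open>D\<close> is immaterial: \<open>ac\<close> is its colour.\<close>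
  define ac where "ac a = co (SOME D. D \<in> L \<and> a \<in> set (arcs D))" for a
  have ac: "ac a = co C" if C: "C \<in> L" "a \<in> set (arcs C)" for a C
  proof -
    let ?D = "SOME D. D \<in> L \<and> a \<in> set (arcs D)"
    have D: "?D \<in> L \<and> a \<in> set (arcs ?D)" by (rule someI[of _ C]) (use C in simp)
    have "?D = C" by (rule sameC[of ?D C a a]) (use C D in auto)
    thus ?thesis unfolding ac_def by simp
  qed
  define N' where "N' a = N (ac a) (fst a) (snd a)" for a
  have N': "s \<le> card (N' a)" "fst a \<in> X" "snd a \<in> X" "fst a \<noteq> snd a" if "a \<in> I" for a
  proof -
    obtain C where C: "C \<in> L" "a \<in> set (arcs C)" using \<open>a \<in> I\<close> unfolding I_def by auto
    show "s \<le> card (N' a)" "fst a \<in> X" "snd a \<in> X" "fst a \<noteq> snd a"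
      using arcC(3)[OF C] ac[OF C] unfolding N'_def A_def by auto
  qed
  have finN': "finite (N' a)" "N' a \<subseteq> W" for a unfolding N'_def N_def using finW by auto
  obtain f where f: "inj_on f I" "\<forall>a\<in>I. f a \<in> N' a"
  proof -
    have "\<exists>f. inj_on f I \<and> (\<forall>a\<in>I. f a \<in> N' a)"
    proof (rule hall[OF finI finN'(1)])
      fix J assume J: "J \<subseteq> I"
      show "card J \<le> card (\<Union>a\<in>J. N' a)"
      proof (rule ccontr)
        assume neg: "\<not> ?thesis"
        let ?U = "\<Union>a\<in>J. N' a"
        have finJ: "finite J" using J finI finite_subset by blast
        \<comment> \<open>Fewer than \<open>card J\<close> connectors face at least
          \<open>card J / 3\<close> disjoint pairs, whence the ratio 3 in
          \<open>few\<close>.\<close>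
        obtain M where M: "M \<subseteq> J" "card J \<le> 3 * card M" "\<forall>a\<in>M. \<forall>b\<in>M. a \<noteq> b \<longrightarrow> {fst a, snd a} \<inter> {fst b, snd b} = {}"
          using sparse_matching[OF finJ inj_on_subset[OF injf J] inj_on_subset[OF injs J]] N'(4) J by blast
        have finM: "finite M" using M(1) finJ finite_subset by blast
        have Mne: "M \<noteq> {}" using M(2) neg by auto
        let ?e = "\<lambda>a. {fst a, snd a}"
        have MI: "M \<subseteq> I" using M(1) J by auto
        have inje: "inj_on ?e M"
        proof (rule inj_onI)
          fix a b assume ab: "a \<in> M" "b \<in> M" "?e a = ?e b"
          show "a = b"
          proof (rule ccontr)
            assume "a \<noteq> b"
            hence "?e a \<inter> ?e b = {}" using M(3) ab by blast
            thus False using ab(3) by auto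
          qed
        qed
        have UW: "?U \<subseteq> W" using finN'(2) by auto
        have fam: "family n 2 (?e ` M) ?U"
          unfolding family_def
        proof (intro conjI ballI)
          fix \<tau> assume "\<tau> \<in> ?e ` M"
          then obtain a where a: "a \<in> M" "\<tau> = ?e a" by auto
          have aI: "a \<in> I" using a MI by auto
          have "\<tau> \<subseteq> X" using N'(2,3)[OF aI] a(2) by auto
          thus "\<tau> \<subseteq> {0..<n}" using X by simp
          show "card \<tau> = 2" using N'(4)[OF aI] a(2) by simp
        next
          show "pairwise disjnt (?e ` M)" unfolding pairwise_def disjnt_def
          proof (intro ballI impI)
            fix S T assume ST: "S \<in> ?e ` M" "T \<in> ?e ` M" "S \<noteq> T"
            then obtain a b where ab: "a \<in> M" "b \<in> M" "S = ?e a" "T = ?e b" by auto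
            hence "a \<noteq> b" using ST(3) by auto
            thus "S \<inter> T = {}" using M(3) ab by simp
          qed
        next
          have "\<Union> (?e ` M) \<subseteq> X" using N'(2,3) MI by auto
          thus "\<Union> (?e ` M) \<inter> ?U = {}" using UW W(2) by auto
        qed (use UW W in auto)
        have cT: "card (?e ` M) = card M" by (rule card_image[OF inje])
        have "cnt E (?e ` M) ?U < s * card (?e ` M)"
          by (rule few[OF fam]) (use N'(2,3) MI UW Mne neg M(2) cT in auto)
        moreover have "s * card M \<le> cnt E (?e ` M) ?U"
        proof -
          have "s * card M = (\<Sum>a\<in>M. s)" by simp
          also have "\<dots> \<le> (\<Sum>a\<in>M. real (card (cn ?U (?e a))))"
          proof (rule sum_mono)
            fix a assume a: "a \<in> M"
            have "N' a \<subseteq> cn ?U (?e a)"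
              using a M(1) unfolding cn_def N'_def N_def K_def by (auto simp: insert_commute)
            hence "card (N' a) \<le> card (cn ?U (?e a))"
              by (rule card_mono[rotated]) (rule finite_subset[OF _ finite_subset[OF UW finW]], auto simp: cn_def)
            thus "s \<le> real (card (cn ?U (?e a)))" using N'(1)[of a] a MI by fastforce
          qed
          also have "\<dots> = real (\<Sum>\<tau>\<in>?e ` M. card (cn ?U \<tau>))" by (simp add: sum.reindex[OF inje])
          also have "\<dots> = cnt E (?e ` M) ?U"
            using cnt_sum[of "?e ` M" ?U] finM finite_subset[OF UW finW] by simp
          finally show ?thesis .
        qed
        ultimately show False unfolding cT by linarith
      qed
    qed
    thus ?thesis using that by blast
  qed
  have fW: "f a \<in> W" "f a \<notin> X" if "a \<in> I" for a using f(2) finN'(2) that W(2) by blast+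
  define G where "G C = (if 3 \<le> length C then concat (map (\<lambda>a. [fst a, f a]) (arcs C)) else C)" for C
  have IL: "a \<in> I" if "C \<in> L" "a \<in> set (arcs C)" for C a using that unfolding I_def by auto
  have Gset: "set (G C) = set C \<union> (if 3 \<le> length C then f ` set (arcs C) else {})" if C: "C \<in> set Cs" for C
  proof (cases "3 \<le> length C")
    case True
    have "set C = fst ` set (arcs C)" using arcs_props(4)[of "A (co C)" C] co[OF C] True by simp
    thus ?thesis unfolding G_def using True by auto
  qed (simp add: G_def)
  have Gcyc: "cc (G C)" if C: "C \<in> set Cs" for C
  proof (cases "3 \<le> length C")
    case False
    hence "length C = 1" using co[OF C] unfolding cyc_def by auto
    then obtain v where "C = [v]" by (metis One_nat_def length_0_conv length_Suc_conv)
    thus ?thesis unfolding G_def by (simp add: cc_singleton)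
  next
    case True
    have CL: "C \<in> L" using C True unfolding L_def by auto
    have cy: "cyc (A (co C)) C" using co[OF C] by auto
    have fK: "K (co C) (fst a) (f a) \<and> K (co C) (snd a) (f a)" if "a \<in> set (arcs C)" for a
      using f(2) IL[OF CL that] ac[OF CL that] unfolding N'_def N_def by auto
    have "cyc (K (co C)) (concat (map (\<lambda>a. [fst a, f a]) (arcs C)))"
    proof (rule cyc_concat_map[OF arcs_props(3)[OF cy True]])
      show "3 \<le> length (arcs C)" using arcs_props(2)[OF cy True] True by simp
    next
      fix a assume a: "a \<in> set (arcs C)"
      have "fst a \<noteq> f a" using fW[OF IL[OF CL a]] N'(2)[OF IL[OF CL a]] by auto
      thus "[fst a, f a] \<noteq> [] \<and> distinct [fst a, f a] \<and> successively (K (co C)) [fst a, f a]" using fK[OF a] by simp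
    next
      fix a b assume ab: "a \<in> set (arcs C)" "b \<in> set (arcs C)" "a \<noteq> b"
      have i: "a \<in> I" "b \<in> I" using IL CL ab by auto
      have "fst a \<noteq> fst b" "f a \<noteq> f b" using inj_onD[OF injf _ i] inj_onD[OF f(1) _ i] ab(3) by auto
      moreover have "fst a \<noteq> f b" "fst b \<noteq> f a" using fW(2)[OF i(1)] fW(2)[OF i(2)] N'(2)[OF i(1)] N'(2)[OF i(2)] by auto
      ultimately show "set [fst a, f a] \<inter> set [fst b, f b] = {}" by auto
    next
      fix a b assume ab: "a \<in> set (arcs C)" "b \<in> set (arcs C)" "snd a = fst b"
      have "K (co C) (f a) (fst b)" using fK[OF ab(1)] ab(3) K_sym by (auto dest: sympD)
      thus "K (co C) (last [fst a, f a]) (hd [fst b, f b])" by simp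
    qed
    thus ?thesis unfolding cc_def G_def using True co[OF C] by auto
  qed
  have dG: "distinct (concat (map G Cs))"
  proof (rule distinct_concat_map[OF dCs])
    fix C assume "C \<in> set Cs"
    thus "distinct (G C)" using Gcyc unfolding cc_def cyc_def by blast
  next
    fix C D assume CD: "C \<in> set Cs" "D \<in> set Cs" "C \<noteq> D"
    have XC: "set C \<subseteq> X" "set D \<subseteq> X" using Cs(3) CD by auto
    have ff: "f a \<noteq> f b" if "C \<in> L" "D \<in> L" "a \<in> set (arcs C)" "b \<in> set (arcs D)" for a b
    proof
      assume "f a = f b"
      hence "a = b" using inj_onD[OF f(1) _ IL[OF that(1,3)] IL[OF that(2,4)]] by simp
      hence "C = D" using sameC[OF that] by auto
      thus False using CD by simp
    qed
    have fX: "f a \<notin> X" if "C' \<in> L" "a \<in> set (arcs C')" for a C' using fW(2) IL that by blast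
    have LC: "C \<in> L" if "3 \<le> length C" using that CD unfolding L_def by auto
    have LD: "D \<in> L" if "3 \<le> length D" using that CD unfolding L_def by auto
    show "set (G C) \<inter> set (G D) = {}"
      unfolding Gset[OF CD(1)] Gset[OF CD(2)] using disC[OF CD] XC ff fX LC LD by (auto split: if_splits)
  qed
  have "X \<subseteq> set (concat (map G Cs))"
  proof -
    have "set C \<subseteq> set (G C)" if "C \<in> set Cs" for C using Gset[OF that] by auto
    thus ?thesis using Cs(3) by fastforce
  qed
  moreover have "set (concat (map G Cs)) \<subseteq> X \<union> W"
  proof -
    have "set (G C) \<subseteq> X \<union> W" if "C \<in> set Cs" for C
    proof -
      have "f a \<in> W" if "3 \<le> length C" "a \<in> set (arcs C)" for a
        using fW(1)[OF IL[of C a]] that \<open>C \<in> set Cs\<close> unfolding L_def by auto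
      moreover have "set C \<subseteq> X" using Cs(3) that by auto
      ultimately show ?thesis using Gset[OF that] by (auto split: if_splits)
    qed
    thus ?thesis by auto
  qed
  moreover have "\<forall>C\<in>set (map G Cs). cc C" using Gcyc by auto
  moreover have "real (length (map G Cs)) \<le> F" using Cs(4) unfolding F_def by simp
  ultimately show ?thesis using dG by blast
qed

end

text \<open>Used to remove all defective sets of size \<open>k\<close> at the cost of the vertices
  of a few disjoint ones: a set avoiding the union of the family is not defective.\<close>

lemma maximal_disjoint_family:
  assumes "finite S" "1 \<le> k"
  shows "\<exists>T. (\<forall>\<tau>\<in>T. \<tau> \<subseteq> S \<and> card \<tau> = k \<and> Q \<tau>) \<and> pairwise disjnt T \<and>
    (\<forall>\<tau>. \<tau> \<subseteq> S \<longrightarrow> card \<tau> = k \<longrightarrow> Q \<tau> \<longrightarrow> \<tau> \<inter> \<Union>T \<noteq> {})"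
proof -
  define P where "P T \<longleftrightarrow> (\<forall>\<tau>\<in>T. \<tau> \<subseteq> S \<and> card \<tau> = k \<and> Q \<tau>) \<and> pairwise disjnt T" for T
  have sub: "T \<subseteq> Pow S" if "P T" for T using that unfolding P_def by auto
  have "P {}" unfolding P_def by auto
  moreover have "\<forall>T. P T \<longrightarrow> card T < Suc (card (Pow S))"
    using sub assms(1) by (auto intro!: le_imp_less_Suc card_mono)
  ultimately have "\<exists>T. P T \<and> (\<forall>U. P U \<longrightarrow> card U \<le> card T)"
    by (rule ex_has_greatest_nat[of P "{}" card "Suc (card (Pow S))"])
  then obtain T where T: "P T" "\<And>U. P U \<Longrightarrow> card U \<le> card T" by blast
  have finT: "finite T" using sub[OF T(1)] assms(1) by (meson finite_Pow_iff finite_subset)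
  have "\<tau> \<inter> \<Union>T \<noteq> {}" if \<tau>: "\<tau> \<subseteq> S" "card \<tau> = k" "Q \<tau>" for \<tau>
  proof
    assume dis: "\<tau> \<inter> \<Union>T = {}"
    have ne: "\<tau> \<noteq> {}" using \<tau>(2) assms(2) by auto
    have nT: "\<tau> \<notin> T" using dis ne by auto
    have "disjnt \<tau> \<sigma>" if "\<sigma> \<in> T" for \<sigma> using dis that unfolding disjnt_def by auto
    hence "P (insert \<tau> T)" using T(1) \<tau> unfolding P_def by (auto simp: pairwise_insert disjnt_sym)
    hence "card (insert \<tau> T) \<le> card T" by (rule T(2))
    thus False using nT finT by simp
  qed
  thus ?thesis using T(1) unfolding P_def by blast
qed

context edge_coloured
begin

lemma cn_split: "finite W \<Longrightarrow> card (cn W \<tau>) \<le> card (cn (W \<inter> U) \<tau>) + card (cn (W - U) \<tau>)"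
proof -
  assume fin: "finite W"
  have "cn W \<tau> = cn (W \<inter> U) \<tau> \<union> cn (W - U) \<tau>" unfolding cn_def by auto
  thus ?thesis by (metis card_Un_le)
qed

text \<open>The sets \<open>W j\<close> lose at most half of each codegree by removing \<open>x\<close>, except for a family of tuples in \<open>y\<close>
  that is smaller than \<open>x\<close> by the factor \<open>\<sigma>\<close>; this family takes the role of \<open>x\<close> at level \<open>j - 1\<close>.\<close>

lemma nested_cover:
  fixes W P :: "nat \<Rightarrow> nat set" and \<sigma> h s q :: real
  assumes P: "\<And>j. P j \<inter> P (Suc j) = {}" "\<And>j. P (Suc (Suc j)) = P j" "\<And>j. P j \<subseteq> {0..<n}"
    and W: "\<And>j. W j \<subseteq> P j" "\<And>i j. i \<le> J \<Longrightarrow> j \<le> J \<Longrightarrow> i \<noteq> j \<Longrightarrow> W i \<inter> W j = {}"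
    and cod: "\<And>j \<tau>. j \<le> J \<Longrightarrow> \<tau> \<subseteq> P (Suc j) \<Longrightarrow> card \<tau> = r + 1 \<Longrightarrow> h \<le> card (cn (W j) \<tau>)"
    and heavy: "\<And>T U. family n (r + 1) T U \<Longrightarrow> T \<noteq> {} \<Longrightarrow> card U \<le> \<sigma> * (r + 1) * card T \<Longrightarrow> card U \<le> q \<Longrightarrow>
        cnt E T U < h / 2 * card T"
    and few: "\<And>T U. family n 2 T U \<Longrightarrow> T \<noteq> {} \<Longrightarrow> card U \<le> 3 * card T \<Longrightarrow> card U \<le> 3 * q \<Longrightarrow> cnt E T U < s * card T"
    and s: "s * (r * (r + 1)\<^sup>2) \<le> h / 2" and \<sigma>: "0 < \<sigma>" and h: "0 \<le> h"
  shows "\<lbrakk>j \<le> J; x \<subseteq> P j; y \<subseteq> P (Suc j); card x < \<sigma> ^ j; card x \<le> q; card y \<le> q\<rbrakk> \<Longrightarrow>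
    \<exists>Cs. (\<forall>C\<in>set Cs. cc C) \<and> distinct (concat Cs) \<and> x \<union> y \<subseteq> set (concat Cs) \<and>
      set (concat Cs) \<subseteq> x \<union> y \<union> (\<Union>i\<le>j. W i) \<and> length Cs \<le> (j + 1) * F"
proof (induction j arbitrary: x y)
  have finP: "finite A" if "A \<subseteq> P j" for A j
    using finite_subset[of A "{0..<n}"] that P(3)[of j] by auto
  have dense: "\<exists>Cs. (\<forall>C\<in>set Cs. cc C) \<and> distinct (concat Cs) \<and> X \<subseteq> set (concat Cs) \<and>
      set (concat Cs) \<subseteq> X \<union> U \<and> length Cs \<le> F"
    if X: "X \<subseteq> P (Suc j)" "card X \<le> q" "U \<subseteq> P j"
      "\<And>\<tau>. \<tau> \<subseteq> X \<Longrightarrow> card \<tau> = r + 1 \<Longrightarrow> h / 2 \<le> card (cn U \<tau>)" for X U j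
  proof (rule dense_cover[OF _ _ _ X(4) _ s])
    show "X \<subseteq> {0..<n}" "U \<subseteq> {0..<n}" "X \<inter> U = {}" using X(1,3) P(1)[of j] P(3)[of j] P(3)[of "Suc j"] by blast+
    fix T U' assume T: "family n 2 T U'" "\<Union>T \<subseteq> X" "U' \<subseteq> U" "T \<noteq> {}" "card U' \<le> 3 * card T"
    have finX: "finite X" by (rule finP[OF X(1)])
    have "2 * card T \<le> card X" using family_card_Union[OF T(1)] card_mono[OF finX T(2)] by simp
    hence "real (card T) \<le> q" using X(2) by linarith
    thus "cnt E T U' < s * card T" using few[OF T(1,4,5)] T(5) by linarith
  qed
  {
    case 0
    \<comment> \<open>\<open>card x < \<sigma> ^ 0\<close>, so at the lowest level nothing blocks
      the connectors.\<close>
    have x: "x = {}" using 0(4) finP[OF 0(2)] by simp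
    have "\<exists>Cs. (\<forall>C\<in>set Cs. cc C) \<and> distinct (concat Cs) \<and> y \<subseteq> set (concat Cs) \<and>
      set (concat Cs) \<subseteq> y \<union> W 0 \<and> length Cs \<le> F"
    proof (rule dense[of y 0 "W 0"])
      fix \<tau> assume \<tau>: "\<tau> \<subseteq> y" "card \<tau> = r + 1"
      have "h \<le> card (cn (W 0) \<tau>)" by (rule cod) (use \<tau> 0 in auto)
      thus "h / 2 \<le> card (cn (W 0) \<tau>)" using h by linarith
    qed (use 0 W in auto)
    thus ?case using x by auto
  next
    case (Suc j)
    have fin: "finite x" "finite y" by (rule finP[OF Suc.prems(2)], rule finP[OF Suc.prems(3)])
    let ?W = "W (Suc j)"
    have finW: "finite ?W" by (rule finP[OF W(1)])
    define U where "U = ?W \<inter> x"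
    define H where "H \<tau> \<longleftrightarrow> h / 2 \<le> real (card (cn U \<tau>))" for \<tau>
    obtain T where T: "\<forall>\<tau>\<in>T. \<tau> \<subseteq> y \<and> card \<tau> = r + 1 \<and> H \<tau>" "pairwise disjnt T"
      "\<forall>\<tau>. \<tau> \<subseteq> y \<longrightarrow> card \<tau> = r + 1 \<longrightarrow> H \<tau> \<longrightarrow> \<tau> \<inter> \<Union>T \<noteq> {}"
      using maximal_disjoint_family[OF fin(2), of "r + 1" H] by auto
    define y' where "y' = \<Union>T"
    have y'y: "y' \<subseteq> y" unfolding y'_def using T(1) by auto
    have yP: "y \<subseteq> P j" using Suc.prems(3) P(2) by auto
    have finU: "finite U" unfolding U_def using fin by auto
    have fam: "family n (r + 1) T U"
      unfolding family_def
    proof (intro conjI ballI)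
      fix \<tau> assume "\<tau> \<in> T"
      thus "\<tau> \<subseteq> {0..<n}" "card \<tau> = r + 1" using T(1) yP P(3)[of j] by blast+
    next
      show "U \<subseteq> {0..<n}" unfolding U_def using Suc.prems(2) P(3)[of "Suc j"] by blast
      show "\<Union>T \<inter> U = {}" using y'y yP Suc.prems(2) P(1)[of j] unfolding y'_def U_def by blast
    qed (rule T(2))
    have cy': "card y' = (r + 1) * card T" unfolding y'_def by (rule family_card_Union[OF fam])
    have "card U \<le> card x" unfolding U_def using fin by (intro card_mono) auto
    hence cU: "real (card U) \<le> card x" by simp
    have small: "card y' < \<sigma> ^ j"
    proof (cases "T = {}")
      case True
      thus ?thesis using cy' \<sigma> by simp
    next
      case False
      have finT: "finite T" using family_finite[OF fam] by simp
      have "h / 2 * card T = (\<Sum>\<tau>\<in>T. h / 2)" by simp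
      also have "\<dots> \<le> (\<Sum>\<tau>\<in>T. real (card (cn U \<tau>)))" using T(1) unfolding H_def by (intro sum_mono) auto
      also have "\<dots> = cnt E T U" using cnt_sum[OF finT finU] by simp
      \<comment> \<open>This is where the factor \<open>\<sigma>\<close> is gained: by
        \<open>heavy\<close>, a set \<open>U\<close> giving \<open>h / 2\<close> connectors to each
        tuple of \<open>T\<close> must have more than \<open>\<sigma> * (r + 1)\<close> vertices per
        tuple.\<close>
      finally have "\<not> real (card U) \<le> \<sigma> * (r + 1) * card T"
        using heavy[OF fam False] cU Suc.prems(5) by linarith
      hence "\<sigma> * real ((r + 1) * card T) < \<sigma> * \<sigma> ^ j"
        using cU Suc.prems(4) by (simp add: algebra_simps)
      thus ?thesis unfolding cy' using \<sigma> by simp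
    qed
    have "card y' \<le> card y" using y'y fin by (intro card_mono)
    hence cy'q: "card y' \<le> q" using Suc.prems(6) by linarith
    \<comment> \<open>The two sides exchange their roles: \<open>y'\<close> lies in
      \<open>P j\<close>, and \<open>x\<close> in \<open>P (Suc j)\<close> is now the set to be
      connected through \<open>W j\<close>.\<close>
    have "\<exists>Cs. (\<forall>C\<in>set Cs. cc C) \<and> distinct (concat Cs) \<and> y' \<union> x \<subseteq> set (concat Cs) \<and>
      set (concat Cs) \<subseteq> y' \<union> x \<union> (\<Union>i\<le>j. W i) \<and> length Cs \<le> (real j + 1) * F"
      by (rule Suc.IH) (use Suc.prems small cy'q yP y'y in auto)
    then obtain Cs where Cs: "\<forall>C\<in>set Cs. cc C" "distinct (concat Cs)" "y' \<union> x \<subseteq> set (concat Cs)"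
      "set (concat Cs) \<subseteq> y' \<union> x \<union> (\<Union>i\<le>j. W i)" "length Cs \<le> (real j + 1) * F" by auto
    define X where "X = y - set (concat Cs)"
    have "\<exists>Ds. (\<forall>C\<in>set Ds. cc C) \<and> distinct (concat Ds) \<and> X \<subseteq> set (concat Ds) \<and>
      set (concat Ds) \<subseteq> X \<union> (?W - x) \<and> length Ds \<le> F"
    proof (rule dense[of X "Suc j" "?W - x"])
      show "X \<subseteq> P (Suc (Suc j))" unfolding X_def using Suc.prems(3) by auto
      show "?W - x \<subseteq> P (Suc j)" using W(1) by auto
      have "card X \<le> card y" unfolding X_def using fin by (intro card_mono) auto
      thus "real (card X) \<le> q" using Suc.prems(6) by linarith
      fix \<tau> assume \<tau>: "\<tau> \<subseteq> X" "card \<tau> = r + 1"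
      have "\<Union>T \<subseteq> set (concat Cs)" using Cs(3) unfolding y'_def by blast
      hence "\<tau> \<inter> \<Union>T = {}" using \<tau>(1) unfolding X_def by blast
      moreover have \<tau>y: "\<tau> \<subseteq> y" using \<tau>(1) unfolding X_def by blast
      ultimately have "\<not> H \<tau>" using T(3) \<tau>(2) by blast
      hence "real (card (cn U \<tau>)) < h / 2" unfolding H_def by simp
      moreover have "h \<le> card (cn ?W \<tau>)"
        by (rule cod[OF Suc.prems(1) _ \<tau>(2)]) (use \<tau>y Suc.prems(3) in blast)
      moreover have "card (cn ?W \<tau>) \<le> card (cn U \<tau>) + card (cn (?W - x) \<tau>)"
        unfolding U_def by (rule cn_split[OF finW])
      ultimately show "h / 2 \<le> card (cn (?W - x) \<tau>)" by linarith
    qed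
    then obtain Ds where Ds: "\<forall>C\<in>set Ds. cc C" "distinct (concat Ds)" "X \<subseteq> set (concat Ds)"
      "set (concat Ds) \<subseteq> X \<union> (?W - x)" "length Ds \<le> F" by auto
    have "?W \<inter> W i = {}" if "i \<le> j" for i using W(2)[of "Suc j" i] Suc.prems(1) that by auto
    moreover have "?W \<inter> y' = {}" using W(1)[of "Suc j"] y'y yP P(1)[of j] by blast
    ultimately have dis: "set (concat Ds) \<inter> set (concat Cs) = {}" using Ds(4) Cs(4) unfolding X_def by blast
    have 1: "\<forall>C\<in>set (Cs @ Ds). cc C" using Cs(1) Ds(1) by auto
    have 2: "distinct (concat (Cs @ Ds))" using Cs(2) Ds(2) dis by auto
    have 3: "x \<union> y \<subseteq> set (concat (Cs @ Ds))" using Cs(3) Ds(3) unfolding X_def by auto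
    have 4: "set (concat (Cs @ Ds)) \<subseteq> x \<union> y \<union> (\<Union>i\<le>Suc j. W i)"
      using Cs(4) Ds(4) y'y unfolding concat_append set_append atMost_Suc X_def by blast
    have 5: "real (length (Cs @ Ds)) \<le> (real (Suc j) + 1) * F" using Cs(5) Ds(5) by (simp add: algebra_simps)
    show ?case using 1 2 3 4 5 by blast
  }
qed

end

section \<open>Long cycles and reservoirs in sparse graphs\<close>

text \<open>\<open>z1\<close> and \<open>z2\<close> are the sizes from which families of vertices
  and of disjoint pairs behave as expected. The lower bound concerns sets rather than single
  vertices, because it is applied to sets that depend on the colouring.\<close>

locale sparse_graph = edge_coloured +
  fixes p z1 z2 :: real
  assumes p: "0 < p" "p \<le> 1" and z: "0 < z1" "0 < z2"
    and U1: "\<And>T W. family n 1 T W \<Longrightarrow> z1 \<le> card T \<Longrightarrow> cnt E T W < 3 / 2 * (real (card T) * max (real (card W)) z1 * p)"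
    and U2: "\<And>T W. family n 2 T W \<Longrightarrow> z2 \<le> card T \<Longrightarrow> cnt E T W < 3 / 2 * (real (card T) * max (real (card W)) z2 * p\<^sup>2)"
    and L1: "\<And>T W. family n 1 T W \<Longrightarrow> z1 \<le> card T \<Longrightarrow> z1 \<le> card W \<Longrightarrow> 3 / 4 * (real (card T) * real (card W) * p) < cnt E T W"
    and CU: "\<And>\<tau>. 1 \<le> card \<tau> \<Longrightarrow> card \<tau> \<le> r + 1 \<Longrightarrow> \<tau> \<subseteq> {0..<n} \<Longrightarrow> cnt E {\<tau>} ({0..<n} - \<tau>) < 3 / 2 * (n * p ^ card \<tau>)"
begin

definition nb :: "nat set \<Rightarrow> nat \<Rightarrow> nat set" where "nb U v = {w \<in> U. {v, w} \<in> E}"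
definition knb :: "nat \<Rightarrow> nat set \<Rightarrow> nat \<Rightarrow> nat set" where "knb i U v = {w \<in> U. K i v w}"
definition m1 :: nat where "m1 = nat \<lceil>z1\<rceil>"
definition m2 :: nat where "m2 = nat \<lceil>z2\<rceil>"

lemma m1: "z1 \<le> m1" "1 \<le> m1" "m1 \<le> z1 + 1"
  unfolding m1_def using z by linarith+

lemma m2: "z2 \<le> m2" "1 \<le> m2" "m2 \<le> z2 + 1"
  unfolding m2_def using z by linarith+

lemma singles_family:
  assumes "S \<subseteq> {0..<n}" "W \<subseteq> {0..<n}" "S \<inter> W = {}"
  shows "family n 1 ((\<lambda>v. {v}) ` S) W" "card ((\<lambda>v. {v}) ` S) = card S"
    "cnt E ((\<lambda>v. {v}) ` S) W = (\<Sum>v\<in>S. card (nb W v))"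
proof -
  show "family n 1 ((\<lambda>v. {v}) ` S) W" using assms unfolding family_def pairwise_def disjnt_def by auto
  show "card ((\<lambda>v. {v}) ` S) = card S" by (rule card_image) auto
  have fin: "finite S" "finite W" using finite_subset[OF assms(1)] finite_subset[OF assms(2)] by auto
  have "cnt E ((\<lambda>v. {v}) ` S) W = (\<Sum>\<tau>\<in>(\<lambda>v. {v}) ` S. card (cn W \<tau>))" by (rule cnt_sum) (use fin in auto)
  also have "\<dots> = (\<Sum>v\<in>S. card (cn W {v}))" by (subst sum.reindex) auto
  also have "\<dots> = (\<Sum>v\<in>S. card (nb W v))" unfolding cn_def nb_def by (simp add: insert_commute)
  finally show "cnt E ((\<lambda>v. {v}) ` S) W = (\<Sum>v\<in>S. card (nb W v))" .
qed

lemma edges_upper: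
  assumes "S \<subseteq> {0..<n}" "W \<subseteq> {0..<n}" "S \<inter> W = {}" "m1 \<le> card S"
  shows "real (\<Sum>v\<in>S. card (nb W v)) < 3 / 2 * (real (card S) * max (real (card W)) z1 * p)"
  using U1[OF singles_family(1)[OF assms(1-3)]] m1 assms(4) unfolding singles_family(2,3)[OF assms(1-3)] by simp

lemma edges_lower:
  assumes "S \<subseteq> {0..<n}" "W \<subseteq> {0..<n}" "S \<inter> W = {}" "m1 \<le> card S" "m1 \<le> card W"
  shows "3 / 4 * (real (card S) * real (card W) * p) < real (\<Sum>v\<in>S. card (nb W v))"
  using L1[OF singles_family(1)[OF assms(1-3)]] m1 assms(4,5) unfolding singles_family(2,3)[OF assms(1-3)] by simp

text \<open>Sending \<open>3 / 2 * w * p\<close> edges per vertex into a set of size at most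
  \<open>w\<close> would exceed the upper count; \<open>z1 < w\<close> excludes that the maximum in
  that count is attained by \<open>z1\<close>.\<close>

lemma expansion:
  fixes d w :: real
  assumes "S \<subseteq> {0..<n}" "W \<subseteq> {0..<n}" "S \<inter> W = {}" "m1 \<le> card S"
    and deg: "\<And>v. v \<in> S \<Longrightarrow> 3 / 2 * w * p \<le> card (nb W v)" and w: "z1 < w"
  shows "w < card W"
proof -
  have "real (card S) * (3 / 2 * w * p) = (\<Sum>v\<in>S. 3 / 2 * w * p)" by simp
  also have "\<dots> \<le> (\<Sum>v\<in>S. real (card (nb W v)))" by (rule sum_mono) (rule deg)
  also have "\<dots> < 3 / 2 * (real (card S) * max (real (card W)) z1 * p)" using edges_upper[OF assms(1-4)] by simp
  finally have "(3 / 2 * real (card S) * p) * w < (3 / 2 * real (card S) * p) * max (card W) z1"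
    by (simp add: mult_ac)
  moreover have "0 < 3 / 2 * real (card S) * p" using assms(4) m1(2) p by simp
  ultimately have "w < max (real (card W)) z1" by (simp only: mult_less_cancel_left_pos)
  thus ?thesis using w by linarith
qed

text \<open>Exactly \<open>m1\<close> such vertices, removed from \<open>Y\<close> as far as they
  belong to it, would contradict the lower count of edges. Their removal explains the subtracted
  \<open>m1\<close>.\<close>

lemma low_degree:
  assumes U: "U \<subseteq> {0..<n}" and Y: "Y \<subseteq> {0..<n}" "2 * m1 \<le> card Y"
  shows "card {v \<in> U. card (nb Y v) \<le> 3 / 4 * (real (card Y) - m1) * p} < m1"
proof (rule ccontr)
  assume "\<not> ?thesis"
  hence *: "m1 \<le> card {v \<in> U. card (nb Y v) \<le> 3 / 4 * (real (card Y) - m1) * p}" by simp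
  obtain S where S: "S \<subseteq> {v \<in> U. card (nb Y v) \<le> 3 / 4 * (real (card Y) - m1) * p}" "card S = m1"
    using obtain_subset_with_card_n[OF *] by metis
  let ?T = "Y - S"
  have finY: "finite Y" using finite_subset[OF Y(1)] by simp
  have finS: "finite S" by (rule card_ge_0_finite) (use S(2) m1(2) in simp)
  have "card Y - m1 \<le> card ?T" using diff_card_le_card_Diff[OF finS, of Y] S(2) by simp
  hence T: "real (card Y) - m1 \<le> card ?T" "m1 \<le> card ?T" using Y(2) by linarith+
  have "3 / 4 * (real (card S) * card ?T * p) < real (\<Sum>v\<in>S. card (nb ?T v))"
    by (rule edges_lower) (use S U Y T in auto)
  also have "\<dots> \<le> (\<Sum>v\<in>S. 3 / 4 * (real (card Y) - m1) * p)"
    unfolding of_nat_sum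
  proof (rule sum_mono)
    fix v assume v: "v \<in> S"
    have "card (nb ?T v) \<le> card (nb Y v)" unfolding nb_def using finY by (intro card_mono) auto
    thus "real (card (nb ?T v)) \<le> 3 / 4 * (real (card Y) - m1) * p" using S(1) v by fastforce
  qed
  also have "\<dots> = 3 / 4 * (real (card S) * (real (card Y) - m1) * p)" by simp
  also have "\<dots> \<le> 3 / 4 * (real (card S) * card ?T * p)" using T(1) p by (intro mult_left_mono mult_right_mono) auto
  finally show False by simp
qed

lemma colour_degree:
  assumes "finite U"
  shows "card (nb U v) \<le> (\<Sum>i<r. card (knb i U v))"
proof -
  have "nb U v = (\<Union>i<r. knb i U v)" unfolding nb_def knb_def K_def using col by auto
  thus ?thesis using card_UN_le[of "{..<r}" "\<lambda>i. knb i U v"] by simp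
qed

lemma majority_colour:
  assumes "finite U"
  shows "\<exists>i<r. card (nb U v) \<le> r * card (knb i U v)"
proof -
  have "real (card (nb U v)) \<le> (\<Sum>i<r. real (card (knb i U v)))"
    using of_nat_mono[OF colour_degree[OF assms, of v], where 'a = real] by simp
  then obtain i where "i < r" "real (card (nb U v)) \<le> r * real (card (knb i U v))"
    using pigeonhole_le[of r "real (card (nb U v))" "\<lambda>i. real (card (knb i U v))"] r2 by auto
  thus ?thesis by (intro exI[of _ i]) (simp flip: of_nat_mult)
qed

text \<open>As in the dense case, with \<open>m1\<close> in place of 1: the separated set has at
  most \<open>2 * m1\<close> vertices, few compared with the minimum degree, so its vertices send
  most of their edges to the cycle, and expansion makes the cycle linear. Numerically
  \<open>27 / 80 - 1 / 50\<close> exceeds \<open>1 / 4\<close>, the degree needed for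
  \<open>w = card U / (6 * r)\<close>.\<close>

lemma sparse_long_cycle:
  assumes U: "U \<subseteq> {0..<n}" and big: "20 * real m1 \<le> card U" "100 * r * real m1 \<le> card U * p" "10 * r * z1 \<le> card U"
  shows "\<exists>C. cc C \<and> distinct C \<and> set C \<subseteq> U \<and> card U \<le> 6 * real r * card (set C)"
proof -
  let ?N = "real (card U)"
  have finU: "finite U" using finite_subset[OF U] by simp
  have rpos: "0 < real r" using r2 by simp
  have Npos: "0 < ?N" using big(1) m1(2) by linarith
  define L where "L = {v \<in> U. card (nb U v) \<le> 3 / 4 * (?N - m1) * p}"
  have "card L < m1" unfolding L_def by (rule low_degree[OF U U]) (use big(1) in linarith)
  hence L: "real (card L) \<le> ?N / 20" using big(1) by linarith
  \<comment> \<open>\<open>19 / 20\<close> of the vertices have degree at least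
    \<open>57 / 80 * card U * p\<close>, and the product of the two fractions is at least
    \<open>27 / 40\<close>.\<close>
  define D where "D = 27 / 40 * ?N * p / r"
  have "D * r * ?N \<le> (\<Sum>v\<in>U - L. real (card (nb U v)))"
  proof -
    have "card (U - L) = card U - card L" by (rule card_Diff_subset) (auto simp: L_def finU)
    moreover have "card L \<le> card U" unfolding L_def using finU by (intro card_mono) auto
    ultimately have c: "19 / 20 * ?N \<le> card (U - L)" using L by simp
    have "27 / 40 * ?N * p * ?N \<le> (19 / 20 * ?N) * (57 / 80 * ?N * p)" using Npos p by (simp add: field_simps)
    also have "\<dots> \<le> card (U - L) * (57 / 80 * ?N * p)" using c p by (intro mult_right_mono) auto
    also have "\<dots> = (\<Sum>v\<in>U - L. 57 / 80 * ?N * p)" by simp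
    also have "\<dots> \<le> (\<Sum>v\<in>U - L. real (card (nb U v)))"
    proof (rule sum_mono)
      fix v assume "v \<in> U - L"
      hence "3 / 4 * (?N - m1) * p < card (nb U v)" unfolding L_def by auto
      moreover have "57 / 80 * ?N * p \<le> 3 / 4 * (?N - m1) * p" using big(1) p by (intro mult_right_mono) auto
      ultimately show "57 / 80 * ?N * p \<le> card (nb U v)" by linarith
    qed
    finally show ?thesis unfolding D_def using rpos by simp
  qed
  also have "\<dots> \<le> (\<Sum>v\<in>U. real (card (nb U v)))" by (rule sum_mono2) (use finU in auto)
  also have "\<dots> \<le> (\<Sum>v\<in>U. \<Sum>i<r. real (card (knb i U v)))"
  proof (rule sum_mono)
    fix v
    show "real (card (nb U v)) \<le> (\<Sum>i<r. real (card (knb i U v)))"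
      using of_nat_mono[OF colour_degree[OF finU, of v], where 'a = real] by simp
  qed
  also have "\<dots> = (\<Sum>i<r. \<Sum>v\<in>U. real (card (knb i U v)))" by (rule sum.swap)
  finally obtain i where i: "i < r" "D * r * ?N \<le> r * (\<Sum>v\<in>U. real (card (knb i U v)))"
    using pigeonhole_le[of r "D * r * ?N" "\<lambda>i. \<Sum>v\<in>U. real (card (knb i U v))"] r2 by auto
  have "r * (D * ?N) \<le> r * (\<Sum>v\<in>U. real (card (knb i U v)))" using i(2) by (simp add: mult_ac)
  hence "D * ?N \<le> (\<Sum>v\<in>U. real (card (knb i U v)))" using rpos by simp
  hence "D * ?N \<le> (\<Sum>v\<in>U. card {w \<in> U. K i v w})" unfolding knb_def by simp
  moreover have "U \<noteq> {}" using Npos by auto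
  ultimately have "\<exists>S\<subseteq>U. S \<noteq> {} \<and> (\<forall>v\<in>S. D / 2 \<le> card {w \<in> S. K i v w})"
    by (intro min_degree_subgraph[OF finU K_sym K_irr])
  then obtain S where S: "S \<subseteq> U" "S \<noteq> {}" "\<forall>v\<in>S. D / 2 \<le> card {w \<in> S. K i v w}" by auto
  have finS: "finite S" using S(1) finU finite_subset by blast
  have D2: "2 * real m1 \<le> 1 / 50 * ?N * p / r" using big(2) rpos by (simp add: field_simps)
  have D3: "D / 2 = 27 / 80 * ?N * p / r" unfolding D_def by simp
  have NpR: "0 < ?N * p / r" using Npos p rpos by simp
  have "m1 \<le> card (S \<inter> S)"
  proof -
    obtain v where v: "v \<in> S" using S(2) by auto
    have "card {w \<in> S. K i v w} \<le> card S" using finS by (intro card_mono) auto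
    moreover have "D / 2 \<le> card {w \<in> S. K i v w}" using S(3) v by auto
    ultimately have "D / 2 \<le> real (card S)" by linarith
    moreover have "real m1 \<le> D / 2" unfolding D3 using D2 NpR by linarith
    ultimately show ?thesis by simp
  qed
  then obtain T C where TC: "T \<subseteq> S" "m1 \<le> card (T \<inter> S)" "card (T \<inter> S) \<le> 2 * m1"
    "C = [] \<or> cyc (K i) C" "set C \<subseteq> S" "\<And>t u. t \<in> T \<Longrightarrow> u \<in> S \<Longrightarrow> K i t u \<Longrightarrow> u \<in> T \<union> set C"
    using cycle_separator[OF finS K_sym[of i] m1(2), of S] by metis
  have TS: "T \<inter> S = T" using TC(1) by auto
  have finT: "finite T" using TC(1) finS finite_subset by blast
  define w where "w = ?N / (6 * r)"
  let ?W = "set C - T"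
  have "w < card ?W"
  proof (rule expansion[of T])
    show "T \<subseteq> {0..<n}" "?W \<subseteq> {0..<n}" using TC(1,5) S(1) U by auto
    show "m1 \<le> card T" using TC(2) TS by simp
    show "z1 < w"
    proof -
      have "z1 * 6 * r < z1 * 10 * r" using z rpos by simp
      hence "z1 * (6 * r) < ?N" using big(3) by (simp add: mult_ac)
      thus ?thesis unfolding w_def using rpos by (simp add: pos_less_divide_eq)
    qed
    fix t assume t: "t \<in> T"
    have "{u \<in> S. K i t u} \<subseteq> T \<union> nb ?W t" using TC(6)[OF t] unfolding nb_def K_def by auto
    hence "card {u \<in> S. K i t u} \<le> card (T \<union> nb ?W t)" using finT by (intro card_mono) (auto simp: nb_def)
    also have "\<dots> \<le> card T + card (nb ?W t)" by (rule card_Un_le)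
    finally have "D / 2 \<le> real (card T) + card (nb ?W t)" using S(3) t TC(1) by fastforce
    moreover have "real (card T) \<le> 2 * real m1" using TC(3) TS by simp
    ultimately have "27 / 80 * ?N * p / r - 1 / 50 * ?N * p / r \<le> card (nb ?W t)" using D2 D3 by linarith
    moreover have "3 / 2 * w * p = 1 / 4 * (?N * p / r)" unfolding w_def by simp
    ultimately show "3 / 2 * w * p \<le> card (nb ?W t)" using NpR by linarith
  qed auto
  moreover have "card ?W \<le> card (set C)" by (intro card_mono) auto
  ultimately have w: "w < card (set C)" by linarith
  have "0 \<le> w" unfolding w_def by simp
  hence "C \<noteq> []" using w by auto
  hence cy: "cyc (K i) C" using TC(4) by auto
  have "?N \<le> 6 * real r * card (set C)" using w unfolding w_def using rpos by (simp add: field_simps)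
  thus ?thesis using cy i(1) TC(5) S(1) unfolding cc_def cyc_def by blast
qed

text \<open>All but \<open>m1\<close> vertices of \<open>X\<close> have
  \<open>57 / 80 * card Y * p / r\<close> neighbours of their majority colour in \<open>Y\<close>,
  so \<open>m1\<close> vertices of one class expand to \<open>\<nu>\<close>. Uncovered vertices
  arise from the separated sets, from the ends of the rounds and from low degrees, together at most
  \<open>(12 * r^2 + r + 1) * m1\<close>.\<close>

lemma reservoir_cover:
  assumes X: "X \<subseteq> {0..<n}" and Y: "Y \<subseteq> {0..<n}" and dis: "X \<inter> Y = {}" and XY: "9 * r * card X \<le> card Y"
    and big: "20 * real m1 \<le> card Y" "4 * r * z1 < card Y"
  shows "\<exists>Cs. (\<forall>C\<in>set Cs. cc C) \<and> distinct (concat Cs) \<and> set (concat Cs) \<subseteq> X \<union> Y \<and>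
    length Cs \<le> 6 * r\<^sup>2 \<and> card (X - set (concat Cs)) \<le> 15 * r\<^sup>2 * m1"
proof -
  let ?b = "real (card Y)"
  have fin: "finite X" "finite Y" using finite_subset[OF X] finite_subset[OF Y] by auto
  have rpos: "0 < real r" using r2 by simp
  have bpos: "0 < ?b" using big(1) m1(2) by linarith
  define L where "L = {v \<in> X. card (nb Y v) \<le> 3 / 4 * (?b - m1) * p}"
  have L: "card L < m1" unfolding L_def by (rule low_degree[OF X Y]) (use big(1) in linarith)
  have "\<forall>v. \<exists>i<r. card (nb Y v) \<le> r * card (knb i Y v)" using majority_colour[OF fin(2)] by blast
  then obtain co where co: "\<And>v. co v < r" "\<And>v. card (nb Y v) \<le> r * card (knb (co v) Y v)" by metis
  define Xi where "Xi i = {v \<in> X - L. co v = i}" for i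
  have UX: "(\<Union>i<r. Xi i) = X - L" using co(1) unfolding Xi_def by auto
  have cX: "(\<Sum>i<r. card (Xi i)) \<le> card X"
  proof -
    have "card (\<Union>i\<in>{..<r}. Xi i) = (\<Sum>i<r. card (Xi i))" by (rule card_UN_disjoint) (auto simp: Xi_def fin)
    thus ?thesis unfolding UX using fin by (metis card_mono Diff_subset)
  qed
  define \<nu> where "\<nu> = 9 / 20 * ?b / r"
  have "\<exists>Cs. (\<forall>C\<in>set Cs. \<exists>i<r. cyc (biprel (Xi i) Y (K i)) C) \<and> distinct (concat Cs) \<and>
      set (concat Cs) \<subseteq> (\<Union>i<r. Xi i) \<union> Y \<and>
      card ((\<Union>i<r. Xi i) - set (concat Cs)) \<le> r * (2 * m1 * (6 * r) + m1) \<and> length Cs \<le> r * (6 * r)"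
  proof (rule multicolour_cover)
    fix i S assume S: "i < r" "S \<subseteq> Xi i" "m1 \<le> card S"
    let ?W = "{y \<in> Y. \<exists>x\<in>S. K i x y}"
    have "\<nu> < card ?W"
    proof (rule expansion[of S])
      show "S \<subseteq> {0..<n}" "?W \<subseteq> {0..<n}" "S \<inter> ?W = {}" using S(2) X Y dis unfolding Xi_def by auto
      show "m1 \<le> card S" by (rule S(3))
      have "4 * (z1 * r) < ?b" using big(2) by (simp add: mult_ac)
      hence "z1 * r < 9 / 20 * ?b" using bpos by linarith
      thus "z1 < \<nu>" unfolding \<nu>_def using rpos by (simp add: pos_less_divide_eq)
      fix v assume v: "v \<in> S"
      hence vX: "v \<in> X" "v \<notin> L" "co v = i" using S(2) unfolding Xi_def by auto
      have "57 / 80 * ?b * p \<le> 3 / 4 * (?b - m1) * p" using big(1) p by (intro mult_right_mono) auto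
      also have "\<dots> \<le> card (nb Y v)" using vX unfolding L_def by auto
      also have "\<dots> \<le> r * real (card (knb i Y v))" using co(2)[of v] vX(3) by (metis of_nat_le_iff of_nat_mult)
      finally have "57 / 80 * ?b * p / r \<le> card (knb i Y v)" using rpos by (simp add: pos_divide_le_eq mult_ac)
      moreover have "knb i Y v \<subseteq> nb ?W v" using v unfolding knb_def nb_def K_def by auto
      hence "card (knb i Y v) \<le> card (nb ?W v)" by (rule card_mono[rotated]) (use fin in \<open>auto simp: nb_def\<close>)
      moreover have "3 / 2 * \<nu> * p \<le> 57 / 80 * ?b * p / r" unfolding \<nu>_def using bpos p rpos by (simp add: field_simps)
      ultimately show "3 / 2 * \<nu> * p \<le> card (nb ?W v)" by linarith
    qed
    thus "\<nu> \<le> card ?W" by simp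
  next
    have "real (9 * r * card X) \<le> ?b" using XY by (rule of_nat_mono)
    hence "9 * (r * real (card X)) \<le> ?b" by simp
    moreover have "r * real (\<Sum>i<r. card (Xi i)) \<le> r * real (card X)" using cX by (intro mult_left_mono of_nat_mono) auto
    ultimately have "4 * (r * real (\<Sum>i<r. card (Xi i))) \<le> 9 / 20 * ?b" using bpos by linarith
    thus "real (4 * (\<Sum>i<r. card (Xi i))) \<le> \<nu>" unfolding \<nu>_def using rpos by (simp add: pos_le_divide_eq mult_ac)
  next
    show "real (8 * card Y) \<le> 3 * \<nu> * real (6 * r)" unfolding \<nu>_def using rpos by simp
    show "0 < \<nu>" unfolding \<nu>_def using bpos rpos by simp
    show "1 \<le> m1" by (rule m1(2))
  qed (use fin dis in \<open>auto simp: Xi_def\<close>)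
  then obtain Cs where Cs: "\<forall>C\<in>set Cs. \<exists>i<r. cyc (biprel (Xi i) Y (K i)) C" "distinct (concat Cs)"
      "set (concat Cs) \<subseteq> X - L \<union> Y"
      "card (X - L - set (concat Cs)) \<le> r * (2 * m1 * (6 * r) + m1)" "length Cs \<le> r * (6 * r)"
    unfolding UX by (elim exE conjE)
  have "cc C" if C: "C \<in> set Cs" for C
  proof -
    obtain i where i: "i < r" "cyc (biprel (Xi i) Y (K i)) C" using Cs(1) C by auto
    have "cyc (K i) C" by (rule cyc_mono[OF i(2)]) (use sympD[OF K_sym] in \<open>auto simp: biprel_def\<close>)
    thus ?thesis unfolding cc_def using i(1) by auto
  qed
  moreover have "card (X - set (concat Cs)) \<le> 15 * r\<^sup>2 * m1"
  proof -
    have "card (X - set (concat Cs)) \<le> card ((X - L - set (concat Cs)) \<union> L)" using fin by (intro card_mono) (auto simp: L_def)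
    also have "\<dots> \<le> card (X - L - set (concat Cs)) + card L" by (rule card_Un_le)
    also have "\<dots> \<le> r * (2 * m1 * (6 * r) + m1) + m1" using Cs(4) L by linarith
    also have "\<dots> = (12 * r\<^sup>2 + r + 1) * m1" by (simp add: power2_eq_square algebra_simps)
    also have "\<dots> \<le> (15 * r\<^sup>2) * m1"
    proof (rule mult_right_mono)
      have "2 * r \<le> r\<^sup>2" unfolding power2_eq_square using r2 by (intro mult_right_mono) auto
      thus "12 * r\<^sup>2 + r + 1 \<le> 15 * r\<^sup>2" using r2 by linarith
    qed simp
    finally show ?thesis .
  qed
  moreover have "length Cs \<le> 6 * r\<^sup>2" using Cs(5) by (simp add: power2_eq_square)
  ultimately show ?thesis using Cs(2,3) by (intro exI[of _ Cs]) auto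
qed

end

section \<open>Counting monochromatic triangles\<close>

lemma ln_r:
  assumes r2: "2 \<le> r"
  shows "1 / 2 \<le> ln (real r)" "2 \<le> real r" "1 \<le> 2 * ln (real r)"
proof -
  have "exp (1 / 2 :: real) ^ 2 = exp 1" by (simp add: exp_of_nat_mult[symmetric])
  also have "\<dots> \<le> 2 ^ 2" using exp_le by simp
  finally have "exp (1 / 2 :: real) \<le> 2" by (rule power2_le_imp_le) simp
  hence "exp (1 / 2) \<le> real r" using r2 by linarith
  thus a: "1 / 2 \<le> ln (real r)" using r2 by (subst ln_ge_iff) auto
  thus "1 \<le> 2 * ln (real r)" by simp
qed (use r2 in simp)

text \<open>Quotient of a lower bound for homogeneous cliques on \<open>r + 2\<close> vertices and
  an upper bound for extensions of a triangle. The factors stand for a vertex set of size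
  \<open>n / 3\<close>, the half of it that is good at each choice, the restrictions to majority
  colours, the inverse of the \<open>3 / 2\<close> in each codegree, and the position of the
  triangle in the clique.\<close>

definition triangle_density :: "nat \<Rightarrow> real" where
  "triangle_density r = (1 / 3) ^ (r + 2) * (1 / 2) ^ (r + 1) * (1 / (2 * r)) ^ (\<Sum>i<r + 2. i) * (2 / 3) ^ (r - 1) / (r + 1)\<^sup>2"

definition absorber_density :: "nat \<Rightarrow> real" where
  "absorber_density r = (triangle_density r)\<^sup>2 / (50000 * r)"

text \<open>\<open>18 * r\<close> is \<open>9 * r\<close>, the ratio required by
  \<open>reservoir_cover\<close>, doubled because only half of the absorbable set serves
  there.\<close>

definition leftover_density :: "nat \<Rightarrow> real" where
  "leftover_density r = absorber_density r / (18 * r)"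

lemma triangle_density_bounds:
  assumes r2: "2 \<le> r"
  shows "0 < triangle_density r" "triangle_density r \<le> 1"
proof -
  show "0 < triangle_density r" unfolding triangle_density_def using r2 by simp
  have a: "(1 / 3 :: real) ^ (r + 2) \<le> 1" "(1 / 2 :: real) ^ (r + 1) \<le> 1" "(2 / 3 :: real) ^ (r - 1) \<le> 1"
    by (rule power_le_one; simp)+
  have b: "(1 / (2 * real r)) ^ (\<Sum>i<r + 2. i) \<le> 1" using r2 by (intro power_le_one) auto
  have m: "x * y \<le> 1" if "x \<le> 1" "y \<le> 1" "0 \<le> y" for x y :: real
    using mult_le_one[OF that(1,3,2)] .
  have c: "(1 / 3 :: real) ^ (r + 2) * (1 / 2) ^ (r + 1) * (1 / (2 * real r)) ^ (\<Sum>i<r + 2. i) * (2 / 3) ^ (r - 1) \<le> 1"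
  proof (intro m)
    show "(1 / (2 * real r)) ^ (\<Sum>i<r + 2. i) \<le> 1" by (rule b)
  qed (use a in auto)
  have "1 \<le> (r + 1)\<^sup>2" by simp
  hence "real 1 \<le> real ((r + 1)\<^sup>2)" by (rule of_nat_mono)
  hence "1 \<le> real ((r + 1)\<^sup>2)" by simp
  thus "triangle_density r \<le> 1" unfolding triangle_density_def using c by (simp only: divide_le_eq_1) (auto intro: order_trans)
qed

lemma absorber_density_bounds:
  assumes r2: "2 \<le> r"
  shows "0 < absorber_density r" "absorber_density r \<le> 1"
proof -
  have r: "2 \<le> real r" using r2 by simp
  show "0 < absorber_density r" unfolding absorber_density_def using triangle_density_bounds[OF r2] r by simp
  have "(triangle_density r)\<^sup>2 \<le> 1" using triangle_density_bounds[OF r2] by (intro power_le_one) auto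
  thus "absorber_density r \<le> 1" unfolding absorber_density_def using r by simp
qed

lemma leftover_density_bounds:
  assumes r2: "2 \<le> r"
  shows "0 < leftover_density r" "leftover_density r \<le> 1" "leftover_density r \<le> absorber_density r / 36"
proof -
  have r: "2 \<le> real r" using r2 by simp
  note b = absorber_density_bounds[OF r2]
  show "0 < leftover_density r" unfolding leftover_density_def using b r by simp
  show "leftover_density r \<le> absorber_density r / 36" unfolding leftover_density_def using b r by (intro divide_left_mono) auto
  thus "leftover_density r \<le> 1" using b by linarith
qed

text \<open>As \<open>r \<ge> 2\<close>, each factor is at least a power of \<open>1 / r\<close>;
  the exponents \<open>2 * (r + 2)\<close>, \<open>r + 1\<close>, \<open>(r + 1) * (r + 2)\<close>,
  \<open>r - 1\<close> and \<open>4\<close> add up to the one stated.\<close>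

lemma triangle_density_lower:
  assumes r2: "2 \<le> r"
  shows "(1 / real r) ^ (r\<^sup>2 + 7 * r + 10) \<le> triangle_density r"
proof -
  define x where "x = 1 / real r"
  have r: "2 \<le> real r" using r2 by simp
  have x: "0 < x" "x \<le> 1 / 2" unfolding x_def using r by (auto simp: field_simps)
  have xx: "x\<^sup>2 \<le> 1 / 4" using power_mono[OF x(2), of 2] x by (simp add: power2_eq_square)
  have S: "2 * (\<Sum>i<r + 2. i) = (r + 1) * (r + 2)"
  proof -
    have "2 * (\<Sum>i<k + 2. i) = (k + 1) * (k + 2)" for k :: nat by (induction k) auto
    thus ?thesis .
  qed
  have a1: "(x\<^sup>2) ^ (r + 2) \<le> (1 / 3) ^ (r + 2)" using xx x by (intro power_mono) auto
  have a2: "x ^ (r + 1) \<le> (1 / 2) ^ (r + 1)" using x by (intro power_mono) auto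
  have a3: "(x\<^sup>2) ^ (\<Sum>i<r + 2. i) \<le> (1 / (2 * real r)) ^ (\<Sum>i<r + 2. i)"
  proof (rule power_mono)
    have "x * x \<le> 1 / 2 * x" using x by (intro mult_right_mono) auto
    thus "x\<^sup>2 \<le> 1 / (2 * real r)" unfolding x_def power2_eq_square by simp
  qed simp
  have a4: "x ^ (r - 1) \<le> (2 / 3) ^ (r - 1)" using x by (intro power_mono) auto
  have a5: "x ^ 4 \<le> 1 / (r + 1)\<^sup>2"
  proof -
    have "r * 2 \<le> r * r" using r2 by (intro mult_le_mono2) auto
    hence "r + 1 \<le> r ^ 2" using r2 unfolding power2_eq_square by linarith
    hence "(r + 1)\<^sup>2 \<le> (r\<^sup>2)\<^sup>2" by (intro power_mono) auto
    hence "(r + 1)\<^sup>2 \<le> r ^ 4" by (simp add: power_mult[symmetric])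
    hence "real ((r + 1)\<^sup>2) \<le> real (r ^ 4)" by (rule of_nat_mono)
    hence "1 / real (r ^ 4) \<le> 1 / real ((r + 1)\<^sup>2)" by (intro divide_left_mono) (use r2 in auto)
    thus ?thesis unfolding x_def by (simp add: power_divide)
  qed
  have e: "r\<^sup>2 + 7 * r + 10 = 2 * (r + 2) + (r + 1) + 2 * (\<Sum>i<r + 2. i) + (r - 1) + 4"
    unfolding S using r2 by (simp add: power2_eq_square algebra_simps)
  have "x ^ (r\<^sup>2 + 7 * r + 10) = (x\<^sup>2) ^ (r + 2) * x ^ (r + 1) * (x\<^sup>2) ^ (\<Sum>i<r + 2. i) * x ^ (r - 1) * x ^ 4"
    unfolding e power_add power_mult ..
  also have "\<dots> \<le> (1 / 3) ^ (r + 2) * (1 / 2) ^ (r + 1) * (1 / (2 * real r)) ^ (\<Sum>i<r + 2. i) * (2 / 3) ^ (r - 1) * (1 / (r + 1)\<^sup>2)"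
    by (intro mult_mono a1 a2 a3 a4 a5 mult_nonneg_nonneg zero_le_power) (use x in auto)
  also have "\<dots> = triangle_density r" unfolding triangle_density_def by simp
  finally show ?thesis unfolding x_def .
qed

text \<open>This logarithm governs the number of greedy long cycles. It is of order
  \<open>r^2 * ln r\<close> since the triangle density is a power of \<open>1 / r\<close> with
  quadratic exponent.\<close>

lemma ln_inverse_leftover:
  assumes r2: "2 \<le> r"
  shows "ln (1 / leftover_density r) \<le> 20 * real r ^ 2 * ln (real r)"
proof -
  let ?r = "real r" and ?l = "ln (real r)"
  note l = ln_r[OF r2]
  have e: "?r * 2 \<le> ?r ^ 2" using mult_left_mono[OF l(2), of ?r] by (simp add: power2_eq_square)
  have "1 / triangle_density r \<le> 1 / (1 / ?r) ^ (r\<^sup>2 + 7 * r + 10)" by (rule divide_left_mono[OF triangle_density_lower[OF r2]]) (use triangle_density_bounds[OF r2] r2 in auto)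
  hence g: "1 / triangle_density r \<le> ?r ^ (r\<^sup>2 + 7 * r + 10)" by (simp add: power_divide)
  have "1 / leftover_density r = 900000 * ?r ^ 2 * (1 / triangle_density r)\<^sup>2" unfolding leftover_density_def absorber_density_def by (simp add: power2_eq_square)
  also have "\<dots> \<le> ?r ^ 20 * ?r ^ 2 * (?r ^ (r\<^sup>2 + 7 * r + 10))\<^sup>2"
  proof (intro mult_mono power_mono g)
    \<comment> \<open>\<open>900000 = 18 * 50000\<close>, from the definitions of the two
      densities.\<close>
    have "(900000 :: real) \<le> 2 ^ 20" by simp
    also have "\<dots> \<le> ?r ^ 20" using l(2) by (rule power_mono) simp
    finally show "900000 \<le> ?r ^ 20" .
  qed (use triangle_density_bounds[OF r2] in auto)
  also have "\<dots> = ?r ^ (2 * r\<^sup>2 + 14 * r + 42)" by (simp flip: power_add power_mult add: algebra_simps)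
  finally have "ln (1 / leftover_density r) \<le> ln (?r ^ (2 * r\<^sup>2 + 14 * r + 42))" using leftover_density_bounds[OF r2] l(2) by (subst ln_le_cancel_iff) auto
  also have "\<dots> = (2 * ?r ^ 2 + 14 * ?r + 42) * ?l" using l(2) by (simp add: ln_realpow)
  also have "\<dots> \<le> (20 * ?r ^ 2) * ?l"
  proof (rule mult_right_mono)
    show "2 * ?r ^ 2 + 14 * ?r + 42 \<le> 20 * ?r ^ 2" using e l(2) by linarith
  qed (use l in simp)
  finally show ?thesis .
qed

lemma card_le_sum_image:
  assumes "finite I" "P \<subseteq> (\<Union>i\<in>I. f i ` C i)" "\<And>i. i \<in> I \<Longrightarrow> finite (C i)"
  shows "card P \<le> (\<Sum>i\<in>I. card (C i))"
proof -
  have "card P \<le> card (\<Union>i\<in>I. f i ` C i)" using assms by (intro card_mono) auto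
  also have "\<dots> \<le> (\<Sum>i\<in>I. card (f i ` C i))" by (rule card_UN_le[OF assms(1)])
  also have "\<dots> \<le> (\<Sum>i\<in>I. card (C i))" using assms(3) by (intro sum_mono card_image_le) auto
  finally show ?thesis .
qed

section \<open>Cliques coloured by their earlier endpoints\<close>

context sparse_graph
begin

abbreviation A :: "nat \<Rightarrow> nat \<Rightarrow> bool" where "A u v \<equiv> {u, v} \<in> E"

definition majority :: "nat set \<Rightarrow> nat \<Rightarrow> nat" where
  "majority U v = (SOME i. i < r \<and> card (nb U v) \<le> r * card (knb i U v))"

lemma majority: "finite U \<Longrightarrow> majority U v < r \<and> card (nb U v) \<le> r * card (knb (majority U v) U v)"
  unfolding majority_def by (rule someI_ex) (use majority_colour in blast)

definition good :: "nat set \<Rightarrow> nat set" where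
  "good U = {v \<in> U. 3 / 4 * (real (card U) - m1) * p < card (nb U v)}"

text \<open>Pairs \<open>(vs, z)\<close> where \<open>vs @ [z]\<close> is a clique in which the colour of an edge
  depends only on its earlier endpoint.\<close>

primrec homog :: "nat \<Rightarrow> nat set \<Rightarrow> (nat list \<times> nat) set" where
  "homog 0 U = {([], z) | z. z \<in> U}"
| "homog (Suc l) U = {(v # vs, z) | v vs z. v \<in> good U \<and> (vs, z) \<in> homog l (knb (majority U v) U v)}"

text \<open>Of \<open>u\<close> vertices at least \<open>u / 2\<close> are good, and each good
  vertex has at least \<open>u * p / (2 * r)\<close> neighbours in its majority colour.\<close>

primrec homog_bound :: "nat \<Rightarrow> real \<Rightarrow> real" where
  "homog_bound 0 u = u"
| "homog_bound (Suc l) u = u / 2 * homog_bound l (u * (p / (2 * r)))"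

lemma homog_bound_eq: "homog_bound l u = u ^ (l + 1) * (1 / 2) ^ l * (p / (2 * r)) ^ (\<Sum>i<Suc l. i)"
proof (induction l arbitrary: u)
  case (Suc l)
  have s: "(\<Sum>i<Suc (Suc l). i) = (l + 1) + (\<Sum>i<Suc l. i)" by simp
  show ?case unfolding homog_bound.simps Suc.IH s power_add power_mult_distrib by (simp add: mult_ac)
qed simp

lemma homog_bound_mono: "0 \<le> u \<Longrightarrow> u \<le> v \<Longrightarrow> homog_bound l u \<le> homog_bound l v"
  unfolding homog_bound_eq using p by (intro mult_right_mono power_mono) auto

lemma homog_bound_nonneg: "0 \<le> u \<Longrightarrow> 0 \<le> homog_bound l u"
  unfolding homog_bound_eq using p by (intro mult_nonneg_nonneg) auto

lemma finite_homog: "finite U \<Longrightarrow> finite (homog l U)"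
proof (induction l arbitrary: U)
  case 0
  have "homog 0 U = (\<lambda>z. ([], z)) ` U" by auto
  thus ?case using 0 by simp
next
  case (Suc l)
  have "homog (Suc l) U = (\<Union>v\<in>good U. (\<lambda>(vs, z). (v # vs, z)) ` homog l (knb (majority U v) U v))" by auto
  moreover have "finite (knb (majority U v) U v)" for v using Suc.prems unfolding knb_def by auto
  moreover have "finite (good U)" using Suc.prems unfolding good_def by auto
  ultimately show ?case using Suc.IH by auto
qed

text \<open>The hypothesis says that the smallest set from which a good vertex still has to be
  chosen is large compared with \<open>m1\<close>; hence the exponent \<open>l - 1\<close>, and no
  requirement when nothing is chosen.\<close>

lemma homog_lower:
  assumes "U \<subseteq> {0..<n}" "l = 0 \<or> 20 * real m1 \<le> card U * (p / (2 * r)) ^ (l - 1)"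
  shows "homog_bound l (card U) \<le> card (homog l U)"
  using assms
proof (induction l arbitrary: U)
  case 0
  have "homog 0 U = (\<lambda>z. ([], z)) ` U" by auto
  hence "card (homog 0 U) = card U" by (simp add: card_image inj_on_def)
  thus ?case by simp
next
  case (Suc l)
  let ?N = "real (card U)" and ?a = "p / (2 * r)"
  have finU: "finite U" using finite_subset[OF Suc.prems(1)] by simp
  have a: "0 < ?a" "?a \<le> 1" using p r2 by (auto simp: field_simps)
  have "?N * ?a ^ l \<le> ?N * 1" using a by (intro mult_left_mono power_le_one) auto
  hence big: "20 * real m1 \<le> ?N" using Suc.prems(2) by simp
  have lowc: "card (U - good U) < m1"
  proof -
    have "U - good U = {v \<in> U. card (nb U v) \<le> 3 / 4 * (real (card U) - m1) * p}" unfolding good_def by auto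
    thus ?thesis using low_degree[OF Suc.prems(1) Suc.prems(1)] big by simp
  qed
  have "card U \<le> card (good U) + card (U - good U)"
    using card_Un_le[of "good U" "U - good U"] card_mono[of "good U \<union> (U - good U)" U] finU
    unfolding good_def by (auto intro: order_trans)
  hence cg: "?N / 2 \<le> card (good U)" using lowc big by linarith
  have each: "homog_bound l (?N * ?a) \<le> card (homog l (knb (majority U v) U v))" if v: "v \<in> good U" for v
  proof -
    let ?U = "knb (majority U v) U v"
    have "?N * p / 2 \<le> 3 / 4 * (?N - m1) * p"
    proof -
      have "?N / 2 \<le> 3 / 4 * (?N - m1)" using big by (simp add: field_simps)
      hence "?N / 2 * p \<le> 3 / 4 * (?N - m1) * p" by (rule mult_right_mono) (use p in simp)
      thus ?thesis by simp
    qed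
    also have "\<dots> \<le> card (nb U v)" using v unfolding good_def by auto
    also have "\<dots> \<le> r * real (card ?U)" using majority[OF finU, of v] by (metis of_nat_le_iff of_nat_mult)
    finally have c: "?N * ?a \<le> card ?U" using r2 by (simp add: field_simps)
    have "homog_bound l (?N * ?a) \<le> homog_bound l (card ?U)" by (rule homog_bound_mono[OF mult_nonneg_nonneg c]) (use a in auto)
    also have "\<dots> \<le> card (homog l ?U)"
    proof (rule Suc.IH)
      show "?U \<subseteq> {0..<n}" using Suc.prems(1) unfolding knb_def by auto
      show "l = 0 \<or> 20 * real m1 \<le> card ?U * ?a ^ (l - 1)"
      proof (cases l)
        case (Suc l')
        have "?N * ?a ^ l = ?N * ?a * ?a ^ l'" unfolding Suc by simp
        also have "\<dots> \<le> card ?U * ?a ^ l'" using c a by (intro mult_right_mono) auto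
        finally show ?thesis using Suc.prems(2) Suc by simp
      qed simp
    qed
    finally show ?thesis .
  qed
  have "homog (Suc l) U = (\<lambda>(v, vs, z). (v # vs, z)) ` (SIGMA v:good U. homog l (knb (majority U v) U v))" by force
  moreover have "inj_on (\<lambda>(v, vs, z). (v # vs, z)) (SIGMA v:good U. homog l (knb (majority U v) U v))"
    by (auto simp: inj_on_def)
  ultimately have "card (homog (Suc l) U) = card (SIGMA v:good U. homog l (knb (majority U v) U v))"
    by (simp only: card_image)
  also have "\<dots> = (\<Sum>v\<in>good U. card (homog l (knb (majority U v) U v)))"
    using finU by (intro card_SigmaI) (auto simp: good_def knb_def intro: finite_homog)
  finally have eq: "real (card (homog (Suc l) U)) = (\<Sum>v\<in>good U. real (card (homog l (knb (majority U v) U v))))" by simp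
  have "homog_bound (Suc l) ?N = ?N / 2 * homog_bound l (?N * ?a)" by simp
  also have "\<dots> \<le> card (good U) * homog_bound l (?N * ?a)" by (rule mult_right_mono[OF cg homog_bound_nonneg[OF mult_nonneg_nonneg]]) (use a in auto)
  also have "\<dots> = (\<Sum>v\<in>good U. homog_bound l (?N * ?a))" by simp
  also have "\<dots> \<le> (\<Sum>v\<in>good U. real (card (homog l (knb (majority U v) U v))))" by (rule sum_mono) (rule each)
  finally show ?case unfolding eq .
qed

lemma homog_props:
  assumes "finite U" "(vs, z) \<in> homog l U"
  shows "length vs = l \<and> set vs \<subseteq> U \<and> z \<in> U \<and> sorted_wrt A vs \<and> (\<forall>v\<in>set vs. A v z) \<and>
    (\<exists>cs. length cs = l \<and> (\<forall>j<l. cs ! j < r \<and> K (cs ! j) (vs ! j) z \<and>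
       (\<forall>k. j < k \<and> k < l \<longrightarrow> K (cs ! j) (vs ! j) (vs ! k))))"
  using assms
proof (induction l arbitrary: U vs)
  case (Suc l)
  then obtain v ws where v: "vs = v # ws" "v \<in> good U" "(ws, z) \<in> homog l (knb (majority U v) U v)" by auto
  let ?c = "majority U v" and ?U = "knb (majority U v) U v"
  have IH: "length ws = l" "set ws \<subseteq> ?U" "z \<in> ?U" "sorted_wrt A ws" "\<forall>v\<in>set ws. A v z"
    "\<exists>cs. length cs = l \<and> (\<forall>j<l. cs ! j < r \<and> K (cs ! j) (ws ! j) z \<and>
       (\<forall>k. j < k \<and> k < l \<longrightarrow> K (cs ! j) (ws ! j) (ws ! k)))"
    using Suc.IH[of ?U ws] v(3) Suc.prems(1) unfolding knb_def by auto
  obtain cs where cs: "length cs = l" "\<forall>j<l. cs ! j < r \<and> K (cs ! j) (ws ! j) z \<and>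
       (\<forall>k. j < k \<and> k < l \<longrightarrow> K (cs ! j) (ws ! j) (ws ! k))" using IH(6) by auto
  have vK: "K ?c v u" if "u \<in> ?U" for u using that unfolding knb_def by auto
  have vU: "v \<in> U" "?c < r" using v(2) majority[OF Suc.prems(1)] unfolding good_def by auto
  have sub: "?U \<subseteq> U" unfolding knb_def by auto
  have cs': "\<forall>j<Suc l. (?c # cs) ! j < r \<and> K ((?c # cs) ! j) (vs ! j) z \<and>
       (\<forall>k. j < k \<and> k < Suc l \<longrightarrow> K ((?c # cs) ! j) (vs ! j) (vs ! k))"
  proof (intro allI impI)
    fix j assume j: "j < Suc l"
    show "(?c # cs) ! j < r \<and> K ((?c # cs) ! j) (vs ! j) z \<and>
       (\<forall>k. j < k \<and> k < Suc l \<longrightarrow> K ((?c # cs) ! j) (vs ! j) (vs ! k))"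
    proof (cases j)
      case 0
      have "K ?c v (vs ! k)" if "0 < k" "k < Suc l" for k
        using that vK IH(1,2) v(1) by (cases k) (auto intro!: vK dest: nth_mem)
      thus ?thesis using 0 vU vK IH(3) v(1) by auto
    next
      case (Suc j')
      have "K (cs ! j') (ws ! j') (vs ! k)" if "j < k" "k < Suc l" for k
        using that cs(2) Suc v(1) by (cases k) auto
      thus ?thesis using Suc cs(2) j v(1) by auto
    qed
  qed
  have "A v u" if "u \<in> ?U" for u using vK[OF that] unfolding K_def by auto
  hence "sorted_wrt A vs" "\<forall>u\<in>set vs. A u z" using IH(2-5) v(1) by auto
  moreover have "length vs = Suc l" "set vs \<subseteq> U" "z \<in> U" using IH(1-3) v(1) vU sub by auto
  moreover have "length (?c # cs) = Suc l" using cs(1) by simp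
  ultimately show ?case using cs' by blast
qed auto

definition mono_triangles :: "nat set \<Rightarrow> (nat \<times> nat \<times> nat) set" where
  "mono_triangles V = {(x, y, z). x \<in> V \<and> y \<in> V \<and> z \<in> V \<and> (\<exists>i<r. K i x y \<and> K i x z \<and> K i y z)}"

definition cliques :: "nat set \<Rightarrow> nat \<Rightarrow> nat list set" where
  "cliques S l = {ws. length ws = l \<and> set ws \<subseteq> {0..<n} \<and> sorted_wrt A ws \<and> (\<forall>w\<in>set ws. \<forall>s\<in>S. A w s)}"

lemma codegree_upper:
  assumes "S \<subseteq> {0..<n}" "1 \<le> card S" "card S \<le> r + 1"
  shows "card (cn {0..<n} S) \<le> 3 / 2 * (n * p ^ card S)"
proof -
  have "cn {0..<n} S = cn ({0..<n} - S) S" unfolding cn_def using edge_distinct by auto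
  moreover have "cnt E {S} ({0..<n} - S) = card (cn ({0..<n} - S) S)" by (subst cnt_sum) auto
  ultimately show ?thesis using CU[OF assms(2,3,1)] by simp
qed

lemma finite_cliques: "finite (cliques S l)"
  unfolding cliques_def by (rule finite_subset[OF _ finite_lists_length_eq[of "{0..<n}" l]]) auto

text \<open>Each new vertex is a common neighbour of all earlier ones, and at most
  \<open>r + 1\<close> vertices precede it, the range in which codegrees are bounded.\<close>

lemma cliques_upper:
  assumes "S \<subseteq> {0..<n}" "1 \<le> card S" "card S + l \<le> r + 2"
  shows "card (cliques S l) \<le> (\<Prod>i<l. 3 / 2 * (n * p ^ (card S + i)))"
  using assms
proof (induction l arbitrary: S)
  case 0
  have "cliques S 0 = {[]}" unfolding cliques_def by auto
  thus ?case by simp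
next
  case (Suc l)
  have finS: "finite S" using Suc.prems(2) card_ge_0_finite by force
  let ?C = "cn {0..<n} S"
  have finC: "finite ?C" unfolding cn_def by auto
  have sub: "cliques S (Suc l) \<subseteq> (\<Union>w\<in>?C. (\<lambda>ws. w # ws) ` cliques (insert w S) l)"
  proof
    fix vs assume vs: "vs \<in> cliques S (Suc l)"
    then obtain w ws where w: "vs = w # ws" unfolding cliques_def by (cases vs) auto
    have "ws \<in> cliques (insert w S) l" "w \<in> ?C" using vs unfolding cliques_def cn_def w by (auto simp: insert_commute)
    thus "vs \<in> (\<Union>w\<in>?C. (\<lambda>ws. w # ws) ` cliques (insert w S) l)" using w by auto
  qed
  have "card (cliques S (Suc l)) \<le> (\<Sum>w\<in>?C. card (cliques (insert w S) l))"
    by (rule card_le_sum_image[OF finC sub]) (rule finite_cliques)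
  hence "real (card (cliques S (Suc l))) \<le> (\<Sum>w\<in>?C. real (card (cliques (insert w S) l)))"
    by (metis of_nat_mono of_nat_sum)
  also have "\<dots> \<le> (\<Sum>w\<in>?C. (\<Prod>i<l. 3 / 2 * (n * p ^ (Suc (card S) + i))))"
  proof (rule sum_mono)
    fix w assume w: "w \<in> ?C"
    have "w \<notin> S" using w edge_distinct unfolding cn_def by auto
    hence c: "card (insert w S) = Suc (card S)" using finS by simp
    show "real (card (cliques (insert w S) l)) \<le> (\<Prod>i<l. 3 / 2 * (n * p ^ (Suc (card S) + i)))"
      using Suc.IH[of "insert w S"] Suc.prems w c unfolding cn_def by auto
  qed
  also have "\<dots> = card ?C * (\<Prod>i<l. 3 / 2 * (n * p ^ (Suc (card S) + i)))" by simp
  also have "\<dots> \<le> 3 / 2 * (n * p ^ card S) * (\<Prod>i<l. 3 / 2 * (n * p ^ (Suc (card S) + i)))"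
    using codegree_upper[OF Suc.prems(1,2)] Suc.prems(3) p by (intro mult_right_mono prod_nonneg) auto
  also have "\<dots> = (\<Prod>i<Suc l. 3 / 2 * (n * p ^ (card S + i)))" by (subst prod.lessThan_Suc_shift) simp
  finally show ?case .
qed

text \<open>Two of the \<open>r + 1\<close> colours along \<open>vs\<close> agree, at positions
  \<open>j < k\<close>, and then \<open>vs ! j\<close>, \<open>vs ! k\<close>, \<open>z\<close> span
  a monochromatic triangle. The clique is determined by \<open>j\<close>, \<open>k\<close>, this
  triangle and the list of the other \<open>r - 1\<close> vertices, which is a clique joined to the
  triangle. An upper bound for the latter turns many homogeneous cliques into many
  triangles.\<close>

lemma homog_upper:
  assumes V: "V \<subseteq> {0..<n}"
  shows "card (homog (r + 1) V) \<le> (r + 1)\<^sup>2 * card (mono_triangles V) * (\<Prod>i<r - 1. 3 / 2 * (n * p ^ (3 + i)))"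
proof -
  have finV: "finite V" using finite_subset[OF V] by simp
  have finT: "finite (mono_triangles V)" by (rule finite_subset[of _ "V \<times> V \<times> V"]) (auto simp: mono_triangles_def finV)
  let ?I = "({..r} \<times> {..r}) \<times> mono_triangles V"
  \<comment> \<open>Restores \<open>x\<close> at position \<open>j\<close> and \<open>y\<close> at
    position \<open>k\<close>; the tail is dropped at \<open>k - 1\<close> because \<open>x\<close>
    is missing from the list.\<close>
  let ?f = "\<lambda>((j, k), (x, y, z)) ws. (take j ws @ x # take (k - j - 1) (drop j ws) @ y # drop (k - 1) ws, z)"
  let ?C = "\<lambda>((j, k), (x, y, z)). cliques {x, y, z} (r - 1)"
  have sub: "homog (r + 1) V \<subseteq> (\<Union>i\<in>?I. ?f i ` ?C i)"
  proof
    fix a assume a: "a \<in> homog (r + 1) V"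
    obtain vs z where az: "a = (vs, z)" by (cases a) auto
    have H: "length vs = r + 1" "set vs \<subseteq> V" "z \<in> V" "sorted_wrt A vs" "\<forall>v\<in>set vs. A v z"
      "\<exists>cs. length cs = r + 1 \<and> (\<forall>j<r + 1. cs ! j < r \<and> K (cs ! j) (vs ! j) z \<and>
       (\<forall>k. j < k \<and> k < r + 1 \<longrightarrow> K (cs ! j) (vs ! j) (vs ! k)))"
      using homog_props[OF finV, of vs z "r + 1"] a az by auto
    obtain cs where cs: "length cs = r + 1" "\<And>j. j < r + 1 \<Longrightarrow> cs ! j < r" "\<And>j. j < r + 1 \<Longrightarrow> K (cs ! j) (vs ! j) z"
       "\<And>j k. j < k \<Longrightarrow> k < r + 1 \<Longrightarrow> K (cs ! j) (vs ! j) (vs ! k)" using H(6) by auto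
    have "card ((\<lambda>j. cs ! j) ` {..<r + 1}) \<le> card {..<r}" using cs(2) by (intro card_mono) auto
    hence "\<not> inj_on (\<lambda>j. cs ! j) {..<r + 1}" using card_image by fastforce
    then obtain j k where "j < r + 1" "k < r + 1" "j \<noteq> k" "cs ! j = cs ! k" unfolding inj_on_def by auto
    hence "\<exists>j k. j < k \<and> k < r + 1 \<and> cs ! j = cs ! k" by (metis nat_neq_iff)
    then obtain j k where jk: "j < k" "k < r + 1" "cs ! j = cs ! k" by auto
    let ?x = "vs ! j" and ?y = "vs ! k" and ?i = "cs ! j"
    have mono_triangles: "(?x, ?y, z) \<in> mono_triangles V"
      unfolding mono_triangles_def using cs(2)[of j] cs(3)[of j] cs(3)[of k] cs(4)[of j k] jk H(1-3) by auto
    define as where "as = take j vs"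
    define rest where "rest = drop (Suc j) vs"
    define bs where "bs = take (k - j - 1) rest"
    define ds where "ds = drop (Suc (k - j - 1)) rest"
    have v1: "vs = as @ ?x # rest" unfolding as_def rest_def using jk H(1) by (simp add: id_take_nth_drop)
    have "rest ! (k - j - 1) = ?y" unfolding rest_def using jk H(1) by (simp add: nth_drop)
    moreover have "k - j - 1 < length rest" unfolding rest_def using jk H(1) by simp
    ultimately have v2: "rest = bs @ ?y # ds" unfolding bs_def ds_def using id_take_nth_drop[of "k - j - 1" rest] by simp
    have la: "length as = j" unfolding as_def using jk H(1) by simp
    have lb: "length bs = k - j - 1" unfolding bs_def rest_def using jk H(1) by simp
    let ?ws = "as @ bs @ ds"
    have v: "vs = as @ ?x # bs @ ?y # ds" using v1 v2 by simp
    have "length vs = length as + length bs + length ds + 2" by (subst v) simp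
    hence lw: "length ?ws = r - 1" using H(1) by simp
    have srt: "sorted_wrt A (as @ ?x # bs @ ?y # ds)" using H(4) v by simp
    have "?ws \<in> cliques {?x, ?y, z} (r - 1)"
      unfolding cliques_def
    proof (intro CollectI conjI ballI)
      show "length ?ws = r - 1" by (rule lw)
      show "set ?ws \<subseteq> {0..<n}"
      proof -
        have "set ?ws \<subseteq> set vs" unfolding arg_cong[OF v, of set] by auto
        thus ?thesis using H(2) V by auto
      qed
      show "sorted_wrt A ?ws" using srt by (auto simp: sorted_wrt_append)
      fix w s assume w: "w \<in> set ?ws" "s \<in> {?x, ?y, z}"
      have "w \<in> set vs" using w(1) unfolding arg_cong[OF v, of set] by auto
      hence "A w z" using H(5) by auto
      moreover have "A w ?x" using w(1) srt by (auto simp: sorted_wrt_append insert_commute)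
      moreover have "A w ?y" using w(1) srt by (auto simp: sorted_wrt_append insert_commute)
      ultimately show "A w s" using w(2) by auto
    qed
    moreover have "?f ((j, k), (?x, ?y, z)) ?ws = a"
    proof -
      have "drop (k - 1) ?ws = ds" using la lb jk by simp
      thus ?thesis using az la lb v by simp
    qed
    moreover have "((j, k), (?x, ?y, z)) \<in> ?I" using jk mono_triangles by simp
    ultimately have "a \<in> ?f ((j, k), (?x, ?y, z)) ` ?C ((j, k), (?x, ?y, z))" by (auto intro!: image_eqI[of _ _ ?ws])
    thus "a \<in> (\<Union>i\<in>?I. ?f i ` ?C i)" using \<open>((j, k), (?x, ?y, z)) \<in> ?I\<close> by (rule UN_I[rotated])
  qed
  have finI: "finite ?I" using finT by simp
  have "card (homog (r + 1) V) \<le> (\<Sum>i\<in>?I. card (?C i))"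
    by (rule card_le_sum_image[OF finI sub]) (auto simp: finite_cliques split: prod.splits)
  hence "real (card (homog (r + 1) V)) \<le> (\<Sum>i\<in>?I. real (card (?C i)))" unfolding of_nat_sum[symmetric] by (rule of_nat_mono)
  also have "\<dots> \<le> (\<Sum>i\<in>?I. (\<Prod>i<r - 1. 3 / 2 * (n * p ^ (3 + i))))"
  proof (rule sum_mono)
    fix i assume i: "i \<in> ?I"
    obtain j k x y z where e: "i = ((j, k), (x, y, z))" by (cases i) auto
    have t: "(x, y, z) \<in> mono_triangles V" using i e by simp
    have "x \<noteq> y" "x \<noteq> z" "y \<noteq> z" using t edge_distinct unfolding mono_triangles_def K_def by auto
    hence c: "card {x, y, z} = 3" by simp
    have "{x, y, z} \<subseteq> {0..<n}" using t V unfolding mono_triangles_def by auto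
    thus "real (card (?C i)) \<le> (\<Prod>i<r - 1. 3 / 2 * (n * p ^ (3 + i)))"
      using cliques_upper[of "{x, y, z}" "r - 1"] c r2 unfolding e by simp
  qed
  also have "\<dots> = card ?I * (\<Prod>i<r - 1. 3 / 2 * (n * p ^ (3 + i)))" by simp
  also have "card ?I = (r + 1)\<^sup>2 * card (mono_triangles V)" by (simp add: card_cartesian_product power2_eq_square)
  finally show ?thesis by simp
qed

abbreviation \<gamma> :: real where "\<gamma> \<equiv> triangle_density r"

lemmas \<gamma> = triangle_density_bounds[OF r2]

text \<open>Homogeneous cliques carry all \<open>3 + e\<close> edges of \<open>r + 2\<close>
  vertices, extensions of a triangle the \<open>e\<close> edges outside it. Dividing the two counts
  leaves the expected order \<open>n^3 * p^3\<close>.\<close>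

lemma triangle_count:
  assumes V: "V \<subseteq> {0..<n}" "n \<le> 3 * card V" and big: "20 * real m1 \<le> card V * (p / (2 * r)) ^ r"
  shows "\<gamma> * (real n ^ 3 * p ^ 3) \<le> card (mono_triangles V)"
proof (cases "n = 0")
  case False
  define e where "e = (\<Sum>i<r - 1. 3 + i)"
  have e3: "(\<Sum>i<Suc (r + 1). i) = 3 + e"
  proof -
    obtain t where t: "r = t + 1" using r2 by (metis add.commute le_add_diff_inverse one_le_numeral order_trans)
    have "(\<Sum>i<Suc (t + 1 + 1). i) = 3 + (\<Sum>i<t. 3 + i)" by (induction t) auto
    thus ?thesis unfolding e_def t by simp
  qed
  have n0: "0 < real n" using False by simp
  have rp: "r - 1 + 3 = r + 2" using r2 by simp
  let ?T = "real (card (mono_triangles V))"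
  have pr: "(\<Prod>i<r - 1. 3 / 2 * (n * p ^ (3 + i))) = (3 / 2) ^ (r - 1) * real n ^ (r - 1) * p ^ e"
  proof -
    have "(\<Prod>i<t. 3 / 2 * (real n * p ^ (3 + i))) = (3 / 2) ^ t * real n ^ t * p ^ (\<Sum>i<t. 3 + i)" for t
      by (induction t) (simp_all add: power_add mult_ac)
    thus ?thesis unfolding e_def .
  qed
  have "(real n / 3) ^ (r + 2) * (1 / 2) ^ (r + 1) * (p / (2 * r)) ^ (3 + e) \<le> homog_bound (r + 1) (card V)"
  proof -
    have "(real n / 3) ^ (r + 2) \<le> real (card V) ^ (r + 2)" using V(2) by (intro power_mono) auto
    hence "(real n / 3) ^ (r + 2) * (1 / 2) ^ (r + 1) \<le> real (card V) ^ (r + 2) * (1 / 2) ^ (r + 1)"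
      by (rule mult_right_mono) simp
    moreover have "r + 1 + 1 = r + 2" by simp
    ultimately show ?thesis unfolding homog_bound_eq e3 using p by (simp only:) (rule mult_right_mono, auto)
  qed
  also have "\<dots> \<le> card (homog (r + 1) V)" by (rule homog_lower[OF V(1)]) (use big in simp)
  also have "\<dots> \<le> (r + 1)\<^sup>2 * ?T * ((3 / 2) ^ (r - 1) * real n ^ (r - 1) * p ^ e)"
    using homog_upper[OF V(1)] unfolding pr by simp
  finally have main: "(real n / 3) ^ (r + 2) * (1 / 2) ^ (r + 1) * (p / (2 * r)) ^ (3 + e)
      \<le> (r + 1)\<^sup>2 * ?T * ((3 / 2) ^ (r - 1) * real n ^ (r - 1) * p ^ e)" .
  define Q where "Q = real ((r + 1)\<^sup>2) * ((3 / 2) ^ (r - 1) * real n ^ (r - 1) * p ^ e)"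
  have Qpos: "0 < Q" unfolding Q_def using n0 p by simp
  have "\<gamma> * (real n ^ 3 * p ^ 3) * Q = (real n / 3) ^ (r + 2) * (1 / 2) ^ (r + 1) * (p / (2 * r)) ^ (3 + e)"
  proof -
    have g: "\<gamma> = (1 / 3) ^ (r + 2) * (1 / 2) ^ (r + 1) * (1 / (2 * r)) ^ (3 + e) * (2 / 3) ^ (r - 1) / (r + 1)\<^sup>2"
    proof -
      have "(\<Sum>i<r + 2. i) = 3 + e" unfolding e3[symmetric] by simp
      moreover have "real ((r + 1)\<^sup>2) = (real r + 1)\<^sup>2" "real (2 * r) = 2 * real r" by simp_all
      ultimately show ?thesis unfolding triangle_density_def by (simp only:)
    qed
    have r0: "real ((r + 1)\<^sup>2) \<noteq> 0" by simp
    have t1: "(2 / 3 :: real) ^ (r - 1) * (3 / 2) ^ (r - 1) = 1" by (simp add: power_mult_distrib[symmetric])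
    have t2: "real n ^ 3 * real n ^ (r - 1) = real n ^ (r + 2)" unfolding power_add[symmetric] using rp by (simp add: add.commute)
    have t3: "p ^ 3 * p ^ e = p ^ (3 + e)" by (simp add: power_add)
    have "\<gamma> * (real n ^ 3 * p ^ 3) * Q = (1 / 3) ^ (r + 2) * (1 / 2) ^ (r + 1) * (1 / (2 * r)) ^ (3 + e) *
       ((2 / 3) ^ (r - 1) * (3 / 2) ^ (r - 1)) * (real n ^ 3 * real n ^ (r - 1)) * (p ^ 3 * p ^ e)"
      unfolding g Q_def using r0 by (simp add: mult_ac)
    also have "\<dots> = (1 / 3) ^ (r + 2) * (1 / 2) ^ (r + 1) * (1 / (2 * r)) ^ (3 + e) * real n ^ (r + 2) * p ^ (3 + e)"
      unfolding t1 t2 t3 by simp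
    also have "\<dots> = (real n / 3) ^ (r + 2) * (1 / 2) ^ (r + 1) * (p / (2 * r)) ^ (3 + e)"
      by (simp add: power_divide power_mult_distrib)
    finally show ?thesis .
  qed
  also have "\<dots> \<le> ?T * Q" using main unfolding Q_def by (simp add: mult_ac)
  finally show ?thesis using Qpos by simp
qed simp

end

section \<open>A linear absorber in the sparse graph\<close>

lemma sum_card_swap:
  assumes "finite A" "finite B"
  shows "(\<Sum>a\<in>A. card {b \<in> B. R a b}) = (\<Sum>b\<in>B. card {a \<in> A. R a b})"
  using sum.swap_restrict[OF assms, of "\<lambda>_ _. 1 :: nat" R] by simp

text \<open>A uniformly random \<open>S\<close> places each triple correctly with probability at
  least \<open>1 / 8\<close>; the averaging is a double count over \<open>Pow V\<close>.\<close>

lemma bipartition_triples: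
  assumes V: "finite V" and T: "finite T" "\<And>x y z. (x, y, z) \<in> T \<Longrightarrow> x \<in> V \<and> y \<in> V \<and> z \<in> V \<and> x \<noteq> z \<and> y \<noteq> z"
  shows "\<exists>S\<subseteq>V. card T \<le> 8 * card {t \<in> T. fst t \<in> S \<and> fst (snd t) \<in> S \<and> snd (snd t) \<notin> S}"
proof (rule ccontr)
  let ?R = "\<lambda>S t. fst t \<in> S \<and> fst (snd t) \<in> S \<and> snd (snd t) \<notin> S"
  assume "\<not> ?thesis"
  hence less: "\<And>S. S \<subseteq> V \<Longrightarrow> 8 * card {t \<in> T. ?R S t} < card T" by (meson not_le)
  have many: "card (Pow V) \<le> 8 * card {S \<in> Pow V. ?R S t}" if t: "t \<in> T" for t
  proof -
    obtain x y z where t': "t = (x, y, z)" by (cases t) auto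
    have xyz: "x \<in> V" "y \<in> V" "z \<in> V" "x \<noteq> z" "y \<noteq> z" using T(2)[of x y z] t t' by auto
    let ?D = "V - {x, y, z}"
    have "Pow V \<subseteq> (\<lambda>(D, S). D \<union> S) ` (Pow {x, y, z} \<times> Pow ?D)"
    proof
      fix S assume "S \<in> Pow V"
      hence "S = (S \<inter> {x, y, z}) \<union> (S - {x, y, z})" "S - {x, y, z} \<subseteq> ?D" by auto
      thus "S \<in> (\<lambda>(D, S). D \<union> S) ` (Pow {x, y, z} \<times> Pow ?D)"
        by (intro image_eqI[of _ _ "(S \<inter> {x, y, z}, S - {x, y, z})"]) auto
    qed
    hence "card (Pow V) \<le> card (Pow {x, y, z} \<times> Pow ?D)" using V by (intro surj_card_le) auto
    also have "\<dots> = card (Pow {x, y, z}) * card (Pow ?D)" by (rule card_cartesian_product)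
    also have "\<dots> \<le> 8 * card (Pow ?D)"
    proof (rule mult_right_mono)
      have "card {x, y, z} \<le> 3" by (simp add: card_insert_if)
      hence "(2 :: nat) ^ card {x, y, z} \<le> 2 ^ 3" by (intro power_increasing) auto
      thus "card (Pow {x, y, z}) \<le> 8" by (simp add: card_Pow)
    qed simp
    also have "card (Pow ?D) \<le> card {S \<in> Pow V. ?R S t}"
    proof (rule card_inj_on_le)
      show "inj_on (\<lambda>S. insert x (insert y S)) (Pow ?D)" unfolding inj_on_def by blast
      show "(\<lambda>S. insert x (insert y S)) ` Pow ?D \<subseteq> {S \<in> Pow V. ?R S t}" using xyz t' by auto
    qed (use V in simp)
    finally show ?thesis by simp
  qed
  have "card (Pow V) * card T = (\<Sum>t\<in>T. card (Pow V))" by simp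
  also have "\<dots> \<le> (\<Sum>t\<in>T. 8 * card {S \<in> Pow V. ?R S t})" by (rule sum_mono) (rule many)
  also have "\<dots> = 8 * (\<Sum>t\<in>T. card {S \<in> Pow V. ?R S t})" by (simp add: sum_distrib_left)
  also have "(\<Sum>t\<in>T. card {S \<in> Pow V. ?R S t}) = (\<Sum>S\<in>Pow V. card {t \<in> T. ?R S t})"
    by (rule sum_card_swap[symmetric]) (use V T in auto)
  also have "8 * \<dots> = (\<Sum>S\<in>Pow V. 8 * card {t \<in> T. ?R S t})" by (simp add: sum_distrib_left)
  also have "\<dots> < (\<Sum>S\<in>Pow V. card T)" by (rule sum_strict_mono) (use V less in auto)
  finally show False by simp
qed

context sparse_graph
begin

text \<open>A bipartition puts the edges \<open>x y\<close> into \<open>S\<close> and the third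
  vertices into \<open>B0\<close>. There are at most \<open>3 / 2 * n^2 * p\<close> ordered edges,
  each with at most \<open>3 / 2 * n * p^2\<close> common neighbours, so averaging gives many heavy
  edges, and the bound on degrees gives linearly many disjoint ones. The expansion required by
  \<open>absorber\<close> comes from the upper count for pairs: \<open>m2\<close> disjoint heavy
  edges cannot have all their common neighbours in a set smaller than
  \<open>\<gamma> * n / 36\<close>.\<close>

lemma sparse_absorber:
  assumes V: "V \<subseteq> {0..<n}" "n \<le> 3 * card V" and big: "20 * real m1 \<le> card V * (p / (2 * r)) ^ r"
    and mm: "200000 * r * real m2 \<le> \<gamma>\<^sup>2 * n"
  obtains i Z B where "i < r" "Z \<subseteq> V" "B \<subseteq> V" "Z \<inter> B = {}" "\<gamma>\<^sup>2 / (50000 * r) * n \<le> card B"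
    "\<And>B'. B' \<subseteq> B \<Longrightarrow> \<exists>vs. cyc (K i) vs \<and> set vs = Z \<union> B'"
proof -
  have finV: "finite V" using finite_subset[OF V(1)] by simp
  have rpos: "0 < real r" using r2 by simp
  note g = \<gamma>
  have npos: "0 < real n"
  proof -
    have "0 < 200000 * r * real m2" using m2(2) rpos by simp
    hence "0 < \<gamma>\<^sup>2 * n" using mm by linarith
    thus ?thesis by (cases "n = 0") auto
  qed
  define \<Gamma> where "\<Gamma> = \<gamma>\<^sup>2 * n / r"
  have \<Gamma>m: "200000 * real m2 \<le> \<Gamma>" unfolding \<Gamma>_def using mm rpos by (simp add: pos_le_divide_eq mult_ac)
  have \<Gamma>1: "200000 \<le> \<Gamma>" using \<Gamma>m m2(2) by linarith
  have finT: "finite (mono_triangles V)" by (rule finite_subset[of _ "V \<times> V \<times> V"]) (auto simp: mono_triangles_def finV)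
  have triV: "x \<in> V \<and> y \<in> V \<and> z \<in> V \<and> x \<noteq> z \<and> y \<noteq> z" if "(x, y, z) \<in> mono_triangles V" for x y z
    using that edge_distinct[of x z] edge_distinct[of y z] unfolding mono_triangles_def K_def by auto
  have "\<exists>S\<subseteq>V. card (mono_triangles V) \<le> 8 * card {t \<in> mono_triangles V. fst t \<in> S \<and> fst (snd t) \<in> S \<and> snd (snd t) \<notin> S}"
    by (rule bipartition_triples[OF finV finT]) (rule triV)
  then obtain S where S: "S \<subseteq> V" "card (mono_triangles V) \<le> 8 * card {t \<in> mono_triangles V. fst t \<in> S \<and> fst (snd t) \<in> S \<and> snd (snd t) \<notin> S}"
    by (elim exE conjE)
  define T where "T = {t \<in> mono_triangles V. fst t \<in> S \<and> fst (snd t) \<in> S \<and> snd (snd t) \<notin> S}"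
  have "\<gamma> * (real n ^ 3 * p ^ 3) \<le> 8 * real (card T)"
    using triangle_count[OF V big] of_nat_mono[OF S(2), where 'a = real] unfolding T_def by simp
  hence cT: "\<gamma> / 8 * (real n ^ 3 * p ^ 3) \<le> real (card T)" by simp
  define B0 where "B0 = V - S"
  define C where "C x y = {z \<in> B0. K (c {x, y}) x z \<and> K (c {x, y}) y z}" for x y
  define PR where "PR = {(x, y). x \<in> S \<and> y \<in> S \<and> {x, y} \<in> E}"
  have finS: "finite S" using S(1) finV finite_subset by auto
  have finC: "finite (C x y)" for x y unfolding C_def B0_def using finV by auto
  have nbd: "card {y. {v, y} \<in> E} \<le> 3 / 2 * (n * p)" for v
  proof (cases "v < n")
    case True
    have "{y. {v, y} \<in> E} = cn {0..<n} {v}" unfolding cn_def using edge_vertices by (auto simp: insert_commute)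
    thus ?thesis using codegree_upper[of "{v}"] True by simp
  next
    case False
    hence "{y. {v, y} \<in> E} = {}" using edge_vertices by auto
    thus ?thesis using p by simp
  qed
  have finnb: "finite {y. {v, y} \<in> E}" for v
    by (rule finite_subset[of _ "{0..<n}"]) (use edge_vertices in auto)
  have finPR: "finite PR" by (rule finite_subset[of _ "S \<times> S"]) (auto simp: PR_def finS)
  have cPR: "card PR \<le> 3 / 2 * (real n ^ 2 * p)"
  proof -
    have "PR \<subseteq> (SIGMA v:S. {y. {v, y} \<in> E})" unfolding PR_def by auto
    hence "card PR \<le> card (SIGMA v:S. {y. {v, y} \<in> E})" using finS finnb by (intro card_mono) auto
    also have "\<dots> = (\<Sum>v\<in>S. card {y. {v, y} \<in> E})" by (rule card_SigmaI) (use finS finnb in auto)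
    finally have "real (card PR) \<le> (\<Sum>v\<in>S. real (card {y. {v, y} \<in> E}))" unfolding of_nat_sum[symmetric] by (rule of_nat_mono)
    also have "\<dots> \<le> (\<Sum>v\<in>S. 3 / 2 * (n * p))" by (rule sum_mono) (rule nbd)
    also have "\<dots> = card S * (3 / 2 * (n * p))" by simp
    also have "\<dots> \<le> n * (3 / 2 * (n * p))"
    proof (rule mult_right_mono)
      have "card S \<le> card {0..<n}" using S(1) V(1) by (intro card_mono) auto
      thus "real (card S) \<le> real n" by simp
    qed (use p in simp)
    finally show ?thesis by (simp add: power2_eq_square mult_ac)
  qed
  have cC: "card (C x y) \<le> 3 / 2 * (n * p\<^sup>2)" if "(x, y) \<in> PR" for x y
  proof -
    have xy: "x \<noteq> y" "x < n" "y < n" using that edge_distinct edge_vertices unfolding PR_def by auto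
    have "C x y \<subseteq> cn {0..<n} {x, y}" unfolding C_def cn_def K_def using edge_vertices by (auto simp: insert_commute)
    hence "card (C x y) \<le> card (cn {0..<n} {x, y})" by (rule card_mono[rotated]) (simp add: cn_def)
    moreover have "card (cn {0..<n} {x, y}) \<le> 3 / 2 * (n * p ^ 2)" using codegree_upper[of "{x, y}"] xy r2 by (simp add: power2_eq_square)
    ultimately show ?thesis by linarith
  qed
  \<comment> \<open>Edges below this threshold account for at most
    \<open>3 / 2 * \<gamma> / 24 = \<gamma> / 16\<close>, half of the triangles counted in
    \<open>cT\<close>.\<close>
  define \<theta> where "\<theta> = \<gamma> / 24"
  define H where "H = {e \<in> PR. \<theta> * (n * p\<^sup>2) \<le> card (C (fst e) (snd e))}"
  have HP: "H \<subseteq> PR" unfolding H_def by auto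
  have finH: "finite H" using finite_subset[OF HP finPR] .
  have cH: "\<gamma> / 24 * (real n ^ 2 * p) \<le> card H"
  proof -
    have "card T \<le> card (SIGMA e:PR. C (fst e) (snd e))"
    proof (rule card_inj_on_le)
      show "inj_on (\<lambda>t. ((fst t, fst (snd t)), snd (snd t))) T" unfolding inj_on_def by auto
      show "(\<lambda>t. ((fst t, fst (snd t)), snd (snd t))) ` T \<subseteq> (SIGMA e:PR. C (fst e) (snd e))"
        unfolding T_def mono_triangles_def PR_def C_def B0_def K_def by auto
    qed (use finPR finC in auto)
    also have "\<dots> = (\<Sum>e\<in>PR. card (C (fst e) (snd e)))" by (rule card_SigmaI) (use finPR finC in auto)
    finally have "real (card T) \<le> (\<Sum>e\<in>PR. real (card (C (fst e) (snd e))))" unfolding of_nat_sum[symmetric] by (rule of_nat_mono)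
    also have "\<dots> = (\<Sum>e\<in>H. real (card (C (fst e) (snd e)))) + (\<Sum>e\<in>PR - H. real (card (C (fst e) (snd e))))"
      using sum.subset_diff[OF HP finPR] by (simp add: add.commute)
    also have "\<dots> \<le> (\<Sum>e\<in>H. 3 / 2 * (n * p\<^sup>2)) + (\<Sum>e\<in>PR - H. \<theta> * (n * p\<^sup>2))"
    proof (intro add_mono sum_mono)
      fix e assume "e \<in> H"
      hence "(fst e, snd e) \<in> PR" using HP by auto
      thus "real (card (C (fst e) (snd e))) \<le> 3 / 2 * (n * p\<^sup>2)" by (rule cC)
    qed (auto simp: H_def)
    also have "\<dots> = card H * (3 / 2 * (n * p\<^sup>2)) + card (PR - H) * (\<theta> * (n * p\<^sup>2))" by simp
    also have "\<dots> \<le> card H * (3 / 2 * (n * p\<^sup>2)) + 3 / 2 * (real n ^ 2 * p) * (\<theta> * (n * p\<^sup>2))"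
    proof (intro add_left_mono mult_right_mono)
      have "card (PR - H) \<le> card PR" using finPR by (intro card_mono) auto
      thus "real (card (PR - H)) \<le> 3 / 2 * (real n ^ 2 * p)" using cPR by linarith
    qed (use g p in \<open>auto simp: \<theta>_def\<close>)
    finally have "\<gamma> / 8 * (real n ^ 3 * p ^ 3) \<le> card H * (3 / 2 * (n * p\<^sup>2)) + 3 / 2 * (real n ^ 2 * p) * (\<theta> * (n * p\<^sup>2))"
      using cT by linarith
    hence "(\<gamma> / 24 * (real n ^ 2 * p)) * (3 / 2 * (n * p\<^sup>2)) \<le> card H * (3 / 2 * (n * p\<^sup>2))"
      unfolding \<theta>_def by (simp add: algebra_simps power2_eq_square power3_eq_cube)
    moreover have "0 < 3 / 2 * (n * p\<^sup>2)" using npos p by simp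
    ultimately show ?thesis by (simp only: mult_le_cancel_right_pos)
  qed
  obtain M where M: "\<forall>\<tau>\<in>M. \<tau> \<subseteq> S \<and> card \<tau> = 2 \<and> (\<exists>e\<in>H. \<tau> = {fst e, snd e})" "pairwise disjnt M"
    "\<forall>\<tau>. \<tau> \<subseteq> S \<longrightarrow> card \<tau> = 2 \<longrightarrow> (\<exists>e\<in>H. \<tau> = {fst e, snd e}) \<longrightarrow> \<tau> \<inter> \<Union>M \<noteq> {}"
    using maximal_disjoint_family[OF finS, of 2 "\<lambda>\<tau>. \<exists>e\<in>H. \<tau> = {fst e, snd e}"] by (auto elim!: exE conjE)
  have finM: "finite M" by (rule finite_subset[of _ "Pow S"]) (use M(1) finS in auto)
  have cUM: "card (\<Union>M) \<le> 2 * card M"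
  proof -
    have "card (\<Union>M) \<le> (\<Sum>\<tau>\<in>M. card \<tau>)" by (rule card_Union_le_sum_card)
    also have "\<dots> = 2 * card M" using M(1) by simp
    finally show ?thesis .
  qed
  \<comment> \<open>\<open>144 = 24 * 6\<close>: the \<open>2 * card M\<close> vertices of the
    maximal family meet every heavy edge, and each lies in at most \<open>3 * n * p\<close> ordered
    edges.\<close>
  have cM: "\<gamma> * n / 144 \<le> card M"
  proof -
    have UM: "\<Union>M \<subseteq> S" using M(1) by auto
    have finUM: "finite (\<Union>M)" using finite_subset[OF UM finS] .
    let ?N = "\<lambda>v. {y. {v, y} \<in> E}"
    have "H \<subseteq> (\<Union>v\<in>\<Union>M. Pair v ` ?N v \<union> (\<lambda>y. (y, v)) ` ?N v)"
    proof
      fix e assume e: "e \<in> H"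
      obtain x y where xy: "e = (x, y)" by (cases e) auto
      have E': "x \<in> S" "y \<in> S" "{x, y} \<in> E" "x \<noteq> y" using e HP xy edge_distinct unfolding PR_def by auto
      have "\<exists>e\<in>H. {x, y} = {fst e, snd e}" by (rule bexI[OF _ e]) (simp add: xy)
      moreover have "{x, y} \<subseteq> S" "card {x, y} = 2" using E' by auto
      ultimately have "{x, y} \<inter> \<Union>M \<noteq> {}" using M(3) by presburger
      hence "x \<in> \<Union>M \<or> y \<in> \<Union>M" by auto
      thus "e \<in> (\<Union>v\<in>\<Union>M. Pair v ` ?N v \<union> (\<lambda>y. (y, v)) ` ?N v)"
      proof
        assume "x \<in> \<Union>M" thus ?thesis using xy E'(3) by (intro UN_I[of x]) auto
      next
        assume "y \<in> \<Union>M" thus ?thesis using xy E'(3) by (intro UN_I[of y]) (auto simp: insert_commute)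
      qed
    qed
    hence "card H \<le> card (\<Union>v\<in>\<Union>M. Pair v ` ?N v \<union> (\<lambda>y. (y, v)) ` ?N v)" using finnb by (intro card_mono finite_UN_I[OF finUM]) auto
    also have "\<dots> \<le> (\<Sum>v\<in>\<Union>M. card (Pair v ` ?N v \<union> (\<lambda>y. (y, v)) ` ?N v))" by (rule card_UN_le[OF finUM])
    also have "\<dots> \<le> (\<Sum>v\<in>\<Union>M. card (?N v) + card (?N v))"
    proof (rule sum_mono)
      fix v
      have "card (Pair v ` ?N v \<union> (\<lambda>y. (y, v)) ` ?N v) \<le> card (Pair v ` ?N v) + card ((\<lambda>y. (y, v)) ` ?N v)" by (rule card_Un_le)
      also have "\<dots> \<le> card (?N v) + card (?N v)" using finnb by (intro add_mono card_image_le) auto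
      finally show "card (Pair v ` ?N v \<union> (\<lambda>y. (y, v)) ` ?N v) \<le> card (?N v) + card (?N v)" .
    qed
    finally have "real (card H) \<le> (\<Sum>v\<in>\<Union>M. real (card (?N v) + card (?N v)))" unfolding of_nat_sum[symmetric] by (rule of_nat_mono)
    also have "\<dots> \<le> (\<Sum>v\<in>\<Union>M. 3 * (n * p))"
    proof (rule sum_mono)
      fix v show "real (card (?N v) + card (?N v)) \<le> 3 * (n * p)" using nbd[of v] by simp
    qed
    also have "\<dots> = card (\<Union>M) * (3 * (n * p))" by simp
    also have "\<dots> \<le> real (2 * card M) * (3 * (n * p))" using p by (intro mult_right_mono of_nat_mono cUM) auto
    finally have "\<gamma> / 24 * (real n ^ 2 * p) \<le> real (2 * card M) * (3 * (n * p))" using cH by linarith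
    hence "(\<gamma> * n / 144) * (n * p) \<le> card M * (n * p)" by (simp add: power2_eq_square field_simps)
    moreover have "0 < n * p" using npos p by simp
    ultimately show ?thesis by (simp only: mult_le_cancel_right_pos)
  qed
  define Mi where "Mi i = {\<tau> \<in> M. c \<tau> = i}" for i
  have MH: "\<exists>e\<in>H. \<tau> = {fst e, snd e}" if "\<tau> \<in> M" for \<tau> using M(1) that by auto
  have ME: "\<tau> \<in> E" if "\<tau> \<in> M" for \<tau> using MH[OF that] HP unfolding PR_def by auto
  have "M = (\<Union>i<r. Mi i)" unfolding Mi_def using ME col by auto
  hence "card M \<le> (\<Sum>i<r. card (Mi i))" using card_UN_le[of "{..<r}" Mi] by simp
  hence "real (card M) \<le> (\<Sum>i<r. real (card (Mi i)))" unfolding of_nat_sum[symmetric] by (rule of_nat_mono)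
  then obtain i where i: "i < r" "real (card M) \<le> r * real (card (Mi i))"
    using pigeonhole_le[of r "real (card M)" "\<lambda>i. real (card (Mi i))"] r2 by auto
  define k0 where "k0 = nat \<lfloor>\<gamma> * n / (144 * r)\<rfloor>"
  define G where "G = \<gamma> * n / r"
  have Ggam: "\<Gamma> = \<gamma> * G" unfolding \<Gamma>_def G_def by (simp add: power2_eq_square)
  have G0: "0 \<le> G" unfolding G_def using g by simp
  have GG: "\<Gamma> \<le> G" unfolding Ggam using g G0 by (simp add: mult_left_le_one_le)
  have k0: "k0 \<le> G / 144" "G / 144 - 1 < k0"
  proof -
    have "\<gamma> * n / (144 * r) = G / 144" unfolding G_def by simp
    thus "k0 \<le> G / 144" "G / 144 - 1 < k0" unfolding k0_def using G0 by (simp_all, linarith+)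
  qed
  have "k0 \<le> card (Mi i)"
  proof -
    have "G / 144 * real r \<le> real (card (Mi i)) * real r" using cM i(2) rpos unfolding G_def by (simp add: mult_ac)
    hence "G / 144 \<le> card (Mi i)" using rpos by (simp only: mult_le_cancel_right_pos)
    thus ?thesis using k0(1) by linarith
  qed
  then obtain M0 where M0: "M0 \<subseteq> Mi i" "card M0 = k0" "finite M0" using obtain_subset_with_card_n by metis
  have M0M: "\<tau> \<in> M" "c \<tau> = i" if "\<tau> \<in> M0" for \<tau> using M0(1) that unfolding Mi_def by auto
  \<comment> \<open>\<open>M\<close> consists of unordered pairs, \<open>H\<close> of ordered ones;
    \<open>f\<close> fixes an orientation, whose first vertex goes on the alternating cycle.\<close>
  define f where "f \<tau> = (SOME e. e \<in> H \<and> \<tau> = {fst e, snd e})" for \<tau>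
  have f: "f \<tau> \<in> H \<and> \<tau> = {fst (f \<tau>), snd (f \<tau>)}" if "\<tau> \<in> M0" for \<tau>
    unfolding f_def by (rule someI_ex) (rule MH[OF M0M(1)[OF that], unfolded Bex_def])
  let ?x = "\<lambda>\<tau>. fst (f \<tau>)" and ?y = "\<lambda>\<tau>. snd (f \<tau>)"
  have disj: "\<tau> = \<tau>'" if "\<tau> \<in> M0" "\<tau>' \<in> M0" "v \<in> \<tau>" "v \<in> \<tau>'" for \<tau> \<tau>' v
    using M(2) M0M(1)[OF that(1)] M0M(1)[OF that(2)] that(3,4) unfolding pairwise_def disjnt_def by auto
  have xin: "?x \<tau> \<in> \<tau>" "?y \<tau> \<in> \<tau>" if "\<tau> \<in> M0" for \<tau> using f[OF that] by blast+
  have injx: "inj_on ?x M0" by (rule inj_onI) (metis disj xin(1))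
  have injy: "inj_on ?y M0" by (rule inj_onI) (metis disj xin(2))
  have xy: "?x \<tau> \<noteq> ?y \<tau>" "?x \<tau> \<in> S" "?y \<tau> \<in> S" "{?x \<tau>, ?y \<tau>} \<in> E" if "\<tau> \<in> M0" for \<tau>
    using f[OF that] HP edge_distinct unfolding PR_def by auto
  define X where "X = ?x ` M0"
  define q where "q v = ?y (the_inv_into M0 ?x v)" for v
  have qx: "q (?x \<tau>) = ?y \<tau>" if "\<tau> \<in> M0" for \<tau> unfolding q_def by (simp add: the_inv_into_f_f[OF injx that])
  have cx: "c {?x \<tau>, ?y \<tau>} = i" if "\<tau> \<in> M0" for \<tau> using f[OF that] M0M(2)[OF that] by simp
  define Cn where "Cn v = {z \<in> B0. K i v z \<and> K i (q v) z}" for v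
  have CnC: "Cn (?x \<tau>) = C (?x \<tau>) (?y \<tau>)" if "\<tau> \<in> M0" for \<tau> unfolding Cn_def C_def qx[OF that] cx[OF that] ..
  have cX: "card X = k0" unfolding X_def using card_image[OF injx] M0(2) by simp
  \<comment> \<open>This is \<open>\<theta> * n\<close> divided by the factor \<open>3 / 2\<close>
    of the upper count; the value of \<open>a\<close> below is then forced by
    \<open>2 * n \<le> \<nu> * a\<close>.\<close>
  define \<nu> where "\<nu> = \<gamma> * n / 36"
  define a where "a = nat \<lceil>72 / \<gamma>\<rceil>"
  have a: "72 / \<gamma> \<le> a" "a \<le> 73 / \<gamma>" "1 \<le> a"
  proof -
    have g1: "1 \<le> 1 / \<gamma>" using g by simp
    have e: "72 / \<gamma> = 72 * (1 / \<gamma>)" "73 / \<gamma> = 73 * (1 / \<gamma>)" by simp_all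
    show "72 / \<gamma> \<le> a" unfolding a_def by linarith
    thus "1 \<le> a" using g1 e by (smt (verit) of_nat_le_iff of_nat_1)
    have "real a \<le> 72 / \<gamma> + 1" unfolding a_def using g1 e by linarith
    thus "a \<le> 73 / \<gamma>" using g1 e by linarith
  qed
  \<comment> \<open>With this \<open>k\<close>, cycles having fewer than \<open>k\<close> points
    contain at most half of \<open>X\<close>, and the other half exceeds the number of uncovered
    vertices.\<close>
  define k where "k = k0 div (2 * a)"
  have ka: "real k0 < (k + 1) * (2 * a)" "real k * (2 * a) \<le> k0"
  proof -
    have "k0 < (k + 1) * (2 * a)" unfolding k_def using a(3) by (metis Suc_eq_plus1 div_less_iff_less_mult lessI mult_pos_pos pos2 less_le_trans zero_less_one)
    thus "real k0 < (k + 1) * (2 * a)" by (metis of_nat_less_iff)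
    have "k * (2 * a) \<le> k0" unfolding k_def by simp
    thus "real k * (2 * a) \<le> k0" by (metis of_nat_le_iff of_nat_mult)
  qed
  have a\<Gamma>: "\<gamma> * a \<le> 73" using a(2) g(1) by (simp add: pos_le_divide_eq mult_ac)
  \<comment> \<open>\<open>21024 = 144 * 146\<close>, where 144 comes from the number of pairs and
    146 bounds \<open>2 * \<gamma> * a\<close>.\<close>
  have klow: "\<Gamma> / 21024 - 2 < k"
  proof -
    have "G / 144 - 1 < (real k + 1) * (2 * real a)" using k0(2) ka(1) by (simp add: algebra_simps)
    hence "\<gamma> * (G / 144 - 1) < \<gamma> * ((real k + 1) * (2 * real a))" using g(1) by (rule mult_strict_left_mono)
    also have "\<dots> = (real k + 1) * 2 * (\<gamma> * a)" by (simp only: mult_ac)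
    also have "\<dots> \<le> (real k + 1) * 2 * 73" by (rule mult_left_mono[OF a\<Gamma>]) simp
    finally have "\<Gamma> / 144 - \<gamma> < (real k + 1) * 146" unfolding Ggam by (simp add: algebra_simps)
    thus ?thesis using g(2) by (simp add: field_simps)
  qed
  have k2: "2 \<le> k"
  proof -
    have "2 < real k" using klow \<Gamma>1 by linarith
    thus ?thesis by simp
  qed
  have S0: "S \<subseteq> {0..<n}" "B0 \<subseteq> {0..<n}" using S(1) V(1) unfolding B0_def by auto
  obtain Z B where ZB: "Z \<inter> B = {}" "B \<subseteq> B0" "Z \<subseteq> X \<union> q ` X \<union> B0" "k \<le> card B + m2"
    "\<And>B'. B' \<subseteq> B \<Longrightarrow> \<exists>vs. cyc (K i) vs \<and> set vs = Z \<union> B'"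
  proof (rule absorber[of X B0 q "K i" Cn m2 \<nu> a k])
    show "finite X" "finite B0" unfolding X_def B0_def using M0(3) finV by auto
    show "X \<inter> B0 = {}" "q ` X \<inter> B0 = {}" unfolding X_def B0_def using xy qx by auto
    show "q ` X \<inter> X = {}"
    proof -
      have "?y \<tau> \<noteq> ?x \<tau>'" if "\<tau> \<in> M0" "\<tau>' \<in> M0" for \<tau> \<tau>'
        using disj[OF that xin(2)[OF that(1)]] xin(1)[OF that(2)] xy(1)[OF that(1)] by metis
      thus ?thesis unfolding X_def using qx by fastforce
    qed
    show "inj_on q X"
      unfolding X_def by (rule inj_onI) (use qx injy in \<open>auto dest: inj_onD\<close>)
    show "symp (K i)" by (rule K_sym)
    fix x assume "x \<in> X"
    then obtain \<tau> where t: "x = ?x \<tau>" "\<tau> \<in> M0" unfolding X_def by auto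
    show "K i x (q x)" unfolding K_def using t qx xy(4) cx by auto
  next
    fix x z assume "z \<in> Cn x" thus "z \<in> B0 \<and> K i x z \<and> K i (q x) z" unfolding Cn_def by auto
  next
    show "1 \<le> m2" by (rule m2(2))
  next
    fix S' assume S': "S' \<subseteq> X" "m2 \<le> card S'"
    let ?W = "\<Union>x\<in>S'. Cn x"
    define M1 where "M1 = {\<tau> \<in> M0. ?x \<tau> \<in> S'}"
    have xM1: "?x ` M1 = S'" using S'(1) unfolding M1_def X_def by auto
    have cM1: "card M1 = card S'" using card_image[of ?x M1] inj_on_subset[OF injx, of M1] xM1 unfolding M1_def by auto
    have M1M: "\<tau> \<in> M0" if "\<tau> \<in> M1" for \<tau> using that unfolding M1_def by auto
    have Wsub: "?W \<subseteq> B0" unfolding Cn_def by auto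
    have fam: "family n 2 M1 ?W"
      unfolding family_def
    proof (intro conjI ballI)
      fix \<tau> assume t: "\<tau> \<in> M1"
      have "\<tau> \<subseteq> S \<and> card \<tau> = 2" using M(1) M0M(1)[OF M1M[OF t]] by auto
      thus "\<tau> \<subseteq> {0..<n}" "card \<tau> = 2" using S0(1) by auto
    next
      show "pairwise disjnt M1" by (rule pairwise_subset[OF M(2)]) (use M1M M0M(1) in auto)
      show "?W \<subseteq> {0..<n}" using Wsub S0(2) by auto
      have "\<Union>M1 \<subseteq> S" using M(1) M0M(1) M1M by blast
      thus "\<Union>M1 \<inter> ?W = {}" using Wsub unfolding B0_def by blast
    qed
    have low: "\<theta> * (n * p\<^sup>2) \<le> card (cn ?W \<tau>)" if t: "\<tau> \<in> M1" for \<tau>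
    proof -
      have t0: "\<tau> \<in> M0" "?x \<tau> \<in> S'" using t unfolding M1_def by auto
      have tau: "\<tau> = {?x \<tau>, ?y \<tau>}" using f[OF t0(1)] by simp
      have "Cn (?x \<tau>) \<subseteq> cn ?W {?x \<tau>, ?y \<tau>}"
        using t0 qx[OF t0(1)] unfolding cn_def Cn_def K_def by (auto simp: insert_commute)
      hence "card (Cn (?x \<tau>)) \<le> card (cn ?W {?x \<tau>, ?y \<tau>})"
        by (rule card_mono[rotated]) (rule finite_subset[of _ B0], use Wsub finV in \<open>auto simp: cn_def B0_def\<close>)
      moreover have "\<theta> * (n * p\<^sup>2) \<le> card (Cn (?x \<tau>))" unfolding CnC[OF t0(1)] using f[OF t0(1)] unfolding H_def by auto
      ultimately show ?thesis using tau by (metis of_nat_le_iff order_trans)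
    qed
    have "card M1 * (\<theta> * (n * p\<^sup>2)) = (\<Sum>\<tau>\<in>M1. \<theta> * (n * p\<^sup>2))" by simp
    also have "\<dots> \<le> (\<Sum>\<tau>\<in>M1. real (card (cn ?W \<tau>)))" by (rule sum_mono) (rule low)
    also have "\<dots> = cnt E M1 ?W" using cnt_sum[of M1 ?W] family_finite[OF fam] by simp
    also have "\<dots> < 3 / 2 * (real (card M1) * max (real (card ?W)) z2 * p\<^sup>2)"
      by (rule U2[OF fam]) (use S'(2) m2(1) cM1 in linarith)
    finally have "(3 / 2 * real (card M1) * p\<^sup>2) * \<nu> < (3 / 2 * real (card M1) * p\<^sup>2) * max (card ?W) z2"
      unfolding \<nu>_def \<theta>_def by (simp add: mult_ac)
    moreover have "0 < 3 / 2 * real (card M1) * p\<^sup>2" using S'(2) cM1 m2(2) p by simp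
    ultimately have "\<nu> < max (real (card ?W)) z2" by (simp only: mult_less_cancel_left_pos)
    moreover have "z2 \<le> \<nu>"
    proof -
      have "real m2 \<le> 1 * (\<gamma> * n) / (200000 * 1)"
      proof -
        have "1 * real m2 \<le> real r * real m2" by (rule mult_right_mono) (use r2 in auto)
        hence "200000 * real m2 \<le> 200000 * r * real m2" by simp
        also have "\<dots> \<le> \<gamma> * (\<gamma> * n)" using mm by (simp add: power2_eq_square)
        also have "\<dots> \<le> \<gamma> * n" using g by (intro mult_left_le_one_le) auto
        finally show ?thesis by simp
      qed
      moreover have "0 \<le> \<gamma> * n" using g by simp
      ultimately show ?thesis using m2(1) unfolding \<nu>_def by linarith
    qed
    ultimately show "\<nu> \<le> card ?W" by linarith
  next
    have "\<gamma> * n / r \<le> \<gamma> * n / 1" using r2 g by (intro divide_left_mono) auto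
    hence "G \<le> \<gamma> * n" unfolding G_def by simp
    thus "real (4 * card X) \<le> \<nu>" unfolding cX \<nu>_def using k0(1) by simp
    show "0 < \<nu>" unfolding \<nu>_def using g npos by simp
    have "card B0 \<le> card {0..<n}" using S0(2) by (intro card_mono) auto
    hence "real (2 * card B0) \<le> 2 * n" by simp
    also have "\<dots> = \<nu> * (72 / \<gamma>)" unfolding \<nu>_def using g by simp
    also have "\<dots> \<le> \<nu> * a" using a(1) \<open>0 < \<nu>\<close> by (intro mult_left_mono) auto
    finally show "real (2 * card B0) \<le> \<nu> * a" .
    show "2 \<le> k" by (rule k2)
    have "a * (k - 1) + (2 * m2 * a + m2) \<le> a * k + 3 * m2 * a" using a(3) by (simp add: mult_le_mono add_mono)
    also have "\<dots> < k0"
    proof -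
      have "\<gamma> * (3 * real m2 * a) = 3 * real m2 * (\<gamma> * a)" by simp
      also have "\<dots> \<le> 3 * real m2 * 73" by (rule mult_left_mono[OF a\<Gamma>]) simp
      also have "\<dots> \<le> \<Gamma> * (219 / 200000)" using \<Gamma>m by simp
      also have "\<dots> = \<gamma> * (G * (219 / 200000))" unfolding Ggam by simp
      finally have "3 * real m2 * a \<le> G * (219 / 200000)" using g(1) by simp
      moreover have "real k * a \<le> k0 / 2" using ka(2) by simp
      moreover have "200000 \<le> G" using \<Gamma>1 GG by linarith
      ultimately have "real k * a + 3 * real m2 * a < k0" using k0(2) by linarith
      hence "real (a * k + 3 * m2 * a) < real k0" by (simp add: mult_ac)
      thus ?thesis by (simp only: of_nat_less_iff)
    qed
    finally show "a * (k - 1) + (2 * m2 * a + m2) < card X" unfolding cX .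
  qed (rule that, assumption+)
  have "\<gamma>\<^sup>2 / (50000 * r) * n \<le> card B"
  proof -
    have "\<gamma>\<^sup>2 / (50000 * r) * n = \<Gamma> / 50000" unfolding \<Gamma>_def by simp
    moreover have "real k \<le> card B + m2" using ZB(4) by (metis of_nat_le_iff of_nat_add)
    ultimately show ?thesis using klow \<Gamma>m \<Gamma>1 by linarith
  qed
  moreover have "Z \<subseteq> V"
  proof -
    have "X \<subseteq> S" "q ` X \<subseteq> S" unfolding X_def using xy qx by auto
    hence "X \<union> q ` X \<union> B0 \<subseteq> V" using S(1) unfolding B0_def by blast
    thus ?thesis using ZB(3) by (rule order_trans[rotated])
  qed
  ultimately show ?thesis using that[OF i(1) _ _ ZB(1) _ ZB(5)] ZB(2) unfolding B0_def by auto
qed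

end

section \<open>Partitioning a coloured sparse graph\<close>

definition residue :: "nat \<Rightarrow> nat \<Rightarrow> nat set" where
  "residue n j = {v \<in> {0..<n}. v mod 8 = j}"

text \<open>Subtracting 4 maps the residues 4 to 7 injectively to the residues 0 to 3.\<close>

lemma card_lower_half: "n \<le> 2 * card {v \<in> {0..<n}. v mod 8 < 4}"
proof -
  let ?V = "{v \<in> {0..<n}. v mod 8 < (4 :: nat)}"
  have "card ({0..<n} - ?V) \<le> card ?V"
  proof (rule card_inj_on_le)
    have ge: "4 \<le> v" if "v \<in> {0..<n} - ?V" for v
      using that mod_less_eq_dividend[of v 8] by (auto simp: not_less)
    show "inj_on (\<lambda>v. v - 4) ({0..<n} - ?V)" by (rule inj_onI) (metis ge le_add_diff_inverse2)
    show "(\<lambda>v. v - 4) ` ({0..<n} - ?V) \<subseteq> ?V"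
    proof
      fix u assume "u \<in> (\<lambda>v. v - 4) ` ({0..<n} - ?V)"
      then obtain v where v: "u = v - 4" "v \<in> {0..<n} - ?V" by (elim imageE)
      hence "v < n" "4 \<le> v mod 8" "4 \<le> v" using ge[OF v(2)] by auto
      moreover have "(v - 4) mod 8 < 4" if "4 \<le> v mod 8" for v :: nat
      proof -
        have e: "v - 4 = 8 * (v div 8) + (v mod 8 - 4)" using that mult_div_mod_eq[of 8 v] by linarith
        have "(v - 4) mod 8 = (v mod 8 - 4) mod 8" unfolding e by (rule mod_mult_self4)
        also have "\<dots> \<le> v mod 8 - 4" by (rule mod_less_eq_dividend)
        finally show ?thesis using that mod_less_divisor[of 8 v] by linarith
      qed
      ultimately show "u \<in> ?V" using v(1) by auto
    qed
  qed simp
  moreover have "card {0..<n} \<le> card ?V + card ({0..<n} - ?V)"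
  proof -
    have e: "?V \<union> ({0..<n} - ?V) = {0..<n}" by auto
    show ?thesis using card_Un_le[of ?V "{0..<n} - ?V"] unfolding e .
  qed
  ultimately show ?thesis by simp
qed

context sparse_graph
begin

abbreviation \<beta> :: real where "\<beta> \<equiv> absorber_density r"
abbreviation \<epsilon> :: real where "\<epsilon> \<equiv> leftover_density r"

lemmas \<beta> = absorber_density_bounds[OF r2] and \<epsilon> = leftover_density_bounds[OF r2]

text \<open>A maximal disjoint family of tuples with low codegree into \<open>W\<close> has fewer
  than \<open>k1\<close> members, since any \<open>k1\<close> of them would have too low an average.
  No such tuple survives the removal of its vertices.\<close>

lemma few_bad_tuples:
  fixes k1 b :: nat
  assumes S: "S \<subseteq> {0..<n}" and W: "W \<subseteq> {0..<n}" "S \<inter> W = {}" "card W = b"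
    and ent: "\<And>T W. family n (r + 1) T W \<Longrightarrow> card T = k1 \<Longrightarrow> card W = b \<Longrightarrow> 3 / 4 * (real (k1 * b) * p ^ (r + 1)) < cnt E T W"
  shows "\<exists>Q\<subseteq>S. card Q \<le> (r + 1) * k1 \<and>
    (\<forall>\<tau>. \<tau> \<subseteq> S - Q \<longrightarrow> card \<tau> = r + 1 \<longrightarrow> 3 / 4 * (b * p ^ (r + 1)) \<le> card (cn W \<tau>))"
proof -
  let ?h = "3 / 4 * (b * p ^ (r + 1))"
  have finS: "finite S" using finite_subset[OF S] by simp
  have r1: "1 \<le> r + 1" by simp
  obtain M where M: "\<forall>\<tau>\<in>M. \<tau> \<subseteq> S \<and> card \<tau> = r + 1 \<and> card (cn W \<tau>) \<le> ?h" "pairwise disjnt M"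
    "\<forall>\<tau>. \<tau> \<subseteq> S \<longrightarrow> card \<tau> = r + 1 \<longrightarrow> card (cn W \<tau>) \<le> ?h \<longrightarrow> \<tau> \<inter> \<Union>M \<noteq> {}"
    using maximal_disjoint_family[OF finS r1, of "\<lambda>\<tau>. card (cn W \<tau>) \<le> ?h"] by (elim exE conjE)
  have finM: "finite M" by (rule finite_subset[of _ "Pow S"]) (use M(1) finS in auto)
  have "card M < k1"
  proof (rule ccontr)
    assume "\<not> card M < k1"
    hence "k1 \<le> card M" by simp
    then obtain T where T: "T \<subseteq> M" "card T = k1" "finite T" by (rule obtain_subset_with_card_n)
    have fam: "family n (r + 1) T W"
      unfolding family_def
    proof (intro conjI ballI)
      fix \<tau> assume "\<tau> \<in> T"
      hence "\<tau> \<subseteq> S \<and> card \<tau> = r + 1" using M(1) T(1) by auto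
      thus "\<tau> \<subseteq> {0..<n}" "card \<tau> = r + 1" using S by auto
    next
      show "pairwise disjnt T" by (rule pairwise_subset[OF M(2) T(1)])
      have "\<Union>T \<subseteq> S" using M(1) T(1) by blast
      thus "\<Union>T \<inter> W = {}" using W(2) by blast
    qed (rule W(1))
    have "real (cnt E T W) = (\<Sum>\<tau>\<in>T. real (card (cn W \<tau>)))" using cnt_sum[of T W] family_finite[OF fam] by simp
    also have "\<dots> \<le> (\<Sum>\<tau>\<in>T. ?h)" by (rule sum_mono) (use M(1) T(1) in auto)
    also have "\<dots> = 3 / 4 * (real (k1 * b) * p ^ (r + 1))" using T(2) by simp
    finally show False using ent[OF fam T(2) W(3)] by linarith
  qed
  moreover have "card (\<Union>M) \<le> (r + 1) * card M"
  proof -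
    have "card (\<Union>M) \<le> (\<Sum>\<tau>\<in>M. card \<tau>)" by (rule card_Union_le_sum_card)
    also have "\<dots> = (r + 1) * card M" using M(1) by simp
    finally show ?thesis .
  qed
  ultimately have c: "card (\<Union>M) \<le> (r + 1) * k1" by (meson less_imp_le_nat mult_le_mono2 order_trans)
  have "?h \<le> card (cn W \<tau>)" if t: "\<tau> \<subseteq> S - \<Union>M" "card \<tau> = r + 1" for \<tau>
  proof (rule ccontr)
    assume "\<not> ?h \<le> card (cn W \<tau>)"
    hence "card (cn W \<tau>) \<le> ?h" by simp
    moreover have "\<tau> \<subseteq> S" using t(1) by auto
    ultimately have "\<tau> \<inter> \<Union>M \<noteq> {}" using M(3) t(2) by blast
    thus False using t(1) by auto
  qed
  thus ?thesis using c M(1) by (intro exI[of _ "\<Union>M"]) auto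
qed

lemma disjoint_family_card:
  assumes "family n 2 T U" "\<Union>T \<subseteq> X" "finite X"
  shows "2 * card T \<le> card X"
proof -
  have "card (\<Union>T) = 2 * card T" using family_card_Union[OF assms(1)] by simp
  thus ?thesis using card_mono[OF assms(3,2)] by simp
qed

lemma cycle_partition:
  fixes h \<sigma> s s' q :: real and b k1 :: nat
  assumes dense: "60 * real m1 \<le> n * (p / (2 * r)) ^ r" and mm: "200000 * r * real m2 \<le> \<gamma>\<^sup>2 * n"
    and cod: "\<And>j \<tau>. 4 \<le> j \<Longrightarrow> j < 8 \<Longrightarrow> \<tau> \<subseteq> {0..<n} - residue n j \<Longrightarrow> card \<tau> = r + 1 \<Longrightarrow> h \<le> card (cn (residue n j) \<tau>)"
    and heavy: "\<And>T U. family n (r + 1) T U \<Longrightarrow> T \<noteq> {} \<Longrightarrow> card U \<le> \<sigma> * (r + 1) * card T \<Longrightarrow> card U \<le> q \<Longrightarrow> cnt E T U < h / 2 * card T"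
    and few: "\<And>T U. family n 2 T U \<Longrightarrow> T \<noteq> {} \<Longrightarrow> card U \<le> 3 * card T \<Longrightarrow> card U \<le> 3 * q \<Longrightarrow> cnt E T U < s * card T"
    and s: "s * (r * (r + 1)\<^sup>2) \<le> h / 2" and \<sigma>: "0 < \<sigma>" and h: "0 \<le> h"
    and ent: "\<And>T W. family n (r + 1) T W \<Longrightarrow> card T = k1 \<Longrightarrow> card W = b \<Longrightarrow> 3 / 4 * (real (k1 * b) * p ^ (r + 1)) < cnt E T W"
    and q: "real ((r + 1) * k1) \<le> q" "real ((r + 1) * k1) < \<sigma> ^ 3"
    and few': "\<And>T U. family n 2 T U \<Longrightarrow> T \<noteq> {} \<Longrightarrow> card U \<le> 3 * card T \<Longrightarrow> card U \<le> 45 * r\<^sup>2 * m1 \<Longrightarrow> cnt E T U < s' * card T"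
    and s': "s' * (r * (r + 1)\<^sup>2) \<le> 3 / 4 * (b * p ^ (r + 1))"
    and b: "b \<le> \<beta> * n / 2" and eps: "100 * r * real m1 \<le> \<epsilon> * n * p"
  shows "\<exists>Cs. (\<forall>C\<in>set Cs. cc C) \<and> distinct (concat Cs) \<and> set (concat Cs) = {0..<n} \<and>
    length Cs \<le> 5 * F + 6 * r * ln (1 / \<epsilon>) + 6 * real r ^ 2 + 2"
proof -
  let ?V = "{0..<n}"
  define V1 where "V1 = {v \<in> {0..<n}. v mod 8 < 4}"
  have V1: "V1 \<subseteq> ?V" "n \<le> 2 * card V1" unfolding V1_def using card_lower_half by auto
  have rpos: "2 \<le> real r" using r2 by simp
  have en: "100 * r * real m1 \<le> \<epsilon> * n"
  proof -
    have "\<epsilon> * n * p \<le> \<epsilon> * n * 1" by (rule mult_left_mono) (use p \<epsilon> in auto)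
    thus ?thesis using eps by linarith
  qed
  have m1r: "200 * real m1 \<le> 100 * r * real m1" using rpos by (intro mult_right_mono) auto
  have big: "20 * real m1 \<le> card V1 * (p / (2 * r)) ^ r"
  proof -
    have "n * (p / (2 * r)) ^ r \<le> (3 * real (card V1)) * (p / (2 * r)) ^ r"
      by (rule mult_right_mono) (use V1(2) p in auto)
    thus ?thesis using dense by linarith
  qed
  have V13: "n \<le> 3 * card V1" using V1(2) by linarith
  obtain i Z B where ZB: "i < r" "Z \<subseteq> V1" "B \<subseteq> V1" "Z \<inter> B = {}" "\<gamma>\<^sup>2 / (50000 * r) * n \<le> card B"
    "\<And>B'. B' \<subseteq> B \<Longrightarrow> \<exists>vs. cyc (K i) vs \<and> set vs = Z \<union> B'"
    by (rule sparse_absorber[OF V1(1) V13 big mm]) blast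
  have cB: "\<beta> * n \<le> card B" using ZB(5) unfolding absorber_density_def .
  have sub: "Z \<subseteq> ?V" "B \<subseteq> ?V" using ZB(2,3) V1(1) by auto
  have finB: "finite B" using finite_subset[OF sub(2)] by simp
  have "b \<le> card B"
  proof -
    have "0 \<le> \<beta> * n" using \<beta> by simp
    hence "real b \<le> real (card B)" using b cB by linarith
    thus ?thesis by simp
  qed
  then obtain B2 where B2: "B2 \<subseteq> B" "card B2 = b" "finite B2" by (rule obtain_subset_with_card_n)
  define B1 where "B1 = B - B2"
  have B12: "B1 \<union> B2 = B" "B1 \<inter> B2 = {}" unfolding B1_def using B2(1) by auto
  have cB1: "\<beta> * n / 2 \<le> card B1"
  proof -
    have "card B = card B1 + card B2" using card_Un_disjoint[of B1 B2] B12 finB finite_Un[of B1 B2] by simp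
    thus ?thesis using cB b B2(2) by simp
  qed
  define R0 where "R0 = ?V - (Z \<union> B)"
  obtain Q where Q: "Q \<subseteq> R0" "card Q \<le> (r + 1) * k1"
    "\<And>\<tau>. \<tau> \<subseteq> R0 - Q \<Longrightarrow> card \<tau> = r + 1 \<Longrightarrow> 3 / 4 * (b * p ^ (r + 1)) \<le> card (cn B2 \<tau>)"
  proof -
    have "\<exists>Q\<subseteq>R0. card Q \<le> (r + 1) * k1 \<and>
      (\<forall>\<tau>. \<tau> \<subseteq> R0 - Q \<longrightarrow> card \<tau> = r + 1 \<longrightarrow> 3 / 4 * (b * p ^ (r + 1)) \<le> card (cn B2 \<tau>))"
      by (rule few_bad_tuples[OF _ _ _ B2(2) ent]) (use B2(1) sub in \<open>auto simp: R0_def\<close>)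
    thus thesis using that by blast
  qed
  \<comment> \<open>Even indices stand for the residues 6 and 7, odd ones for 0 to 5. The classes
    \<open>W 0\<close> and \<open>W 2\<close> are 6 and 7, \<open>W 1\<close> and \<open>W 3\<close>
    are 4 and 5, so each \<open>W j\<close> is disjoint from the part \<open>P (Suc j)\<close> that
    it connects.\<close>
  define P where "P j = {v \<in> ?V. if even j then 6 \<le> v mod 8 else v mod 8 < 6}" for j :: nat
  define W where "W j = (if j = 0 then residue n 6 else if j = 1 then residue n 4
    else if j = 2 then residue n 7 else if j = 3 then residue n 5 else {})" for j :: nat
  have Wsub: "W j \<subseteq> {v \<in> ?V. 4 \<le> v mod 8}" for j unfolding W_def residue_def by auto
  have finQ: "finite Q" using Q(1) finite_subset[of Q ?V] unfolding R0_def by auto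
  have cQ: "real (card (Q \<inter> A)) \<le> real ((r + 1) * k1)" for A
  proof -
    have "card (Q \<inter> A) \<le> card Q" using finQ by (intro card_mono) auto
    thus ?thesis using Q(2) by (simp only: of_nat_le_iff)
  qed
  have ex: "\<exists>Cs. (\<forall>C\<in>set Cs. cc C) \<and> distinct (concat Cs) \<and> (Q \<inter> P 3) \<union> (Q \<inter> P (Suc 3)) \<subseteq> set (concat Cs) \<and>
      set (concat Cs) \<subseteq> (Q \<inter> P 3) \<union> (Q \<inter> P (Suc 3)) \<union> (\<Union>i\<le>3. W i) \<and> length Cs \<le> (real 3 + 1) * F"
  proof (rule nested_cover[where J = 3 and \<sigma> = \<sigma> and h = h and s = s and q = q and W = W and P = P])
    show "P j \<inter> P (Suc j) = {}" for j unfolding P_def by auto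
    show "P (Suc (Suc j)) = P j" for j unfolding P_def by simp
    show "P j \<subseteq> {0..<n}" for j unfolding P_def by auto
    show "W j \<subseteq> P j" for j unfolding P_def W_def residue_def by auto
    show "W i \<inter> W j = {}" if "i \<le> 3" "j \<le> 3" "i \<noteq> j" for i j
      using that unfolding W_def residue_def by (auto split: if_splits)
    show "h \<le> card (cn (W j) \<tau>)" if j: "j \<le> 3" "\<tau> \<subseteq> P (Suc j)" "card \<tau> = r + 1" for j \<tau>
    proof -
      define l :: nat where "l = (if j = 0 then 6 else if j = 1 then 4 else if j = 2 then 7 else 5)"
      have l: "4 \<le> l" "l < 8" "W j = residue n l" using j(1) unfolding l_def W_def by auto
      have "P (Suc j) \<inter> W j = {}" "P (Suc j) \<subseteq> ?V" unfolding P_def W_def residue_def by auto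
      hence "\<tau> \<subseteq> {0..<n} - residue n l" using j(2) unfolding l(3)[symmetric] by blast
      thus ?thesis using cod[OF l(1,2)] j(3) unfolding l(3) by blast
    qed
    show "s * real (r * (r + 1)\<^sup>2) \<le> h / 2" by (rule s)
    show "real (card (Q \<inter> P 3)) < \<sigma> ^ 3" using cQ[of "P 3"] q(2) by linarith
    show "real (card (Q \<inter> P 3)) \<le> q" "real (card (Q \<inter> P (Suc 3))) \<le> q" using cQ q(1) order_trans by blast+
  qed (use \<sigma> h heavy few in auto)
  have QP: "(Q \<inter> P 3) \<union> (Q \<inter> P (Suc 3)) = Q" using Q(1) unfolding P_def R0_def by auto
  obtain C1 where C1: "\<forall>C\<in>set C1. cc C" "distinct (concat C1)" "Q \<subseteq> set (concat C1)"
    "set (concat C1) \<subseteq> Q \<union> (\<Union>i\<le>3. W i)" "length C1 \<le> (real 3 + 1) * F"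
    using ex unfolding QP by (elim exE conjE)
  have C1R: "set (concat C1) \<subseteq> R0"
  proof -
    have "(\<Union>i\<le>3. W i) \<subseteq> R0" using Wsub ZB(2,3) unfolding R0_def V1_def by fastforce
    thus ?thesis using C1(4) Q(1) by blast
  qed
  define R1 where "R1 = R0 - set (concat C1)"
  have R1: "R1 \<subseteq> ?V" unfolding R1_def R0_def by auto
  have finR1: "finite R1" using finite_subset[OF R1] by simp
  have step: "\<exists>C. cc C \<and> distinct C \<and> set C \<subseteq> U \<and> card U \<le> 6 * real r * card (set C)"
    if U: "U \<subseteq> R1" "\<epsilon> * n < card U" for U
  proof (rule sparse_long_cycle)
    show "U \<subseteq> ?V" using U(1) R1 by auto
    show "20 * real m1 \<le> card U" using U(2) en m1r m1(2) by linarith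
    have "\<epsilon> * n * p \<le> card U * p" by (rule mult_right_mono) (use U(2) p in auto)
    thus "100 * r * real m1 \<le> card U * p" using eps by linarith
    have "10 * r * z1 \<le> 10 * r * real m1" using m1(1) by (intro mult_left_mono) auto
    also have "\<dots> \<le> 100 * r * real m1" by (intro mult_right_mono) auto
    finally show "10 * r * z1 \<le> card U" using U(2) en by linarith
  qed
  obtain C2 where C2: "\<And>C. C \<in> set C2 \<Longrightarrow> cc C" "distinct (concat C2)" "set (concat C2) \<subseteq> R1"
    "length C2 \<le> 6 * real r * ln (1 / \<epsilon>) + 1"
    "card (R1 - set (concat C2)) \<le> \<epsilon> * n \<or> card (R1 - set (concat C2)) \<le> \<epsilon> * card R1"
    by (rule greedy_rounds_ln[where Q = cc and \<tau> = "\<epsilon> * n" and \<kappa> = "6 * real r", OF finR1 _ \<epsilon>(1,2) step]) (use rpos in auto)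
  define X where "X = R1 - set (concat C2)"
  have cX: "card X \<le> \<epsilon> * n"
  proof -
    have "card R1 \<le> card ?V" using R1 by (intro card_mono) auto
    hence "\<epsilon> * card R1 \<le> \<epsilon> * n" using \<epsilon> by (intro mult_left_mono) auto
    thus ?thesis using C2(5) unfolding X_def by linarith
  qed
  have XB1: "X \<inter> B1 = {}" "X \<subseteq> ?V" "B1 \<subseteq> ?V" using R1 sub(2) unfolding X_def R1_def R0_def B1_def by auto
  have "\<exists>Cs. (\<forall>C\<in>set Cs. cc C) \<and> distinct (concat Cs) \<and> set (concat Cs) \<subseteq> X \<union> B1 \<and>
    length Cs \<le> 6 * r\<^sup>2 \<and> card (X - set (concat Cs)) \<le> 15 * r\<^sup>2 * m1"
  proof (rule reservoir_cover[OF XB1(2,3,1)])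
    have "9 * r * real (card X) \<le> 9 * r * (\<epsilon> * n)" using cX by (intro mult_left_mono) auto
    also have "\<dots> = \<beta> * n / 2" unfolding leftover_density_def using rpos by simp
    finally have "real (9 * r * card X) \<le> card B1" using cB1 by simp
    thus "9 * r * card X \<le> card B1" by (simp only: of_nat_le_iff)
    have "\<epsilon> * n \<le> \<beta> / 36 * n" using \<epsilon>(3) by (intro mult_right_mono) auto
    hence e: "\<epsilon> * n \<le> card B1" using cB1 \<beta>(1) mult_nonneg_nonneg[of \<beta> "real n"] by simp
    show "20 * real m1 \<le> card B1" using e en m1r m1(2) by linarith
    have "4 * r * z1 \<le> 4 * r * real m1" using m1(1) by (intro mult_left_mono) auto
    also have "\<dots> < 100 * r * real m1" using rpos m1(2) by simp
    finally show "4 * r * z1 < card B1" using e en by linarith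
  qed
  then obtain C3 where C3: "\<forall>C\<in>set C3. cc C" "distinct (concat C3)" "set (concat C3) \<subseteq> X \<union> B1"
    "length C3 \<le> 6 * r\<^sup>2" "card (X - set (concat C3)) \<le> 15 * r\<^sup>2 * m1" by (elim exE conjE)
  define L where "L = X - set (concat C3)"
  have LR: "L \<subseteq> R0 - Q" using C1(3) unfolding L_def X_def R1_def by auto
  have finL: "finite L" unfolding L_def X_def using finR1 by auto
  have LB2: "L \<subseteq> ?V" "B2 \<subseteq> ?V" "L \<inter> B2 = {}" using LR B2(1) sub(2) unfolding R0_def by auto
  have "\<exists>Cs. (\<forall>C\<in>set Cs. cc C) \<and> distinct (concat Cs) \<and> L \<subseteq> set (concat Cs) \<and> set (concat Cs) \<subseteq> L \<union> B2 \<and> length Cs \<le> F"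
  proof (rule dense_cover[OF LB2 _ _ s'])
    fix \<tau> assume "\<tau> \<subseteq> L" "card \<tau> = r + 1"
    thus "3 / 4 * (b * p ^ (r + 1)) \<le> card (cn B2 \<tau>)" using Q(3) LR by auto
  next
    fix T U assume TU: "family n 2 T U" "\<Union>T \<subseteq> L" "U \<subseteq> B2" "T \<noteq> {}" "card U \<le> 3 * card T"
    have "2 * card T \<le> card L" by (rule disjoint_family_card[OF TU(1,2) finL])
    hence "card U \<le> 45 * r\<^sup>2 * m1" using TU(5) C3(5) unfolding L_def by linarith
    thus "cnt E T U < s' * card T" by (rule few'[OF TU(1,4,5)])
  qed
  then obtain C4 where C4: "\<forall>C\<in>set C4. cc C" "distinct (concat C4)" "L \<subseteq> set (concat C4)" "set (concat C4) \<subseteq> L \<union> B2" "length C4 \<le> F"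
    by (elim exE conjE)
  let ?D = "B - set (concat C3) - set (concat C4)"
  obtain vs where vs: "cyc (K i) vs" "set vs = Z \<union> ?D" using ZB(6)[of ?D] by blast
  have vsd: "distinct vs" "cc vs" using vs(1) ZB(1) unfolding cyc_def cc_def by auto
  let ?Cs = "C1 @ C2 @ C3 @ C4 @ [vs]"
  let ?S1 = "set (concat C1)" and ?S2 = "set (concat C2)" and ?S3 = "set (concat C3)" and ?S4 = "set (concat C4)"
  have R0B: "R0 \<inter> (Z \<union> B) = {}" "R0 \<union> (Z \<union> B) = ?V" unfolding R0_def using sub by auto
  have XR: "X \<subseteq> R0 - ?S1 - ?S2" "R0 - ?S1 - ?S2 \<subseteq> X" unfolding X_def R1_def by auto
  have S2: "?S2 \<subseteq> R0 - ?S1" using C2(3) unfolding R1_def .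
  have S3: "?S3 \<subseteq> X \<union> B1" by (rule C3(3))
  have LX: "L = X - ?S3" by (rule L_def)
  have S4: "?S4 \<subseteq> L \<union> B2" "L \<subseteq> ?S4" by (rule C4(4), rule C4(3))
  have B: "B1 \<subseteq> B" "B2 \<subseteq> B" "B1 \<inter> B2 = {}" using B12 by auto
  have d12: "?S1 \<inter> ?S2 = {}" using S2 by blast
  have d13: "?S1 \<inter> ?S3 = {}" using S3 XR(1) C1R R0B(1) B(1) by blast
  have d23: "?S2 \<inter> ?S3 = {}" using S3 XR(1) S2 R0B(1) B(1) by blast
  have d14: "?S1 \<inter> ?S4 = {}" using S4(1) LX XR(1) C1R R0B(1) B(2) by blast
  have d24: "?S2 \<inter> ?S4 = {}" using S4(1) LX XR(1) S2 R0B(1) B(2) by blast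
  have d34: "?S3 \<inter> ?S4 = {}" using S4(1) LX S3 XR(1) R0B(1) B by blast
  have d1v: "?S1 \<inter> set vs = {}" unfolding vs(2) using C1R R0B(1) by blast
  have d2v: "?S2 \<inter> set vs = {}" unfolding vs(2) using S2 R0B(1) by blast
  have d3v: "?S3 \<inter> set vs = {}" unfolding vs(2) using S3 XR(1) R0B(1) ZB(4) B(1) by blast
  have d4v: "?S4 \<inter> set vs = {}" unfolding vs(2) using S4(1) LX XR(1) R0B(1) ZB(4) B(2) by blast
  have "distinct (concat ?Cs)"
    using C1(2) C2(2) C3(2) C4(2) vsd(1) d12 d13 d23 d14 d24 d34 d1v d2v d3v d4v
    by (simp only: concat_append distinct_append set_append concat.simps append_Nil2 Int_Un_distrib) simp
  moreover have "set (concat ?Cs) = ?V"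
  proof
    have "?S1 \<subseteq> ?V" "?S2 \<subseteq> ?V" using C1R S2 R0B(2) by blast+
    moreover have "?S3 \<subseteq> ?V" using S3 XB1(2,3) by blast
    moreover have "?S4 \<subseteq> ?V" using S4(1) LB2 by blast
    moreover have "set vs \<subseteq> ?V" unfolding vs(2) using sub by blast
    ultimately show "set (concat ?Cs) \<subseteq> ?V" by (simp only: concat_append set_append concat.simps append_Nil2) simp
    have "R0 \<subseteq> ?S1 \<union> ?S2 \<union> ?S3 \<union> ?S4" using XR(2) LX S4(2) by blast
    moreover have "Z \<union> B \<subseteq> ?S3 \<union> ?S4 \<union> set vs" unfolding vs(2) by blast
    ultimately have "?V \<subseteq> ?S1 \<union> ?S2 \<union> ?S3 \<union> ?S4 \<union> set vs" using R0B(2) by blast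
    thus "?V \<subseteq> set (concat ?Cs)" by (simp only: concat_append set_append concat.simps append_Nil2) (simp add: Un_assoc)
  qed
  moreover have "\<forall>C\<in>set ?Cs. cc C" using C1(1) C2(1) C3(1) C4(1) vsd(2) by auto
  moreover have "length ?Cs \<le> 5 * F + 6 * r * ln (1 / \<epsilon>) + 6 * real r ^ 2 + 2"
  proof -
    have "real (length C3) \<le> 6 * real r ^ 2" using of_nat_mono[OF C3(4), where 'a = real] by simp
    thus ?thesis using C1(5) C2(4) C4(5) by simp
  qed
  ultimately show ?thesis by blast
qed

text \<open>The graph without edges is interpreted only to unfold the constants, which depend on
  \<open>r\<close> alone. With \<open>9600 \<le> r^14\<close> the logarithm \<open>\<Lambda>\<close>
  is at most \<open>(4 * r + 21) * ln r\<close>, and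
  \<open>4 * r + 21 \<le> 29 / 2 * r\<close>.\<close>

lemma F_bound: "F \<le> 115 * real r ^ 4 * ln (real r)"
proof -
  interpret G: coloured_graph "\<lambda>_ _ _. False" r
    by unfold_locales (auto simp: r2 symp_def irreflp_def)
  let ?r = "real r" and ?l = "ln (real r)"
  note l = ln_r[OF r2]
  have sq: "?r + 1 \<le> ?r ^ 2"
    using mult_right_mono[of 2 ?r ?r] l(2) unfolding power2_eq_square by linarith
  have c: "9600 * (real G.g)\<^sup>2 * real (r * (r + 1)) \<le> ?r ^ (4 * r + 21)"
  proof -
    have "(real G.g)\<^sup>2 = ?r ^ (4 * r + 4)" 
    proof -
      have "2 * (r + 1) * 2 = 4 * r + 4" by simp
      thus ?thesis unfolding G.g_def by (simp only: of_nat_power power_mult[symmetric])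
    qed
    moreover have "(9600 :: real) \<le> ?r ^ 14"
    proof -
      have "(9600 :: real) \<le> 2 ^ 14" by simp
      also have "\<dots> \<le> ?r ^ 14" using l(2) by (rule power_mono) simp
      finally show ?thesis .
    qed
    moreover have "real (r * (r + 1)) \<le> ?r ^ 3"
      using mult_left_mono[OF sq, of ?r] by (simp add: power3_eq_cube power2_eq_square algebra_simps)
    ultimately have "9600 * (real G.g)\<^sup>2 * real (r * (r + 1)) \<le> ?r ^ 14 * ?r ^ (4 * r + 4) * ?r ^ 3"
      by (simp only:) (intro mult_mono, auto)
    also have "\<dots> = ?r ^ (4 * r + 21)" by (simp flip: power_add add: algebra_simps)
    finally show ?thesis .
  qed
  have gpos: "0 < real G.g" unfolding G.g_def using r2 by simp
  have "G.\<Lambda> \<le> ln (?r ^ (4 * r + 21))"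
    unfolding G.\<Lambda>_def by (rule ln_mono[OF c]) (use gpos r2 in \<open>auto intro!: mult_pos_pos add_pos_pos\<close>)
  also have "\<dots> = (4 * ?r + 21) * ?l" using l(2) by (simp add: ln_realpow)
  also have "\<dots> \<le> (29 / 2 * ?r) * ?l" using l by (intro mult_right_mono) auto
  finally have \<Lambda>: "G.\<Lambda> \<le> 29 / 2 * ?r * ?l" .
  have r1: "1 \<le> ?r" using l(2) by simp
  have e: "?r * 2 \<le> ?r ^ 2" using mult_left_mono[OF l(2), of ?r] by (simp add: power2_eq_square)
  have e3: "?r ^ 2 * 2 \<le> ?r ^ 3" using mult_left_mono[OF l(2), of "?r ^ 2"] by (simp add: power3_eq_cube power2_eq_square)
  have "G.\<Phi> \<le> 6 * ?r ^ 2 * (29 / 2 * ?r * ?l) + (1 + (9 * ?r ^ 2 * (?r + 1) + ?r) + 1)"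
    unfolding G.\<Phi>_def using mult_left_mono[OF \<Lambda>, of "6 * ?r ^ 2"] by (simp add: algebra_simps)
  also have "\<dots> = 87 * ?r ^ 3 * ?l + (9 * ?r ^ 3 + 9 * ?r ^ 2 + ?r + 2)"
    by (simp add: power2_eq_square power3_eq_cube algebra_simps)
  also have "\<dots> \<le> 87 * ?r ^ 3 * ?l + 14 * ?r ^ 3 * (2 * ?l)"
  proof -
    have "9 * ?r ^ 3 + 9 * ?r ^ 2 + ?r + 2 \<le> 14 * ?r ^ 3 * 1" using e e3 l(2) by linarith
    also have "\<dots> \<le> 14 * ?r ^ 3 * (2 * ?l)" using l(3) r1 by (intro mult_left_mono) auto
    finally show ?thesis by (rule add_left_mono)
  qed
  finally have "G.\<Phi> \<le> 115 * ?r ^ 3 * ?l" by (simp add: mult_ac)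
  hence "?r * G.\<Phi> \<le> ?r * (115 * ?r ^ 3 * ?l)" using r1 by (intro mult_left_mono) auto
  thus ?thesis unfolding F_def by (simp add: power_def numeral_eq_Suc mult_ac)
qed

text \<open>In units of \<open>r^4 * ln r\<close> the parts contribute \<open>5 * 115\<close>,
  \<open>120\<close> and \<open>14\<close>, in total 709.\<close>

lemma cycle_count: "5 * F + 6 * r * ln (1 / \<epsilon>) + 6 * real r ^ 2 + 2 \<le> 1000 * real r ^ 4 * ln (real r)"
proof -
  let ?r = "real r" and ?l = "ln (real r)"
  note l = ln_r[OF r2]
  have e: "?r * 2 \<le> ?r ^ 2" "?r ^ 2 * 2 \<le> ?r ^ 3" "?r ^ 3 * 2 \<le> ?r ^ 4"
    using mult_left_mono[OF l(2), of ?r] mult_left_mono[OF l(2), of "?r ^ 2"] mult_left_mono[OF l(2), of "?r ^ 3"]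
    by (simp_all add: power_def numeral_eq_Suc mult_ac)
  have "6 * ?r * ln (1 / \<epsilon>) \<le> 6 * ?r * (20 * ?r ^ 2 * ?l)" by (rule mult_left_mono[OF ln_inverse_leftover[OF r2]]) simp
  also have "\<dots> = 120 * ?l * ?r ^ 3" by (simp add: power_def numeral_eq_Suc mult_ac)
  also have "\<dots> \<le> 120 * ?l * ?r ^ 4" using e(3) l by (intro mult_left_mono) auto
  finally have a: "6 * ?r * ln (1 / \<epsilon>) \<le> 120 * (?r ^ 4 * ?l)" by (simp add: mult_ac)
  have "6 * ?r ^ 2 + 2 \<le> 7 * ?r ^ 4" using e l(2) by linarith
  also have "\<dots> * 1 \<le> 7 * ?r ^ 4 * (2 * ?l)" using l(3) by (intro mult_left_mono) auto
  finally have b: "6 * ?r ^ 2 + 2 \<le> 14 * (?r ^ 4 * ?l)" by simp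
  have "0 \<le> ?r ^ 4 * ?l" using l by simp
  moreover have "F \<le> 115 * (?r ^ 4 * ?l)" using F_bound by (simp only: mult.assoc)
  moreover have "1000 * ?r ^ 4 * ?l = 1000 * (?r ^ 4 * ?l)" by simp
  ultimately show ?thesis using a b by linarith
qed

end

section \<open>The random graph at the threshold density\<close>

text \<open>A single term of the exponential series gives
  \<open>b^b / fact b \<le> exp b\<close>.\<close>

lemma binomial_exp_bound:
  assumes "1 \<le> b"
  shows "real (n choose b) \<le> (exp 1 * n / b) ^ b"
proof -
  have "real b ^ b / fact b \<le> exp (real b)"
  proof -
    have "(\<lambda>k. real b ^ k /\<^sub>R fact k) sums exp (real b)" by (rule exp_converges)
    hence s: "summable (\<lambda>k. real b ^ k /\<^sub>R fact k)" "(\<Sum>k. real b ^ k /\<^sub>R fact k) = exp (real b)"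
      by (auto simp: sums_iff)
    have "(\<Sum>k\<in>{b}. real b ^ k /\<^sub>R fact k) \<le> (\<Sum>k. real b ^ k /\<^sub>R fact k)"
      by (rule sum_le_suminf[OF s(1)]) auto
    thus ?thesis unfolding s(2) by (simp add: field_simps)
  qed
  hence f: "real b ^ b \<le> exp (real b) * fact b" by (simp add: field_simps)
  have "fact b * real (n choose b) \<le> real n ^ b"
  proof -
    have "(n choose b) * fact b \<le> n ^ b" by (rule binomial_fact_pow)
    hence "real ((n choose b) * fact b) \<le> real (n ^ b)" by (rule of_nat_mono)
    thus ?thesis by (simp add: mult.commute)
  qed
  hence "real b ^ b * (fact b * real (n choose b)) \<le> (exp (real b) * fact b) * real n ^ b"
    using f by (intro mult_mono) auto
  hence "fact b * (real b ^ b * real (n choose b)) \<le> fact b * (exp (real b) * real n ^ b)" by (simp add: mult_ac)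
  hence "real b ^ b * real (n choose b) \<le> exp (real b) * real n ^ b" by (simp only: mult_le_cancel_left_pos[OF fact_gt_zero])
  moreover have "exp (real b) = exp 1 ^ b" by (simp add: exp_of_nat_mult[symmetric])
  ultimately have "real (n choose b) * real b ^ b \<le> (exp 1 * n) ^ b" by (simp add: power_mult_distrib mult.commute)
  moreover have "0 < real b ^ b" using assms by simp
  ultimately show ?thesis by (simp add: power_divide pos_le_divide_eq)
qed

lemma card_residue:
  assumes "j < 8"
  shows "n div 8 \<le> card (residue n j)"
proof -
  have "card {..<n div 8} \<le> card (residue n j)"
  proof (rule card_inj_on_le)
    show "inj_on (\<lambda>i. 8 * i + j) {..<n div 8}" by (auto simp: inj_on_def)
    show "(\<lambda>i. 8 * i + j) ` {..<n div 8} \<subseteq> residue n j" using assms unfolding residue_def by auto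
    show "finite (residue n j)" unfolding residue_def by simp
  qed
  thus ?thesis by simp
qed

text \<open>For \<open>b \<ge> \<beta> * n / 4\<close> the logarithm of \<open>n choose b\<close> is
  at most \<open>b * ln (4 * exp 1 / \<beta>)\<close>. The factor 64 lets this use up half of the
  tail exponent, which carries \<open>1 / 32\<close>.\<close>

definition entropy_const :: "nat \<Rightarrow> real" where
  "entropy_const r = 64 * ln (4 * exp 1 / absorber_density r)"

lemma entropy_const:
  assumes r2: "2 \<le> r"
  shows "0 < entropy_const r" "(real r + 1) * (entropy_const r + 1) \<le> 2 ^ 12 * real r ^ 4"
proof -
  note b = absorber_density_bounds[OF r2] and e = leftover_density_bounds[OF r2]
  have r: "2 \<le> real r" using r2 by simp
  have e1: "exp 1 \<le> (3 :: real)" by (rule exp_le)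
  have e2: "1 \<le> exp (1 :: real)" by simp
  have "absorber_density r < 4 * exp 1" using b e2 by linarith
  hence "1 < 4 * exp 1 / absorber_density r" using b by (simp add: pos_less_divide_eq)
  thus "0 < entropy_const r" unfolding entropy_const_def by simp
  \<comment> \<open>Since \<open>4 * exp 1 \<le> 18 * r\<close>, the estimate for the leftover
    density can be reused.\<close>
  have "4 * exp 1 / absorber_density r \<le> 18 * r / absorber_density r" using e1 r b by (intro divide_right_mono) auto
  also have "\<dots> = 1 / leftover_density r" unfolding leftover_density_def by simp
  finally have "ln (4 * exp 1 / absorber_density r) \<le> ln (1 / leftover_density r)" by (rule ln_mono) (use b in simp)
  also have "\<dots> \<le> 20 * real r ^ 2 * ln (real r)" by (rule ln_inverse_leftover[OF r2])
  also have "\<dots> \<le> 20 * real r ^ 2 * real r" using ln_le_minus_one[of "real r"] r by (intro mult_left_mono) auto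
  finally have k: "entropy_const r \<le> 1280 * real r ^ 3" unfolding entropy_const_def by (simp add: power2_eq_square power3_eq_cube)
  have "1 \<le> real r ^ 3" using r by simp
  hence k': "entropy_const r + 1 \<le> 1281 * real r ^ 3" using k by linarith
  have "(real r + 1) * (entropy_const r + 1) \<le> (2 * real r) * (1281 * real r ^ 3)"
    by (rule mult_mono) (use r k' \<open>0 < entropy_const r\<close> in auto)
  also have "\<dots> = 2562 * real r ^ 4" by (simp add: power_def numeral_eq_Suc)
  also have "\<dots> \<le> 2 ^ 12 * real r ^ 4" by (intro mult_right_mono) auto
  finally show "(real r + 1) * (entropy_const r + 1) \<le> 2 ^ 12 * real r ^ 4" .
qed

text \<open>Each factor is one place where \<open>ln n\<close> has to be negligible against \<open>n p^(r + 1)\<close>, which is at least \<open>n^(1/4)\<close>.\<close>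

definition thresholds :: "nat \<Rightarrow> real set" where
  "thresholds r = {30780 * (2 * real r) ^ r, 102600000 * r / (triangle_density r)\<^sup>2, 51300 * r / leftover_density r,
     512 * (r + 2), (128 * ((real r + 1) * (entropy_const r + 1)))\<^sup>2, 1000 * (r + 5), 768 * r * (r + 1)\<^sup>2,
     256 * (r + 2) / absorber_density r, 738720 * r ^ 3 * (r + 1)\<^sup>2 / absorber_density r}"

text \<open>A single \<open>n\<close> is fixed; \<open>large\<close> replaces the passage to all
  large \<open>n\<close>, and the density assumption is raised to the power \<open>2 * r\<close> to
  avoid fractional exponents.\<close>

locale random_regime =
  fixes n r :: nat and p :: real
  assumes r2: "2 \<le> r" and p: "0 < p" "p \<le> 1" and n4: "4 \<le> n"
    and density: "(2 ^ 9 * real r ^ 5) ^ (2 * r) \<le> n * p ^ (2 * r)"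
    and large: "\<And>x. x \<in> thresholds r \<Longrightarrow> x * ln n \<le> n powr (1 / 4)"
begin

abbreviation \<beta> :: real where "\<beta> \<equiv> absorber_density r"

lemmas \<beta> = absorber_density_bounds[OF r2]

text \<open>Order of the codegree of \<open>r + 1\<close> vertices, hence of the supply of
  connectors.\<close>

definition X :: real where "X = n * p ^ (r + 1)"

lemma r: "2 \<le> real r" using r2 by simp

lemma n_pos: "0 < real n" using n4 by simp

lemma ln_n: "1 \<le> ln n"
proof -
  have "exp 1 \<le> real n" using exp_le n4 by linarith
  thus ?thesis using n_pos by (subst ln_ge_iff) auto
qed

lemma P_pos: "0 < p ^ k" "p ^ k \<le> 1" using p by (auto intro: power_le_one)

lemma density_lower: "2 ^ 36 * real r ^ 20 \<le> n * p ^ (2 * r)"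
proof -
  have "1 \<le> real r ^ 5" using r by simp
  hence C: "1 \<le> 2 ^ 9 * real r ^ 5" by simp
  have "(2 :: real) ^ 36 * real r ^ 20 = (2 ^ 9 * real r ^ 5) ^ 4" by (simp add: power_mult_distrib power_mult[symmetric])
  also have "\<dots> \<le> (2 ^ 9 * real r ^ 5) ^ (2 * r)" using r2 by (intro power_increasing C) auto
  finally show ?thesis using density by linarith
qed

lemma density_one: "1 \<le> n * p ^ (2 * r)"
proof -
  have "1 \<le> real r ^ 20" using r by simp
  hence "(1 :: real) \<le> 2 ^ 36 * real r ^ 20" by simp
  thus ?thesis using density_lower by linarith
qed

text \<open>\<open>X^(2 * r) = n^(r - 1) * (n * p^(2 * r))^(r + 1)\<close>, where the last factor is
  at least 1 and \<open>r - 1 \<ge> r / 2\<close>.\<close>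

lemma X_lower: "n powr (1 / 4) \<le> X"
proof (rule power_le_imp_le_base)
  have e: "Suc (2 * r - 1) = 2 * r" using r2 by simp
  have "(n powr (1 / 4)) ^ (2 * r) = n powr (1 / 4 * (2 * r))" using n_pos by (simp add: powr_realpow[symmetric] powr_powr)
  also have "\<dots> \<le> n powr (real (r - 1))" using n4 r2 by (intro powr_mono) auto
  also have "\<dots> = real n ^ (r - 1)" using n_pos by (simp add: powr_realpow)
  also have "\<dots> * 1 \<le> real n ^ (r - 1) * (n * p ^ (2 * r)) ^ (r + 1)"
    by (intro mult_left_mono one_le_power density_one) simp
  also have "\<dots> = real n ^ (r - 1 + (r + 1)) * p ^ (2 * r * (r + 1))" 
  proof -
    have "(n * p ^ (2 * r)) ^ (r + 1) = real n ^ (r + 1) * p ^ (2 * r * (r + 1))" unfolding power_mult_distrib power_mult[symmetric] ..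
    thus ?thesis by (simp only: power_add mult.assoc)
  qed
  also have "r - 1 + (r + 1) = 2 * r" using r2 by simp
  also have "real n ^ (2 * r) * p ^ (2 * r * (r + 1)) = X ^ (2 * r)"
    unfolding X_def power_mult_distrib by (simp only: power_mult[symmetric] mult.commute)
  finally show "(n powr (1 / 4)) ^ Suc (2 * r - 1) \<le> X ^ Suc (2 * r - 1)" unfolding e by simp
  show "0 \<le> X" unfolding X_def using p by simp
qed

lemma X_large: "x \<in> thresholds r \<Longrightarrow> x * ln n \<le> X"
  using large X_lower by (rule order_trans)

lemma X_le: "k \<le> r + 1 \<Longrightarrow> X \<le> n * p ^ k"
  unfolding X_def using p by (intro mult_left_mono power_decreasing) auto

lemma X_le_n: "X \<le> n" using X_le[of 0] by simp

lemma X_large':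
  assumes "x \<in> thresholds r" "0 \<le> x"
  shows "x \<le> X"
proof -
  have "x * 1 \<le> x * ln n" using assms(2) ln_n by (rule mult_left_mono[rotated])
  thus ?thesis using X_large[OF assms(1)] by simp
qed

lemma X_pos: "0 < X" unfolding X_def using p n_pos by simp

section \<open>Parameters at the threshold density\<close>

definition z1 :: real where "z1 = 512 * ln n / p"
definition z2 :: real where "z2 = 512 * ln n / p\<^sup>2"
text \<open>Three quarters of \<open>X / 16\<close>, as a residue class has at least
  \<open>n / 16\<close> vertices.\<close>

definition h :: real where "h = 3 * X / 64"
text \<open>Makes \<open>\<sigma> * (r + 1)\<close>, the number of vertices of \<open>W\<close> per
  tuple, equal to \<open>h / 32\<close>; their choice then costs half of the exponent gained in
  \<open>prob_crowded_heavy\<close>.\<close>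

definition \<sigma> :: real where "\<sigma> = h / (32 * (real r + 1))"
definition A :: real where "A = (real r + 1) * (entropy_const r + 1)"
definition q :: real where "q = A / p ^ (r + 1)"
text \<open>Number of disjoint tuples from which the tail bound beats the entropy of all sets of
  size \<open>b\<close>.\<close>

definition k1 :: nat where "k1 = nat \<lceil>entropy_const r / p ^ (r + 1)\<rceil>"
definition b :: nat where "b = nat \<lfloor>\<beta> * n / 2\<rfloor>"
definition s :: real where "s = h / (2 * (real r * (real r + 1)\<^sup>2))"
definition s' :: real where "s' = 3 * (b * p ^ (r + 1)) / (4 * (real r * (real r + 1)\<^sup>2))"
text \<open>Bounds three times the \<open>15 * r^2 * m1\<close> vertices left over by
  \<open>reservoir_cover\<close>.\<close>

definition q' :: real where "q' = 45 * (real r)\<^sup>2 * (z1 + 1)"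

lemma z: "0 < z1" "0 < z2" unfolding z1_def z2_def using ln_n p by auto

lemma A: "0 < A" "A \<le> 2 ^ 12 * real r ^ 4"
  unfolding A_def using entropy_const[OF r2] by auto

lemma pow_exp:
  assumes "(real t + 1) * ln n \<le> y"
  shows "real n ^ t * exp (- y) \<le> 1 / n"
proof -
  have "real n ^ t = exp (t * ln n)" using n_pos by (simp add: exp_of_nat_mult)
  hence "real n ^ t * exp (- y) = exp (t * ln n - y)" by (simp add: exp_diff exp_minus field_simps)
  also have "\<dots> \<le> exp (- ln n)" using assms by (simp add: algebra_simps)
  also have "\<dots> = 1 / n" using n_pos by (simp add: exp_minus field_simps)
  finally show ?thesis .
qed

lemma b: "\<beta> * n / 4 \<le> b" "b \<le> \<beta> * n / 2" "1 \<le> b"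
proof -
  have "256 * (r + 2) / \<beta> \<le> n" using X_large'[of "256 * (r + 2) / \<beta>"] X_le_n \<beta> unfolding thresholds_def by simp
  hence "256 * (r + 2) \<le> \<beta> * n" using \<beta> by (simp add: pos_divide_le_eq mult.commute)
  hence b4: "4 \<le> \<beta> * n" using r by simp
  show "b \<le> \<beta> * n / 2" unfolding b_def using b4 by linarith
  show "\<beta> * n / 4 \<le> b" unfolding b_def using b4 by linarith
  thus "1 \<le> b" using b4 by linarith
qed

lemma residue_lower: "j < 8 \<Longrightarrow> n / 16 \<le> card (residue n j)"
proof -
  assume j: "j < 8"
  have "512 * (real r + 2) \<le> X" using X_large'[of "512 * (r + 2)"] unfolding thresholds_def by simp
  hence "512 * (real r + 2) \<le> n" using X_le_n by linarith
  hence "real 16 \<le> real n" using r by simp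
  hence "16 \<le> n" by (simp only: of_nat_le_iff)
  hence "n \<le> 16 * (n div 8)" by linarith
  also have "\<dots> \<le> 16 * card (residue n j)" using card_residue[OF j] by simp
  finally have "real n \<le> real (16 * card (residue n j))" by (rule of_nat_mono)
  thus ?thesis by simp
qed

section \<open>Events to be excluded and their probabilities\<close>

definition dense_spot :: "nat \<Rightarrow> real \<Rightarrow> nat set set \<Rightarrow> bool" where
  "dense_spot t z E \<longleftrightarrow> (\<exists>T W. family n t T W \<and> z \<le> real (card T) \<and> 3 / 2 * (real (card T) * max (real (card W)) z * p ^ t) \<le> real (cnt E T W))"
definition sparse_spot :: "nat set set \<Rightarrow> bool" where
  "sparse_spot E \<longleftrightarrow> (\<exists>T W. family n 1 T W \<and> (z1 \<le> card T \<and> z1 \<le> card W) \<and> cnt E T W \<le> 3 / 4 * (real (card T * card W) * p ^ 1))"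
definition high_codegree :: "nat \<Rightarrow> nat set set \<Rightarrow> bool" where
  "high_codegree t E \<longleftrightarrow> (\<exists>\<tau>. \<tau> \<subseteq> {0..<n} \<and> card \<tau> = t \<and> 3 / 2 * (n * p ^ t) \<le> cnt E {\<tau>} ({0..<n} - \<tau>))"
definition low_codegree :: "nat \<Rightarrow> nat set set \<Rightarrow> bool" where
  "low_codegree j E \<longleftrightarrow> (\<exists>\<tau>. family n (r + 1) {\<tau>} (residue n j) \<and> cnt E {\<tau>} (residue n j) \<le> 3 / 4 * (card (residue n j) * p ^ (r + 1)))"
text \<open>A small \<open>W\<close> receiving too many connections per tuple. For pairs this would
  obstruct Hall's condition, for \<open>r + 1\<close>-tuples the descent between the levels.\<close>

definition crowded :: "nat \<Rightarrow> real \<Rightarrow> real \<Rightarrow> real \<Rightarrow> nat set set \<Rightarrow> bool" where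
  "crowded t \<rho> a d E \<longleftrightarrow> (\<exists>T W. family n t T W \<and> (1 \<le> card T \<and> real (card W) \<le> \<rho> * real (card T) \<and> real (card W) \<le> a) \<and> d * real (card T) \<le> real (cnt E T W))"
definition low_average :: "nat set set \<Rightarrow> bool" where
  "low_average E \<longleftrightarrow> (\<exists>T W. family n (r + 1) T W \<and> card T = k1 \<and> card W = b \<and> cnt E T W \<le> 3 / 4 * (real (k1 * b) * p ^ (r + 1)))"

lemma prob_dense_spot: "prob_Gnp n p (dense_spot 1 z1) \<le> 1 / n" "prob_Gnp n p (dense_spot 2 z2) \<le> 1 / n"
proof -
  show "prob_Gnp n p (dense_spot 1 z1) \<le> 1 / n"
    unfolding dense_spot_def by (rule prob_upper_uniform[OF n4 _ _ p]) (use p in \<open>auto simp: z1_def\<close>)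
  show "prob_Gnp n p (dense_spot 2 z2) \<le> 1 / n"
    unfolding dense_spot_def by (rule prob_upper_uniform[OF n4 _ _ p]) (use p in \<open>auto simp: z2_def\<close>)
qed

lemma prob_sparse_spot: "prob_Gnp n p sparse_spot \<le> 1 / n"
  unfolding sparse_spot_def by (rule prob_lower_uniform[OF n4 _ _ p]) (use p in \<open>auto simp: z1_def\<close>)

lemma prob_high_codegree:
  assumes "t \<le> r + 1"
  shows "prob_Gnp n p (high_codegree t) \<le> 1 / n"
proof -
  have "(real t + 1) * ln n \<le> (real r + 2) * ln n" using assms ln_n by (intro mult_right_mono) auto
  moreover have "512 * (real r + 2) * ln n \<le> X" using X_large[of "512 * (r + 2)"] unfolding thresholds_def by (simp add: algebra_simps)
  ultimately have "(real t + 1) * ln n \<le> n * p ^ t / 32" using X_le[OF assms] X_pos by linarith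
  hence "real n ^ t * exp (- (n * p ^ t / 32)) \<le> 1 / n" by (rule pow_exp)
  hence "real n ^ t * exp (- (n * p ^ t) / 32) \<le> 1 / n" by simp
  thus ?thesis unfolding high_codegree_def using prob_codegree_upper[of p n t] p by linarith
qed

lemma prob_low_codegree:
  assumes "j < 8"
  shows "prob_Gnp n p (low_codegree j) \<le> 1 / n"
proof -
  have "512 * (real r + 2) * ln n \<le> X" using X_large[of "512 * (r + 2)"] unfolding thresholds_def by (simp add: algebra_simps)
  moreover have "X / 16 \<le> card (residue n j) * p ^ (r + 1)"
    unfolding X_def using mult_right_mono[OF residue_lower[OF assms], of "p ^ (r + 1)"] p by simp
  ultimately have "(real (r + 1) + 1) * ln n \<le> card (residue n j) * p ^ (r + 1) / 32" by (simp add: algebra_simps)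
  hence "real n ^ (r + 1) * exp (- (card (residue n j) * p ^ (r + 1) / 32)) \<le> 1 / n" by (rule pow_exp)
  hence "real n ^ (r + 1) * exp (- (card (residue n j) * p ^ (r + 1)) / 32) \<le> 1 / n" by simp
  thus ?thesis unfolding low_codegree_def using prob_codegree_lower[of p n "r + 1" "residue n j"] p by linarith
qed

text \<open>With \<open>\<theta> = 1 / (2 * exp 1)\<close> the probability is
  \<open>2 powr (- d)\<close> per pair, and \<open>d * ln 2 \<ge> 9 * ln n\<close> pays for
  \<open>n^2\<close> choices of the pair, \<open>n^3\<close> choices of its three connectors and the
  desired \<open>1 / n^4\<close>.\<close>

lemma prob_crowded_pairs:
  assumes a: "a * p\<^sup>2 \<le> d / 6" and d: "18 * ln n \<le> d"
  shows "prob_Gnp n p (crowded 2 3 a d) \<le> 1 / n"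
  unfolding crowded_def
proof (rule prob_few_connectors[OF n4 _ p, where \<theta> = "1 / (2 * exp 1)"])
  have e: "exp 1 \<le> (3 :: real)" "1 \<le> exp (1 :: real)" using exp_le by auto
  have d0: "0 \<le> d" using d ln_n by linarith
  show "0 < 1 / (2 * exp (1 :: real))" by simp
  have "1 \<le> 1 * (2 * exp (1 :: real))" using e(2) by linarith
  thus "1 / (2 * exp (1 :: real)) \<le> 1" by (subst pos_divide_le_eq) auto
  have "1 / 6 * d \<le> 1 / (2 * exp 1) * d" using e d0 by (intro mult_right_mono) (auto simp: field_simps)
  thus "a * p\<^sup>2 \<le> 1 / (2 * exp 1) * d" using a by linarith
  have "1 / 2 \<le> ln (2 :: real)" using ln_r[of 2] by simp
  hence "d * (1 / 2) \<le> d * ln 2" using d0 by (rule mult_left_mono)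
  hence l: "9 * ln n \<le> d * ln 2" using d by linarith
  have "(exp 1 * (1 / (2 * exp 1))) powr d = exp (- (d * ln 2))" by (simp add: powr_def ln_div)
  also have "\<dots> * real n ^ 2 * real n powr 3 = exp (5 * ln n - d * ln 2)"
  proof -
    have "real n ^ 2 = exp (2 * ln n)" using n_pos by (simp add: exp_double)
    moreover have "real n powr 3 = exp (3 * ln n)" using n_pos by (simp add: powr_def)
    ultimately show ?thesis by (simp flip: exp_add)
  qed
  also have "\<dots> \<le> exp (- (4 * ln n))" using l by simp
  also have "\<dots> = 1 / real n ^ 4"
  proof -
    have "real n ^ 4 = exp (4 * ln n)" using n_pos exp_of_nat_mult[of 4 "ln (real n)"] by simp
    thus ?thesis by (simp add: exp_minus field_simps)
  qed
  finally show "(exp 1 * (1 / (2 * exp 1))) powr d * real n ^ 2 * real n powr 3 \<le> 1 / real n ^ 4" .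
qed simp

lemma s: "s * (r * (r + 1)\<^sup>2) = h / 2"
  unfolding s_def using r by (simp add: field_simps)

lemma s': "s' * (r * (r + 1)\<^sup>2) = 3 / 4 * (b * p ^ (r + 1))"
  unfolding s'_def using r by (simp add: field_simps)

text \<open>This step dictates the exponent in the density. The condition on \<open>q\<close> and
  \<open>s\<close> compares \<open>A * p^2 / p^(r + 1)\<close> with \<open>n * p^(r + 1)\<close>
  over a multiple of \<open>r * (r + 1)^2\<close>, so \<open>n * p^(2 * r)\<close> has to exceed a
  constant times \<open>r^7\<close>.\<close>

lemma prob_crowded_bad: "prob_Gnp n p (crowded 2 3 (3 * q) s) \<le> 1 / n"
proof (rule prob_crowded_pairs)
  let ?R = "real r * (real r + 1)\<^sup>2"
  have R: "0 < ?R" using r by simp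
  have sX: "s = 3 * X / (128 * ?R)" unfolding s_def h_def by (simp add: algebra_simps)
  have "768 * ?R * ln n \<le> X" using X_large[of "768 * r * (r + 1)\<^sup>2"] unfolding thresholds_def by (simp add: algebra_simps)
  thus "18 * ln n \<le> s" unfolding sX using R by (simp add: pos_le_divide_eq mult_ac)
  have "?R \<le> real r * (2 * real r)\<^sup>2" using r by (intro mult_left_mono power_mono) auto
  hence R4: "?R \<le> 4 * real r ^ 3" by (simp add: power2_eq_square power3_eq_cube)
  have "A * (768 * ?R) \<le> (2 ^ 12 * real r ^ 4) * (768 * (4 * real r ^ 3))"
    by (rule mult_mono) (use A R4 in auto)
  also have "\<dots> = 2 ^ 12 * 3072 * real r ^ 7" by (simp add: power_def numeral_eq_Suc)
  also have "\<dots> \<le> 2 ^ 36 * real r ^ 20" using r by (intro mult_mono power_increasing) auto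
  also have "\<dots> \<le> n * p ^ (2 * r)" by (rule density_lower)
  finally have "A * (768 * ?R) * p\<^sup>2 \<le> n * p ^ (2 * r) * p\<^sup>2" by (rule mult_right_mono) simp
  also have "\<dots> = X * p ^ (r + 1)" unfolding X_def by (simp flip: power_add add: mult_2)
  finally have "A * p\<^sup>2 * (768 * ?R) \<le> X * p ^ (r + 1)" by (simp only: mult_ac)
  hence "A * p\<^sup>2 \<le> X * p ^ (r + 1) / (768 * ?R)" using R by (simp add: pos_le_divide_eq)
  hence "3 * (A * p\<^sup>2) \<le> (s / 6) * p ^ (r + 1)" unfolding sX by simp
  thus "3 * q * p\<^sup>2 \<le> s / 6" unfolding q_def using P_pos(1)[of "r + 1"] by (simp only: times_divide_eq_right times_divide_eq_left pos_divide_le_eq mult.assoc)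
qed

lemma m_bounds: "z1 + 1 \<le> 513 * ln n / p" "z2 + 1 \<le> 513 * ln n / p\<^sup>2"
proof -
  have "1 \<le> ln n / p" "1 \<le> ln n / p\<^sup>2" using ln_n p P_pos(2)[of 2] by (simp_all add: pos_le_divide_eq)
  thus "z1 + 1 \<le> 513 * ln n / p" "z2 + 1 \<le> 513 * ln n / p\<^sup>2" unfolding z1_def z2_def by linarith+
qed

text \<open>Here the connecting sets have only order \<open>ln n / p\<close> vertices, so
  \<open>q' * p^2\<close> is at most logarithmic in \<open>n\<close>, while \<open>s'\<close> is
  linear in \<open>X\<close>.\<close>

lemma prob_crowded_lost: "prob_Gnp n p (crowded 2 3 q' s') \<le> 1 / n"
proof (rule prob_crowded_pairs)
  let ?R = "real r * (real r + 1)\<^sup>2"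
  have R: "0 < ?R" using r by simp
  have "\<beta> * X / 4 \<le> b * p ^ (r + 1)" unfolding X_def using mult_right_mono[OF b(1), of "p ^ (r + 1)"] p by simp
  hence sb: "3 * (\<beta> * X / 4) / (4 * ?R) \<le> s'" unfolding s'_def by (intro divide_right_mono mult_left_mono) (use R in auto)
  have "738720 * real r ^ 3 * (real r + 1)\<^sup>2 / \<beta> * ln n \<le> X"
    using X_large[of "738720 * r ^ 3 * (r + 1)\<^sup>2 / \<beta>"] unfolding thresholds_def by (simp add: add.commute)
  hence "738720 * real r ^ 3 * (real r + 1)\<^sup>2 * ln n \<le> \<beta> * X" using \<beta> by (simp add: pos_divide_le_eq mult_ac)
  hence "(738720 * real r ^ 2 * ln n) * ?R \<le> \<beta> * X" by (simp add: power2_eq_square power3_eq_cube mult_ac)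
  hence "738720 * real r ^ 2 * ln n * 3 / 16 \<le> 3 * (\<beta> * X / 4) / (4 * ?R)" using R by (simp add: pos_le_divide_eq mult_ac)
  hence big: "138510 * (real r ^ 2 * ln n) \<le> s'" using sb by linarith
  have "1 * ln n \<le> real r ^ 2 * ln n" using ln_n r by (intro mult_right_mono one_le_power) auto
  thus "18 * ln n \<le> s'" using big ln_n by linarith
  have "q' * p\<^sup>2 \<le> 45 * real r ^ 2 * (513 * ln n / p) * p\<^sup>2"
    unfolding q'_def by (intro mult_right_mono mult_left_mono m_bounds) auto
  also have "\<dots> = 23085 * (real r ^ 2 * ln n) * p" using p by (simp add: power2_eq_square)
  also have "\<dots> \<le> 23085 * (real r ^ 2 * ln n) * 1" using p ln_n by (intro mult_left_mono) auto
  finally show "q' * p\<^sup>2 \<le> s' / 6" using big by linarith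
qed

lemma \<sigma>_pos: "0 < \<sigma>" and h_pos: "0 < h"
  unfolding \<sigma>_def h_def using X_pos r by simp_all

text \<open>\<open>q * p^(r + 1) = A\<close> does not depend on \<open>n\<close>, while
  \<open>h\<close> is of order at least \<open>n powr (1 / 4)\<close>, so \<open>\<theta>\<close>
  may be a negative power of \<open>n\<close>. The \<open>h / 2\<close> connections per tuple then
  gain \<open>n powr (h / 16)\<close>, and the choice of \<open>W\<close> costs only
  \<open>n powr (h / 32)\<close>.\<close>

lemma prob_crowded_heavy: "prob_Gnp n p (crowded (r + 1) (\<sigma> * (r + 1)) q (h / 2)) \<le> 1 / n"
  unfolding crowded_def
proof (rule prob_few_connectors[OF n4 _ p, where \<theta> = "n powr (- 1 / 8) / exp 1"])
  show "0 < n powr (- 1 / 8) / exp 1" using n_pos by simp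
  have "real n powr (- 1 / 8) \<le> real n powr 0" using n4 by (intro powr_mono) auto
  hence "n powr (- 1 / 8) \<le> 1 * exp 1" using n_pos exp_ge_add_one_self[of "1 :: real"] by simp
  thus "n powr (- 1 / 8) / exp 1 \<le> 1" by (simp add: pos_divide_le_eq)
  have A8: "128 * A \<le> n powr (1 / 8)"
  proof (rule power2_le_imp_le)
    have "(128 * A)\<^sup>2 * 1 \<le> (128 * A)\<^sup>2 * ln n" using ln_n by (intro mult_left_mono) auto
    also have "\<dots> \<le> n powr (1 / 4)" using large[of "(128 * A)\<^sup>2"] unfolding thresholds_def A_def by simp
    also have "\<dots> = (n powr (1 / 8))\<^sup>2" using n_pos by (simp add: power2_eq_square flip: powr_add)
    finally show "(128 * A)\<^sup>2 \<le> (n powr (1 / 8))\<^sup>2" by simp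
  qed simp
  have "q * p ^ (r + 1) = A" unfolding q_def using p by simp
  also have "\<dots> \<le> n powr (- 1 / 8) * n powr (1 / 4) / 128"
  proof -
    have "n powr (- 1 / 8) * n powr (1 / 4) = n powr (1 / 8)" by (simp flip: powr_add)
    thus ?thesis using A8 by simp
  qed
  also have "\<dots> \<le> n powr (- 1 / 8) * X / 128" using X_lower by (intro divide_right_mono mult_left_mono) auto
  also have "\<dots> \<le> n powr (- 1 / 8) / exp 1 * (h / 2)"
  proof -
    have "0 \<le> n powr (- 1 / 8) * X" using X_pos by simp
    moreover have "1 / 128 \<le> (1 / exp 1) * (3 / 128 :: real)" using exp_le by (simp add: field_simps)
    ultimately have "n powr (- 1 / 8) * X * (1 / 128) \<le> n powr (- 1 / 8) * X * ((1 / exp 1) * (3 / 128))" by (rule mult_left_mono[rotated])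
    thus ?thesis unfolding h_def by simp
  qed
  finally show "q * p ^ (r + 1) \<le> n powr (- 1 / 8) / exp 1 * (h / 2)" .
  have X: "1000 * (real r + 5) \<le> X" using X_large'[of "1000 * (r + 5)"] unfolding thresholds_def by simp
  have "exp 1 * (n powr (- 1 / 8) / exp 1) = n powr (- 1 / 8)" by simp
  hence "(exp 1 * (n powr (- 1 / 8) / exp 1)) powr (h / 2) * real n ^ (r + 1) * real n powr (\<sigma> * (r + 1))
    = n powr (- 1 / 8 * (h / 2) + real (r + 1) + \<sigma> * (r + 1))"
    using n_pos by (simp only: powr_powr powr_add powr_realpow)
  also have "\<dots> \<le> n powr (- 4)"
  proof (rule powr_mono)
    have "\<sigma> * (r + 1) = h / 32" unfolding \<sigma>_def using r by (simp add: field_simps)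
    moreover have "32 * (real r + 5) \<le> h" using X r unfolding h_def by (simp add: field_simps)
    ultimately show "- 1 / 8 * (h / 2) + real (r + 1) + \<sigma> * (r + 1) \<le> - 4" by simp
  qed (use n4 in simp)
  also have "\<dots> = 1 / real n ^ 4" using n_pos by (rule powr_neg_numeral)
  finally show "(exp 1 * (n powr (- 1 / 8) / exp 1)) powr (h / 2) * real n ^ (r + 1) * real n powr (\<sigma> * (r + 1)) \<le> 1 / real n ^ 4" .
qed simp

lemma k1: "entropy_const r \<le> k1 * p ^ (r + 1)" "1 \<le> k1" "real ((r + 1) * k1) \<le> q"
proof -
  have e: "0 < entropy_const r / p ^ (r + 1)" using entropy_const[OF r2] p by simp
  have k: "entropy_const r / p ^ (r + 1) \<le> k1" "k1 \<le> entropy_const r / p ^ (r + 1) + 1" unfolding k1_def using e by linarith+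
  show "entropy_const r \<le> k1 * p ^ (r + 1)" using k(1) P_pos(1)[of "r + 1"] by (simp only: pos_divide_le_eq)
  have "0 < real k1" using e k(1) by linarith
  thus "1 \<le> k1" by simp
  have "1 \<le> 1 / p ^ (r + 1)" using P_pos[of "r + 1"] by simp
  hence "real k1 \<le> (entropy_const r + 1) / p ^ (r + 1)" using k(2) by (simp add: add_divide_distrib)
  hence "(real r + 1) * real k1 \<le> (real r + 1) * ((entropy_const r + 1) / p ^ (r + 1))" by (rule mult_left_mono) simp
  moreover have "real ((r + 1) * k1) = (real r + 1) * real k1" by (simp add: algebra_simps)
  ultimately show "real ((r + 1) * k1) \<le> q" unfolding q_def A_def by (simp only: times_divide_eq_right)
qed

text \<open>This is where \<open>n\<^sup>3 p^(4 r + 4)\<close> must be large, which for \<open>r = 2\<close> holds only because of the constant in the density.\<close>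

lemma q_less: "q < \<sigma> ^ 3"
proof -
  let ?P = "p ^ (r + 1)"
  have \<sigma>: "X / (2048 * real r) \<le> \<sigma>"
  proof -
    have "X / (2048 * real r) \<le> 3 * X / (2048 * (real r + 1))" using r X_pos by (simp add: field_simps)
    thus ?thesis unfolding \<sigma>_def h_def by simp
  qed
  have D: "(2 ^ 36 * real r ^ 20)\<^sup>2 \<le> (n * p ^ (2 * r))\<^sup>2" by (intro power_mono density_lower) simp
  have "A * (2048 * real r) ^ 3 \<le> 2 ^ 12 * real r ^ 4 * (2048 * real r) ^ 3" using A by (intro mult_right_mono) auto
  also have "\<dots> = 2 ^ 45 * real r ^ 7" by (simp add: power_def numeral_eq_Suc)
  also have "\<dots> < 2 ^ 72 * real r ^ 40" using r by (intro mult_less_le_imp_less power_increasing) auto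
  also have "\<dots> = (2 ^ 36 * real r ^ 20)\<^sup>2" by (simp add: power_mult_distrib power_mult[symmetric])
  also have "\<dots> \<le> (n * p ^ (2 * r))\<^sup>2 * 1" using D by simp
  also have "\<dots> \<le> (n * p ^ (2 * r))\<^sup>2 * (n * p ^ (2 * r))" using density_one by (intro mult_left_mono) auto
  also have "\<dots> = real n ^ 3 * p ^ (6 * r)" by (simp add: power2_eq_square power3_eq_cube flip: power_add)
  \<comment> \<open>Three descents produce the exponent \<open>4 * (r + 1)\<close>, which is at most
    \<open>6 * r\<close> from \<open>r = 2\<close> on, with equality there.\<close>
  also have "\<dots> \<le> real n ^ 3 * p ^ (4 * r + 4)" using p r2 by (intro mult_left_mono power_decreasing) auto
  also have "\<dots> = X ^ 3 * ?P"
  proof -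
    have "4 * r + 4 = (r + 1) * 3 + (r + 1)" by simp
    thus ?thesis unfolding X_def power_mult_distrib by (simp only: power_add power_mult mult.assoc)
  qed
  finally have "A * (2048 * real r) ^ 3 < X ^ 3 * ?P" .
  hence "A < X ^ 3 * ?P / (2048 * real r) ^ 3" using r by (subst pos_less_divide_eq) auto
  also have "\<dots> = (X / (2048 * real r)) ^ 3 * ?P" by (simp add: power_divide)
  also have "\<dots> \<le> \<sigma> ^ 3 * ?P" using \<sigma> X_pos r p by (intro mult_right_mono power_mono) auto
  finally show ?thesis unfolding q_def using P_pos(1)[of "r + 1"] by (simp only: pos_divide_less_eq)
qed

text \<open>Half of the tail exponent pays for the sets of size \<open>b\<close>, by the choice of
  \<open>k1\<close>; the other half pays for the \<open>(r + 1) * k1\<close> vertices of the tuples,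
  as \<open>b * p^(r + 1)\<close> exceeds a large multiple of \<open>ln n\<close>.\<close>

lemma prob_low_average: "prob_Gnp n p low_average \<le> 1 / n"
proof -
  let ?P = "p ^ (r + 1)" and ?l = "ln (4 * exp 1 / \<beta>)"
  have "exp 1 * n / b \<le> 4 * exp 1 / \<beta>"
  proof -
    have "real n \<le> 4 * b / \<beta>" using b(1) \<beta> by (simp add: pos_le_divide_eq mult.commute)
    hence "exp 1 * n \<le> exp 1 * (4 * b / \<beta>)" by (rule mult_left_mono) simp
    thus ?thesis using b(3) by (simp add: pos_divide_le_eq mult_ac)
  qed
  hence "(exp 1 * n / b) ^ b \<le> (4 * exp 1 / \<beta>) ^ b" by (rule power_mono) simp
  also have "\<dots> = exp (b * ?l)" using \<beta> by (simp add: exp_of_nat_mult)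
  finally have c: "real (n choose b) \<le> exp (b * ?l)" using binomial_exp_bound[OF b(3), of n] by linarith
  have e1: "real n ^ ((r + 1) * k1) = exp (real ((r + 1) * k1) * ln n)" using n_pos by (simp only: exp_of_nat_mult exp_ln)
  have "real n ^ ((r + 1) * k1) * real (n choose b) * exp (- (real (k1 * b) * ?P) / 32)
    \<le> exp (real ((r + 1) * k1) * ln n) * exp (b * ?l) * exp (- (real (k1 * b) * ?P) / 32)"
    unfolding e1 by (intro mult_right_mono mult_left_mono c) auto
  also have "\<dots> = exp (real ((r + 1) * k1) * ln n + b * ?l + - (real (k1 * b) * ?P) / 32)" by (simp only: exp_add)
  also have "\<dots> \<le> exp (- ln n)"
  proof -
    have "b * (64 * ?l) \<le> b * (k1 * ?P)" using k1(1) unfolding entropy_const_def by (intro mult_left_mono) auto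
    hence i1: "b * ?l \<le> real (k1 * b) * ?P / 64" by (simp add: mult_ac)
    have "\<beta> * X / 4 \<le> b * ?P" unfolding X_def using mult_right_mono[OF b(1), of ?P] p by simp
    moreover have "256 * (real r + 2) * ln n \<le> \<beta> * X"
      using X_large[of "256 * (r + 2) / \<beta>"] \<beta> unfolding thresholds_def by (simp add: pos_divide_le_eq algebra_simps)
    ultimately have "64 * ((real r + 2) * ln n) \<le> b * ?P" by linarith
    hence "k1 * (64 * ((real r + 2) * ln n)) \<le> k1 * (b * ?P)" by (rule mult_left_mono) simp
    hence i2: "real k1 * ((real r + 2) * ln n) \<le> real (k1 * b) * ?P / 64" by (simp add: mult_ac)
    have "1 * ln n \<le> real k1 * ln n" using k1(2) ln_n by (intro mult_right_mono) auto
    hence "real ((r + 1) * k1) * ln n + ln n \<le> real k1 * ((real r + 2) * ln n)" by (simp add: algebra_simps)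
    thus ?thesis using i1 i2 by simp
  qed
  also have "\<dots> = 1 / n" using n_pos by (simp add: exp_minus field_simps)
  finally show ?thesis unfolding low_average_def
    using prob_entropy_lower[of p n "r + 1" k1 b] p by linarith
qed

definition bad :: "nat set set \<Rightarrow> bool" where
  "bad E \<longleftrightarrow> dense_spot 1 z1 E \<or> dense_spot 2 z2 E \<or> sparse_spot E \<or> (\<exists>t\<in>{1..r + 1}. high_codegree t E) \<or>
     (\<exists>j\<in>{4..<8}. low_codegree j E) \<or> crowded (r + 1) (\<sigma> * (r + 1)) q (h / 2) E \<or> crowded 2 3 (3 * q) s E \<or>
     low_average E \<or> crowded 2 3 q' s' E"

text \<open>Three spots, \<open>r + 1\<close> upper codegrees, four residue classes and four further
  events, each of probability at most \<open>1 / n\<close>.\<close>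

lemma prob_bad: "prob_Gnp n p bad \<le> (r + 12) / n"
proof -
  have p': "0 \<le> p" "p \<le> 1" using p by auto
  have V: "prob_Gnp n p (\<lambda>E. P E \<or> Q E) \<le> x + y" if "prob_Gnp n p P \<le> x" "prob_Gnp n p Q \<le> y" for P Q x y
    using prob_Gnp_Un[OF p', of n P Q] that by linarith
  have bad_eq: "bad = (\<lambda>E. dense_spot 1 z1 E \<or> dense_spot 2 z2 E \<or> sparse_spot E \<or> (\<exists>t\<in>{1..r + 1}. high_codegree t E) \<or>
     (\<exists>j\<in>{4..<8}. low_codegree j E) \<or> crowded (r + 1) (\<sigma> * (r + 1)) q (h / 2) E \<or> crowded 2 3 (3 * q) s E \<or>
     low_average E \<or> crowded 2 3 q' s' E)"
    by (rule ext) (rule bad_def)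
  have hc: "prob_Gnp n p (\<lambda>E. \<exists>t\<in>{1..r + 1}. high_codegree t E) \<le> (r + 1) / n"
  proof -
    have "prob_Gnp n p (\<lambda>E. \<exists>t\<in>{1..r + 1}. high_codegree t E) \<le> (\<Sum>t\<in>{1..r + 1}. prob_Gnp n p (high_codegree t))"
      by (rule prob_Gnp_UN[OF p']) simp
    also have "\<dots> \<le> (\<Sum>t\<in>{1..r + 1}. 1 / n)" by (intro sum_mono prob_high_codegree) simp
    finally show ?thesis by simp
  qed
  have lc: "prob_Gnp n p (\<lambda>E. \<exists>j\<in>{4..<8}. low_codegree j E) \<le> 4 / n"
  proof -
    have "prob_Gnp n p (\<lambda>E. \<exists>j\<in>{4..<8}. low_codegree j E) \<le> (\<Sum>j\<in>{4..<8}. prob_Gnp n p (low_codegree j))"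
      by (rule prob_Gnp_UN[OF p']) simp
    also have "\<dots> \<le> (\<Sum>j\<in>{4..<8::nat}. 1 / n)" by (intro sum_mono prob_low_codegree) simp
    finally show ?thesis by simp
  qed
  have "prob_Gnp n p bad \<le> 1 / n + (1 / n + (1 / n + ((r + 1) / n + (4 / n + (1 / n + (1 / n + (1 / n + 1 / n)))))))"
    unfolding bad_eq
    by (rule V[OF prob_dense_spot(1) V[OF prob_dense_spot(2) V[OF prob_sparse_spot V[OF hc V[OF lc
      V[OF prob_crowded_heavy V[OF prob_crowded_bad V[OF prob_low_average prob_crowded_lost]]]]]]]])
  also have "\<dots> = (r + 12) / n" by (simp add: add_divide_distrib)
  finally show ?thesis .
qed

text \<open>The excluded events concern the uncoloured graph and quantify over all families and
  sets. They therefore also cover the sets that are constructed from the colouring, which is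
  arbitrary.\<close>

lemma good_property:
  assumes E: "E \<subseteq> all_edges n" and good: "\<not> bad E"
  shows "cycle_partition_property r (1000 * real r ^ 4 * ln (real r)) n E"
  unfolding cycle_partition_property_def
proof (intro allI impI)
  fix c :: "nat set \<Rightarrow> nat"
  assume c: "\<forall>e\<in>E. c e < r"
  have g: "\<not> dense_spot 1 z1 E" "\<not> dense_spot 2 z2 E" "\<not> sparse_spot E" "\<And>t. 1 \<le> t \<Longrightarrow> t \<le> r + 1 \<Longrightarrow> \<not> high_codegree t E"
    "\<And>j. 4 \<le> j \<Longrightarrow> j < 8 \<Longrightarrow> \<not> low_codegree j E" "\<not> crowded (r + 1) (\<sigma> * (r + 1)) q (h / 2) E"
    "\<not> crowded 2 3 (3 * q) s E" "\<not> low_average E" "\<not> crowded 2 3 q' s' E"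
    using good unfolding bad_def by auto
  interpret G: sparse_graph n r E c p z1 z2
  proof unfold_locales
    fix T W assume TW: "family n 1 T W" "z1 \<le> card T"
    show "cnt E T W < 3 / 2 * (real (card T) * max (real (card W)) z1 * p)"
    proof (rule ccontr)
      assume "\<not> ?thesis"
      hence "dense_spot 1 z1 E" unfolding dense_spot_def using TW by (intro exI[of _ T] exI[of _ W]) simp
      thus False using g(1) by simp
    qed
  next
    fix T W assume TW: "family n 2 T W" "z2 \<le> card T"
    show "cnt E T W < 3 / 2 * (real (card T) * max (real (card W)) z2 * p\<^sup>2)"
    proof (rule ccontr)
      assume "\<not> ?thesis"
      hence "dense_spot 2 z2 E" unfolding dense_spot_def using TW by (intro exI[of _ T] exI[of _ W]) simp
      thus False using g(2) by simp
    qed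
  next
    fix T W assume TW: "family n 1 T W" "z1 \<le> card T" "z1 \<le> card W"
    show "3 / 4 * (real (card T) * real (card W) * p) < cnt E T W"
    proof (rule ccontr)
      assume "\<not> ?thesis"
      hence "sparse_spot E" unfolding sparse_spot_def using TW by (intro exI[of _ T] exI[of _ W]) simp
      thus False using g(3) by simp
    qed
  next
    fix \<tau> assume t: "1 \<le> card \<tau>" "card \<tau> \<le> r + 1" "\<tau> \<subseteq> {0..<n}"
    show "cnt E {\<tau>} ({0..<n} - \<tau>) < 3 / 2 * (n * p ^ card \<tau>)"
    proof (rule ccontr)
      assume "\<not> ?thesis"
      hence "high_codegree (card \<tau>) E" unfolding high_codegree_def using t(3) by (intro exI[of _ \<tau>]) simp
      thus False using g(4)[OF t(1,2)] by simp
    qed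
  qed (use r2 E c p z in auto)
  have m1: "real G.m1 \<le> 513 * ln n / p" and m2: "real G.m2 \<le> 513 * ln n / p\<^sup>2"
    using G.m1(3) G.m2(3) m_bounds by linarith+
  note \<gamma> = triangle_density_bounds[OF r2] and \<epsilon> = leftover_density_bounds[OF r2]
  have uncrowded: "cnt E T W < d * card T"
    if "\<not> crowded t \<rho> a d E" "family n t T W" "T \<noteq> {}" "card W \<le> \<rho> * real (card T)" "card W \<le> a" for t T W and \<rho> a d :: real
  proof (rule ccontr)
    assume "\<not> ?thesis"
    moreover have "1 \<le> card T" using that(3) family_finite[OF that(2)] by (simp add: Suc_le_eq card_gt_0_iff)
    ultimately have "crowded t \<rho> a d E" unfolding crowded_def using that by (intro exI[of _ T] exI[of _ W]) simp
    thus False using that(1) by simp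
  qed
  have "\<exists>Cs. (\<forall>C\<in>set Cs. G.cc C) \<and> distinct (concat Cs) \<and> set (concat Cs) = {0..<n} \<and>
    length Cs \<le> 5 * G.F + 6 * r * ln (1 / leftover_density r) + 6 * real r ^ 2 + 2"
  proof (rule G.cycle_partition[of h \<sigma> q s k1 b s'])
    let ?R = "(2 * real r) ^ r"
    have R: "0 < ?R" using r by simp
    have "30780 * ?R * ln n \<le> X" using X_large[of "30780 * ?R"] unfolding thresholds_def by simp
    also have "\<dots> = n * p ^ r * p" unfolding X_def by simp
    finally have "30780 * ln n / p * ?R \<le> n * p ^ r" using p by (simp add: pos_divide_le_eq mult_ac)
    hence "30780 * ln n / p \<le> n * p ^ r / ?R" using R by (simp only: pos_le_divide_eq)
    also have "\<dots> = n * (p / (2 * r)) ^ r" by (simp add: power_divide)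
    finally show "60 * real G.m1 \<le> n * (p / (2 * r)) ^ r" using m1 by simp
  next
    have "102600000 * r / (triangle_density r)\<^sup>2 * ln n \<le> n * p\<^sup>2"
      using X_large[of "102600000 * r / (triangle_density r)\<^sup>2"] X_le[of 2] r2 unfolding thresholds_def by simp
    hence "102600000 * r * ln n \<le> (triangle_density r)\<^sup>2 * n * p\<^sup>2" using \<gamma> by (simp add: pos_divide_le_eq mult_ac)
    hence "102600000 * r * ln n / p\<^sup>2 \<le> (triangle_density r)\<^sup>2 * n" using p by (subst pos_divide_le_eq) auto
    moreover have "200000 * r * real G.m2 \<le> 200000 * r * (513 * ln n / p\<^sup>2)" using m2 by (rule mult_left_mono) simp
    ultimately show "200000 * r * real G.m2 \<le> (triangle_density r)\<^sup>2 * n" by simp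
  next
    fix j \<tau> assume j: "4 \<le> j" "j < 8" "\<tau> \<subseteq> {0..<n} - residue n j" "card \<tau> = r + 1"
    have fam: "family n (r + 1) {\<tau>} (residue n j)" using j(3,4) unfolding family_def residue_def by auto
    have "\<not> cnt E {\<tau>} (residue n j) \<le> 3 / 4 * (card (residue n j) * p ^ (r + 1))"
    proof
      assume "cnt E {\<tau>} (residue n j) \<le> 3 / 4 * (card (residue n j) * p ^ (r + 1))"
      hence "low_codegree j E" unfolding low_codegree_def using fam by blast
      thus False using g(5)[OF j(1,2)] by simp
    qed
    moreover have "cnt E {\<tau>} (residue n j) = card (G.cn (residue n j) \<tau>)"
      by (subst G.cnt_sum) (auto simp: residue_def)
    moreover have "X / 16 \<le> card (residue n j) * p ^ (r + 1)"
      unfolding X_def using mult_right_mono[OF residue_lower[OF j(2)], of "p ^ (r + 1)"] p by simp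
    ultimately show "h \<le> card (G.cn (residue n j) \<tau>)" unfolding h_def by simp
  next
    fix T U assume "family n (r + 1) T U" "T \<noteq> {}" "card U \<le> \<sigma> * (r + 1) * card T" "card U \<le> q"
    thus "cnt E T U < h / 2 * card T" by (intro uncrowded[OF g(6)]) auto
  next
    fix T U assume "family n 2 T U" "T \<noteq> {}" "card U \<le> 3 * card T" "card U \<le> 3 * q"
    thus "cnt E T U < s * card T" by (intro uncrowded[OF g(7)]) auto
  next
    show "s * real (r * (r + 1)\<^sup>2) \<le> h / 2" using s by simp
    show "0 < \<sigma>" by (rule \<sigma>_pos)
    show "0 \<le> h" using h_pos by simp
  next
    fix T W assume TW: "family n (r + 1) T W" "card T = k1" "card W = b"
    show "3 / 4 * (real (k1 * b) * p ^ (r + 1)) < cnt E T W"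
    proof (rule ccontr)
      assume "\<not> ?thesis"
      hence "low_average E" unfolding low_average_def using TW by (intro exI[of _ T] exI[of _ W]) simp
      thus False using g(8) by simp
    qed
  next
    show "real ((r + 1) * k1) \<le> q" by (rule k1(3))
    show "real ((r + 1) * k1) < \<sigma> ^ 3" using k1(3) q_less by linarith
  next
    fix T U assume TU: "family n 2 T U" "T \<noteq> {}" "card U \<le> 3 * card T" "card U \<le> 45 * r\<^sup>2 * G.m1"
    have "real (card U) \<le> real (45 * r\<^sup>2 * G.m1)" using TU(4) by (simp only: of_nat_le_iff)
    also have "\<dots> = 45 * (real r)\<^sup>2 * real G.m1" by simp
    also have "\<dots> \<le> q'" unfolding q'_def using G.m1(3) by (intro mult_left_mono) auto
    finally show "cnt E T U < s' * card T" using TU(1-3) by (intro uncrowded[OF g(9)]) auto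
  next
    show "s' * real (r * (r + 1)\<^sup>2) \<le> 3 / 4 * (b * p ^ (r + 1))" using s' by simp
    show "b \<le> \<beta> * n / 2" by (rule b(2))
  next
    have "51300 * r / leftover_density r * ln n \<le> n * p\<^sup>2"
      using X_large[of "51300 * r / leftover_density r"] X_le[of 2] r2 unfolding thresholds_def by simp
    hence "51300 * r * ln n \<le> leftover_density r * n * p * p" using \<epsilon> by (simp add: pos_divide_le_eq power2_eq_square mult_ac)
    hence "51300 * r * ln n / p \<le> leftover_density r * n * p" using p by (subst pos_divide_le_eq) auto
    moreover have "100 * r * real G.m1 \<le> 100 * r * (513 * ln n / p)" using m1 by (rule mult_left_mono) simp
    ultimately show "100 * r * real G.m1 \<le> leftover_density r * n * p" by simp
  qed
  then obtain Cs where Cs: "\<forall>C\<in>set Cs. G.cc C" "distinct (concat Cs)" "set (concat Cs) = {0..<n}"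
    "length Cs \<le> 5 * G.F + 6 * r * ln (1 / leftover_density r) + 6 * real r ^ 2 + 2" by (elim exE conjE)
  show "\<exists>Cs. (\<forall>vs\<in>set Cs. mono_cycle E c vs) \<and>
      (\<forall>i<length Cs. \<forall>j<length Cs. i \<noteq> j \<longrightarrow> set (Cs ! i) \<inter> set (Cs ! j) = {}) \<and>
      (\<Union>vs\<in>set Cs. set vs) = {0..<n} \<and> real (length Cs) \<le> 1000 * real r ^ 4 * ln (real r)"
    by (rule G.partition_property[OF Cs(1-3)]) (use Cs(4) G.cycle_count in linarith)
qed

lemma prob_property: "1 - (r + 12) / n \<le> prob_Gnp n p (cycle_partition_property r (1000 * real r ^ 4 * ln (real r)) n)"
proof -
  have "prob_Gnp n p (\<lambda>E. \<not> cycle_partition_property r (1000 * real r ^ 4 * ln (real r)) n E) \<le> prob_Gnp n p bad"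
    by (rule prob_Gnp_mono) (use p good_property in auto)
  thus ?thesis using prob_bad prob_Gnp_compl[of n p "cycle_partition_property r (1000 * real r ^ 4 * ln (real r)) n"] by linarith
qed

end

text \<open>\<open>ln n \<le> 8 * n powr (1 / 8)\<close>, and for large \<open>n\<close> a second
  factor \<open>n powr (1 / 8)\<close> absorbs the constant \<open>8 * x\<close>.\<close>

lemma eventually_thresholds: "\<forall>\<^sub>F n in sequentially. \<forall>x\<in>thresholds r. x * ln (real n) \<le> real n powr (1 / 4)"
proof (rule eventually_ball_finite)
  show "finite (thresholds r)" unfolding thresholds_def by simp
  show "\<forall>x\<in>thresholds r. \<forall>\<^sub>F n in sequentially. x * ln (real n) \<le> real n powr (1 / 4)"
  proof
    fix x :: real
    define Y where "Y = 8 * \<bar>x\<bar> + 1"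
    show "\<forall>\<^sub>F n in sequentially. x * ln (real n) \<le> real n powr (1 / 4)"
      using eventually_ge_at_top[of "nat \<lceil>Y ^ 8\<rceil>"] eventually_ge_at_top[of "1 :: nat"]
    proof eventually_elim
      case (elim n)
      have n1: "1 \<le> real n" using elim(2) by simp
      have Y: "0 < Y" unfolding Y_def by simp
      have "Y ^ 8 \<le> n" using elim(1) by linarith
      hence "(Y ^ 8) powr (1 / 8) \<le> n powr (1 / 8)" by (rule powr_mono2[rotated 2]) (use Y in auto)
      moreover have "(Y ^ 8) powr (1 / 8) = Y" using Y by (simp add: powr_powr flip: powr_numeral)
      ultimately have Yn: "8 * \<bar>x\<bar> \<le> n powr (1 / 8)" unfolding Y_def by simp
      have l: "ln n \<le> 8 * n powr (1 / 8)" using ln_powr_bound[OF n1, of "1 / 8"] by simp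
      have "x * ln n \<le> \<bar>x\<bar> * ln n" using n1 by (intro mult_right_mono) auto
      also have "\<dots> \<le> \<bar>x\<bar> * (8 * n powr (1 / 8))" using l by (intro mult_left_mono) auto
      also have "\<dots> = (8 * \<bar>x\<bar>) * n powr (1 / 8)" by simp
      also have "\<dots> \<le> n powr (1 / 8) * n powr (1 / 8)" using Yn by (intro mult_right_mono) auto
      also have "\<dots> = n powr (1 / 4)" by (simp flip: powr_add)
      finally show ?case .
    qed
  qed
qed

theorem theorem1p1:
  fixes r :: nat and p :: "nat \<Rightarrow> real"
  assumes "r \<ge> 2"
    and "\<forall>\<^sub>F n in sequentially. 0 \<le> p n \<and> p n \<le> 1 \<and>
            2 ^ 9 * real r ^ 5 * real n powr (- 1 / (2 * real r)) \<le> p n"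
  shows "(\<lambda>n. prob_Gnp n (p n)
            (cycle_partition_property r (1000 * real r ^ 4 * ln (real r)) n))
         \<longlonglongrightarrow> 1"
proof (rule tendsto_sandwich)
  let ?P = "\<lambda>n. prob_Gnp n (p n) (cycle_partition_property r (1000 * real r ^ 4 * ln (real r)) n)"
  show "\<forall>\<^sub>F n in sequentially. 1 - real (r + 12) / real n \<le> ?P n"
    using assms(2) eventually_thresholds[of r] eventually_ge_at_top[of "4 :: nat"]
  proof eventually_elim
    case (elim n)
    have n: "0 < real n" using elim(3) by simp
    have C: "0 < 2 ^ 9 * real r ^ 5" using assms(1) by simp
    interpret random_regime n r "p n"
    proof
      show "2 \<le> r" by (rule assms(1))
      have "0 < 2 ^ 9 * real r ^ 5 * real n powr (- 1 / (2 * real r))" using C n by simp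
      thus "0 < p n" using elim(1) by linarith
      show "p n \<le> 1" using elim(1) by simp
      show "4 \<le> n" by (rule elim(3))
      have "(real n powr (- 1 / (2 * real r))) ^ (2 * r) = real n powr (- 1 / (2 * real r) * real (2 * r))"
        using n by (simp only: powr_realpow[symmetric] powr_powr powr_gt_zero)
      also have "\<dots> = 1 / n" using assms(1) n by (simp add: powr_minus_divide)
      finally have e: "(2 ^ 9 * real r ^ 5 * real n powr (- 1 / (2 * real r))) ^ (2 * r) = (2 ^ 9 * real r ^ 5) ^ (2 * r) * (1 / n)"
        by (simp only: power_mult_distrib)
      have "(2 ^ 9 * real r ^ 5 * real n powr (- 1 / (2 * real r))) ^ (2 * r) \<le> p n ^ (2 * r)"
        using elim(1) by (intro power_mono) auto
      hence "(2 ^ 9 * real r ^ 5) ^ (2 * r) / n \<le> p n ^ (2 * r)" unfolding e by simp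
      thus "(2 ^ 9 * real r ^ 5) ^ (2 * r) \<le> n * p n ^ (2 * r)" using n by (simp only: pos_divide_le_eq mult.commute)
      show "x * ln (real n) \<le> real n powr (1 / 4)" if "x \<in> thresholds r" for x using elim(2) that by blast
    qed
    show ?case using prob_property by simp
  qed
  show "\<forall>\<^sub>F n in sequentially. ?P n \<le> 1"
    using assms(2)
  proof eventually_elim
    case (elim n)
    show ?case
      using prob_Gnp_compl[of n "p n" "cycle_partition_property r (1000 * real r ^ 4 * ln (real r)) n"] prob_Gnp_nonneg[of "p n" n] elim by simp
  qed
  have "(\<lambda>n. 1 - real (r + 12) * (1 / real n)) \<longlonglongrightarrow> 1 - real (r + 12) * 0"
    by (intro tendsto_intros lim_1_over_n)
  thus "(\<lambda>n. 1 - real (r + 12) / real n) \<longlonglongrightarrow> 1" by simp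
qed simp

end
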